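(* Let $\nu>0$, let $D$ be a bounded, smooth domain compactly contained in $\{(r,z): 0<r<\infty,\ z\in\mathbb{R}\}$, and set $C=\{(r,z,\theta): (r,z)\in D,\ 0\le\theta\le2\pi\}\subset\mathbb{R}^3$ (cylindrical coordinates). Then there exists a constant $M=M(D,\nu)>0$ such that the following holds. Let $u_0\in H(C)$ be an axially symmetric vector field and let $u\in C^0([0,\infty);H_w(C))\cap L^2((0,\infty);V(C))$ be the unique weak solution of the axi-symmetric incompressible Navier--Stokes equations with viscosity $\nu$, zero forcing and initial data $u_0$. Let $v_0\in H(C)$ and let $v\in C^0([0,\infty);H(C))\cap L^2((0,\infty);V(C))$ be a Leray--Hopf weak solution of the three-dimensional incompressible Navier--Stokes equations in $C$ with viscosity $\nu$, zero forcing and initial data $v_0$. Then $$\|v-u\|_{L^2(C)}^2(t)\le\|v_0-u_0\|_{L^2(C)}^2\,\exp\left(M\|u_0\|_{L^2(C)}^4\right)\quad\text{for all } t\ge0.$$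
   Context: The Navier--Stokes equations with viscosity $\nu>0$ and zero forcing are $\partial_t u+(u\cdot\nabla)u=-\nabla p+\nu\Delta u$, $\operatorname{div}u=0$. For the axi-symmetric domain $C$, $\mathcal{D}(C)$ is the space of compactly supported $C^\infty$ $\mathbb{R}^3$-valued fields on $C$; $H(C)$ and $V(C)$ are the closures of the divergence-free fields in $\mathcal{D}(C)$ in the $L^2(C)$ and $H^1(C)$ norms, respectively (so elements of $V(C)$ satisfy the no-slip condition). $H_w(C)$ is $H(C)$ endowed with the weak $L^2$ topology. A vector field is axially symmetric (axi-symmetric) if its components in the cylindrical frame $(e_r,e_\theta,e_z)$ do not depend on $\theta$. Leray--Hopf weak solution on $\Omega=C$ with initial data $v_0\in H(\Omega)$ and zero forcing: a field $v\in C^0([0,\infty);H_w(\Omega))\cap L^\infty((0,\infty);H(\Omega))\cap L^2_{\mathrm{loc}}([0,\infty);V(\Omega))$ such that (1) for every $\phi\in C_c^\infty([0,\infty);\mathcal{D}(\Omega))$ with $\operatorname{div}\phi=0$, $$\int_0^\infty\!\!\int_\Omega\{-\partial_t\phi\cdot v-[(v\cdot\nabla)\phi]\cdot v+\nu\nabla v:\nabla\phi\}\,dx\,dt-\int_\Omega v_0\cdot\phi(0,x)\,dx=0,$$ where $A:B=\sum_{i,j}a_{ij}b_{ij}$; (2) for every $t>0$, $\|v(t,\cdot)\|_{L^2(\Omega)}^2+2\nu\int_0^t\|\nabla v(s,\cdot)\|_{L^2(\Omega)}^2\,ds\le\|v_0\|_{L^2(\Omega)}^2$. The weak solution of the axi-symmetric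 Navier--Stokes equations with axi-symmetric data $u_0$ is the field $u$, with $u(t,\cdot)$ axi-symmetric for every $t$, that satisfies (1) and (2) with initial data $u_0$; its existence and its uniqueness among such axi-symmetric solutions are known. *)

theory Defs
  imports "HOL-Analysis.Analysis"
begin

text \<open>
  An element of a Lebesgue or Sobolev space on \<open>\<Omega>\<close> is represented by an arbitrary function on the
  whole space: only its values on \<open>\<Omega>\<close>, up to a null set, matter. Likewise a time-dependent field
  \<open>v\<close> is represented by a map from times to such functions, and only its values at times
  \<open>t \<ge> 0\<close> matter; no joint measurability of \<open>v\<close> in \<open>(t, x)\<close> is imposed.
\<close>

section \<open>Smooth functions, smooth domains, test fields\<close>

primrec Ck_on :: "nat \<Rightarrow> 'a::euclidean_space set \<Rightarrow> ('a \<Rightarrow> 'b::euclidean_space) \<Rightarrow> bool" where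
  "Ck_on 0 S f \<longleftrightarrow> continuous_on S f"
| "Ck_on (Suc k) S f \<longleftrightarrow> (\<forall>x\<in>S. f differentiable (at x)) \<and>
     (\<forall>h. Ck_on k S (\<lambda>x. frechet_derivative f (at x) h))"

text \<open>To be used for open \<open>S\<close> only.\<close>

definition smooth_on :: "'a::euclidean_space set \<Rightarrow> ('a \<Rightarrow> 'b::euclidean_space) \<Rightarrow> bool" where
  "smooth_on S f \<longleftrightarrow> (\<forall>k. Ck_on k S f)"

text \<open>
  A domain is a nonempty connected open set; it is smooth if near each boundary point it is the
  sublevel set of a \<open>C\<^sup>\<infinity>\<close> function without critical points.
\<close>

definition smooth_domain :: "'a::euclidean_space set \<Rightarrow> bool" where
  "smooth_domain D \<longleftrightarrow> open D \<and> connected D \<and> D \<noteq> {} \<and>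
     (\<forall>p\<in>frontier D. \<exists>U (\<rho> :: 'a \<Rightarrow> real). open U \<and> p \<in> U \<and> smooth_on U \<rho> \<and>
        (\<forall>x\<in>U. frechet_derivative \<rho> (at x) \<noteq> (\<lambda>_. 0)) \<and> D \<inter> U = {x\<in>U. \<rho> x < 0})"

text \<open>Test functions on \<open>\<Omega>\<close> are extended by zero to the whole space.\<close>

definition test_functions :: "'a::euclidean_space set \<Rightarrow> ('a \<Rightarrow> 'b::euclidean_space) set" where
  "test_functions \<Omega> = {\<phi>. smooth_on UNIV \<phi> \<and> compact (closure {x. \<phi> x \<noteq> 0}) \<and>
     closure {x. \<phi> x \<noteq> 0} \<subseteq> \<Omega>}"

text \<open>\<open>jacobian f (at x) $ i $ j\<close> is the derivative of the \<open>i\<close>-th component in direction \<open>j\<close>.\<close>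

definition divergence :: "(real^'n \<Rightarrow> real^'n) \<Rightarrow> real^'n \<Rightarrow> real" where
  "divergence f x = trace (jacobian f (at x))"

definition solenoidal_test_fields :: "(real^3) set \<Rightarrow> (real^3 \<Rightarrow> real^3) set" where
  "solenoidal_test_fields \<Omega> = {\<phi> \<in> test_functions \<Omega>. \<forall>x. divergence \<phi> x = 0}"

section \<open>The spaces \<open>H\<close> and \<open>V\<close>\<close>

definition L2_fields :: "'a::euclidean_space set \<Rightarrow> ('a \<Rightarrow> 'b::euclidean_space) set" where
  "L2_fields \<Omega> = {f. f \<in> borel_measurable (lebesgue_on \<Omega>) \<and>
     integrable (lebesgue_on \<Omega>) (\<lambda>x. (norm (f x))\<^sup>2)}"

definition L2_norm :: "'a::euclidean_space set \<Rightarrow> ('a \<Rightarrow> 'b::euclidean_space) \<Rightarrow> real" where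
  "L2_norm \<Omega> f = sqrt (LINT x|lebesgue_on \<Omega>. (norm (f x))\<^sup>2)"

definition has_weak_gradient ::
  "(real^3) set \<Rightarrow> (real^3 \<Rightarrow> real^3) \<Rightarrow> (real^3 \<Rightarrow> real^3^3) \<Rightarrow> bool" where
  "has_weak_gradient \<Omega> f G \<longleftrightarrow>
     (\<forall>\<psi> \<in> test_functions \<Omega> :: (real^3 \<Rightarrow> real) set. \<forall>i j.
        (LINT x|lebesgue_on \<Omega>. f x $ i * frechet_derivative \<psi> (at x) (axis j 1)) =
        - (LINT x|lebesgue_on \<Omega>. G x $ i $ j * \<psi> x))"

definition H1_fields :: "(real^3) set \<Rightarrow> (real^3 \<Rightarrow> real^3) set" where
  "H1_fields \<Omega> = {f \<in> L2_fields \<Omega>. \<exists>G \<in> L2_fields \<Omega>. has_weak_gradient \<Omega> f G}"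

text \<open>Determined up to a null subset of \<open>\<Omega>\<close> if \<open>f\<close> is in \<open>H\<^sup>1(\<Omega>)\<close>, and meaningless otherwise.\<close>

definition weak_gradient :: "(real^3) set \<Rightarrow> (real^3 \<Rightarrow> real^3) \<Rightarrow> real^3 \<Rightarrow> real^3^3" where
  "weak_gradient \<Omega> f = (SOME G. G \<in> L2_fields \<Omega> \<and> has_weak_gradient \<Omega> f G)"

definition H1_norm :: "(real^3) set \<Rightarrow> (real^3 \<Rightarrow> real^3) \<Rightarrow> real" where
  "H1_norm \<Omega> f = sqrt ((L2_norm \<Omega> f)\<^sup>2 + (L2_norm \<Omega> (weak_gradient \<Omega> f))\<^sup>2)"

definition H_space :: "(real^3) set \<Rightarrow> (real^3 \<Rightarrow> real^3) set" where
  "H_space \<Omega> = {f \<in> L2_fields \<Omega>.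
     \<forall>\<epsilon>>0. \<exists>\<phi> \<in> solenoidal_test_fields \<Omega>. L2_norm \<Omega> (\<lambda>x. f x - \<phi> x) < \<epsilon>}"

definition V_space :: "(real^3) set \<Rightarrow> (real^3 \<Rightarrow> real^3) set" where
  "V_space \<Omega> = {f \<in> H1_fields \<Omega>.
     \<forall>\<epsilon>>0. \<exists>\<phi> \<in> solenoidal_test_fields \<Omega>. H1_norm \<Omega> (\<lambda>x. f x - \<phi> x) < \<epsilon>}"

section \<open>Functions of time with values in a space of fields\<close>

definition C0_strong :: "(real^3) set \<Rightarrow> (real \<Rightarrow> real^3 \<Rightarrow> real^3) set" where
  "C0_strong \<Omega> = {v. \<forall>t\<ge>0. v t \<in> H_space \<Omega> \<and>
     ((\<lambda>s. L2_norm \<Omega> (\<lambda>x. v s x - v t x)) \<longlongrightarrow> 0) (at t within {0..})}"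

definition C0_weak :: "(real^3) set \<Rightarrow> (real \<Rightarrow> real^3 \<Rightarrow> real^3) set" where
  "C0_weak \<Omega> = {v. (\<forall>t\<ge>0. v t \<in> H_space \<Omega>) \<and>
     (\<forall>\<psi> \<in> L2_fields \<Omega>. continuous_on {0..} (\<lambda>t. LINT x|lebesgue_on \<Omega>. v t x \<bullet> \<psi> x))}"

text \<open>
  Bochner spaces over a time interval \<open>I\<close> with values in a space \<open>X\<close> of fields carrying the
  (semi)norm \<open>N\<close>: strong measurability means almost everywhere approximability in \<open>N\<close> by
  \<open>X\<close>-valued simple functions.
\<close>

definition strongly_measurable ::
  "('a \<Rightarrow> 'b::real_vector) set \<Rightarrow> (('a \<Rightarrow> 'b) \<Rightarrow> real) \<Rightarrow> real set \<Rightarrow> (real \<Rightarrow> 'a \<Rightarrow> 'b) \<Rightarrow> bool" where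
  "strongly_measurable X N I f \<longleftrightarrow> (AE t in lebesgue_on I. f t \<in> X) \<and>
     (\<exists>s :: nat \<Rightarrow> real \<Rightarrow> 'a \<Rightarrow> 'b.
        (\<forall>n. simple_function (lebesgue_on I) (s n) \<and> s n ` I \<subseteq> X) \<and>
        (AE t in lebesgue_on I. (\<lambda>n. N (\<lambda>x. s n t x - f t x)) \<longlonglongrightarrow> 0))"

definition Bochner_L2 ::
  "('a \<Rightarrow> 'b::real_vector) set \<Rightarrow> (('a \<Rightarrow> 'b) \<Rightarrow> real) \<Rightarrow> real set \<Rightarrow> (real \<Rightarrow> 'a \<Rightarrow> 'b) set" where
  "Bochner_L2 X N I = {f. strongly_measurable X N I f \<and>
     integrable (lebesgue_on I) (\<lambda>t. (N (f t))\<^sup>2)}"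

definition Bochner_Linf ::
  "('a \<Rightarrow> 'b::real_vector) set \<Rightarrow> (('a \<Rightarrow> 'b) \<Rightarrow> real) \<Rightarrow> real set \<Rightarrow> (real \<Rightarrow> 'a \<Rightarrow> 'b) set" where
  "Bochner_Linf X N I = {f. strongly_measurable X N I f \<and>
     (\<exists>B. AE t in lebesgue_on I. N (f t) \<le> B)}"

section \<open>Leray-Hopf weak solutions\<close>

text \<open>
  A test field that is smooth on \<open>[0,\<infinity>)\<close> up to \<open>t = 0\<close> is given as the restriction of a field that
  is smooth and compactly supported in \<open>\<real> \<times> \<Omega>\<close>; the divergence has to vanish for \<open>t \<ge> 0\<close> only.
  The inner product of matrices is the sum of the products of their entries.
\<close>

definition weak_formulation ::
  "real \<Rightarrow> (real^3) set \<Rightarrow> (real^3 \<Rightarrow> real^3) \<Rightarrow> (real \<Rightarrow> real^3 \<Rightarrow> real^3) \<Rightarrow> bool" where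
  "weak_formulation \<nu> \<Omega> v\<^sub>0 v \<longleftrightarrow>
     (\<forall>\<phi> :: real \<times> (real^3) \<Rightarrow> real^3.
        \<phi> \<in> test_functions (UNIV \<times> \<Omega>) \<and> (\<forall>t\<ge>0. \<forall>x. divergence (\<lambda>y. \<phi> (t, y)) x = 0) \<longrightarrow>
        (LINT t|lebesgue_on {0..}. LINT x|lebesgue_on \<Omega>.
           - (vector_derivative (\<lambda>s. \<phi> (s, x)) (at t) \<bullet> v t x)
           - (jacobian (\<lambda>y. \<phi> (t, y)) (at x) *v v t x) \<bullet> v t x
           + \<nu> * (weak_gradient \<Omega> (v t) x \<bullet> jacobian (\<lambda>y. \<phi> (t, y)) (at x)))
        - (LINT x|lebesgue_on \<Omega>. v\<^sub>0 x \<bullet> \<phi> (0, x)) = 0)"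

definition energy_inequality ::
  "real \<Rightarrow> (real^3) set \<Rightarrow> (real^3 \<Rightarrow> real^3) \<Rightarrow> (real \<Rightarrow> real^3 \<Rightarrow> real^3) \<Rightarrow> bool" where
  "energy_inequality \<nu> \<Omega> v\<^sub>0 v \<longleftrightarrow>
     (\<forall>t>0. (L2_norm \<Omega> (v t))\<^sup>2
        + 2 * \<nu> * (LINT s|lebesgue_on {0..t}. (L2_norm \<Omega> (weak_gradient \<Omega> (v s)))\<^sup>2)
      \<le> (L2_norm \<Omega> v\<^sub>0)\<^sup>2)"

definition Leray_Hopf_solution ::
  "real \<Rightarrow> (real^3) set \<Rightarrow> (real^3 \<Rightarrow> real^3) \<Rightarrow> (real \<Rightarrow> real^3 \<Rightarrow> real^3) \<Rightarrow> bool" where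
  "Leray_Hopf_solution \<nu> \<Omega> v\<^sub>0 v \<longleftrightarrow>
     v \<in> C0_weak \<Omega> \<and>
     v \<in> Bochner_Linf (H_space \<Omega>) (L2_norm \<Omega>) {0<..} \<and>
     (\<forall>T>0. v \<in> Bochner_L2 (V_space \<Omega>) (H1_norm \<Omega>) {0<..<T}) \<and>
     weak_formulation \<nu> \<Omega> v\<^sub>0 v \<and> energy_inequality \<nu> \<Omega> v\<^sub>0 v"

section \<open>Axial symmetry\<close>

definition cyl_point :: "real \<Rightarrow> real \<Rightarrow> real \<Rightarrow> real^3" where
  "cyl_point r z \<theta> = vector [r * cos \<theta>, r * sin \<theta>, z]"

definition e_r :: "real \<Rightarrow> real^3" where
  "e_r \<theta> = vector [cos \<theta>, sin \<theta>, 0]"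

definition e_theta :: "real \<Rightarrow> real^3" where
  "e_theta \<theta> = vector [- sin \<theta>, cos \<theta>, 0]"

definition e_z :: "real^3" where
  "e_z = vector [0, 0, 1]"

definition axi_domain :: "(real \<times> real) set \<Rightarrow> (real^3) set" where
  "axi_domain D = {cyl_point r z \<theta> | r z \<theta>. (r, z) \<in> D \<and> 0 \<le> \<theta> \<and> \<theta> \<le> 2 * pi}"

text \<open>Independence of the angle is required for almost every point, as fields are a.e. classes.\<close>

definition axisymmetric :: "(real^3) set \<Rightarrow> (real^3 \<Rightarrow> real^3) \<Rightarrow> bool" where
  "axisymmetric \<Omega> f \<longleftrightarrow> (\<exists>f\<^sub>r f\<^sub>\<theta> f\<^sub>z :: real \<Rightarrow> real \<Rightarrow> real.
     AE x in lebesgue_on \<Omega>. \<forall>r z \<theta>. 0 < r \<and> x = cyl_point r z \<theta> \<longrightarrow>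
       f x \<bullet> e_r \<theta> = f\<^sub>r r z \<and> f x \<bullet> e_theta \<theta> = f\<^sub>\<theta> r z \<and> f x \<bullet> e_z = f\<^sub>z r z)"

definition axisymmetric_weak_solution ::
  "real \<Rightarrow> (real^3) set \<Rightarrow> (real^3 \<Rightarrow> real^3) \<Rightarrow> (real \<Rightarrow> real^3 \<Rightarrow> real^3) \<Rightarrow> bool" where
  "axisymmetric_weak_solution \<nu> \<Omega> u\<^sub>0 u \<longleftrightarrow>
     Leray_Hopf_solution \<nu> \<Omega> u\<^sub>0 u \<and> (\<forall>t\<ge>0. axisymmetric \<Omega> (u t))"

end

theory Submission
  imports Defs
begin

text \<open>
  Write \<open>w = v - u\<close>. Since \<open>v\<close> satisfies only an energy inequality, one computes \<open>(v, u)\<close> by testing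
  each equation with the other solution and subtracts twice this from the sum of the energy
  inequalities, which leaves
  \<open>\<parallel>w(t)\<parallel>\<^sup>2 + 2\<nu>\<integral>\<parallel>\<nabla>w\<parallel>\<^sup>2 \<le> \<parallel>w(0)\<parallel>\<^sup>2 + 2\<integral>((w \<cdot> \<nabla>)w, u)\<close>.
  The gain over Serrin's condition is an anisotropic Ladyzhenskaya inequality. Away from the axis
  the field \<open>u\<close> depends on the two variables \<open>(r, z)\<close> only; integrating \<open>|w|\<^sup>2\<close> over the angle first
  and using the embedding of \<open>W\<^sup>1\<^sup>,\<^sup>1\<close> into \<open>L\<^sup>2\<close> in the \<open>(r, z)\<close> plane gives
  \<open>\<parallel>|w||u|\<parallel>\<^sup>2 \<le> K\<^sup>2 \<parallel>u\<parallel> \<parallel>\<nabla>u\<parallel> \<parallel>w\<parallel> \<parallel>\<nabla>w\<parallel>\<close>, so the right-hand side is absorbed by Young's inequality up to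
  \<open>K\<^sup>4\<nu>\<^sup>-\<^sup>3 \<parallel>u\<parallel>\<^sup>2 \<parallel>\<nabla>u\<parallel>\<^sup>2 \<parallel>w\<parallel>\<^sup>2\<close>, and the energy inequality for \<open>u\<close> turns Gronwall's inequality into
  the claim.

  The testing itself is done with time increments: \<open>(v, u)(t + h) - (v, u)(t)\<close> is an integral of
  the two weak formulations tested with the fixed fields \<open>u(t + h)\<close> and \<open>v(t)\<close>, and averaging over
  \<open>t\<close> and letting \<open>h \<rightarrow> 0\<close> only needs the continuity of translations in \<open>L\<^sup>2(V)\<close>.
\<close>


section \<open>Smooth functions\<close>

text \<open>What shapes the proof is integrability in time. For general fields of \<open>V\<close>
  the convective term (v . grad) phi . v is only bounded by |v|_V^2 |phi|_V, which is integrable in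
  time for a fixed phi but not for phi in L2(V). For an axisymmetric phi the planar exponents
  replace this by |v|_V^(3/2) |phi|_V^(1/2), up to L2 norms that stay bounded, and this is
  integrable for two fields in L2(V); so \<open>u\<close> may be inserted into the equation of
  \<open>v\<close>. The equation of \<open>u\<close> accepts \<open>v\<close> because |u|^2 is
  square integrable in space and time. The weak equation is therefore first integrated in time for
  fixed fields of \<open>V\<close>, where the cruder bound is enough, and only then are increments
  of (v, u) compared with the expected rate. All estimates are made for Borel representatives with
  values in \<open>V\<close> at every time, since the definitions supply neither joint measurability
  nor regularity at each time. The domain enters only through the smallest and largest distance r0
  and r1 to the axis: K^2 is 8 pi r1^2 / r0^3, and M is (K + 1)^4 / nu^4, where the added 1 only
  serves positivity.\<close>

lemma Ck_on_SucI:
  assumes "\<And>x. (f has_derivative f' x) (at x)" and "\<And>h. Ck_on k UNIV (\<lambda>x. f' x h)"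
  shows "Ck_on (Suc k) UNIV f"
proof -
  have "frechet_derivative f (at x) = f' x" for x
    using frechet_derivative_at[OF assms(1)] by simp
  then show ?thesis
    using assms by (auto simp: differentiable_def)
qed

text \<open>The recursion of \<open>Ck_on\<close> descends through derivatives and never compares
  orders directly; the base case is that differentiability implies continuity. The product rule
  needs this comparison, since it leaves one factor undifferentiated.\<close>

lemma Ck_on_SucD:
  "Ck_on (Suc k) S f \<Longrightarrow> Ck_on k S f"
proof (induction k arbitrary: f)
  case 0
  then show ?case
    by (simp add: differentiable_at_imp_differentiable_on differentiable_imp_continuous_on)
next
  case (Suc k)
  then show ?case by auto
qed

lemma Ck_on_Suc_has_derivative:
  "Ck_on (Suc k) UNIV f \<Longrightarrow> (f has_derivative frechet_derivative f (at x)) (at x)"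
  by (simp add: frechet_derivative_works)

lemma Ck_on_const: "Ck_on k UNIV (\<lambda>_. c)"
  by (induction k arbitrary: c) auto

lemma Ck_on_add:
  "Ck_on k UNIV f \<Longrightarrow> Ck_on k UNIV g \<Longrightarrow> Ck_on k UNIV (\<lambda>x. f x + g x)"
proof (induction k arbitrary: f g)
  case 0
  then show ?case by (auto intro: continuous_intros)
next
  case (Suc k)
  show ?case
    by (rule Ck_on_SucI[OF has_derivative_add[OF Ck_on_Suc_has_derivative[OF Suc.prems(1)]
            Ck_on_Suc_has_derivative[OF Suc.prems(2)]]])
       (use Suc in auto)
qed

lemma Ck_on_bilinear:
  assumes b: "bounded_bilinear b"
  shows "Ck_on k UNIV f \<Longrightarrow> Ck_on k UNIV g \<Longrightarrow> Ck_on k UNIV (\<lambda>x. b (f x) (g x))"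
proof (induction k arbitrary: f g)
  case 0
  then show ?case using bounded_bilinear.continuous_on[OF b] by auto
next
  case (Suc k)
  show ?case
  proof (rule Ck_on_SucI[OF bounded_bilinear.FDERIV[OF b Ck_on_Suc_has_derivative[OF Suc.prems(1)]
            Ck_on_Suc_has_derivative[OF Suc.prems(2)]]])
    fix h
    show "Ck_on k UNIV (\<lambda>x. b (f x) (frechet_derivative g (at x) h) +
                    b (frechet_derivative f (at x) h) (g x))"
      using Suc Ck_on_SucD[OF Suc.prems(1)] Ck_on_SucD[OF Suc.prems(2)]
      by (intro Ck_on_add Suc.IH) auto
  qed
qed

lemma Ck_on_compose_affine:
  assumes L: "bounded_linear L"
  shows "Ck_on k UNIV f \<Longrightarrow> Ck_on k UNIV (\<lambda>x. f (L x + d))"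
proof (induction k arbitrary: f)
  case 0
  then show ?case
    by (auto intro!: continuous_intros continuous_on_compose2[of UNIV f]
        linear_continuous_on[OF L])
next
  case (Suc k)
  have d: "((\<lambda>x. f (L x + d)) has_derivative (\<lambda>h. frechet_derivative f (at (L x + d)) (L h))) (at x)" for x
  proof -
    have "((\<lambda>x. L x + d) has_derivative L) (at x)"
      using bounded_linear.has_derivative[OF L has_derivative_ident] by (auto intro!: derivative_eq_intros)
    from has_derivative_compose[OF this Ck_on_Suc_has_derivative[OF Suc.prems]] show ?thesis .
  qed
  show ?case by (rule Ck_on_SucI[OF d]) (use Suc in auto)
qed

lemma Ck_on_linear_compose:
  assumes L: "bounded_linear L"
  shows "Ck_on k UNIV f \<Longrightarrow> Ck_on k UNIV (\<lambda>x. L (f x))"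
proof (induction k arbitrary: f)
  case 0
  then show ?case
    using continuous_on_compose2[OF linear_continuous_on[OF L, of UNIV]] by auto
next
  case (Suc k)
  show ?case
    by (rule Ck_on_SucI[OF bounded_linear.has_derivative[OF L Ck_on_Suc_has_derivative[OF Suc.prems]]])
       (use Suc in auto)
qed

lemma Ck_on_Suc_realI:
  fixes f :: "real \<Rightarrow> real"
  assumes "\<And>x. (f has_field_derivative f' x) (at x)" and "Ck_on k UNIV f'"
  shows "Ck_on (Suc k) UNIV f"
  using assms Ck_on_bilinear[OF bounded_bilinear_mult assms(2) Ck_on_const]
  by (intro Ck_on_SucI[of f "\<lambda>x h. f' x * h"]) (auto simp: has_field_derivative_def)

lemma smooth_on_frechet:
  "smooth_on UNIV f \<Longrightarrow> smooth_on UNIV (\<lambda>x. frechet_derivative f (at x) h)"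
  unfolding smooth_on_def by (metis Ck_on.simps(2))

lemma smooth_on_has_derivative:
  "smooth_on UNIV f \<Longrightarrow> (f has_derivative frechet_derivative f (at x)) (at x)"
  unfolding smooth_on_def using Ck_on_Suc_has_derivative by blast

lemma smooth_on_continuous: "smooth_on UNIV f \<Longrightarrow> continuous_on A f"
  unfolding smooth_on_def by (metis Ck_on.simps(1) continuous_on_subset subset_UNIV)

lemma smooth_on_bilinear:
  "bounded_bilinear b \<Longrightarrow> smooth_on UNIV f \<Longrightarrow> smooth_on UNIV g \<Longrightarrow> smooth_on UNIV (\<lambda>x. b (f x) (g x))"
  unfolding smooth_on_def using Ck_on_bilinear by blast

lemma smooth_on_compose_affine:
  "bounded_linear L \<Longrightarrow> smooth_on UNIV f \<Longrightarrow> smooth_on UNIV (\<lambda>x. f (L x + d))"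
  unfolding smooth_on_def using Ck_on_compose_affine by blast

lemma smooth_on_linear_compose:
  "bounded_linear L \<Longrightarrow> smooth_on UNIV f \<Longrightarrow> smooth_on UNIV (\<lambda>x. L (f x))"
  unfolding smooth_on_def using Ck_on_linear_compose by blast

lemma smooth_on_const: "smooth_on UNIV (\<lambda>_. c)"
  unfolding smooth_on_def using Ck_on_const by blast

lemma smooth_on_prod:
  fixes f :: "'i \<Rightarrow> 'a::euclidean_space \<Rightarrow> real"
  shows "finite I \<Longrightarrow> (\<And>i. i \<in> I \<Longrightarrow> smooth_on UNIV (f i)) \<Longrightarrow> smooth_on UNIV (\<lambda>x. \<Prod>i\<in>I. f i x)"
  by (induction I rule: finite_induct)
     (auto intro: smooth_on_const smooth_on_bilinear[OF bounded_bilinear_mult])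

section \<open>Smooth cut-off functions on the line\<close>

text \<open>The functions \<open>x\<^sup>-\<^sup>n exp(-1/x)\<close> span a space that is closed under differentiation.\<close>

definition flat_exp :: "nat \<Rightarrow> real \<Rightarrow> real" where
  "flat_exp n x = (if x > 0 then (1 / x) ^ n * exp (- (1 / x)) else 0)"

text \<open>With y = 1/x this is the decay of y^n / exp y at infinity.\<close>

lemma flat_exp_lim: "((\<lambda>x. flat_exp n x) \<longlongrightarrow> 0) (at_right 0)"
proof -
  have "((\<lambda>y::real. y ^ n / exp y) \<longlongrightarrow> 0) at_top"
    by (rule tendsto_power_div_exp_0)
  then have "((\<lambda>x::real. (inverse x) ^ n / exp (inverse x)) \<longlongrightarrow> 0) (at_right 0)"
    by (rule filterlim_compose[OF _ filterlim_inverse_at_top_right])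
  then show ?thesis
    by (rule Lim_transform_eventually)
       (auto simp: eventually_at_filter flat_exp_def exp_minus field_simps)
qed

text \<open>For x > 0 the product rule raises the power of 1/x by one or two. At 0 the difference
  quotient of \<open>flat_exp n\<close> is \<open>flat_exp (Suc n)\<close> from the right and 0 from
  the left, so the limit just computed gives the derivative 0.\<close>

lemma flat_exp_deriv:
  "(flat_exp n has_field_derivative (flat_exp (n + 2) x - real n * flat_exp (n + 1) x)) (at x)"
proof -
  consider "x > 0" | "x < 0" | "x = 0" by linarith
  then show ?thesis
  proof cases
    case 1
    have "((\<lambda>x. (1 / x) ^ n * exp (- (1 / x))) has_field_derivative
        (flat_exp (n + 2) x - real n * flat_exp (n + 1) x)) (at x)"
    proof (rule DERIV_cong)
      have "((\<lambda>x::real. 1 / x) has_field_derivative - ((1 / x) * (1 / x))) (at x)"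
        using 1 by (auto intro!: derivative_eq_intros simp: field_simps)
      note d = this
      show "((\<lambda>x. (1 / x) ^ n * exp (- (1 / x))) has_field_derivative
          (real n * (- ((1 / x) * (1 / x)) * (1 / x) ^ (n - 1))) * exp (- (1 / x)) +
          (exp (- (1 / x)) * - (- ((1 / x) * (1 / x)))) * (1 / x) ^ n) (at x)"
        using DERIV_mult[OF DERIV_power[OF d, of n] DERIV_fun_exp[OF DERIV_minus[OF d]]]
        by simp
      show "(real n * (- ((1 / x) * (1 / x)) * (1 / x) ^ (n - 1))) * exp (- (1 / x)) +
          (exp (- (1 / x)) * - (- ((1 / x) * (1 / x)))) * (1 / x) ^ n =
          flat_exp (n + 2) x - real n * flat_exp (n + 1) x"
        using 1 by (cases n) (simp_all add: flat_exp_def algebra_simps)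
    qed
    then show ?thesis
      by (rule has_field_derivative_transform_within_open[where S="{0<..}"])
         (use 1 in \<open>auto simp: flat_exp_def\<close>)
  next
    case 2
    have "((\<lambda>x. 0) has_field_derivative 0) (at x)" by simp
    then have "(flat_exp n has_field_derivative 0) (at x)"
      by (rule has_field_derivative_transform_within_open[where S="{..<0}"])
         (use 2 in \<open>auto simp: flat_exp_def\<close>)
    then show ?thesis using 2 by (simp add: flat_exp_def)
  next
    case 3
    have "((\<lambda>h. (flat_exp n (0 + h) - flat_exp n 0) / h) \<longlongrightarrow> 0) (at 0)"
    proof -
      have "((\<lambda>h. (flat_exp n (0 + h) - flat_exp n 0) / h) \<longlongrightarrow> 0) (at_right 0)"
        using flat_exp_lim[of "Suc n"]
        by (rule Lim_transform_eventually) (auto simp: eventually_at_filter flat_exp_def)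
      moreover have "((\<lambda>h. (flat_exp n (0 + h) - flat_exp n 0) / h) \<longlongrightarrow> 0) (at_left 0)"
        by (rule Lim_transform_eventually[OF tendsto_const])
           (auto simp: eventually_at_filter flat_exp_def)
      ultimately show ?thesis using filterlim_split_at_real by blast
    qed
    then show ?thesis using 3 by (simp add: DERIV_def flat_exp_def)
  qed
qed

lemma smooth_flat_exp: "smooth_on UNIV (flat_exp n)"
proof -
  have "Ck_on k UNIV (flat_exp n)" for k
  proof (induction k arbitrary: n)
    case 0
    have "\<And>x. isCont (flat_exp n) x" using flat_exp_deriv DERIV_isCont by blast
    then show ?case by (auto intro: continuous_at_imp_continuous_on)
  next
    case (Suc k)
    have "Ck_on k UNIV (\<lambda>x. flat_exp (n + 2) x + (- real n) * flat_exp (n + 1) x)"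
      by (intro Ck_on_add Ck_on_bilinear[OF bounded_bilinear_mult] Ck_on_const Suc)
    then show ?case by (intro Ck_on_Suc_realI[OF flat_exp_deriv]) simp
  qed
  then show ?thesis by (simp add: smooth_on_def)
qed

text \<open>\<open>S\<close> is the normalised primitive of the bump \<open>b\<close>, which is
  smooth, nonnegative and supported in the unit interval. Smoothness of the primitive needs no new
  computation, since its derivative is \<open>b\<close>.\<close>

lemma ex_smooth_step:
  obtains S :: "real \<Rightarrow> real" where
    "smooth_on UNIV S" "\<And>x. x \<le> 0 \<Longrightarrow> S x = 0" "\<And>x. x \<ge> 1 \<Longrightarrow> S x = 1" "mono S"
proof -
  define b where "b x = flat_exp 0 x * flat_exp 0 (1 - x)" for x
  have flat_smooth: "smooth_on UNIV (\<lambda>x. flat_exp 0 (- x + 1))"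
    by (rule smooth_on_compose_affine[OF bounded_linear_minus[OF bounded_linear_ident] smooth_flat_exp])
  have b_smooth: "smooth_on UNIV b"
    unfolding b_def using smooth_on_bilinear[OF bounded_bilinear_mult smooth_flat_exp[of 0] flat_smooth]
    by (simp add: add.commute)
  have b_nonneg: "b x \<ge> 0" for x by (simp add: b_def flat_exp_def)
  have b_zero: "b x = 0" if "x \<le> 0 \<or> x \<ge> 1" for x using that by (auto simp: b_def flat_exp_def)
  have b_cont: "continuous_on A b" for A using smooth_on_continuous[OF b_smooth] .
  have b_int: "b integrable_on {a..c}" for a c
    using integrable_continuous_interval[OF b_cont] by simp
  \<comment> \<open>The base point -1 lies to the left of the support of \<open>b\<close>. Thus for
    x > -1 the fundamental theorem applies in an interval around x, and for x <= -1 the function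
    \<open>B\<close> is zero near x.\<close>
  define B where "B x = integral {-1..x} b" for x
  define c where "c = B 1"
  have cpos: "c > 0"
  proof -
    have "c \<ge> integral {1/4..3/4} b"
      unfolding c_def B_def
      by (rule integral_subset_le) (auto simp: b_int b_nonneg)
    also have "integral {1/4..3/4} b > 0"
    proof (rule ccontr)
      assume "\<not> 0 < integral {1 / 4..3 / 4} b"
      moreover have "integral {1/4..3/4} b \<ge> 0" by (intro integral_nonneg b_int b_nonneg)
      ultimately have "(b has_integral 0) (cbox (1/4) (3/4))"
        using b_int[of "1/4" "3/4"] by (metis integrable_integral interval_cbox less_eq_real_def)
      then have "b (1/2) = 0"
        by (intro has_integral_0_cbox_imp_0[OF b_cont b_nonneg]) (auto simp: box_real)
      then show False by (simp add: b_def flat_exp_def)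
    qed
    finally (xtrans) show ?thesis .
  qed
  have B_add: "B y = B x + integral {x..y} b" if "-1 \<le> x" "x \<le> y" for x y
    unfolding B_def using Henstock_Kurzweil_Integration.integral_combine[OF that b_int] by simp
  have B_deriv: "(B has_field_derivative b x) (at x)" for x
  proof (cases "x > -1")
    case True
    have "(B has_vector_derivative b x) (at x within {-1..x+1})"
      unfolding B_def using True by (intro integral_has_vector_derivative b_cont) auto
    then have "(B has_vector_derivative b x) (at x)"
      using True at_within_interior[of x "{-1..x+1}"] by auto
    then show ?thesis by (simp add: has_real_derivative_iff_has_vector_derivative)
  next
    case False
    have z: "B y = 0" if "y < 0" for y
    proof -
      have "B y = integral {-1..y} (\<lambda>_. 0)"
        unfolding B_def by (rule integral_cong) (use that b_zero in auto)
      then show ?thesis by simp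
    qed
    have "((\<lambda>_. 0) has_field_derivative 0) (at x)" by simp
    then have "(B has_field_derivative 0) (at x)"
      by (rule has_field_derivative_transform_within_open[where S="{..<0}"]) (use z False in auto)
    then show ?thesis using b_zero[of x] False by simp
  qed
  have B_smooth: "smooth_on UNIV B"
    unfolding smooth_on_def
  proof
    fix k
    show "Ck_on k UNIV B"
      using Ck_on_SucD[OF Ck_on_Suc_realI[OF B_deriv]] b_smooth unfolding smooth_on_def by blast
  qed
  have B0: "B x = 0" if "x \<le> 0" for x
  proof -
    have "B x = integral {-1..x} (\<lambda>_. 0)"
      unfolding B_def by (rule integral_cong) (use that b_zero in auto)
    then show ?thesis by simp
  qed
  have B1: "B x = c" if "x \<ge> 1" for x
  proof -
    have "integral {1..x} b = integral {1..x} (\<lambda>_. 0)"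
      by (rule integral_cong) (use that b_zero in auto)
    then show ?thesis using B_add[of 1 x] that by (simp add: c_def)
  qed
  have mono: "mono B"
  proof (rule monoI)
    fix x y :: real
    assume "x \<le> y"
    then show "B x \<le> B y"
      using B_deriv b_nonneg by (intro DERIV_nonneg_imp_nondecreasing[of x y B]) blast+
  qed
  show ?thesis
  proof (rule that[of "\<lambda>x. (1/c) * B x"])
    show "smooth_on UNIV (\<lambda>x. 1 / c * B x)"
      by (intro smooth_on_bilinear[OF bounded_bilinear_mult] smooth_on_const B_smooth)
    show "mono (\<lambda>x. 1 / c * B x)"
      using mono cpos by (auto simp: mono_def divide_right_mono)
  qed (use B0 B1 cpos in auto)
qed

section \<open>Test functions\<close>

lemma test_functionsI:
  assumes "smooth_on UNIV \<phi>" "compact K" "K \<subseteq> \<Omega>" "\<And>x. x \<notin> K \<Longrightarrow> \<phi> x = 0"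
  shows "\<phi> \<in> test_functions \<Omega>"
proof -
  have "closure {x. \<phi> x \<noteq> 0} \<subseteq> K"
    by (rule closure_minimal) (use assms compact_imp_closed in auto)
  then show ?thesis
    using assms compact_Int_closed[OF assms(2), of "closure {x. \<phi> x \<noteq> 0}"]
    by (auto simp: test_functions_def Int_absorb1)
qed

lemma test_functionsE:
  assumes "\<phi> \<in> test_functions \<Omega>"
  obtains K where "smooth_on UNIV \<phi>" "compact K" "K \<subseteq> \<Omega>" "\<And>x. x \<notin> K \<Longrightarrow> \<phi> x = 0"
proof (rule that)
  show "\<phi> x = 0" if "x \<notin> closure {x. \<phi> x \<noteq> 0}" for x
    using that closure_subset[of "{x. \<phi> x \<noteq> 0}"] by auto
qed (use assms in \<open>auto simp: test_functions_def\<close>)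

lemma test_functions_frechet:
  assumes "\<phi> \<in> test_functions \<Omega>"
  shows "(\<lambda>x. frechet_derivative \<phi> (at x) e) \<in> test_functions \<Omega>"
proof -
  obtain K where K: "smooth_on UNIV \<phi>" "compact K" "K \<subseteq> \<Omega>" "\<And>x. x \<notin> K \<Longrightarrow> \<phi> x = 0"
    using test_functionsE[OF assms] by blast
  have "frechet_derivative \<phi> (at x) e = 0" if "x \<notin> K" for x
  proof -
    have "(\<phi> has_derivative (\<lambda>_. 0)) (at x)"
      by (rule has_derivative_transform_within_open[where f="\<lambda>_. 0" and s="- K"])
         (use K that compact_imp_closed in auto)
    from frechet_derivative_at[OF this] show ?thesis by metis
  qed
  with K show ?thesis
    by (intro test_functionsI[of _ K] smooth_on_frechet) auto
qed

lemma test_functions_bounded: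
  assumes "\<phi> \<in> test_functions \<Omega>"
  obtains B where "B > 0" "\<And>x. norm (\<phi> x) \<le> B"
proof -
  obtain K where K: "smooth_on UNIV \<phi>" "compact K" "K \<subseteq> \<Omega>" "\<And>x. x \<notin> K \<Longrightarrow> \<phi> x = 0"
    using test_functionsE[OF assms] by blast
  have "bounded (\<phi> ` K)"
    by (intro compact_imp_bounded compact_continuous_image smooth_on_continuous K)
  then obtain B where "\<forall>x\<in>K. norm (\<phi> x) \<le> B" by (auto simp: bounded_iff)
  then have "norm (\<phi> x) \<le> max B 1" for x using K(4)[of x] by (cases "x \<in> K") force+
  then show ?thesis using that[of "max B 1"] by auto
qed

lemma test_functions_borel: "\<phi> \<in> test_functions \<Omega> \<Longrightarrow> \<phi> \<in> borel_measurable borel"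
  using smooth_on_continuous by (auto simp: test_functions_def intro: borel_measurable_continuous_onI)

lemma test_functions_integrable:
  assumes "\<phi> \<in> test_functions \<Omega>"
  shows "integrable lborel \<phi>"
proof -
  obtain K where K: "smooth_on UNIV \<phi>" "compact K" "K \<subseteq> \<Omega>" "\<And>x. x \<notin> K \<Longrightarrow> \<phi> x = 0"
    using test_functionsE[OF assms] by blast
  have "integrable lborel (\<lambda>x. indicator K x *\<^sub>R \<phi> x)"
    by (intro borel_integrable_compact K smooth_on_continuous)
  moreover have "(\<lambda>x. indicator K x *\<^sub>R \<phi> x) = \<phi>"
    using K(4) by (auto simp: fun_eq_iff indicator_def)
  ultimately show ?thesis by simp
qed

lemma test_functions_zero: "\<phi> \<in> test_functions \<Omega> \<Longrightarrow> x \<notin> \<Omega> \<Longrightarrow> \<phi> x = 0"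
  by (elim test_functionsE) auto

lemma test_functions_bilinear:
  assumes "bounded_bilinear b" "f \<in> test_functions \<Omega>'" "\<psi> \<in> test_functions \<Omega>"
  shows "(\<lambda>x. b (f x) (\<psi> x)) \<in> test_functions \<Omega>"
proof -
  interpret b: bounded_bilinear b by fact
  obtain K where K: "smooth_on UNIV \<psi>" "compact K" "K \<subseteq> \<Omega>" "\<And>x. x \<notin> K \<Longrightarrow> \<psi> x = 0"
    using test_functionsE[OF assms(3)] by blast
  show ?thesis
    by (rule test_functionsI[of _ K])
       (use K assms smooth_on_bilinear[OF assms(1)] in \<open>auto simp: test_functions_def b.zero_right\<close>)
qed

lemma test_functions_linear:
  assumes "bounded_linear L" "f \<in> test_functions \<Omega>"
  shows "(\<lambda>x. L (f x)) \<in> test_functions \<Omega>"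
proof -
  obtain K where K: "smooth_on UNIV f" "compact K" "K \<subseteq> \<Omega>" "\<And>x. x \<notin> K \<Longrightarrow> f x = 0"
    using test_functionsE[OF assms(2)] by blast
  show ?thesis
    by (rule test_functionsI[of _ K])
       (use K smooth_on_linear_compose[OF assms(1)] in \<open>auto simp: linear_0[OF bounded_linear.linear[OF assms(1)]]\<close>)
qed

lemma test_functions_add:
  assumes "f \<in> test_functions \<Omega>" "g \<in> test_functions \<Omega>"
  shows "(\<lambda>x. f x + g x) \<in> test_functions \<Omega>"
proof -
  obtain K where K: "smooth_on UNIV f" "compact K" "K \<subseteq> \<Omega>" "\<And>x. x \<notin> K \<Longrightarrow> f x = 0"
    using test_functionsE[OF assms(1)] by blast
  obtain K' where K': "smooth_on UNIV g" "compact K'" "K' \<subseteq> \<Omega>" "\<And>x. x \<notin> K' \<Longrightarrow> g x = 0"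
    using test_functionsE[OF assms(2)] by blast
  show ?thesis
    by (rule test_functionsI[of _ "K \<union> K'"]) (use K K' in \<open>auto simp: smooth_on_def intro: Ck_on_add\<close>)
qed

text \<open>Each coordinate contributes the two cut-offs S(n (x_i - a_i)) and S(n (b_i - x_i)). One
  of them vanishes outside the closed box, and S(n t) tends to 1 for t > 0 and is 0 for t <= 0, so
  the limit is the indicator of the open box.\<close>

lemma ex_box_bumps:
  fixes a b :: "'a::euclidean_space"
  assumes "cbox a b \<subseteq> \<Omega>"
  obtains \<psi> :: "nat \<Rightarrow> 'a \<Rightarrow> real" where
    "\<And>n. \<psi> n \<in> test_functions \<Omega>" "\<And>n x. 0 \<le> \<psi> n x" "\<And>n x. \<psi> n x \<le> 1"
    "\<And>x. (\<lambda>n. \<psi> n x) \<longlonglongrightarrow> indicator (box a b) x"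
proof -
  obtain S :: "real \<Rightarrow> real" where S: "smooth_on UNIV S" "\<And>x. x \<le> 0 \<Longrightarrow> S x = 0"
    "\<And>x. x \<ge> 1 \<Longrightarrow> S x = 1" "mono S"
    using ex_smooth_step by blast
  have S0: "0 \<le> S x" for x using monoD[OF S(4), of "min x 0" x] S(2)[of "min x 0"] by simp
  have S1: "S x \<le> 1" for x using monoD[OF S(4), of x "max x 1"] S(3)[of "max x 1"] by simp
  define \<psi> where "\<psi> n x = (\<Prod>i\<in>Basis. S (real n * (x \<bullet> i - a \<bullet> i)) * S (real n * (b \<bullet> i - x \<bullet> i)))" for n x
  have Slim: "(\<lambda>n. S (real n * t)) \<longlonglongrightarrow> (if t > 0 then 1 else 0)" for t :: real
  proof (cases "t > 0")
    case True
    obtain N where N: "real N * t > 1" using reals_Archimedean3[OF True] by blast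
    have "S (real n * t) = 1" if "n \<ge> N" for n
    proof (rule S(3))
      have "real N * t \<le> real n * t" using that True by (intro mult_right_mono) auto
      then show "1 \<le> real n * t" using N by linarith
    qed
    then have "\<forall>\<^sub>F n in sequentially. S (real n * t) = 1" by (auto simp: eventually_sequentially)
    then show ?thesis using True by (simp add: tendsto_eventually)
  next
    case False
    then have "S (real n * t) = 0" for n by (intro S(2)) (simp add: mult_nonneg_nonpos)
    then show ?thesis using False by simp
  qed
  show ?thesis
  proof (rule that[of \<psi>])
    fix n
    show "\<psi> n \<in> test_functions \<Omega>"
    proof (rule test_functionsI[of _ "cbox a b"])
      have 1: "smooth_on UNIV (\<lambda>x::'a. S (real n * (x \<bullet> i - a \<bullet> i)))" for i
        using smooth_on_compose_affine[of "\<lambda>x. real n * (x \<bullet> i)" S "- real n * (a \<bullet> i)"] S(1)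
        by (simp add: algebra_simps bounded_linear_mult_const bounded_linear_const_mult bounded_linear_inner_left)
      have 2: "smooth_on UNIV (\<lambda>x::'a. S (real n * (b \<bullet> i - x \<bullet> i)))" for i
        using smooth_on_compose_affine[of "\<lambda>x. - (real n * (x \<bullet> i))" S "real n * (b \<bullet> i)"] S(1)
        by (simp add: algebra_simps bounded_linear_minus bounded_linear_const_mult bounded_linear_inner_left)
      show "smooth_on UNIV (\<psi> n)"
        unfolding \<psi>_def by (intro smooth_on_prod smooth_on_bilinear[OF bounded_bilinear_mult] 1 2) auto
      fix x assume "x \<notin> cbox a b"
      then obtain i where i: "i \<in> Basis" "x \<bullet> i < a \<bullet> i \<or> b \<bullet> i < x \<bullet> i" by (force simp: mem_box)
      then have "S (real n * (x \<bullet> i - a \<bullet> i)) * S (real n * (b \<bullet> i - x \<bullet> i)) = 0"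
        using S(2) by (auto simp: mult_nonneg_nonpos)
      with i(1) show "\<psi> n x = 0" unfolding \<psi>_def by (intro prod_zero) auto
    qed (use assms in auto)
    show "0 \<le> \<psi> n x" for x unfolding \<psi>_def by (intro prod_nonneg) (auto simp: S0)
    show "\<psi> n x \<le> 1" for x unfolding \<psi>_def by (intro prod_le_1) (auto simp: S0 S1 mult_le_one)
  next
    fix x
    have "(\<lambda>n. \<psi> n x) \<longlonglongrightarrow> (\<Prod>i\<in>Basis. (if x \<bullet> i - a \<bullet> i > 0 then 1 else 0) * (if b \<bullet> i - x \<bullet> i > 0 then 1 else 0))"
      unfolding \<psi>_def by (intro tendsto_prod tendsto_mult Slim)
    also have "(\<Prod>i\<in>Basis. (if x \<bullet> i - a \<bullet> i > 0 then 1 else 0) * (if b \<bullet> i - x \<bullet> i > 0 then 1 else 0)) = indicat_real (box a b) x"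
    proof (cases "x \<in> box a b")
      case True
      then show ?thesis by (auto simp: mem_box intro!: prod.neutral)
    next
      case False
      then obtain i where "i \<in> Basis" "\<not> (a \<bullet> i < x \<bullet> i \<and> x \<bullet> i < b \<bullet> i)" by (auto simp: mem_box)
      then have "(\<Prod>i\<in>Basis. (if x \<bullet> i - a \<bullet> i > 0 then 1 else 0) * (if b \<bullet> i - x \<bullet> i > 0 then 1 else 0)) = (0::real)"
        by (intro prod_zero) auto
      with False show ?thesis by simp
    qed
    finally show "(\<lambda>n. \<psi> n x) \<longlonglongrightarrow> indicator (box a b) x" .
  qed
qed

section \<open>The fundamental lemma of the calculus of variations\<close>

text \<open>The sets over which \<open>g\<close> integrates to zero form a Dynkin system, and boxes
  are an intersection-stable generator of the Borel sets. The whole space is not a box, so its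
  integral is a separate assumption, used for complements. Uniqueness of densities then yields
  \<open>g = 0\<close> almost everywhere.\<close>

lemma integral_boxes_zero_AE:
  fixes g :: "'a::euclidean_space \<Rightarrow> real"
  assumes g: "integrable lborel g" and z: "\<And>a b. (LINT x|lborel. indicator (box a b) x *\<^sub>R g x) = 0"
    and z': "(LINT x|lborel. g x) = 0"
  shows "AE x in lborel. g x = 0"
proof -
  have "(LINT x|lborel. indicator A x *\<^sub>R g x) = 0" if "A \<in> sets lborel" for A
  proof -
    let ?E = "range (\<lambda>(a, b). box a b::'a set)"
    have A: "A \<in> sigma_sets UNIV ?E" using that by (simp add: borel_eq_box)
    have I: "Int_stable ?E" "?E \<subseteq> Pow UNIV" by (auto simp: Int_stable_def box_Int_box)
    show ?thesis
      using I A
    proof (induction rule: sigma_sets_induct_disjoint)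
      case (basic A)
      then show ?case using z by auto
    next
      case empty
      then show ?case by simp
    next
      case (compl A)
      have A: "A \<in> sets lborel" using compl by (simp add: borel_eq_box)
      have "(LINT x|lborel. indicator (UNIV - A) x *\<^sub>R g x) = (LINT x|lborel. g x - indicator A x *\<^sub>R g x)"
        by (intro Bochner_Integration.integral_cong) (auto simp: indicator_def)
      also have "\<dots> = (LINT x|lborel. g x) - (LINT x|lborel. indicator A x *\<^sub>R g x)"
        by (intro Bochner_Integration.integral_diff g integrable_mult_indicator A)
      finally show ?case using compl z' by simp
    next
      case (union A)
      have A: "A i \<in> sets lborel" for i using union by (auto simp: borel_eq_box)
      have "set_lebesgue_integral lborel (\<Union>i. A i) g = (\<Sum>i. set_lebesgue_integral lborel (A i) g)"
      proof (rule lebesgue_integral_countable_add)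
        show "set_integrable lborel (\<Union>i. A i) g"
          unfolding set_integrable_def by (intro integrable_mult_indicator g) (use A in auto)
      qed (use A union in \<open>auto simp: disjoint_family_on_def\<close>)
      then show ?case using union by (simp add: set_lebesgue_integral_def)
    qed
  qed
  then show ?thesis
    by (intro density_unique_real[of lborel g "\<lambda>_. 0"]) (auto simp: g set_lebesgue_integral_def)
qed

text \<open>The definitions integrate over \<open>lebesgue_on\<close>, while Fubini and generator
  arguments work with Borel functions on the whole space; a representative that is zero outside
  \<open>\<Omega>\<close> connects the two.\<close>

lemma lebesgue_on_borel_version:
  fixes g :: "'a::euclidean_space \<Rightarrow> real"
  assumes "\<Omega> \<in> sets borel" and g: "g \<in> borel_measurable (lebesgue_on \<Omega>)"
  obtains g' where "g' \<in> borel_measurable borel" "\<And>x. x \<notin> \<Omega> \<Longrightarrow> g' x = 0"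
    "AE x in lborel. x \<in> \<Omega> \<longrightarrow> g' x = g x"
proof -
  have "(\<lambda>x. indicator \<Omega> x *\<^sub>R g x) \<in> borel_measurable lebesgue"
    using g assms(1) by (subst borel_measurable_restrict_space_iff[symmetric]) auto
  then obtain h where h: "h \<in> borel_measurable lborel" "AE x in lborel. indicator \<Omega> x *\<^sub>R g x = h x"
    using completion_ex_borel_measurable_real by metis
  show ?thesis
  proof (rule that[of "\<lambda>x. indicator \<Omega> x * h x"])
    show "(\<lambda>x. indicator \<Omega> x * h x) \<in> borel_measurable borel"
      using h(1) assms(1) by measurable
    show "AE x in lborel. x \<in> \<Omega> \<longrightarrow> indicator \<Omega> x * h x = g x"
      using h(2) by eventually_elim (auto simp: indicator_def)
  qed auto
qed

lemma AE_lebesgue_on_iff: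
  "\<Omega> \<in> sets lebesgue \<Longrightarrow> (AE x in lebesgue_on \<Omega>. P x) \<longleftrightarrow> (AE x in lebesgue. x \<in> \<Omega> \<longrightarrow> P x)"
  by (subst AE_restrict_space_iff) auto

lemma integral_lebesgue_on_lborel:
  fixes f :: "'a::euclidean_space \<Rightarrow> 'b::{banach, second_countable_topology}"
  assumes "\<Omega> \<in> sets borel" "f \<in> borel_measurable borel" "\<And>x. x \<notin> \<Omega> \<Longrightarrow> f x = 0"
  shows "(LINT x|lebesgue_on \<Omega>. f x) = (LINT x|lborel. f x)"
    and "integrable (lebesgue_on \<Omega>) f \<longleftrightarrow> integrable lborel f"
proof -
  have eq: "(\<lambda>x. indicator \<Omega> x *\<^sub>R f x) = f" using assms(3) by (auto simp: fun_eq_iff indicator_def)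
  show "(LINT x|lebesgue_on \<Omega>. f x) = (LINT x|lborel. f x)"
    using assms by (simp add: integral_restrict_space eq integral_completion)
  show "integrable (lebesgue_on \<Omega>) f \<longleftrightarrow> integrable lborel f"
    using assms by (simp add: integrable_restrict_space eq integrable_completion)
qed

text \<open>Testing with \<open>ex_box_bumps\<close> and dominated convergence give zero integrals
  over all boxes whose closure lies in \<open>\<Omega>\<close>. This determines the function on each
  such box, and countably many closed boxes cover \<open>\<Omega>\<close>.\<close>

lemma du_Bois_Reymond:
  fixes g :: "'a::euclidean_space \<Rightarrow> real"
  assumes \<Omega>: "open \<Omega>" and g: "integrable (lebesgue_on \<Omega>) g"
    and z: "\<And>\<psi>. \<psi> \<in> test_functions \<Omega> \<Longrightarrow> (LINT x|lebesgue_on \<Omega>. g x * \<psi> x) = 0"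
  shows "AE x in lebesgue_on \<Omega>. g x = 0"
proof -
  have \<Omega>b: "\<Omega> \<in> sets borel" "\<Omega> \<in> sets lebesgue" using \<Omega> by auto
  obtain g' where g': "g' \<in> borel_measurable borel" "\<And>x. x \<notin> \<Omega> \<Longrightarrow> g' x = 0"
    "AE x in lborel. x \<in> \<Omega> \<longrightarrow> g' x = g x"
    using lebesgue_on_borel_version[OF \<Omega>b(1) borel_measurable_integrable[OF g]] by blast
  have ae: "AE x in lebesgue_on \<Omega>. g' x = g x"
    using g'(3) by (simp add: AE_lebesgue_on_iff[OF \<Omega>b(2)] AE_completion)
  have g'm: "g' \<in> borel_measurable (lebesgue_on \<Omega>)" using g'(1) by (intro measurable_restrict_space1 measurable_completion) simp
  have g'i: "integrable lborel g'"
    using integrable_cong_AE_imp[OF g g'm] ae integral_lebesgue_on_lborel(2)[OF \<Omega>b(1) g'(1,2)]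
    by (simp add: eq_commute)
  have zero: "(LINT x|lborel. indicator (box a b) x *\<^sub>R g' x) = 0" if "cbox a b \<subseteq> \<Omega>" for a b
  proof -
    obtain \<psi> :: "nat \<Rightarrow> 'a \<Rightarrow> real" where \<psi>: "\<And>n. \<psi> n \<in> test_functions \<Omega>" "\<And>n x. 0 \<le> \<psi> n x"
      "\<And>n x. \<psi> n x \<le> 1" "\<And>x. (\<lambda>n. \<psi> n x) \<longlonglongrightarrow> indicator (box a b) x"
      using ex_box_bumps[OF \<open>cbox a b \<subseteq> \<Omega>\<close>] by blast
    note [measurable] = test_functions_borel[OF \<psi>(1)] g'(1)
    have "(LINT x|lborel. \<psi> n x *\<^sub>R g' x) = 0" for n
    proof -
      have "(LINT x|lborel. \<psi> n x *\<^sub>R g' x) = (LINT x|lebesgue_on \<Omega>. \<psi> n x *\<^sub>R g' x)"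
        by (rule integral_lebesgue_on_lborel(1)[symmetric]) (use \<Omega>b g'(2) in auto)
      also have "\<dots> = (LINT x|lebesgue_on \<Omega>. g x * \<psi> n x)"
      proof (rule integral_cong_AE)
        show "(\<lambda>x. \<psi> n x *\<^sub>R g' x) \<in> borel_measurable (lebesgue_on \<Omega>)"
          by (intro measurable_restrict_space1 measurable_completion) simp
        show "(\<lambda>x. g x * \<psi> n x) \<in> borel_measurable (lebesgue_on \<Omega>)"
          by (intro borel_measurable_times borel_measurable_integrable[OF g]
              measurable_restrict_space1 measurable_completion) simp
        show "AE x in lebesgue_on \<Omega>. \<psi> n x *\<^sub>R g' x = g x * \<psi> n x"
          using ae by eventually_elim auto
      qed
      finally show ?thesis using z[OF \<psi>(1)] by simp
    qed
    moreover have "(\<lambda>n. LINT x|lborel. \<psi> n x *\<^sub>R g' x) \<longlonglongrightarrow> (LINT x|lborel. indicator (box a b) x *\<^sub>R g' x)"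
    proof (rule integral_dominated_convergence[where w="\<lambda>x. norm (g' x)"])
      show "AE x in lborel. norm (\<psi> n x *\<^sub>R g' x) \<le> norm (g' x)" for n
        using \<psi>(2,3)[of n] by (auto simp: abs_mult intro!: mult_left_le_one_le)
      show "AE x in lborel. (\<lambda>n. \<psi> n x *\<^sub>R g' x) \<longlonglongrightarrow> indicator (box a b) x *\<^sub>R g' x"
        using \<psi>(4) by (auto intro!: tendsto_intros)
    qed (use g'i in auto)
    ultimately show ?thesis by (simp add: LIMSEQ_const_iff)
  qed
  \<comment> \<open>\<open>zero\<close> is available for boxes inside \<open>\<Omega>\<close> only,
    so the generator argument is applied to \<open>g'\<close> cut off to one box; the intersection
    of this box with any other is again of the admissible kind.\<close>
  have loc: "AE x in lborel. x \<in> box a b \<longrightarrow> g' x = 0" if ab: "cbox a b \<subseteq> \<Omega>" for a b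
  proof -
    have "AE x in lborel. indicator (box a b) x *\<^sub>R g' x = 0"
    proof (rule integral_boxes_zero_AE)
      show "integrable lborel (\<lambda>x. indicator (box a b) x *\<^sub>R g' x)"
        by (intro integrable_mult_indicator g'i) auto
      show "(LINT x|lborel. indicator (box a b) x *\<^sub>R g' x) = 0" using zero[OF ab] .
      fix c d
      define l u where "l = (\<Sum>i\<in>Basis. max (c \<bullet> i) (a \<bullet> i) *\<^sub>R i)" and "u = (\<Sum>i\<in>Basis. min (d \<bullet> i) (b \<bullet> i) *\<^sub>R i)"
      have "(LINT x|lborel. indicator (box c d) x *\<^sub>R indicator (box a b) x *\<^sub>R g' x)
         = (LINT x|lborel. indicator (box l u) x *\<^sub>R g' x)"
        unfolding l_def u_def box_Int_box[symmetric] indicator_inter_arith by (simp add: mult.assoc)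
      also have "\<dots> = 0"
        by (rule zero) (use ab in \<open>auto simp: l_def u_def Int_interval[symmetric]\<close>)
      finally show "(LINT x|lborel. indicator (box c d) x *\<^sub>R indicator (box a b) x *\<^sub>R g' x) = 0" .
    qed
    then show ?thesis by eventually_elim (auto simp: indicator_def)
  qed
  obtain \<X> where \<X>: "countable \<X>" "\<X> \<subseteq> Pow \<Omega>" "\<And>X. X \<in> \<X> \<Longrightarrow> \<exists>a b. X = cbox a b" "\<Union>\<X> = \<Omega>"
    using open_countable_Union_open_cbox[OF \<Omega>] by metis
  have "AE x in lborel. \<forall>X\<in>\<X>. x \<in> X \<longrightarrow> g' x = 0"
  proof (subst AE_ball_countable[OF \<X>(1)], intro ballI)
    fix X assume X: "X \<in> \<X>"
    obtain a b where ab: "X = cbox a b" using \<X>(3)[OF X] by blast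
    \<comment> \<open>The covering consists of closed boxes while \<open>loc\<close> speaks of open
      ones; the boundary of a box is a null set.\<close>
    have "AE x in lborel. x \<notin> cbox a b - box a b"
      by (rule AE_not_in) (simp add: null_sets_def emeasure_lborel_cbox_eq emeasure_lborel_box_eq emeasure_Diff box_subset_cbox)
    moreover have "cbox a b \<subseteq> \<Omega>" using \<X>(2) X ab by auto
    ultimately have "AE x in lborel. x \<notin> cbox a b - box a b \<and> (x \<in> box a b \<longrightarrow> g' x = 0)"
      using loc[of a b] by auto
    then show "AE x in lborel. x \<in> X \<longrightarrow> g' x = 0"
      by eventually_elim (auto simp: ab)
  qed
  then have "AE x in lborel. x \<in> \<Omega> \<longrightarrow> g' x = 0"
    by eventually_elim (use \<X>(4) in auto)
  then have "AE x in lebesgue_on \<Omega>. g' x = 0"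
    by (simp add: AE_lebesgue_on_iff[OF \<Omega>b(2)] AE_completion)
  with ae show ?thesis by eventually_elim simp
qed

text \<open>Translation invariance of Lebesgue measure makes the integral of every difference
  quotient of \<open>h\<close> vanish, and the quotients converge to the derivative. This is the
  only form of integration by parts that is needed.\<close>

lemma integral_directional_derivative_zero:
  fixes h :: "'a::euclidean_space \<Rightarrow> real"
  assumes h: "h \<in> test_functions \<Omega>"
  shows "(LINT x|lborel. frechet_derivative h (at x) e) = 0"
proof -
  define D where "D x = frechet_derivative h (at x)" for x
  obtain K where K: "smooth_on UNIV h" "compact K" "\<And>x. x \<notin> K \<Longrightarrow> h x = 0"
    using test_functionsE[OF h] by metis
  have hd: "(h has_derivative D x) (at x)" for x
    unfolding D_def by (rule smooth_on_has_derivative[OF K(1)])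
  obtain B where B: "B > 0" "\<And>x. norm (D x e) \<le> B"
    using test_functions_bounded[OF test_functions_frechet[OF h, of e]] unfolding D_def by blast
  obtain R where R: "R > 0" "\<And>x. x \<in> K \<Longrightarrow> norm x \<le> R"
    using compact_imp_bounded[OF K(2)] by (auto simp: bounded_pos)
  define q where "q n x = real (Suc n) * (h ((1 / real (Suc n)) *\<^sub>R e + x) - h x)" for n x
  note [measurable] = test_functions_borel[OF h]
  have line: "((\<lambda>s. h (x + s *\<^sub>R e)) has_real_derivative D (x + s *\<^sub>R e) e) (at s)" for x s
  proof -
    have "((\<lambda>s. x + s *\<^sub>R e) has_derivative (\<lambda>k. k *\<^sub>R e)) (at s)"
      by (auto intro!: derivative_eq_intros)
    from has_derivative_compose[OF this hd]
    show ?thesis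
      using linear_cmul[OF has_derivative_linear[OF hd]]
      by (simp add: has_field_derivative_def mult_commute_abs)
  qed
  \<comment> \<open>By the mean value theorem the quotients are bounded by \<open>B\<close>. They
    vanish outside the ball of radius R + |e|, because a translation by at most |e| cannot lead from
    there into the support.\<close>
  have "(\<lambda>n. LINT x|lborel. q n x) \<longlonglongrightarrow> (LINT x|lborel. D x e)"
  proof (rule integral_dominated_convergence[where w="\<lambda>x. indicator (cball 0 (R + norm e)) x *\<^sub>R B"])
    show "(\<lambda>x. D x e) \<in> borel_measurable lborel"
      using test_functions_borel[OF test_functions_frechet[OF h, of e]] by (simp add: D_def)
    show "integrable lborel (\<lambda>x. indicator (cball 0 (R + norm e)) x *\<^sub>R B)"
      by (intro integrable_real_indicator[THEN integrable_scaleR_left]) (use emeasure_bounded_finite[OF bounded_cball] in auto)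
    show "AE x in lborel. (\<lambda>n. q n x) \<longlonglongrightarrow> D x e"
    proof (intro AE_I2)
      fix x
      have "((\<lambda>k. (h (x + k *\<^sub>R e) - h x) / k) \<longlongrightarrow> D x e) (at 0)"
        using line[of x 0] by (simp add: DERIV_def)
      then have "(\<lambda>n. (h (x + (1 / real (Suc n)) *\<^sub>R e) - h x) / (1 / real (Suc n))) \<longlonglongrightarrow> D x e"
        by (rule filterlim_compose) (auto simp: filterlim_at simp del: of_nat_Suc intro!: LIMSEQ_inverse_real_of_nat[unfolded inverse_eq_divide])
      then show "(\<lambda>n. q n x) \<longlonglongrightarrow> D x e"
        by (simp add: q_def add.commute mult.commute)
    qed
    show "AE x in lborel. norm (q n x) \<le> indicator (cball 0 (R + norm e)) x *\<^sub>R B" for n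
    proof (intro AE_I2)
      fix x
      define s where "s = 1 / real (Suc n)"
      have s: "0 < s" "s \<le> 1" by (auto simp: s_def)
      show "norm (q n x) \<le> indicator (cball 0 (R + norm e)) x *\<^sub>R B"
      proof (cases "norm x \<le> R + norm e")
        case True
        obtain z where "h (x + s *\<^sub>R e) - h (x + 0 *\<^sub>R e) = (s - 0) * D (x + z *\<^sub>R e) e"
          using MVT2[OF s(1), of "\<lambda>s. h (x + s *\<^sub>R e)" "\<lambda>s. D (x + s *\<^sub>R e) e", OF line] by blast
        then have "q n x = D (x + z *\<^sub>R e) e"
          using s by (simp add: q_def s_def add.commute field_simps)
        then show ?thesis using B True by simp
      next
        case False
        have "norm (s *\<^sub>R e) \<le> norm e" using s by (simp add: mult_left_le_one_le)
        then have "norm (s *\<^sub>R e + x) > R" using False norm_triangle_ineq2[of x "- (s *\<^sub>R e)"] by (simp add: add.commute)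
        then have "s *\<^sub>R e + x \<notin> K" using R(2)[of "s *\<^sub>R e + x"] by linarith
        moreover have "x \<notin> K" using R(2)[of x] False norm_ge_zero[of e] by linarith
        ultimately have "h (s *\<^sub>R e + x) = 0" "h x = 0" using K(3) by auto
        then show ?thesis using False by (simp add: q_def s_def)
      qed
    qed
  qed (auto simp: q_def)
  moreover have "(LINT x|lborel. q n x) = 0" for n
  proof -
    define c where "c = (1 / real (Suc n)) *\<^sub>R e"
    have hi: "integrable lborel h" by (rule test_functions_integrable[OF h])
    have hi': "integrable lborel (\<lambda>x. h (c + x))"
      by (subst integrable_distr_eq[of "(+) c" _ borel, symmetric]) (auto simp: lborel_distr_plus hi)
    have "(LINT x|lborel. h (c + x)) = (LINT x|distr lborel borel ((+) c). h x)"
      by (subst integral_distr) auto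
    then have "(LINT x|lborel. h (c + x)) = (LINT x|lborel. h x)" by (simp add: lborel_distr_plus)
    then show ?thesis using hi hi' by (simp add: q_def c_def[symmetric] del: of_nat_Suc)
  qed
  ultimately show ?thesis by (simp add: D_def LIMSEQ_const_iff)
qed

section \<open>Square integrable fields and weak gradients\<close>

lemma integrable_real_product:
  fixes f g :: "'a \<Rightarrow> real"
  assumes [measurable]: "f \<in> borel_measurable M" "g \<in> borel_measurable M"
    and "integrable M (\<lambda>x. (f x)\<^sup>2)" "integrable M (\<lambda>x. (g x)\<^sup>2)"
  shows "integrable M (\<lambda>x. f x * g x)"
proof (rule Bochner_Integration.integrable_bound)
  show "integrable M (\<lambda>x. (f x)\<^sup>2 + (g x)\<^sup>2)" using assms by auto
  have "\<bar>a * b\<bar> \<le> a\<^sup>2 + b\<^sup>2" for a b :: real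
  proof -
    have "2 * (\<bar>a\<bar> * \<bar>b\<bar>) \<le> a\<^sup>2 + b\<^sup>2"
      using sum_squares_bound[of "\<bar>a\<bar>" "\<bar>b\<bar>"] by simp
    moreover have "0 \<le> \<bar>a\<bar> * \<bar>b\<bar>" by simp
    ultimately show ?thesis unfolding abs_mult by linarith
  qed
  then show "AE x in M. norm (f x * g x) \<le> norm ((f x)\<^sup>2 + (g x)\<^sup>2)" by (auto simp: abs_mult)
qed measurable

text \<open>The integral of (f - t g)^2 is a nonnegative polynomial in t of degree at most
  two.\<close>

lemma integral_Cauchy_Schwarz:
  fixes f g :: "'a \<Rightarrow> real"
  assumes m: "f \<in> borel_measurable M" "g \<in> borel_measurable M"
    and i: "integrable M (\<lambda>x. (f x)\<^sup>2)" "integrable M (\<lambda>x. (g x)\<^sup>2)"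
  shows "(LINT x|M. f x * g x)\<^sup>2 \<le> (LINT x|M. (f x)\<^sup>2) * (LINT x|M. (g x)\<^sup>2)"
proof -
  define A B C where "A = (LINT x|M. (f x)\<^sup>2)" and "B = (LINT x|M. f x * g x)" and "C = (LINT x|M. (g x)\<^sup>2)"
  note i' = integrable_real_product[OF m i]
  have q: "0 \<le> A - 2 * t * B + t\<^sup>2 * C" for t
  proof -
    have "0 \<le> (LINT x|M. (f x - t * g x)\<^sup>2)" by simp
    also have "\<dots> = (LINT x|M. ((f x)\<^sup>2 - (2 * t) * (f x * g x)) + t\<^sup>2 * (g x)\<^sup>2)"
      by (simp add: power2_diff power_mult_distrib algebra_simps)
    also have "\<dots> = A - 2 * t * B + t\<^sup>2 * C"
      unfolding A_def B_def C_def using i i' by simp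
    finally show ?thesis .
  qed
  have C: "C \<ge> 0" "A \<ge> 0" by (simp_all add: C_def A_def)
  show ?thesis
  proof (cases "C = 0")
    case True
    have "B = 0"
    proof (rule ccontr)
      assume "B \<noteq> 0"
      \<comment> \<open>For \<open>C = 0\<close> the polynomial is affine in t, and at this t its
        value would be -1.\<close>
      with q[of "(A + 1) / (2 * B)"] True show False by simp
    qed
    then show ?thesis using C by (simp add: A_def[symmetric] B_def[symmetric] C_def[symmetric] True)
  next
    case False
    then have "C > 0" using C by simp
    with q[of "B / C"] have "B\<^sup>2 \<le> A * C"
      by (simp add: field_simps power2_eq_square)
    then show ?thesis by (simp add: A_def B_def C_def)
  qed
qed

lemma L2_fieldsD:
  assumes "f \<in> L2_fields \<Omega>"
  shows "f \<in> borel_measurable (lebesgue_on \<Omega>)" "integrable (lebesgue_on \<Omega>) (\<lambda>x. (norm (f x))\<^sup>2)"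
  using assms by (auto simp: L2_fields_def)

lemma L2_norm_nonneg [simp]: "0 \<le> L2_norm \<Omega> f"
  by (simp add: L2_norm_def)

lemma L2_norm_sq: "(L2_norm \<Omega> f)\<^sup>2 = (LINT x|lebesgue_on \<Omega>. (norm (f x))\<^sup>2)"
  by (simp add: L2_norm_def)

lemma L2_fields_bound:
  assumes "f \<in> borel_measurable (lebesgue_on \<Omega>)" "g \<in> L2_fields \<Omega>"
    and "AE x in lebesgue_on \<Omega>. norm (f x) \<le> c * norm (g x)"
  shows "f \<in> L2_fields \<Omega>"
proof -
  have "integrable (lebesgue_on \<Omega>) (\<lambda>x. (norm (f x))\<^sup>2)"
  proof (rule Bochner_Integration.integrable_bound)
    show "integrable (lebesgue_on \<Omega>) (\<lambda>x. c\<^sup>2 * (norm (g x))\<^sup>2)" using L2_fieldsD[OF assms(2)] by simp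
    show "AE x in lebesgue_on \<Omega>. norm ((norm (f x))\<^sup>2) \<le> norm (c\<^sup>2 * (norm (g x))\<^sup>2)"
      using assms(3)
      by eventually_elim (auto simp: power_mult_distrib[symmetric] intro!: power_mono)
  qed (use assms(1) in measurable)
  then show ?thesis using assms by (auto simp: L2_fields_def)
qed

lemma L2_fields_add:
  assumes "f \<in> L2_fields \<Omega>" "g \<in> L2_fields \<Omega>"
  shows "(\<lambda>x. f x + g x) \<in> L2_fields \<Omega>"
proof -
  note [measurable] = L2_fieldsD(1)[OF assms(1)] L2_fieldsD(1)[OF assms(2)]
  have "integrable (lebesgue_on \<Omega>) (\<lambda>x. (norm (f x + g x))\<^sup>2)"
  proof (rule Bochner_Integration.integrable_bound)
    show "integrable (lebesgue_on \<Omega>) (\<lambda>x. 2 * (norm (f x))\<^sup>2 + 2 * (norm (g x))\<^sup>2)"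
      using L2_fieldsD[OF assms(1)] L2_fieldsD[OF assms(2)] by auto
    have "(norm (a + b))\<^sup>2 \<le> 2 * (norm a)\<^sup>2 + 2 * (norm b)\<^sup>2" for a b :: 'b
    proof -
      have "(norm (a + b))\<^sup>2 \<le> (norm a + norm b)\<^sup>2" by (intro power_mono norm_triangle_ineq) auto
      also have "\<dots> \<le> 2 * (norm a)\<^sup>2 + 2 * (norm b)\<^sup>2"
        using sum_squares_bound[of "norm a" "norm b"] by (simp add: power2_sum)
      finally show ?thesis .
    qed
    then show "AE x in lebesgue_on \<Omega>. norm ((norm (f x + g x))\<^sup>2) \<le> norm (2 * (norm (f x))\<^sup>2 + 2 * (norm (g x))\<^sup>2)"
      by auto
  qed measurable
  then show ?thesis by (auto simp: L2_fields_def)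
qed

lemma L2_fields_scaleR: "f \<in> L2_fields \<Omega> \<Longrightarrow> (\<lambda>x. c *\<^sub>R f x) \<in> L2_fields \<Omega>"
  by (auto simp: L2_fields_def power_mult_distrib)

lemma L2_fields_diff:
  "f \<in> L2_fields \<Omega> \<Longrightarrow> g \<in> L2_fields \<Omega> \<Longrightarrow> (\<lambda>x. f x - g x) \<in> L2_fields \<Omega>"
  using L2_fields_add[of f \<Omega> "\<lambda>x. (-1) *\<^sub>R g x"] L2_fields_scaleR[of g \<Omega> "-1"] by simp

lemma L2_norm_scaleR: "L2_norm \<Omega> (\<lambda>x. c *\<^sub>R f x) = \<bar>c\<bar> * L2_norm \<Omega> f"
  by (simp add: L2_norm_def power_mult_distrib real_sqrt_mult)

lemma L2_norm_commute: "L2_norm \<Omega> (\<lambda>x. f x - g x) = L2_norm \<Omega> (\<lambda>x. g x - f x)"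
  by (simp add: L2_norm_def norm_minus_commute)

lemma L2_norm_cong_AE:
  assumes "f \<in> borel_measurable (lebesgue_on \<Omega>)" "g \<in> borel_measurable (lebesgue_on \<Omega>)"
    and "AE x in lebesgue_on \<Omega>. f x = g x"
  shows "L2_norm \<Omega> f = L2_norm \<Omega> g"
  unfolding L2_norm_def
  by (intro arg_cong[where f=sqrt] integral_cong_AE) (use assms in auto)

lemma L2_norm_mono:
  assumes "f \<in> borel_measurable (lebesgue_on \<Omega>)" "g \<in> L2_fields \<Omega>"
    and "AE x in lebesgue_on \<Omega>. norm (f x) \<le> norm (g x)"
  shows "L2_norm \<Omega> f \<le> L2_norm \<Omega> g"
proof -
  have f: "f \<in> L2_fields \<Omega>" using L2_fields_bound[of f \<Omega> g 1] assms by simp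
  show ?thesis
    unfolding L2_norm_def
    by (intro real_sqrt_le_mono integral_mono_AE L2_fieldsD f assms)
       (use assms(3) in \<open>auto intro: power_mono\<close>)
qed

definition L2_inner :: "'a::euclidean_space set \<Rightarrow> ('a \<Rightarrow> 'b::euclidean_space) \<Rightarrow> ('a \<Rightarrow> 'b) \<Rightarrow> real" where
  "L2_inner \<Omega> f g = (LINT x|lebesgue_on \<Omega>. f x \<bullet> g x)"

lemma integrable_norm_mult:
  assumes "f \<in> L2_fields \<Omega>" "g \<in> L2_fields \<Omega>"
  shows "integrable (lebesgue_on \<Omega>) (\<lambda>x. norm (f x) * norm (g x))"
  by (rule integrable_real_product) (use L2_fieldsD[OF assms(1)] L2_fieldsD[OF assms(2)] in auto)

lemma integral_norm_mult_le:
  assumes "f \<in> L2_fields \<Omega>" "g \<in> L2_fields \<Omega>"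
  shows "(LINT x|lebesgue_on \<Omega>. norm (f x) * norm (g x)) \<le> L2_norm \<Omega> f * L2_norm \<Omega> g"
proof -
  have "(LINT x|lebesgue_on \<Omega>. norm (f x) * norm (g x))\<^sup>2 \<le> (L2_norm \<Omega> f * L2_norm \<Omega> g)\<^sup>2"
    unfolding power_mult_distrib L2_norm_sq
    by (rule integral_Cauchy_Schwarz) (use L2_fieldsD[OF assms(1)] L2_fieldsD[OF assms(2)] in auto)
  then show ?thesis by (rule power2_le_imp_le) simp
qed

lemma integrable_inner:
  assumes "f \<in> L2_fields \<Omega>" "g \<in> L2_fields \<Omega>"
  shows "integrable (lebesgue_on \<Omega>) (\<lambda>x. f x \<bullet> g x)"
  by (rule Bochner_Integration.integrable_bound[OF integrable_norm_mult[OF assms]])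
     (use L2_fieldsD[OF assms(1)] L2_fieldsD[OF assms(2)] in \<open>auto simp: Cauchy_Schwarz_ineq2\<close>)

lemma abs_L2_inner_le:
  assumes "f \<in> L2_fields \<Omega>" "g \<in> L2_fields \<Omega>"
  shows "\<bar>L2_inner \<Omega> f g\<bar> \<le> L2_norm \<Omega> f * L2_norm \<Omega> g"
proof -
  have "\<bar>L2_inner \<Omega> f g\<bar> \<le> (LINT x|lebesgue_on \<Omega>. \<bar>f x \<bullet> g x\<bar>)"
    unfolding L2_inner_def using integral_norm_bound[of "lebesgue_on \<Omega>" "\<lambda>x. f x \<bullet> g x"] by simp
  also have "\<dots> \<le> (LINT x|lebesgue_on \<Omega>. norm (f x) * norm (g x))"
    by (intro integral_mono integrable_norm_mult assms integrable_abs integrable_inner) (rule Cauchy_Schwarz_ineq2)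
  finally show ?thesis using integral_norm_mult_le[OF assms] by simp
qed

lemma L2_inner_self: "L2_inner \<Omega> f f = (L2_norm \<Omega> f)\<^sup>2"
  by (simp add: L2_inner_def L2_norm_sq power2_norm_eq_inner)

lemma L2_inner_commute: "L2_inner \<Omega> f g = L2_inner \<Omega> g f"
  by (simp add: L2_inner_def inner_commute)

lemma L2_inner_diff_left:
  assumes "f \<in> L2_fields \<Omega>" "g \<in> L2_fields \<Omega>" "h \<in> L2_fields \<Omega>"
  shows "L2_inner \<Omega> (\<lambda>x. f x - g x) h = L2_inner \<Omega> f h - L2_inner \<Omega> g h"
  using assms by (simp add: L2_inner_def inner_diff_left integrable_inner)

lemma L2_inner_diff_right:
  assumes "f \<in> L2_fields \<Omega>" "g \<in> L2_fields \<Omega>" "h \<in> L2_fields \<Omega>"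
  shows "L2_inner \<Omega> h (\<lambda>x. f x - g x) = L2_inner \<Omega> h f - L2_inner \<Omega> h g"
  using assms by (simp add: L2_inner_def inner_diff_right integrable_inner)

lemma L2_norm_diff_sq:
  assumes "f \<in> L2_fields \<Omega>" "g \<in> L2_fields \<Omega>"
  shows "(L2_norm \<Omega> (\<lambda>x. f x - g x))\<^sup>2 = (L2_norm \<Omega> f)\<^sup>2 + (L2_norm \<Omega> g)\<^sup>2 - 2 * L2_inner \<Omega> f g"
  using assms unfolding L2_inner_self[symmetric]
  by (simp add: L2_inner_diff_left L2_inner_diff_right L2_fields_diff L2_inner_commute[of _ g f])

lemma L2_norm_triangle:
  assumes "f \<in> L2_fields \<Omega>" "g \<in> L2_fields \<Omega>"
  shows "L2_norm \<Omega> (\<lambda>x. f x + g x) \<le> L2_norm \<Omega> f + L2_norm \<Omega> g"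
proof -
  have g': "(\<lambda>x. - g x) \<in> L2_fields \<Omega>" using L2_fields_scaleR[OF assms(2), of "-1"] by simp
  have "(L2_norm \<Omega> (\<lambda>x. f x - - g x))\<^sup>2 = (L2_norm \<Omega> f)\<^sup>2 + (L2_norm \<Omega> g)\<^sup>2 + 2 * L2_inner \<Omega> f g"
    unfolding L2_norm_diff_sq[OF assms(1) g'] by (simp add: L2_inner_def L2_norm_def)
  also have "\<dots> \<le> (L2_norm \<Omega> f + L2_norm \<Omega> g)\<^sup>2"
    using abs_L2_inner_le[OF assms] by (simp add: power2_sum)
  finally have "(L2_norm \<Omega> (\<lambda>x. f x + g x))\<^sup>2 \<le> (L2_norm \<Omega> f + L2_norm \<Omega> g)\<^sup>2" by simp
  then show ?thesis by (rule power2_le_imp_le) simp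
qed

lemma L2_norm_triangle_diff:
  assumes "f \<in> L2_fields \<Omega>" "g \<in> L2_fields \<Omega>" "h \<in> L2_fields \<Omega>"
  shows "L2_norm \<Omega> (\<lambda>x. f x - h x) \<le> L2_norm \<Omega> (\<lambda>x. f x - g x) + L2_norm \<Omega> (\<lambda>x. g x - h x)"
  using L2_norm_triangle[OF L2_fields_diff[OF assms(1,2)] L2_fields_diff[OF assms(2,3)]] by simp

lemma L2_norm_abs_diff_le:
  assumes "f \<in> L2_fields \<Omega>" "g \<in> L2_fields \<Omega>"
  shows "\<bar>L2_norm \<Omega> f - L2_norm \<Omega> g\<bar> \<le> L2_norm \<Omega> (\<lambda>x. f x - g x)"
  using L2_norm_triangle[OF L2_fields_diff[OF assms] assms(2)]
    L2_norm_triangle[OF L2_fields_diff[OF assms(2,1)] assms(1)] L2_norm_commute[of \<Omega> f g]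
  by simp

lemma L2_norm_tendsto:
  assumes "\<And>n. f n \<in> L2_fields \<Omega>" "g \<in> L2_fields \<Omega>" "(\<lambda>n. L2_norm \<Omega> (\<lambda>x. f n x - g x)) \<longlonglongrightarrow> 0"
  shows "(\<lambda>n. L2_norm \<Omega> (f n)) \<longlonglongrightarrow> L2_norm \<Omega> g"
  by (rule Lim_transform_bound[OF _ assms(3), THEN LIM_zero_cancel])
     (use L2_norm_abs_diff_le[OF assms(1,2)] in auto)

lemma L2_inner_tendsto:
  assumes f: "\<And>n. f n \<in> L2_fields \<Omega>" "f' \<in> L2_fields \<Omega>" "(\<lambda>n. L2_norm \<Omega> (\<lambda>x. f n x - f' x)) \<longlonglongrightarrow> 0"
    and g: "\<And>n. g n \<in> L2_fields \<Omega>" "g' \<in> L2_fields \<Omega>" "(\<lambda>n. L2_norm \<Omega> (\<lambda>x. g n x - g' x)) \<longlonglongrightarrow> 0"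
  shows "(\<lambda>n. L2_inner \<Omega> (f n) (g n)) \<longlonglongrightarrow> L2_inner \<Omega> f' g'"
proof (rule LIM_zero_cancel, rule Lim_null_comparison[OF always_eventually], rule allI)
  fix n
  have "L2_inner \<Omega> (f n) (g n) - L2_inner \<Omega> f' g' = L2_inner \<Omega> (\<lambda>x. f n x - f' x) (g n) + L2_inner \<Omega> f' (\<lambda>x. g n x - g' x)"
    using f g by (simp add: L2_inner_diff_left L2_inner_diff_right)
  then show "norm (L2_inner \<Omega> (f n) (g n) - L2_inner \<Omega> f' g') \<le>
     L2_norm \<Omega> (\<lambda>x. f n x - f' x) * L2_norm \<Omega> (g n) + L2_norm \<Omega> f' * L2_norm \<Omega> (\<lambda>x. g n x - g' x)"
    using abs_L2_inner_le[OF L2_fields_diff[OF f(1,2)] g(1), of n n]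
      abs_L2_inner_le[OF f(2) L2_fields_diff[OF g(1,2)], of n] by simp
next
  show "(\<lambda>n. L2_norm \<Omega> (\<lambda>x. f n x - f' x) * L2_norm \<Omega> (g n) + L2_norm \<Omega> f' * L2_norm \<Omega> (\<lambda>x. g n x - g' x)) \<longlonglongrightarrow> 0"
    by (rule tendsto_eq_intros f g L2_norm_tendsto[OF g] refl | simp)+
qed

lemma borel_measurable_nth:
  fixes f :: "'a \<Rightarrow> 'b::euclidean_space^'n"
  shows "f \<in> borel_measurable M \<Longrightarrow> (\<lambda>x. f x $ i) \<in> borel_measurable M"
  by (rule measurable_compose[OF _ borel_measurable_continuous_onI]) (auto intro!: continuous_intros)

lemma L2_fields_nth: "f \<in> L2_fields \<Omega> \<Longrightarrow> (\<lambda>x. f x $ i) \<in> L2_fields \<Omega>"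
  by (rule L2_fields_bound[of _ _ f 1]) (auto intro: borel_measurable_nth L2_fieldsD simp: Finite_Cartesian_Product.norm_nth_le)

section \<open>Weak gradients and the spaces H1 and V on a bounded open set\<close>

locale bounded_open =
  fixes \<Omega> :: "(real^3) set"
  assumes open_\<Omega>: "open \<Omega>" and bounded_\<Omega>: "bounded \<Omega>"
begin

abbreviation "M \<equiv> lebesgue_on \<Omega>"

lemma sets_\<Omega> [simp]: "\<Omega> \<in> sets borel" "\<Omega> \<in> sets lebesgue"
  using open_\<Omega> by auto

lemma finite_M: "finite_measure M"
proof
  have "emeasure lebesgue \<Omega> < \<infinity>" using emeasure_bounded_finite[OF bounded_\<Omega>] by auto
  then show "emeasure M (space M) \<noteq> \<infinity>" by (simp add: emeasure_restrict_space)
qed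

lemma borel_M: "f \<in> borel_measurable borel \<Longrightarrow> f \<in> borel_measurable M"
  by (intro measurable_restrict_space1 measurable_completion) simp

lemma integrable_const_M [simp]: "integrable M (\<lambda>x. c :: 'b::{banach, second_countable_topology})"
  using finite_measure.integrable_const[OF finite_M] .

lemma L2_fields_bounded:
  assumes "f \<in> borel_measurable M" "\<And>x. norm (f x) \<le> B"
  shows "f \<in> L2_fields \<Omega>"
proof -
  have "(\<lambda>x. B) \<in> L2_fields \<Omega>" by (simp add: L2_fields_def)
  then show ?thesis by (rule L2_fields_bound[OF assms(1), of _ 1]) (use assms(2) in \<open>auto intro!: order_trans[OF _ abs_ge_self]\<close>)
qed

lemma L2_fields_mult_bounded:
  fixes f :: "real^3 \<Rightarrow> real" and g :: "real^3 \<Rightarrow> 'b::euclidean_space"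
  assumes "f \<in> borel_measurable M" "\<And>x. norm (f x) \<le> B" "g \<in> L2_fields \<Omega>"
  shows "(\<lambda>x. f x *\<^sub>R g x) \<in> L2_fields \<Omega>"
proof (rule L2_fields_bound[OF _ assms(3), of _ B])
  show "(\<lambda>x. f x *\<^sub>R g x) \<in> borel_measurable M" using assms L2_fieldsD by measurable
qed (use assms(2) in \<open>auto intro!: mult_right_mono\<close>)

lemma test_L2:
  assumes "\<phi> \<in> test_functions \<Omega>'"
  shows "\<phi> \<in> L2_fields \<Omega>"
proof -
  obtain B where "B > 0" "\<And>x. norm (\<phi> x) \<le> B" using test_functions_bounded[OF assms] by blast
  then show ?thesis by (intro L2_fields_bounded borel_M test_functions_borel[OF assms])
qed

text \<open>The fundamental lemma is applied to each entry of the difference. As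
  \<open>weak_gradient\<close> is defined by choice, this uniqueness is what identifies it with a
  gradient found by computation.\<close>

lemma weak_gradient_unique:
  assumes G: "G \<in> L2_fields \<Omega>" "has_weak_gradient \<Omega> f G" and G': "G' \<in> L2_fields \<Omega>" "has_weak_gradient \<Omega> f G'"
  shows "AE x in M. G x = G' x"
proof -
  have L: "(\<lambda>x. G x $ i $ j) \<in> L2_fields \<Omega>" "(\<lambda>x. G' x $ i $ j) \<in> L2_fields \<Omega>" for i j
    using G G' by (auto intro: L2_fields_nth)
  have "AE x in M. G x $ i $ j - G' x $ i $ j = 0" for i j
  proof (rule du_Bois_Reymond[OF open_\<Omega>])
    have i: "integrable M f" if "f \<in> L2_fields \<Omega>" for f :: "real^3 \<Rightarrow> real"
      using integrable_inner[OF that, of "\<lambda>_. 1"] by (simp add: L2_fields_def)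
    show "integrable M (\<lambda>x. G x $ i $ j - G' x $ i $ j)" by (intro Bochner_Integration.integrable_diff i L)
    fix \<psi> :: "real^3 \<Rightarrow> real" assume \<psi>: "\<psi> \<in> test_functions \<Omega>"
    have "(LINT x|M. G x $ i $ j * \<psi> x) = (LINT x|M. G' x $ i $ j * \<psi> x)"
      using G(2)[unfolded has_weak_gradient_def, rule_format, OF \<psi>, of i j]
        G'(2)[unfolded has_weak_gradient_def, rule_format, OF \<psi>, of i j] by linarith
    moreover have "integrable M (\<lambda>x. G x $ i $ j * \<psi> x)" "integrable M (\<lambda>x. G' x $ i $ j * \<psi> x)"
      using integrable_inner[OF L(1) test_L2[OF \<psi>]] integrable_inner[OF L(2) test_L2[OF \<psi>]] by auto
    ultimately show "(LINT x|M. (G x $ i $ j - G' x $ i $ j) * \<psi> x) = 0"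
      by (simp add: left_diff_distrib)
  qed
  then have "AE x in M. \<forall>i j. G x $ i $ j - G' x $ i $ j = 0"
    by (simp add: AE_all_countable)
  then show ?thesis by eventually_elim (simp add: vec_eq_iff)
qed

lemma weak_gradient_works:
  assumes "f \<in> H1_fields \<Omega>"
  shows "weak_gradient \<Omega> f \<in> L2_fields \<Omega>" "has_weak_gradient \<Omega> f (weak_gradient \<Omega> f)"
proof -
  have "\<exists>G. G \<in> L2_fields \<Omega> \<and> has_weak_gradient \<Omega> f G" using assms by (auto simp: H1_fields_def)
  from someI_ex[OF this] show "weak_gradient \<Omega> f \<in> L2_fields \<Omega>" "has_weak_gradient \<Omega> f (weak_gradient \<Omega> f)"
    by (auto simp: weak_gradient_def)
qed

lemma weak_gradient_eqI:
  assumes "f \<in> L2_fields \<Omega>" "G \<in> L2_fields \<Omega>" "has_weak_gradient \<Omega> f G"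
  shows "f \<in> H1_fields \<Omega>" "AE x in M. weak_gradient \<Omega> f x = G x"
proof -
  show "f \<in> H1_fields \<Omega>" using assms by (auto simp: H1_fields_def)
  from weak_gradient_works[OF this] show "AE x in M. weak_gradient \<Omega> f x = G x"
    using weak_gradient_unique assms by blast
qed

lemma has_weak_gradient_add_scaled:
  assumes f: "f \<in> L2_fields \<Omega>" "F \<in> L2_fields \<Omega>" "has_weak_gradient \<Omega> f F"
    and g: "g \<in> L2_fields \<Omega>" "G \<in> L2_fields \<Omega>" "has_weak_gradient \<Omega> g G"
  shows "has_weak_gradient \<Omega> (\<lambda>x. f x + c *\<^sub>R g x) (\<lambda>x. F x + c *\<^sub>R G x)"
  unfolding has_weak_gradient_def
proof (intro ballI allI)
  fix \<psi> :: "real^3 \<Rightarrow> real" and i j assume \<psi>: "\<psi> \<in> test_functions \<Omega>"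
  note L = test_L2[OF \<psi>] test_L2[OF test_functions_frechet[OF \<psi>, of "axis j 1"]]
  have I: "integrable M (\<lambda>x. f x $ i * frechet_derivative \<psi> (at x) (axis j 1))"
     "integrable M (\<lambda>x. g x $ i * frechet_derivative \<psi> (at x) (axis j 1))"
     "integrable M (\<lambda>x. F x $ i $ j * \<psi> x)" "integrable M (\<lambda>x. G x $ i $ j * \<psi> x)"
    using integrable_inner[OF L2_fields_nth[OF f(1)] L(2)] integrable_inner[OF L2_fields_nth[OF g(1)] L(2)]
      integrable_inner[OF L2_fields_nth[OF L2_fields_nth[OF f(2)]] L(1)]
      integrable_inner[OF L2_fields_nth[OF L2_fields_nth[OF g(2)]] L(1)] by auto
  have "(LINT x|M. (f x + c *\<^sub>R g x) $ i * frechet_derivative \<psi> (at x) (axis j 1)) =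
     (LINT x|M. f x $ i * frechet_derivative \<psi> (at x) (axis j 1)) + c * (LINT x|M. g x $ i * frechet_derivative \<psi> (at x) (axis j 1))"
    using I by (simp add: algebra_simps)
  also have "\<dots> = - (LINT x|M. F x $ i $ j * \<psi> x) + c * (- (LINT x|M. G x $ i $ j * \<psi> x))"
    using f(3) g(3) \<psi> by (simp add: has_weak_gradient_def)
  also have "\<dots> = - (LINT x|M. (F x + c *\<^sub>R G x) $ i $ j * \<psi> x)"
    using I by (simp add: algebra_simps)
  finally show "(LINT x|M. (f x + c *\<^sub>R g x) $ i * frechet_derivative \<psi> (at x) (axis j 1)) =
      - (LINT x|M. (F x + c *\<^sub>R G x) $ i $ j * \<psi> x)" .
qed

lemma H1_fields_L2: "f \<in> H1_fields \<Omega> \<Longrightarrow> f \<in> L2_fields \<Omega>"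
  by (simp add: H1_fields_def)

text \<open>The weak gradient of the difference is a choice of its own, so linearity can only be
  expected almost everywhere.\<close>

lemma H1_diff:
  assumes "f \<in> H1_fields \<Omega>" "g \<in> H1_fields \<Omega>"
  shows "(\<lambda>x. f x - g x) \<in> H1_fields \<Omega>"
    "AE x in M. weak_gradient \<Omega> (\<lambda>x. f x - g x) x = weak_gradient \<Omega> f x - weak_gradient \<Omega> g x"
  using weak_gradient_eqI[OF L2_fields_diff[OF assms[THEN H1_fields_L2]]
      L2_fields_diff[OF assms[THEN weak_gradient_works(1)]]]
    has_weak_gradient_add_scaled[OF H1_fields_L2[OF assms(1)] weak_gradient_works[OF assms(1)]
      H1_fields_L2[OF assms(2)] weak_gradient_works[OF assms(2)], of "-1"]
  by auto

lemma H1_diff_norm: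
  assumes "f \<in> H1_fields \<Omega>" "g \<in> H1_fields \<Omega>"
  shows "L2_norm \<Omega> (weak_gradient \<Omega> (\<lambda>x. f x - g x)) = L2_norm \<Omega> (\<lambda>x. weak_gradient \<Omega> f x - weak_gradient \<Omega> g x)"
  by (rule L2_norm_cong_AE)
     (use H1_diff[OF assms] assms in \<open>auto intro!: L2_fieldsD L2_fields_diff weak_gradient_works\<close>)

lemma L2_le_H1: "L2_norm \<Omega> f \<le> H1_norm \<Omega> f" "L2_norm \<Omega> (weak_gradient \<Omega> f) \<le> H1_norm \<Omega> f"
  by (auto simp: H1_norm_def intro: real_le_rsqrt)

lemma H1_norm_nonneg [simp]: "0 \<le> H1_norm \<Omega> f"
  by (simp add: H1_norm_def)

lemma H1_norm_commute:
  assumes "f \<in> H1_fields \<Omega>" "g \<in> H1_fields \<Omega>"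
  shows "H1_norm \<Omega> (\<lambda>x. f x - g x) = H1_norm \<Omega> (\<lambda>x. g x - f x)"
  unfolding H1_norm_def H1_diff_norm[OF assms] H1_diff_norm[OF assms(2,1)]
  by (simp add: L2_norm_commute[of \<Omega> f] L2_norm_commute[of \<Omega> "weak_gradient \<Omega> f"])

lemma H1_norm_triangle:
  assumes "f \<in> H1_fields \<Omega>" "g \<in> H1_fields \<Omega>" "h \<in> H1_fields \<Omega>"
  shows "H1_norm \<Omega> (\<lambda>x. f x - h x) \<le> H1_norm \<Omega> (\<lambda>x. f x - g x) + H1_norm \<Omega> (\<lambda>x. g x - h x)"
proof -
  note [simp] = assms[THEN H1_fields_L2] assms[THEN weak_gradient_works(1)]
  \<comment> \<open>\<open>H1_norm\<close> is the Euclidean norm in the plane of the pair formed by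
    the two L2 norms, hence Minkowski's inequality in the plane.\<close>
  have "sqrt (a\<^sup>2 + b\<^sup>2) \<le> sqrt (c\<^sup>2 + d\<^sup>2) + sqrt (e\<^sup>2 + f\<^sup>2)"
    if "0 \<le> a" "a \<le> c + e" "0 \<le> b" "b \<le> d + f" for a b c d e f :: real
  proof -
    have "sqrt (a\<^sup>2 + b\<^sup>2) \<le> sqrt ((c + e)\<^sup>2 + (d + f)\<^sup>2)"
      using that by (intro real_sqrt_le_mono add_mono power_mono) auto
    also have "\<dots> \<le> sqrt (c\<^sup>2 + d\<^sup>2) + sqrt (e\<^sup>2 + f\<^sup>2)"
      using real_sqrt_sum_squares_triangle_ineq[of c e d f] by simp
    finally show ?thesis .
  qed
  then show ?thesis
    unfolding H1_norm_def
    using L2_norm_triangle_diff[of f \<Omega> g h]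
      L2_norm_triangle_diff[of "weak_gradient \<Omega> f" \<Omega> "weak_gradient \<Omega> g" "weak_gradient \<Omega> h"]
    by (simp add: H1_diff_norm assms)
qed

lemma jacobian_nth: "jacobian \<phi> (at x) $ i $ j = frechet_derivative \<phi> (at x) (axis j 1) $ i"
  by (simp add: jacobian_def matrix_def)

lemma test_jacobian:
  assumes \<phi>: "\<phi> \<in> test_functions \<Omega>'"
  shows "(\<lambda>x. jacobian \<phi> (at x)) \<in> borel_measurable borel" "\<exists>B>0. \<forall>x. norm (jacobian \<phi> (at x)) \<le> B"
proof -
  have c: "(\<lambda>x. jacobian \<phi> (at x) $ i $ j) \<in> test_functions \<Omega>'" for i j
    unfolding jacobian_nth
    by (rule test_functions_linear[OF _ test_functions_frechet[OF \<phi>]]) (rule bounded_linear_vec_nth)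
  show "(\<lambda>x. jacobian \<phi> (at x)) \<in> borel_measurable borel"
    using test_functions_borel[OF c]
    by (subst borel_measurable_euclidean_space) (auto simp: Basis_vec_def inner_axis)
  have "\<exists>B. \<forall>x. norm (jacobian \<phi> (at x) $ i $ j) \<le> B" for i j
    using test_functions_bounded[OF c, of i j] by metis
  then obtain B where B: "\<And>i j x. norm (jacobian \<phi> (at x) $ i $ j) \<le> B i j" by metis
  have "norm (jacobian \<phi> (at x)) \<le> (\<Sum>i\<in>UNIV. \<Sum>j\<in>UNIV. B i j)" for x
  proof -
    have "norm (jacobian \<phi> (at x)) \<le> (\<Sum>i\<in>UNIV. norm (jacobian \<phi> (at x) $ i))"
      unfolding norm_vec_def by (rule L2_set_le_sum) auto
    also have "\<dots> \<le> (\<Sum>i\<in>UNIV. \<Sum>j\<in>UNIV. norm (jacobian \<phi> (at x) $ i $ j))"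
      by (intro sum_mono) (simp add: norm_vec_def[of "_ $ _"] L2_set_le_sum)
    also have "\<dots> \<le> (\<Sum>i\<in>UNIV. \<Sum>j\<in>UNIV. B i j)" by (intro sum_mono B)
    finally show ?thesis .
  qed
  then show "\<exists>B>0. \<forall>x. norm (jacobian \<phi> (at x)) \<le> B"
    by (intro exI[of _ "max 1 (\<Sum>i\<in>UNIV. \<Sum>j\<in>UNIV. B i j)"]) (auto simp: le_max_iff_disj)
qed

lemma test_jacobian_L2: "\<phi> \<in> test_functions \<Omega>' \<Longrightarrow> (\<lambda>x. jacobian \<phi> (at x)) \<in> L2_fields \<Omega>"
  using test_jacobian[of \<phi> \<Omega>'] L2_fields_bounded borel_M by metis

lemma frechet_derivative_mult:
  fixes f g :: "real^3 \<Rightarrow> real"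
  assumes "smooth_on UNIV f" "smooth_on UNIV g"
  shows "frechet_derivative (\<lambda>x. f x * g x) (at x) e =
    f x * frechet_derivative g (at x) e + frechet_derivative f (at x) e * g x"
  by (rule arg_cong[of _ _ "\<lambda>F. F e", OF frechet_derivative_at[symmetric]])
     (intro has_derivative_mult smooth_on_has_derivative assms)

lemma frechet_derivative_nth:
  assumes "smooth_on UNIV \<phi>"
  shows "frechet_derivative (\<lambda>x. \<phi> x $ i) (at x) e = frechet_derivative \<phi> (at x) e $ i"
  by (rule arg_cong[of _ _ "\<lambda>F. F e", OF frechet_derivative_at[symmetric]])
     (intro bounded_linear.has_derivative[OF bounded_linear_vec_nth] smooth_on_has_derivative assms)

text \<open>A component of \<open>\<phi>\<close> times \<open>\<psi>\<close> is a test function on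
  \<open>\<Omega>\<close>, so its partial derivatives integrate to zero; the product rule then moves
  the derivative.\<close>

lemma test_has_weak_gradient:
  assumes \<phi>: "\<phi> \<in> test_functions \<Omega>'"
  shows "has_weak_gradient \<Omega> \<phi> (\<lambda>x. jacobian \<phi> (at x))"
  unfolding has_weak_gradient_def
proof (intro ballI allI)
  fix \<psi> :: "real^3 \<Rightarrow> real" and i j assume \<psi>: "\<psi> \<in> test_functions \<Omega>"
  define e :: "real^3" where "e = axis j 1"
  have \<phi>i: "(\<lambda>x. \<phi> x $ i) \<in> test_functions \<Omega>'"
    by (rule test_functions_linear[OF _ \<phi>]) (rule bounded_linear_vec_nth)
  have p: "(\<lambda>x. \<phi> x $ i * \<psi> x) \<in> test_functions \<Omega>"
    by (rule test_functions_bilinear[OF bounded_bilinear_mult \<phi>i \<psi>])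
  have s: "smooth_on UNIV \<phi>" "smooth_on UNIV \<psi>" "smooth_on UNIV (\<lambda>x. \<phi> x $ i)"
    using \<phi> \<psi> \<phi>i by (auto simp: test_functions_def)
  have "0 = (LINT x|lborel. frechet_derivative (\<lambda>x. \<phi> x $ i * \<psi> x) (at x) e)"
    using integral_directional_derivative_zero[OF p] by simp
  also have "\<dots> = (LINT x|M. frechet_derivative (\<lambda>x. \<phi> x $ i * \<psi> x) (at x) e)"
    by (rule integral_lebesgue_on_lborel(1)[symmetric])
       (use test_functions_borel[OF test_functions_frechet[OF p]] test_functions_zero[OF test_functions_frechet[OF p]] in auto)
  also have "\<dots> = (LINT x|M. \<phi> x $ i * frechet_derivative \<psi> (at x) e + jacobian \<phi> (at x) $ i $ j * \<psi> x)"
    by (simp add: frechet_derivative_mult s frechet_derivative_nth jacobian_nth e_def)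
  also have "\<dots> = (LINT x|M. \<phi> x $ i * frechet_derivative \<psi> (at x) e) + (LINT x|M. jacobian \<phi> (at x) $ i $ j * \<psi> x)"
    using integrable_inner[OF test_L2[OF \<phi>i] test_L2[OF test_functions_frechet[OF \<psi>, of e]]]
      integrable_inner[OF L2_fields_nth[OF L2_fields_nth[OF test_jacobian_L2[OF \<phi>]]] test_L2[OF \<psi>]]
    by (intro Bochner_Integration.integral_add) auto
  finally show "(LINT x|M. \<phi> x $ i * frechet_derivative \<psi> (at x) (axis j 1)) = - (LINT x|M. jacobian \<phi> (at x) $ i $ j * \<psi> x)"
    by (simp add: e_def)
qed

lemma test_H1:
  assumes \<phi>: "\<phi> \<in> test_functions \<Omega>'"
  shows "\<phi> \<in> H1_fields \<Omega>" "AE x in M. weak_gradient \<Omega> \<phi> x = jacobian \<phi> (at x)"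
  using weak_gradient_eqI[OF test_L2[OF \<phi>] test_jacobian_L2[OF \<phi>] test_has_weak_gradient[OF \<phi>]] by auto

lemma V_H1: "f \<in> V_space \<Omega> \<Longrightarrow> f \<in> H1_fields \<Omega>"
  by (simp add: V_space_def)

lemma V_L2: "f \<in> V_space \<Omega> \<Longrightarrow> f \<in> L2_fields \<Omega>"
  by (simp add: V_H1 H1_fields_L2)

lemma V_gradient_L2: "f \<in> V_space \<Omega> \<Longrightarrow> weak_gradient \<Omega> f \<in> L2_fields \<Omega>"
  by (simp add: V_H1 weak_gradient_works)

lemma solenoidal_test: "\<phi> \<in> solenoidal_test_fields \<Omega> \<Longrightarrow> \<phi> \<in> test_functions \<Omega>"
  by (simp add: solenoidal_test_fields_def)

lemma solenoidal_V:
  assumes "\<phi> \<in> solenoidal_test_fields \<Omega>"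
  shows "\<phi> \<in> V_space \<Omega>"
proof -
  have "H1_norm \<Omega> (\<lambda>x. \<phi> x - \<phi> x) = 0"
    unfolding H1_norm_def using H1_diff_norm[of \<phi> \<phi>] test_H1(1)[OF solenoidal_test[OF assms]]
    by (simp add: L2_norm_def)
  then show ?thesis
    using test_H1(1)[OF solenoidal_test[OF assms]] assms by (auto simp: V_space_def intro!: bexI[of _ \<phi>])
qed

lemma solenoidal_diff:
  assumes "\<phi> \<in> solenoidal_test_fields \<Omega>" "\<psi> \<in> solenoidal_test_fields \<Omega>"
  shows "(\<lambda>x. \<phi> x - \<psi> x) \<in> solenoidal_test_fields \<Omega>"
proof -
  have t: "(\<lambda>x. \<phi> x + (-1) *\<^sub>R \<psi> x) \<in> test_functions \<Omega>"
    using assms by (intro test_functions_add test_functions_linear[OF bounded_linear_scaleR_right])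
      (auto simp: solenoidal_test_fields_def)
  have s: "smooth_on UNIV \<phi>" "smooth_on UNIV \<psi>"
    using assms by (auto simp: solenoidal_test_fields_def test_functions_def)
  have "frechet_derivative (\<lambda>x. \<phi> x - \<psi> x) (at x) = (\<lambda>e. frechet_derivative \<phi> (at x) e - frechet_derivative \<psi> (at x) e)" for x
    by (rule frechet_derivative_at[symmetric]) (intro has_derivative_diff smooth_on_has_derivative s)
  then have "divergence (\<lambda>x. \<phi> x - \<psi> x) x = divergence \<phi> x - divergence \<psi> x" for x
    by (simp add: divergence_def trace_def jacobian_nth sum_subtractf)
  then show ?thesis using t assms by (simp add: solenoidal_test_fields_def)
qed

lemma V_approx:
  assumes "f \<in> V_space \<Omega>"
  obtains \<phi> where "\<And>n. \<phi> n \<in> solenoidal_test_fields \<Omega>" "(\<lambda>n. H1_norm \<Omega> (\<lambda>x. \<phi> n x - f x)) \<longlonglongrightarrow> 0"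
proof -
  have "\<forall>n. \<exists>\<phi>\<in>solenoidal_test_fields \<Omega>. H1_norm \<Omega> (\<lambda>x. f x - \<phi> x) < inverse (real (Suc n))"
    using assms by (auto simp: V_space_def)
  then obtain \<phi> where \<phi>: "\<And>n. \<phi> n \<in> solenoidal_test_fields \<Omega>"
    "\<And>n. H1_norm \<Omega> (\<lambda>x. f x - \<phi> n x) < inverse (real (Suc n))" by metis
  have "H1_norm \<Omega> (\<lambda>x. \<phi> n x - f x) < inverse (real (Suc n))" for n
    using \<phi> H1_norm_commute[OF V_H1[OF assms] V_H1[OF solenoidal_V[OF \<phi>(1)]]] by simp
  then have "(\<lambda>n. H1_norm \<Omega> (\<lambda>x. \<phi> n x - f x)) \<longlonglongrightarrow> 0"
    by (intro tendsto_sandwich[OF _ _ tendsto_const LIMSEQ_inverse_real_of_nat])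
       (auto intro!: always_eventually less_imp_le)
  with \<phi>(1) show ?thesis using that by blast
qed

lemma V_approxI:
  assumes "f \<in> H1_fields \<Omega>" "\<And>n. \<phi> n \<in> solenoidal_test_fields \<Omega>" "(\<lambda>n. H1_norm \<Omega> (\<lambda>x. \<phi> n x - f x)) \<longlonglongrightarrow> 0"
  shows "f \<in> V_space \<Omega>"
  unfolding V_space_def
proof (intro CollectI conjI allI impI assms(1))
  fix \<epsilon> :: real assume "\<epsilon> > 0"
  then have "\<forall>\<^sub>F n in sequentially. H1_norm \<Omega> (\<lambda>x. \<phi> n x - f x) < \<epsilon>"
    using assms(3) order_tendstoD(2) by blast
  then obtain n where "H1_norm \<Omega> (\<lambda>x. \<phi> n x - f x) < \<epsilon>"
    by (meson eventually_sequentially order_refl)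
  then show "\<exists>\<phi>\<in>solenoidal_test_fields \<Omega>. H1_norm \<Omega> (\<lambda>x. f x - \<phi> x) < \<epsilon>"
    using assms(2)[of n] H1_norm_commute[OF assms(1) V_H1[OF solenoidal_V[OF assms(2)]], of n]
    by (intro bexI[of _ "\<phi> n"]) simp_all
qed

lemma H1_norm_tendsto:
  assumes "\<And>n. f n \<in> H1_fields \<Omega>" "g \<in> H1_fields \<Omega>" "(\<lambda>n. H1_norm \<Omega> (\<lambda>x. f n x - g x)) \<longlonglongrightarrow> 0"
  shows "(\<lambda>n. L2_norm \<Omega> (\<lambda>x. f n x - g x)) \<longlonglongrightarrow> 0"
    "(\<lambda>n. L2_norm \<Omega> (\<lambda>x. weak_gradient \<Omega> (f n) x - weak_gradient \<Omega> g x)) \<longlonglongrightarrow> 0"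
proof -
  show "(\<lambda>n. L2_norm \<Omega> (\<lambda>x. f n x - g x)) \<longlonglongrightarrow> 0"
    by (rule tendsto_sandwich[OF _ _ tendsto_const assms(3)]) (auto simp: L2_le_H1)
  show "(\<lambda>n. L2_norm \<Omega> (\<lambda>x. weak_gradient \<Omega> (f n) x - weak_gradient \<Omega> g x)) \<longlonglongrightarrow> 0"
    by (rule tendsto_sandwich[OF _ _ tendsto_const assms(3)])
       (auto simp: H1_diff_norm[OF assms(1,2), symmetric] L2_le_H1)
qed

lemma V_diff:
  assumes "f \<in> V_space \<Omega>" "g \<in> V_space \<Omega>"
  shows "(\<lambda>x. f x - g x) \<in> V_space \<Omega>"
proof -
  obtain \<phi> where \<phi>: "\<And>n. \<phi> n \<in> solenoidal_test_fields \<Omega>" "(\<lambda>n. H1_norm \<Omega> (\<lambda>x. \<phi> n x - f x)) \<longlonglongrightarrow> 0"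
    using V_approx[OF assms(1)] by blast
  obtain \<psi> where \<psi>: "\<And>n. \<psi> n \<in> solenoidal_test_fields \<Omega>" "(\<lambda>n. H1_norm \<Omega> (\<lambda>x. \<psi> n x - g x)) \<longlonglongrightarrow> 0"
    using V_approx[OF assms(2)] by blast
  note H = V_H1[OF assms(1)] V_H1[OF assms(2)] V_H1[OF solenoidal_V[OF \<phi>(1)]] V_H1[OF solenoidal_V[OF \<psi>(1)]]
  have le: "H1_norm \<Omega> (\<lambda>x. (\<phi> n x - \<psi> n x) - (f x - g x)) \<le> H1_norm \<Omega> (\<lambda>x. \<phi> n x - f x) + H1_norm \<Omega> (\<lambda>x. \<psi> n x - g x)" for n
  proof -
    have "H1_norm \<Omega> (\<lambda>x. (\<phi> n x - f x) - (\<psi> n x - g x)) \<le> H1_norm \<Omega> (\<lambda>x. (\<phi> n x - f x) - 0) + H1_norm \<Omega> (\<lambda>x. 0 - (\<psi> n x - g x))"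
    proof (rule H1_norm_triangle)
      have "(\<lambda>x. f x - f x) \<in> H1_fields \<Omega>" by (rule H1_diff(1)[OF H(1,1)])
      then show "(\<lambda>x. 0) \<in> H1_fields \<Omega>" by simp
    qed (intro H1_diff H)+
    also have "H1_norm \<Omega> (\<lambda>x. 0 - (\<psi> n x - g x)) = H1_norm \<Omega> (\<lambda>x. \<psi> n x - g x)"
      using H1_norm_commute[OF H(2) H(4), of n] by simp
    finally show ?thesis by (simp add: algebra_simps)
  qed
  show ?thesis
  proof (rule V_approxI)
    show "(\<lambda>x. f x - g x) \<in> H1_fields \<Omega>" by (intro H1_diff H)
    show "(\<lambda>x. \<phi> n x - \<psi> n x) \<in> solenoidal_test_fields \<Omega>" for n by (intro solenoidal_diff \<phi> \<psi>)
    have lim: "(\<lambda>n. H1_norm \<Omega> (\<lambda>x. \<phi> n x - f x) + H1_norm \<Omega> (\<lambda>x. \<psi> n x - g x)) \<longlonglongrightarrow> 0"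
      using tendsto_add[OF \<phi>(2) \<psi>(2)] by simp
    show "(\<lambda>n. H1_norm \<Omega> (\<lambda>x. \<phi> n x - \<psi> n x - (f x - g x))) \<longlonglongrightarrow> 0"
      by (rule tendsto_sandwich[OF _ _ tendsto_const lim]) (use le in auto)
  qed
qed

end

section \<open>The Ladyzhenskaya inequality in three dimensions\<close>

text \<open>The norm of matrices is the Frobenius norm, so Cauchy-Schwarz can be applied row by
  row.\<close>

lemma norm_matrix_vector_mult_le:
  fixes A :: "real^'n^'m" and x :: "real^'n"
  shows "norm (A *v x) \<le> norm A * norm x"
proof -
  have "(norm (A *v x))\<^sup>2 = (\<Sum>i\<in>UNIV. (A $ i \<bullet> x)\<^sup>2)"
    by (simp add: norm_vec_def L2_set_def sum_nonneg matrix_vector_mul_component)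
  also have "\<dots> \<le> (\<Sum>i\<in>UNIV. (norm (A $ i))\<^sup>2 * (norm x)\<^sup>2)"
  proof (intro sum_mono)
    fix i
    have "\<bar>A $ i \<bullet> x\<bar> \<le> norm (A $ i) * norm x" by (rule Cauchy_Schwarz_ineq2)
    then have "\<bar>A $ i \<bullet> x\<bar>\<^sup>2 \<le> (norm (A $ i) * norm x)\<^sup>2" by (rule power_mono) simp
    then show "(A $ i \<bullet> x)\<^sup>2 \<le> (norm (A $ i))\<^sup>2 * (norm x)\<^sup>2" by (simp add: power_mult_distrib)
  qed
  also have "\<dots> = (norm A * norm x)\<^sup>2"
    by (simp add: norm_vec_def[of A] L2_set_def sum_nonneg power_mult_distrib sum_distrib_right)
  finally show ?thesis by (rule power2_le_imp_le) simp
qed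

text \<open>The fundamental theorem of calculus for |phi|^2 along a line that starts at a zero of
  phi, with derivative 2 phi . d phi. The extended nonnegative form allows Fubini to be applied
  afterwards without integrability conditions. The lemma serves the Cartesian directions as well as
  the radial and the vertical one.\<close>

lemma norm_square_le_line_integral:
  fixes \<phi> :: "'a::euclidean_space \<Rightarrow> 'b::euclidean_space"
  assumes \<phi>: "smooth_on UNIV \<phi>" and "s\<^sub>0 \<le> t" and z: "\<phi> (p + s\<^sub>0 *\<^sub>R e) = 0"
  shows "ennreal ((norm (\<phi> (p + t *\<^sub>R e)))\<^sup>2) \<le>
    (\<integral>\<^sup>+s. ennreal (2 * norm (\<phi> (p + s *\<^sub>R e)) * norm (frechet_derivative \<phi> (at (p + s *\<^sub>R e)) e)) * indicator {s\<^sub>0..t} s \<partial>lborel)"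
proof -
  define h h' k where "h s = \<phi> (p + s *\<^sub>R e) \<bullet> \<phi> (p + s *\<^sub>R e)"
    and "h' s = 2 * (\<phi> (p + s *\<^sub>R e) \<bullet> frechet_derivative \<phi> (at (p + s *\<^sub>R e)) e)"
    and "k s = 2 * norm (\<phi> (p + s *\<^sub>R e)) * norm (frechet_derivative \<phi> (at (p + s *\<^sub>R e)) e)" for s
  have line: "((\<lambda>s. \<phi> (p + s *\<^sub>R e)) has_vector_derivative frechet_derivative \<phi> (at (p + s *\<^sub>R e)) e) (at s)" for s
  proof -
    have "((\<lambda>s. p + s *\<^sub>R e) has_derivative (\<lambda>k. k *\<^sub>R e)) (at s)"
      by (auto intro!: derivative_eq_intros)
    from has_derivative_compose[OF this smooth_on_has_derivative[OF \<phi>]]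
    show ?thesis
      using linear_cmul[OF has_derivative_linear[OF smooth_on_has_derivative[OF \<phi>]]]
      by (simp add: has_vector_derivative_def)
  qed
  have der: "DERIV h s :> h' s" for s
    unfolding h_def[abs_def] h'_def has_field_derivative_def
    using has_derivative_inner[OF line[unfolded has_vector_derivative_def, of s] line[unfolded has_vector_derivative_def, of s]]
    by (rule has_derivative_eq_rhs) (auto simp: fun_eq_iff inner_commute)
  have cont: "continuous_on UNIV (\<lambda>s. \<phi> (p + s *\<^sub>R e))"
    "continuous_on UNIV (\<lambda>s. frechet_derivative \<phi> (at (p + s *\<^sub>R e)) e)"
    by (auto intro!: continuous_intros continuous_on_compose2[OF smooth_on_continuous[OF \<phi>, of UNIV]]
        continuous_on_compose2[OF smooth_on_continuous[OF smooth_on_frechet[OF \<phi>, of e], of UNIV]])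
  have ch: "isCont h' s" and ck: "isCont k s" for s
    using cont unfolding h'_def k_def by (auto intro!: continuous_intros simp: continuous_on_eq_continuous_at)
  have hk: "h' s \<le> k s" for s
    unfolding h'_def k_def using norm_cauchy_schwarz[of "\<phi> (p + s *\<^sub>R e)" "frechet_derivative \<phi> (at (p + s *\<^sub>R e)) e"] by simp
  have ik: "integrable lborel (\<lambda>s. k s * indicator {s\<^sub>0..t} s)" and ih: "integrable lborel (\<lambda>s. h' s * indicator {s\<^sub>0..t} s)"
    using borel_integrable_atLeastAtMost[of s\<^sub>0 t k] borel_integrable_atLeastAtMost[of s\<^sub>0 t h'] ch ck
    by (auto simp: mult.commute)
  have "(norm (\<phi> (p + t *\<^sub>R e)))\<^sup>2 = h t - h s\<^sub>0"
    using z by (simp add: h_def power2_norm_eq_inner)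
  also have "\<dots> = (LINT s|lborel. h' s * indicator {s\<^sub>0..t} s)"
    by (rule integral_FTC_Icc_real[OF \<open>s\<^sub>0 \<le> t\<close>, symmetric]) (use der ch in auto)
  also have "\<dots> \<le> (LINT s|lborel. k s * indicator {s\<^sub>0..t} s)"
    by (intro integral_mono ih ik) (auto simp: indicator_def hk)
  finally have "ennreal ((norm (\<phi> (p + t *\<^sub>R e)))\<^sup>2) \<le> ennreal (LINT s|lborel. k s * indicator {s\<^sub>0..t} s)"
    by (rule ennreal_leI)
  also have "\<dots> = (\<integral>\<^sup>+s. ennreal (k s * indicator {s\<^sub>0..t} s) \<partial>lborel)"
    by (rule nn_integral_eq_integral[symmetric, OF ik]) (auto simp: k_def)
  also have "\<dots> = (\<integral>\<^sup>+s. ennreal (k s) * indicator {s\<^sub>0..t} s \<partial>lborel)"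
    by (intro nn_integral_cong) (auto simp: indicator_def)
  finally show ?thesis by (simp add: k_def)
qed

section \<open>Iterated integrals in three-space\<close>

lemma emeasure_lborel_Times:
  fixes A :: "'a::euclidean_space set" and B :: "'b::euclidean_space set"
  assumes "A \<in> sets borel" "B \<in> sets borel"
  shows "emeasure lborel (A \<times> B) = emeasure lborel A * emeasure lborel B"
  using assms by (simp add: lborel_prod[symmetric] lborel.emeasure_pair_measure_Times del: lborel_prod)

lemma nn_integral_lborel_Times:
  fixes f :: "'a::euclidean_space \<times> 'b::euclidean_space \<Rightarrow> ennreal"
  assumes "f \<in> borel_measurable borel"
  shows "(\<integral>\<^sup>+p. f p \<partial>lborel) = (\<integral>\<^sup>+x. \<integral>\<^sup>+y. f (x, y) \<partial>lborel \<partial>lborel)"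
proof -
  have "f \<in> borel_measurable (lborel \<Otimes>\<^sub>M lborel)" using assms by (simp add: lborel_prod)
  from lborel.nn_integral_fst[OF this] show ?thesis by (simp add: lborel_prod)
qed

text \<open>Lebesgue measure is determined by its values on boxes, and the preimage of a box under
  the coordinate map is a product of three intervals. The identity reduces integrals over
  \<open>real^3\<close> to iterated ones.\<close>

lemma lborel_real3: "(lborel :: (real^3) measure) = distr lborel borel (\<lambda>(x, y, z). vector [x, y, z])"
proof (rule lborel_eqI)
  let ?T = "\<lambda>(x, y, z). vector [x, y, z] :: real^3"
  have T: "?T \<in> borel_measurable borel"
  proof (rule borel_measurable_continuous_onI)
    have "?T = (\<lambda>p. fst p *\<^sub>R axis 1 1 + fst (snd p) *\<^sub>R axis 2 1 + snd (snd p) *\<^sub>R axis 3 1)"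
      by (auto simp: fun_eq_iff vec_eq_iff forall_3 axis_def)
    then show "continuous_on UNIV ?T" by (auto intro!: continuous_intros)
  qed
  fix l u :: "real^3" assume lu: "\<And>b. b \<in> Basis \<Longrightarrow> l \<bullet> b \<le> u \<bullet> b"
  have lu': "l $ i \<le> u $ i" for i using lu[of "axis i 1"] by (simp add: inner_axis)
  have pre: "?T -` box l u = {l $ 1<..<u $ 1} \<times> {l $ 2<..<u $ 2} \<times> {l $ 3<..<u $ 3}"
    by (auto simp: mem_box_cart forall_3)
  have "emeasure (distr lborel borel ?T) (box l u) = emeasure lborel (?T -` box l u)"
    using T by (subst emeasure_distr) auto
  also have "\<dots> = ennreal (u $ 1 - l $ 1) * (ennreal (u $ 2 - l $ 2) * ennreal (u $ 3 - l $ 3))"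
    unfolding pre using lu' by (simp add: emeasure_lborel_Times borel_Times)
  also have "\<dots> = ennreal (\<Prod>b\<in>Basis. (u - l) \<bullet> b)"
  proof -
    have "(\<Prod>b\<in>Basis. (u - l) \<bullet> b) = (\<Prod>i\<in>UNIV. u $ i - l $ i)"
    proof -
      have B: "(Basis :: (real^3) set) = (\<lambda>i. axis i 1) ` UNIV" unfolding Basis_vec_def Basis_real_def by blast
      have inj: "inj (\<lambda>i. axis i (1::real) :: real^3)" by (rule injI) (simp add: axis_eq_axis)
      show ?thesis unfolding B prod.reindex[OF inj] o_def inner_axis vector_minus_component inner_real_def mult_1_right ..
    qed
    also have "\<dots> = (u $ 1 - l $ 1) * ((u $ 2 - l $ 2) * (u $ 3 - l $ 3))" unfolding UNIV_3 by (simp add: ac_simps)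
    finally show ?thesis using lu' by (simp add: ennreal_mult)
  qed
  finally show "emeasure (distr lborel borel ?T) (box l u) = (\<Prod>b\<in>Basis. (u - l) \<bullet> b)" .
qed simp

lemma measurable_vector3 [measurable]:
  "(\<lambda>p. vector [fst p, fst (snd p), snd (snd p)] :: real^3) \<in> borel_measurable borel"
proof (rule borel_measurable_continuous_onI)
  have "(\<lambda>p. vector [fst p, fst (snd p), snd (snd p)] :: real^3) =
      (\<lambda>p. fst p *\<^sub>R axis 1 1 + fst (snd p) *\<^sub>R axis 2 1 + snd (snd p) *\<^sub>R axis 3 1)"
    by (auto simp: fun_eq_iff vec_eq_iff forall_3 axis_def)
  then show "continuous_on UNIV (\<lambda>p. vector [fst p, fst (snd p), snd (snd p)] :: real^3)"
    by (simp only:) (intro continuous_intros)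
qed

lemma measurable_vector3_comp [measurable (raw)]:
  fixes f g h :: "'a \<Rightarrow> real"
  assumes [measurable]: "f \<in> borel_measurable N" "g \<in> borel_measurable N" "h \<in> borel_measurable N"
  shows "(\<lambda>x. vector [f x, g x, h x] :: real^3) \<in> borel_measurable N"
proof -
  have eq: "(\<lambda>x. vector [f x, g x, h x] :: real^3) =
      (\<lambda>x. f x *\<^sub>R axis 1 1 + g x *\<^sub>R axis 2 1 + h x *\<^sub>R axis 3 1)"
    by (auto simp: fun_eq_iff vec_eq_iff forall_3 axis_def)
  show ?thesis unfolding eq by measurable
qed

lemma nn_integral_real3:
  assumes [measurable]: "h \<in> borel_measurable borel"
  shows "(\<integral>\<^sup>+x. h x \<partial>(lborel :: (real^3) measure)) =
    (\<integral>\<^sup>+x. \<integral>\<^sup>+y. \<integral>\<^sup>+z. h (vector [x, y, z]) \<partial>lborel \<partial>lborel \<partial>lborel)"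
proof -
  have m: "(\<lambda>(x, y, z). vector [x, y, z] :: real^3) \<in> borel_measurable borel"
    using measurable_vector3 by (simp add: case_prod_beta)
  have "(\<integral>\<^sup>+x. h x \<partial>(lborel :: (real^3) measure)) = (\<integral>\<^sup>+p. h (case p of (x, y, z) \<Rightarrow> vector [x, y, z]) \<partial>lborel)"
    by (subst lborel_real3) (use m in \<open>auto simp: nn_integral_distr\<close>)
  also have "\<dots> = (\<integral>\<^sup>+x. \<integral>\<^sup>+q. h (vector [x, fst q, snd q]) \<partial>lborel \<partial>lborel)"
    using m by (subst nn_integral_lborel_Times) (auto simp: case_prod_beta)
  also have "\<dots> = (\<integral>\<^sup>+x. \<integral>\<^sup>+y. \<integral>\<^sup>+z. h (vector [x, y, z]) \<partial>lborel \<partial>lborel \<partial>lborel)"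
    by (intro nn_integral_cong, subst nn_integral_lborel_Times) (auto simp: borel_prod[symmetric])
  finally show ?thesis .
qed

text \<open>Here \<open>a\<close> stands for |phi| and \<open>d\<close> for |grad phi|. On a slice
  of fixed z the bounds in x and y separate as in the plane and give S(z)^2. Cauchy-Schwarz splits
  this into the slice integrals of 4 a^2 and d^2, and the bound in the third direction controls the
  slice integral of a^2 by \<open>Q\<close>, uniformly in z. Integration over z then concerns d^2
  only.\<close>

lemma nn_integral_power4_le:
  fixes a d :: "real \<times> real \<times> real \<Rightarrow> ennreal"
  assumes [measurable]: "a \<in> borel_measurable (borel \<Otimes>\<^sub>M borel \<Otimes>\<^sub>M borel)"
    "d \<in> borel_measurable (borel \<Otimes>\<^sub>M borel \<Otimes>\<^sub>M borel)"
  assumes 1: "\<And>x y z. (a (x, y, z))\<^sup>2 \<le> (\<integral>\<^sup>+s. 2 * a (s, y, z) * d (s, y, z) \<partial>lborel)"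
    and 2: "\<And>x y z. (a (x, y, z))\<^sup>2 \<le> (\<integral>\<^sup>+s. 2 * a (x, s, z) * d (x, s, z) \<partial>lborel)"
    and 3: "\<And>x y z. (a (x, y, z))\<^sup>2 \<le> (\<integral>\<^sup>+s. 2 * a (x, y, s) * d (x, y, s) \<partial>lborel)"
  shows "(\<integral>\<^sup>+x. \<integral>\<^sup>+y. \<integral>\<^sup>+z. (a (x, y, z)) ^ 4 \<partial>lborel \<partial>lborel \<partial>lborel) \<le>
     8 * (\<integral>\<^sup>+x. \<integral>\<^sup>+y. \<integral>\<^sup>+z. a (x, y, z) * d (x, y, z) \<partial>lborel \<partial>lborel \<partial>lborel) *
     (\<integral>\<^sup>+x. \<integral>\<^sup>+y. \<integral>\<^sup>+z. (d (x, y, z))\<^sup>2 \<partial>lborel \<partial>lborel \<partial>lborel)"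
proof -
  define P where "P p = 2 * a p * d p" for p
  have [measurable]: "P \<in> borel_measurable (borel \<Otimes>\<^sub>M borel \<Otimes>\<^sub>M borel)"
    unfolding P_def by measurable
  have rot: "(\<integral>\<^sup>+x. \<integral>\<^sup>+y. \<integral>\<^sup>+z. h (x, y, z) \<partial>lborel \<partial>lborel \<partial>lborel) =
      (\<integral>\<^sup>+z. \<integral>\<^sup>+x. \<integral>\<^sup>+y. h (x, y, z) \<partial>lborel \<partial>lborel \<partial>lborel)"
    if [measurable]: "h \<in> borel_measurable (borel \<Otimes>\<^sub>M borel \<Otimes>\<^sub>M borel)"
    for h :: "real \<times> real \<times> real \<Rightarrow> ennreal"
  proof -
    have "(\<integral>\<^sup>+x. \<integral>\<^sup>+y. \<integral>\<^sup>+z. h (x, y, z) \<partial>lborel \<partial>lborel \<partial>lborel) = (\<integral>\<^sup>+x. \<integral>\<^sup>+z. \<integral>\<^sup>+y. h (x, y, z) \<partial>lborel \<partial>lborel \<partial>lborel)"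
      by (intro nn_integral_cong lborel_pair.Fubini') measurable
    also have "\<dots> = (\<integral>\<^sup>+z. \<integral>\<^sup>+x. \<integral>\<^sup>+y. h (x, y, z) \<partial>lborel \<partial>lborel \<partial>lborel)"
      by (rule lborel_pair.Fubini') measurable
    finally show ?thesis .
  qed
  define Q where "Q = (\<integral>\<^sup>+x. \<integral>\<^sup>+y. \<integral>\<^sup>+z. P (x, y, z) \<partial>lborel \<partial>lborel \<partial>lborel)"
  define S where "S z = (\<integral>\<^sup>+x. \<integral>\<^sup>+y. P (x, y, z) \<partial>lborel \<partial>lborel)" for z
  define E where "E z = (\<integral>\<^sup>+x. \<integral>\<^sup>+y. (d (x, y, z))\<^sup>2 \<partial>lborel \<partial>lborel)" for z
  have slice: "(\<integral>\<^sup>+x. \<integral>\<^sup>+y. (a (x, y, z)) ^ 4 \<partial>lborel \<partial>lborel) \<le> 4 * Q * E z" for z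
  proof -
    have "(\<integral>\<^sup>+x. \<integral>\<^sup>+y. (a (x, y, z)) ^ 4 \<partial>lborel \<partial>lborel) \<le>
      (\<integral>\<^sup>+x. \<integral>\<^sup>+y. (\<integral>\<^sup>+s. P (s, y, z) \<partial>lborel) * (\<integral>\<^sup>+s. P (x, s, z) \<partial>lborel) \<partial>lborel \<partial>lborel)"
    proof (intro nn_integral_mono)
      fix x y
      have "(a (x, y, z)) ^ 4 = (a (x, y, z))\<^sup>2 * (a (x, y, z))\<^sup>2" by (simp flip: power_add)
      also have "\<dots> \<le> (\<integral>\<^sup>+s. P (s, y, z) \<partial>lborel) * (\<integral>\<^sup>+s. P (x, s, z) \<partial>lborel)"
        unfolding P_def by (intro mult_mono 1 2) auto
      finally show "(a (x, y, z)) ^ 4 \<le> (\<integral>\<^sup>+s. P (s, y, z) \<partial>lborel) * (\<integral>\<^sup>+s. P (x, s, z) \<partial>lborel)" .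
    qed
    also have "\<dots> = (\<integral>\<^sup>+x. (\<integral>\<^sup>+y. \<integral>\<^sup>+s. P (s, y, z) \<partial>lborel \<partial>lborel) * (\<integral>\<^sup>+s. P (x, s, z) \<partial>lborel) \<partial>lborel)"
      by (intro nn_integral_cong nn_integral_multc) measurable
    also have "\<dots> = (\<integral>\<^sup>+y. \<integral>\<^sup>+s. P (s, y, z) \<partial>lborel \<partial>lborel) * (\<integral>\<^sup>+x. \<integral>\<^sup>+s. P (x, s, z) \<partial>lborel \<partial>lborel)"
      by (intro nn_integral_cmult) measurable
    also have "(\<integral>\<^sup>+y. \<integral>\<^sup>+s. P (s, y, z) \<partial>lborel \<partial>lborel) = S z"
      unfolding S_def by (rule lborel_pair.Fubini') measurable
    also have "(\<integral>\<^sup>+x. \<integral>\<^sup>+s. P (x, s, z) \<partial>lborel \<partial>lborel) = S z" by (simp add: S_def)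
    also have "S z * S z = (\<integral>\<^sup>+p. (2 * a (fst p, snd p, z)) * d (fst p, snd p, z) \<partial>(lborel \<Otimes>\<^sub>M lborel))\<^sup>2"
    proof -
      have "S z = (\<integral>\<^sup>+p. (2 * a (fst p, snd p, z)) * d (fst p, snd p, z) \<partial>(lborel \<Otimes>\<^sub>M lborel))"
        unfolding S_def P_def by (subst lborel.nn_integral_fst[symmetric]) auto
      then show ?thesis by (simp add: power2_eq_square)
    qed
    also have "\<dots> \<le> (\<integral>\<^sup>+p. (2 * a (fst p, snd p, z))\<^sup>2 \<partial>(lborel \<Otimes>\<^sub>M lborel)) *
        (\<integral>\<^sup>+p. (d (fst p, snd p, z))\<^sup>2 \<partial>(lborel \<Otimes>\<^sub>M lborel))"
      by (rule Cauchy_Schwarz_nn_integral) measurable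
    also have "(\<integral>\<^sup>+p. (d (fst p, snd p, z))\<^sup>2 \<partial>(lborel \<Otimes>\<^sub>M lborel)) = E z"
      unfolding E_def by (subst lborel.nn_integral_fst[symmetric]) auto
    also have "(\<integral>\<^sup>+p. (2 * a (fst p, snd p, z))\<^sup>2 \<partial>(lborel \<Otimes>\<^sub>M lborel)) = (\<integral>\<^sup>+x. \<integral>\<^sup>+y. 4 * (a (x, y, z))\<^sup>2 \<partial>lborel \<partial>lborel)"
      by (subst lborel.nn_integral_fst[symmetric]) (auto simp: power_mult_distrib)
    also have "\<dots> = 4 * (\<integral>\<^sup>+x. \<integral>\<^sup>+y. (a (x, y, z))\<^sup>2 \<partial>lborel \<partial>lborel)"
      by (simp add: nn_integral_cmult)
    also have "(\<integral>\<^sup>+x. \<integral>\<^sup>+y. (a (x, y, z))\<^sup>2 \<partial>lborel \<partial>lborel) \<le> Q"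
      unfolding Q_def P_def by (intro nn_integral_mono 3)
    finally show ?thesis by (simp add: mult_left_mono mult_right_mono)
  qed
  have "(\<integral>\<^sup>+x. \<integral>\<^sup>+y. \<integral>\<^sup>+z. (a (x, y, z)) ^ 4 \<partial>lborel \<partial>lborel \<partial>lborel) = (\<integral>\<^sup>+z. \<integral>\<^sup>+x. \<integral>\<^sup>+y. (a (x, y, z)) ^ 4 \<partial>lborel \<partial>lborel \<partial>lborel)"
    by (rule rot) measurable
  also have "\<dots> \<le> (\<integral>\<^sup>+z. 4 * Q * E z \<partial>lborel)" by (intro nn_integral_mono slice)
  also have "\<dots> = 4 * Q * (\<integral>\<^sup>+z. E z \<partial>lborel)"
    by (rule nn_integral_cmult) (unfold E_def, measurable)
  also have "(\<integral>\<^sup>+z. E z \<partial>lborel) = (\<integral>\<^sup>+x. \<integral>\<^sup>+y. \<integral>\<^sup>+z. (d (x, y, z))\<^sup>2 \<partial>lborel \<partial>lborel \<partial>lborel)"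
    unfolding E_def by (rule rot[symmetric]) measurable
  \<comment> \<open>The factor 8 of the statement is 4, from the square of 2 a, times the 2 in the
    definition of \<open>P\<close>.\<close>
  also have "Q = 2 * (\<integral>\<^sup>+x. \<integral>\<^sup>+y. \<integral>\<^sup>+z. a (x, y, z) * d (x, y, z) \<partial>lborel \<partial>lborel \<partial>lborel)"
    unfolding Q_def P_def by (simp add: mult.assoc nn_integral_cmult)
  finally show ?thesis by (simp add: mult.assoc[symmetric])
qed

lemma norm_frechet_le_jacobian:
  fixes \<phi> :: "real^3 \<Rightarrow> real^3"
  assumes "smooth_on UNIV \<phi>" "norm e \<le> 1"
  shows "norm (frechet_derivative \<phi> (at x) e) \<le> norm (jacobian \<phi> (at x))"
proof -
  have "frechet_derivative \<phi> (at x) e = jacobian \<phi> (at x) *v e"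
    
    using frechet_derivative_at[OF jacobian_works[THEN iffD1, OF differentiableI[OF smooth_on_has_derivative[OF assms(1)]]]]
    by metis
  then have "norm (frechet_derivative \<phi> (at x) e) \<le> norm (jacobian \<phi> (at x)) * norm e"
    using norm_matrix_vector_mult_le by metis
  also have "\<dots> \<le> norm (jacobian \<phi> (at x))" using assms(2) by (simp add: mult_left_le)
  finally show ?thesis .
qed

lemma test_power4_nn:
  fixes \<phi> :: "real^3 \<Rightarrow> real^3"
  assumes \<phi>: "\<phi> \<in> test_functions \<Omega>'"
  shows "(\<integral>\<^sup>+x. ennreal (norm (\<phi> x)) ^ 4 \<partial>lborel) \<le>
    8 * (\<integral>\<^sup>+x. ennreal (norm (\<phi> x)) * ennreal (norm (jacobian \<phi> (at x))) \<partial>lborel) *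
    (\<integral>\<^sup>+x. (ennreal (norm (jacobian \<phi> (at x))))\<^sup>2 \<partial>lborel)"
proof -
  \<comment> \<open>The facts about Jacobians of test functions are stated in the context of a
    domain but do not mention it; the empty set gives access to them.\<close>
  interpret bounded_open "{}" by standard auto
  note [measurable] = test_functions_borel[OF \<phi>] test_jacobian(1)[OF \<phi>]
  obtain K where K: "smooth_on UNIV \<phi>" "compact K" "\<And>x. x \<notin> K \<Longrightarrow> \<phi> x = 0"
    using test_functionsE[OF \<phi>] by metis
  obtain R where R: "R > 0" "\<And>x. x \<in> K \<Longrightarrow> norm x \<le> R"
    using compact_imp_bounded[OF K(2)] by (auto simp: bounded_pos)
  define a d where "a p = ennreal (norm (\<phi> (vector [fst p, fst (snd p), snd (snd p)])))"
    and "d p = ennreal (norm (jacobian \<phi> (at (vector [fst p, fst (snd p), snd (snd p)]))))" for p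
  have line: "(ennreal (norm (\<phi> (p + t *\<^sub>R axis i 1))))\<^sup>2 \<le>
    (\<integral>\<^sup>+s. 2 * ennreal (norm (\<phi> (p + s *\<^sub>R axis i 1))) * ennreal (norm (jacobian \<phi> (at (p + s *\<^sub>R axis i 1)))) \<partial>lborel)"
    if p: "p $ i = 0" for p t i
  proof -
    \<comment> \<open>The line integral starts at a point not to the right of t whose i-th
      coordinate is below -R, hence outside the support.\<close>
    define s\<^sub>0 where "s\<^sub>0 = min t (- R - 1)"
    have "\<phi> (p + s\<^sub>0 *\<^sub>R axis i 1) = 0"
    proof (rule K(3), rule notI)
      assume "p + s\<^sub>0 *\<^sub>R axis i 1 \<in> K"
      then have "norm (p + s\<^sub>0 *\<^sub>R axis i 1) \<le> R" by (rule R)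
      moreover have "\<bar>(p + s\<^sub>0 *\<^sub>R axis i 1) $ i\<bar> \<le> norm (p + s\<^sub>0 *\<^sub>R axis i 1)"
        by (rule component_le_norm_cart)
      moreover have "(p + s\<^sub>0 *\<^sub>R axis i 1) $ i = s\<^sub>0" using p by (simp add: axis_def)
      moreover have "s\<^sub>0 \<le> - R - 1" by (simp add: s\<^sub>0_def)
      ultimately show False by linarith
    qed
    then have "ennreal ((norm (\<phi> (p + t *\<^sub>R axis i 1)))\<^sup>2) \<le>
      (\<integral>\<^sup>+s. ennreal (2 * norm (\<phi> (p + s *\<^sub>R axis i 1)) * norm (frechet_derivative \<phi> (at (p + s *\<^sub>R axis i 1)) (axis i 1))) * indicator {s\<^sub>0..t} s \<partial>lborel)"
      by (rule norm_square_le_line_integral[OF K(1), rotated]) (simp add: s\<^sub>0_def)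
    also have "\<dots> \<le> (\<integral>\<^sup>+s. 2 * ennreal (norm (\<phi> (p + s *\<^sub>R axis i 1))) * ennreal (norm (jacobian \<phi> (at (p + s *\<^sub>R axis i 1)))) \<partial>lborel)"
    proof (intro nn_integral_mono)
      fix s
      have "ennreal (2 * norm (\<phi> (p + s *\<^sub>R axis i 1)) * norm (frechet_derivative \<phi> (at (p + s *\<^sub>R axis i 1)) (axis i 1)))
        \<le> ennreal (2 * norm (\<phi> (p + s *\<^sub>R axis i 1)) * norm (jacobian \<phi> (at (p + s *\<^sub>R axis i 1))))"
        by (intro ennreal_leI mult_left_mono norm_frechet_le_jacobian K(1)) (auto simp: norm_axis_1)
      then show "ennreal (2 * norm (\<phi> (p + s *\<^sub>R axis i 1)) * norm (frechet_derivative \<phi> (at (p + s *\<^sub>R axis i 1)) (axis i 1))) * indicator {s\<^sub>0..t} s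
        \<le> 2 * ennreal (norm (\<phi> (p + s *\<^sub>R axis i 1))) * ennreal (norm (jacobian \<phi> (at (p + s *\<^sub>R axis i 1))))"
        by (auto simp: ennreal_mult indicator_def)
    qed
    finally show ?thesis by (simp add: ennreal_power)
  qed
  have v: "vector [x, y, z] = vector [0, y, z] + x *\<^sub>R (axis 1 1 :: real^3)"
    "vector [x, y, z] = vector [x, 0, z] + y *\<^sub>R (axis 2 1 :: real^3)"
    "vector [x, y, z] = vector [x, y, 0] + z *\<^sub>R (axis 3 1 :: real^3)" for x y z
    by (auto simp: vec_eq_iff forall_3 axis_def)
  have "(\<integral>\<^sup>+x. \<integral>\<^sup>+y. \<integral>\<^sup>+z. (a (x, y, z)) ^ 4 \<partial>lborel \<partial>lborel \<partial>lborel) \<le>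
     8 * (\<integral>\<^sup>+x. \<integral>\<^sup>+y. \<integral>\<^sup>+z. a (x, y, z) * d (x, y, z) \<partial>lborel \<partial>lborel \<partial>lborel) *
     (\<integral>\<^sup>+x. \<integral>\<^sup>+y. \<integral>\<^sup>+z. (d (x, y, z))\<^sup>2 \<partial>lborel \<partial>lborel \<partial>lborel)"
  proof (rule nn_integral_power4_le)
    show "a \<in> borel_measurable (borel \<Otimes>\<^sub>M borel \<Otimes>\<^sub>M borel)"
      "d \<in> borel_measurable (borel \<Otimes>\<^sub>M borel \<Otimes>\<^sub>M borel)"
      unfolding a_def d_def by measurable
    fix x y z
    show "(a (x, y, z))\<^sup>2 \<le> (\<integral>\<^sup>+s. 2 * a (s, y, z) * d (s, y, z) \<partial>lborel)"
      using line[of "vector [0, y, z]" 1 x] by (simp add: a_def d_def v(1)[symmetric])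
    show "(a (x, y, z))\<^sup>2 \<le> (\<integral>\<^sup>+s. 2 * a (x, s, z) * d (x, s, z) \<partial>lborel)"
      using line[of "vector [x, 0, z]" 2 y] by (simp add: a_def d_def v(2)[symmetric])
    show "(a (x, y, z))\<^sup>2 \<le> (\<integral>\<^sup>+s. 2 * a (x, y, s) * d (x, y, s) \<partial>lborel)"
      using line[of "vector [x, y, 0]" 3 z] by (simp add: a_def d_def v(3)[symmetric])
  qed
  then show ?thesis
    unfolding a_def d_def by (simp add: nn_integral_real3)
qed

context bounded_open
begin

lemma nn_integral_M:
  assumes [measurable]: "f \<in> borel_measurable borel"
  shows "(\<integral>\<^sup>+x. f x \<partial>M) = (\<integral>\<^sup>+x. f x * indicator \<Omega> x \<partial>lborel)"
  by (simp add: nn_integral_restrict_space nn_integral_completion)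

text \<open>The L4 norm is expressed as the L2 norm of |phi|^2, so that the calculus of L2 norms
  suffices. In these terms the bound is Ladyzhenskaya's inequality with the three-dimensional
  exponents 1 and 3.\<close>

lemma test_L4:
  fixes \<phi> :: "real^3 \<Rightarrow> real^3"
  assumes \<phi>: "\<phi> \<in> test_functions \<Omega>"
  shows "(\<lambda>x. (norm (\<phi> x))\<^sup>2) \<in> L2_fields \<Omega>"
    "(L2_norm \<Omega> (\<lambda>x. (norm (\<phi> x))\<^sup>2))\<^sup>2 \<le> 8 * L2_norm \<Omega> \<phi> * (L2_norm \<Omega> (\<lambda>x. jacobian \<phi> (at x)))^3"
proof -
  note [measurable] = test_functions_borel[OF \<phi>] test_jacobian(1)[OF \<phi>]
  obtain B where B: "B > 0" "\<And>x. norm (\<phi> x) \<le> B" using test_functions_bounded[OF \<phi>] by blast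
  show L4: "(\<lambda>x. (norm (\<phi> x))\<^sup>2) \<in> L2_fields \<Omega>"
    by (rule L2_fields_bounded[of _ "B\<^sup>2"]) (auto intro!: borel_M power_mono B)
  have z: "\<phi> x = 0" "jacobian \<phi> (at x) = 0" if "x \<notin> \<Omega>" for x
    using test_functions_zero[OF \<phi> that] test_functions_zero[OF test_functions_frechet[OF \<phi>] that]
    by (auto simp: vec_eq_iff jacobian_nth)
  have e: "(\<integral>\<^sup>+x. f x \<partial>M) = (\<integral>\<^sup>+x. f x \<partial>lborel)"
    if "f \<in> borel_measurable borel" "\<And>x. x \<notin> \<Omega> \<Longrightarrow> f x = 0" for f :: "real^3 \<Rightarrow> ennreal"
    unfolding nn_integral_M[OF that(1)] by (intro nn_integral_cong) (use that in \<open>auto simp: indicator_def\<close>)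
  have 1: "(\<integral>\<^sup>+x. ennreal (norm (\<phi> x)) ^ 4 \<partial>lborel) = ennreal ((L2_norm \<Omega> (\<lambda>x. (norm (\<phi> x))\<^sup>2))\<^sup>2)"
  proof -
    have "(\<integral>\<^sup>+x. ennreal (norm (\<phi> x)) ^ 4 \<partial>lborel) = (\<integral>\<^sup>+x. ennreal ((norm ((norm (\<phi> x))\<^sup>2))\<^sup>2) \<partial>M)"
      by (subst e[symmetric]) (auto simp: z ennreal_power simp flip: power_mult)
    then show ?thesis
      by (simp only: L2_norm_sq nn_integral_eq_integral[OF L2_fieldsD(2)[OF L4]] zero_le_power2 AE_I2)
  qed
  have 2: "(\<integral>\<^sup>+x. (ennreal (norm (jacobian \<phi> (at x))))\<^sup>2 \<partial>lborel) = ennreal ((L2_norm \<Omega> (\<lambda>x. jacobian \<phi> (at x)))\<^sup>2)"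
  proof -
    have "(\<integral>\<^sup>+x. (ennreal (norm (jacobian \<phi> (at x))))\<^sup>2 \<partial>lborel) = (\<integral>\<^sup>+x. ennreal ((norm (jacobian \<phi> (at x)))\<^sup>2) \<partial>M)"
      by (subst e[symmetric]) (auto simp: z ennreal_power)
    then show ?thesis
      by (simp add: L2_norm_sq nn_integral_eq_integral[OF L2_fieldsD(2)[OF test_jacobian_L2[OF \<phi>]]])
  qed
  have 3: "(\<integral>\<^sup>+x. ennreal (norm (\<phi> x)) * ennreal (norm (jacobian \<phi> (at x))) \<partial>lborel) \<le> ennreal (L2_norm \<Omega> \<phi> * L2_norm \<Omega> (\<lambda>x. jacobian \<phi> (at x)))"
  proof -
    have "(\<integral>\<^sup>+x. ennreal (norm (\<phi> x)) * ennreal (norm (jacobian \<phi> (at x))) \<partial>lborel) = (\<integral>\<^sup>+x. ennreal (norm (\<phi> x) * norm (jacobian \<phi> (at x))) \<partial>M)"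
      by (subst e[symmetric]) (auto simp: z ennreal_mult)
    also have "\<dots> = ennreal (LINT x|M. norm (\<phi> x) * norm (jacobian \<phi> (at x)))"
      by (intro nn_integral_eq_integral integrable_norm_mult test_L2[OF \<phi>] test_jacobian_L2[OF \<phi>]) auto
    also have "\<dots> \<le> ennreal (L2_norm \<Omega> \<phi> * L2_norm \<Omega> (\<lambda>x. jacobian \<phi> (at x)))"
      by (intro ennreal_leI integral_norm_mult_le test_L2[OF \<phi>] test_jacobian_L2[OF \<phi>])
    finally show ?thesis .
  qed
  have "ennreal ((L2_norm \<Omega> (\<lambda>x. (norm (\<phi> x))\<^sup>2))\<^sup>2) \<le>
      8 * ennreal (L2_norm \<Omega> \<phi> * L2_norm \<Omega> (\<lambda>x. jacobian \<phi> (at x))) * ennreal ((L2_norm \<Omega> (\<lambda>x. jacobian \<phi> (at x)))\<^sup>2)"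
    using test_power4_nn[OF \<phi>] unfolding 1 2
    by (rule order_trans) (intro mult_right_mono mult_left_mono 3; simp)
  also have "\<dots> = ennreal (8 * (L2_norm \<Omega> \<phi> * L2_norm \<Omega> (\<lambda>x. jacobian \<phi> (at x))) * (L2_norm \<Omega> (\<lambda>x. jacobian \<phi> (at x)))\<^sup>2)"
    by (simp add: ennreal_mult)
  finally show "(L2_norm \<Omega> (\<lambda>x. (norm (\<phi> x))\<^sup>2))\<^sup>2 \<le> 8 * L2_norm \<Omega> \<phi> * (L2_norm \<Omega> (\<lambda>x. jacobian \<phi> (at x)))^3"
    by (simp add: power3_eq_cube power2_eq_square mult.assoc)
qed

end

section \<open>Cylindrical coordinates\<close>

lemma cyl_point_eq:
  "cyl_point r z \<theta> = z *\<^sub>R axis 3 1 + r *\<^sub>R e_r \<theta>"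
  by (auto simp: cyl_point_def e_r_def vec_eq_iff forall_3 axis_def)

lemma cyl_point_eq': "cyl_point r z \<theta> = cyl_point r 0 \<theta> + z *\<^sub>R axis 3 1"
  by (auto simp: cyl_point_def vec_eq_iff forall_3 axis_def)

lemma norm_e_r [simp]: "norm (e_r \<theta>) = 1"
  by (simp add: e_r_def norm_eq_1 inner_vec_def sum_3 sin_cos_squared_add3 flip: power2_eq_square)

text \<open>The radius is recovered from the horizontal part. Two angles with equal sine and cosine
  differ by a multiple of 2 pi, and within a half-open period this multiple is zero.\<close>

lemma cyl_point_inj:
  assumes "cyl_point r z \<theta> = cyl_point r' z' \<theta>'" "0 < r" "0 < r'" "0 \<le> \<theta>" "\<theta> < 2 * pi" "0 \<le> \<theta>'" "\<theta>' < 2 * pi"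
  shows "r = r'" "z = z'" "\<theta> = \<theta>'"
proof -
  have e: "r * cos \<theta> = r' * cos \<theta>'" "r * sin \<theta> = r' * sin \<theta>'" and z: "z = z'"
    using assms(1) by (auto simp: cyl_point_def vec_eq_iff forall_3)
  have "r\<^sup>2 = (r * cos \<theta>)\<^sup>2 + (r * sin \<theta>)\<^sup>2" "r'\<^sup>2 = (r' * cos \<theta>')\<^sup>2 + (r' * sin \<theta>')\<^sup>2"
    by (simp_all add: power_mult_distrib flip: distrib_left)
  then have "r\<^sup>2 = r'\<^sup>2" using e by simp
  then show r: "r = r'" using assms(2,3) by (simp add: power2_eq_iff_nonneg)
  show "z = z'" by (rule z)
  have "sin \<theta> = sin \<theta>' \<and> cos \<theta> = cos \<theta>'" using e r assms(2) by simp
  then obtain n :: int where n: "\<theta> = \<theta>' + 2 * pi * n" using sin_cos_eq_iff by auto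
  have "2 * pi * \<bar>real_of_int n\<bar> = \<bar>\<theta> - \<theta>'\<bar>" using n by (simp add: abs_mult)
  also have "\<dots> < 2 * pi * 1" using assms(4-7) by linarith
  finally have "\<bar>real_of_int n\<bar> < 1" using pi_gt_zero by (simp only: mult_less_cancel_left_pos)
  then have "n = 0" by linarith
  with n show "\<theta> = \<theta>'" by simp
qed

definition cyl_map :: "real^3 \<Rightarrow> real^3" where
  "cyl_map q = cyl_point (q $ 1) (q $ 2) (q $ 3)"

definition cyl_deriv :: "real^3 \<Rightarrow> real^3 \<Rightarrow> real^3" where
  "cyl_deriv q h = vector [h $ 1 * cos (q $ 3) - q $ 1 * sin (q $ 3) * h $ 3,
     h $ 1 * sin (q $ 3) + q $ 1 * cos (q $ 3) * h $ 3, h $ 2]"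

lemma cyl_map_has_derivative: "(cyl_map has_derivative cyl_deriv q) (at q within S)"
proof -
  have m: "cyl_map = (\<lambda>q. (q $ 1 * cos (q $ 3)) *\<^sub>R axis 1 1 + (q $ 1 * sin (q $ 3)) *\<^sub>R axis 2 1 + (q $ 2) *\<^sub>R axis 3 1)"
    by (auto simp: fun_eq_iff cyl_map_def cyl_point_def vec_eq_iff forall_3 axis_def)
  have d: "cyl_deriv q = (\<lambda>h. (h $ 1 * cos (q $ 3) - q $ 1 * sin (q $ 3) * h $ 3) *\<^sub>R axis 1 1 +
      (h $ 1 * sin (q $ 3) + q $ 1 * cos (q $ 3) * h $ 3) *\<^sub>R axis 2 1 + (h $ 2) *\<^sub>R axis 3 1)"
    by (auto simp: fun_eq_iff cyl_deriv_def vec_eq_iff forall_3 axis_def)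
  have n: "((\<lambda>q. q $ i) has_derivative (\<lambda>h. h $ i)) (at q within S)" for i :: 3
    by (rule bounded_linear_imp_has_derivative[OF bounded_linear_vec_nth])
  show ?thesis
    unfolding m d by (auto intro!: derivative_eq_intros n simp: fun_eq_iff algebra_simps)
qed

text \<open>The coordinates are ordered r, z, theta, an odd permutation of the usual order, so the
  determinant itself is -r.\<close>

lemma det_cyl_deriv: "\<bar>det (matrix (cyl_deriv q))\<bar> = \<bar>q $ 1\<bar>"
proof -
  have "det (matrix (cyl_deriv q)) = - (q $ 1 * (cos (q $ 3))\<^sup>2 + q $ 1 * (sin (q $ 3))\<^sup>2)"
    by (simp add: det_3 matrix_def cyl_deriv_def axis_def algebra_simps power2_eq_square)
  also have "\<dots> = - (q $ 1 * ((cos (q $ 3))\<^sup>2 + (sin (q $ 3))\<^sup>2))"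
    by (simp only: distrib_left)
  finally show ?thesis by simp
qed

text \<open>The bounds \<open>r\<^sub>0\<close> and \<open>r\<^sub>1\<close> on the distance to the
  axis make the weight r of cylindrical coordinates comparable to a constant on
  \<open>\<Omega>\<close>. Every constant that depends on the domain comes from these two
  numbers.\<close>

locale axi = bounded_open \<Omega> for \<Omega> +
  fixes D :: "(real \<times> real) set" and r\<^sub>0 r\<^sub>1 :: real
  assumes \<Omega>_eq: "\<Omega> = axi_domain D" and r0_pos: "0 < r\<^sub>0"
    and D_bounds: "\<And>r z. (r, z) \<in> D \<Longrightarrow> r\<^sub>0 \<le> r \<and> r \<le> r\<^sub>1"
begin

lemma cyl_in_iff:
  assumes "0 < r"
  shows "cyl_point r z \<theta> \<in> \<Omega> \<longleftrightarrow> (r, z) \<in> D"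
proof
  assume "cyl_point r z \<theta> \<in> \<Omega>"
  then obtain r' z' \<theta>' where *: "cyl_point r z \<theta> = cyl_point r' z' \<theta>'" "(r', z') \<in> D"
    unfolding \<Omega>_eq axi_domain_def by auto
  have e: "r * cos \<theta> = r' * cos \<theta>'" "r * sin \<theta> = r' * sin \<theta>'" "z = z'"
    using *(1) by (auto simp: cyl_point_def vec_eq_iff forall_3)
  have "r\<^sup>2 = (r * cos \<theta>)\<^sup>2 + (r * sin \<theta>)\<^sup>2" "r'\<^sup>2 = (r' * cos \<theta>')\<^sup>2 + (r' * sin \<theta>')\<^sup>2"
    by (simp_all add: power_mult_distrib flip: distrib_left)
  then have "r\<^sup>2 = r'\<^sup>2" using e by simp
  then have "r = r'" using assms D_bounds[OF *(2)] r0_pos by (simp add: power2_eq_iff_nonneg)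
  with e *(2) show "(r, z) \<in> D" by simp
next
  assume D: "(r, z) \<in> D"
  obtain \<theta>' where \<theta>': "0 \<le> \<theta>'" "\<theta>' < 2 * pi" "cos \<theta> = cos \<theta>'" "sin \<theta> = sin \<theta>'"
    using sincos_total_2pi[of "cos \<theta>" "sin \<theta>"] by auto
  then have "cyl_point r z \<theta> = cyl_point r z \<theta>'" by (simp add: cyl_point_def)
  then show "cyl_point r z \<theta> \<in> \<Omega>" unfolding \<Omega>_eq axi_domain_def using D \<theta>' by force
qed

text \<open>The axis is removed and the angle is restricted to a half-open period so that
  \<open>cyl_map\<close> is injective; the image still contains \<open>\<Omega>\<close>.\<close>

definition S_cyl :: "(real^3) set" where
  "S_cyl = {q. 0 < q $ 1 \<and> 0 \<le> q $ 3 \<and> q $ 3 < 2 * pi}"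

lemma S_cyl_borel [measurable]: "S_cyl \<in> sets borel"
proof -
  have [measurable]: "(\<lambda>q::real^3. q $ i) \<in> borel_measurable borel" for i
    by (rule borel_measurable_nth) simp
  show ?thesis unfolding S_cyl_def by measurable
qed

lemma \<Omega>_subset_image: "\<Omega> \<subseteq> cyl_map ` S_cyl"
proof
  fix x assume "x \<in> \<Omega>"
  then obtain r z \<theta> where x: "x = cyl_point r z \<theta>" "(r, z) \<in> D"
    unfolding \<Omega>_eq axi_domain_def by auto
  obtain \<theta>' where \<theta>': "0 \<le> \<theta>'" "\<theta>' < 2 * pi" "cos \<theta> = cos \<theta>'" "sin \<theta> = sin \<theta>'"
    using sincos_total_2pi[of "cos \<theta>" "sin \<theta>"] by auto
  have "x = cyl_map (vector [r, z, \<theta>'])" using x \<theta>' by (simp add: cyl_map_def cyl_point_def)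
  moreover have "vector [r, z, \<theta>'] \<in> S_cyl"
    using D_bounds[OF x(2)] r0_pos \<theta>' by (simp add: S_cyl_def)
  ultimately show "x \<in> cyl_map ` S_cyl" by blast
qed

lemma inj_cyl: "inj_on cyl_map S_cyl"
proof (rule inj_onI)
  fix p q assume "p \<in> S_cyl" "q \<in> S_cyl" "cyl_map p = cyl_map q"
  then show "p = q"
    using cyl_point_inj[of "p $ 1" "p $ 2" "p $ 3" "q $ 1" "q $ 2" "q $ 3"]
    by (simp add: S_cyl_def cyl_map_def vec_eq_iff forall_3)
qed

text \<open>Integration against dr dz dtheta, deliberately without the Jacobian r: for this product
  measure the variables separate as the planar argument requires.\<close>

definition cyl_int :: "(real^3 \<Rightarrow> ennreal) \<Rightarrow> ennreal" where
  "cyl_int f = (\<integral>\<^sup>+r. \<integral>\<^sup>+z. \<integral>\<^sup>+\<theta>. f (cyl_point r z \<theta>) * indicator {0<..} r * indicator {0..<2*pi} \<theta> \<partial>lborel \<partial>lborel \<partial>lborel)"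

lemma cyl_point_measurable [measurable (raw)]:
  assumes [measurable]: "f \<in> borel_measurable N" "g \<in> borel_measurable N" "h \<in> borel_measurable N"
  shows "(\<lambda>x. cyl_point (f x) (g x) (h x)) \<in> borel_measurable N"
  unfolding cyl_point_def by measurable

text \<open>A bounded nonnegative function supported in a bounded set is integrable, so the change
  of variables applies; the result is rewritten with extended nonnegative integrals, ready for
  Fubini.\<close>

lemma nn_integral_cyl:
  fixes f :: "real^3 \<Rightarrow> real"
  assumes f [measurable]: "f \<in> borel_measurable borel" and b: "\<And>x. 0 \<le> f x" "\<And>x. f x \<le> B" and z: "\<And>x. x \<notin> \<Omega> \<Longrightarrow> f x = 0"
  shows "(\<integral>\<^sup>+x. ennreal (f x) \<partial>lborel) =
    (\<integral>\<^sup>+r. \<integral>\<^sup>+z. \<integral>\<^sup>+\<theta>. ennreal r * ennreal (f (cyl_point r z \<theta>)) * indicator {0<..} r * indicator {0..<2*pi} \<theta> \<partial>lborel \<partial>lborel \<partial>lborel)"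
proof -
  have i: "integrable lborel f"
  proof -
    have "integrable M f"
      by (rule Bochner_Integration.integrable_bound[OF integrable_const_M[of B]])
         (use b in \<open>auto intro!: borel_M order_trans[OF _ abs_ge_self]\<close>)
    then show ?thesis using integral_lebesgue_on_lborel(2)[of \<Omega> f] z f by simp
  qed
  have il: "integrable lebesgue f" using i by (simp add: integrable_completion)
  define b where "b = (LINT x|lborel. f x)"
  have fS: "(\<lambda>x. if x \<in> cyl_map ` S_cyl then f x else 0) = f" using z \<Omega>_subset_image by (auto simp: fun_eq_iff)
  have "f absolutely_integrable_on UNIV" using il by (simp add: set_integrable_def)
  then have fa: "f absolutely_integrable_on (cyl_map ` S_cyl)"
    by (subst absolutely_integrable_restrict_UNIV[symmetric]) (simp add: fS)
  have "integral (cyl_map ` S_cyl) f = integral UNIV f"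
    by (subst integral_restrict_UNIV[symmetric]) (simp add: fS)
  also have "\<dots> = b" unfolding b_def using has_integral_integral_lborel[OF i] by (rule integral_unique)
  finally have fb: "integral (cyl_map ` S_cyl) f = b" .
  \<comment> \<open>The change of variables theorem concerns functions with values in a space of
    vectors, so \<open>f\<close> is regarded as a function into \<open>real^1\<close>.\<close>
  let ?lift = "vec :: real \<Rightarrow> real^1"
  have "(\<lambda>x. ?lift (f x)) absolutely_integrable_on (cyl_map ` S_cyl) \<and> integral (cyl_map ` S_cyl) (\<lambda>x. ?lift (f x)) = ?lift b"
    using fa fb by (simp add: absolutely_integrable_on_1_iff integral_on_1_eq)
  then have "(\<lambda>x. \<bar>det (matrix (cyl_deriv x))\<bar> *\<^sub>R ?lift (f (cyl_map x))) absolutely_integrable_on S_cyl \<and>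
     integral S_cyl (\<lambda>x. \<bar>det (matrix (cyl_deriv x))\<bar> *\<^sub>R ?lift (f (cyl_map x))) = ?lift b"
    by (subst has_absolute_integral_change_of_variables[OF _ cyl_map_has_derivative inj_cyl]) auto
  then have "((\<lambda>x. \<bar>x $ 1\<bar> * f (cyl_map x)) has_integral b) S_cyl"
    by (simp add: absolutely_integrable_on_1_iff integral_on_1_eq det_cyl_deriv absolutely_integrable_on_def has_integral_iff vec_eq_iff)
  then have "(\<integral>\<^sup>+x. ennreal (\<bar>x $ 1\<bar> * f (cyl_map x)) * indicator S_cyl x \<partial>lborel) = ennreal b"
    by (rule nn_integral_has_integral_lebesgue'[rotated]) (simp add: b)
  also have "ennreal b = (\<integral>\<^sup>+x. ennreal (f x) \<partial>lborel)"
    unfolding b_def by (rule nn_integral_eq_integral[symmetric, OF i]) (simp add: b)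
  finally have "(\<integral>\<^sup>+x. ennreal (f x) \<partial>lborel) = (\<integral>\<^sup>+x. ennreal (\<bar>x $ 1\<bar> * f (cyl_map x)) * indicator S_cyl x \<partial>lborel)" by simp
  also have "\<dots> = (\<integral>\<^sup>+r. \<integral>\<^sup>+z. \<integral>\<^sup>+\<theta>. ennreal (\<bar>r\<bar> * f (cyl_point r z \<theta>)) * indicator S_cyl (vector [r, z, \<theta>]) \<partial>lborel \<partial>lborel \<partial>lborel)"
  proof -
    have [measurable]: "(\<lambda>q::real^3. q $ i) \<in> borel_measurable borel" for i
      by (rule borel_measurable_nth) simp
    show ?thesis by (subst nn_integral_real3) (auto simp: cyl_map_def)
  qed
  also have "\<dots> = (\<integral>\<^sup>+r. \<integral>\<^sup>+z. \<integral>\<^sup>+\<theta>. ennreal r * ennreal (f (cyl_point r z \<theta>)) * indicator {0<..} r * indicator {0..<2*pi} \<theta> \<partial>lborel \<partial>lborel \<partial>lborel)"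
    by (intro nn_integral_cong) (auto simp: indicator_def S_cyl_def ennreal_mult b)
  finally show ?thesis .
qed

text \<open>Where the integrand does not vanish the point lies in \<open>\<Omega>\<close>, and its
  radius is then between \<open>r\<^sub>0\<close> and \<open>r\<^sub>1\<close>.\<close>

lemma cyl_int_bounds:
  fixes f :: "real^3 \<Rightarrow> real"
  assumes f [measurable]: "f \<in> borel_measurable borel" and b: "\<And>x. 0 \<le> f x" "\<And>x. f x \<le> B" and z: "\<And>x. x \<notin> \<Omega> \<Longrightarrow> f x = 0"
  shows "(\<integral>\<^sup>+x. ennreal (f x) \<partial>lborel) \<le> ennreal r\<^sub>1 * cyl_int (\<lambda>x. ennreal (f x))"
    "ennreal r\<^sub>0 * cyl_int (\<lambda>x. ennreal (f x)) \<le> (\<integral>\<^sup>+x. ennreal (f x) \<partial>lborel)"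
proof -
  have eq: "(\<integral>\<^sup>+x. ennreal (f x) \<partial>lborel) =
    (\<integral>\<^sup>+r. \<integral>\<^sup>+z. \<integral>\<^sup>+\<theta>. ennreal r * ennreal (f (cyl_point r z \<theta>)) * indicator {0<..} r * indicator {0..<2*pi} \<theta> \<partial>lborel \<partial>lborel \<partial>lborel)"
    by (rule nn_integral_cyl[OF f b z])
  have c: "(\<integral>\<^sup>+r. \<integral>\<^sup>+z. \<integral>\<^sup>+\<theta>. c * ennreal (f (cyl_point r z \<theta>)) * indicator {0<..} r * indicator {0..<2*pi} \<theta> \<partial>lborel \<partial>lborel \<partial>lborel)
     = c * cyl_int (\<lambda>x. ennreal (f x))" for c :: ennreal
    unfolding cyl_int_def by (simp add: nn_integral_cmult mult.assoc)
  have le: "ennreal r * ennreal (f (cyl_point r z \<theta>)) * indicator {0<..} r \<le> ennreal r\<^sub>1 * ennreal (f (cyl_point r z \<theta>)) * indicator {0<..} r"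
     "ennreal r\<^sub>0 * ennreal (f (cyl_point r z \<theta>)) * indicator {0<..} r \<le> ennreal r * ennreal (f (cyl_point r z \<theta>)) * indicator {0<..} r" for r z \<theta>
  proof -
    consider "r \<le> 0" | "0 < r" "(r, z) \<in> D" | "0 < r" "f (cyl_point r z \<theta>) = 0"
      using z cyl_in_iff by (meson not_le)
    then have "ennreal r * ennreal (f (cyl_point r z \<theta>)) * indicator {0<..} r \<le> ennreal r\<^sub>1 * ennreal (f (cyl_point r z \<theta>)) * indicator {0<..} r \<and>
     ennreal r\<^sub>0 * ennreal (f (cyl_point r z \<theta>)) * indicator {0<..} r \<le> ennreal r * ennreal (f (cyl_point r z \<theta>)) * indicator {0<..} r"
    proof cases
      case 2
      then show ?thesis using D_bounds[OF 2(2)] by (auto intro!: mult_right_mono ennreal_leI)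
    qed auto
    then show "ennreal r * ennreal (f (cyl_point r z \<theta>)) * indicator {0<..} r \<le> ennreal r\<^sub>1 * ennreal (f (cyl_point r z \<theta>)) * indicator {0<..} r"
     "ennreal r\<^sub>0 * ennreal (f (cyl_point r z \<theta>)) * indicator {0<..} r \<le> ennreal r * ennreal (f (cyl_point r z \<theta>)) * indicator {0<..} r" by auto
  qed
  show "(\<integral>\<^sup>+x. ennreal (f x) \<partial>lborel) \<le> ennreal r\<^sub>1 * cyl_int (\<lambda>x. ennreal (f x))"
    unfolding eq c[symmetric] by (intro nn_integral_mono mult_right_mono le) auto
  show "ennreal r\<^sub>0 * cyl_int (\<lambda>x. ennreal (f x)) \<le> (\<integral>\<^sup>+x. ennreal (f x) \<partial>lborel)"
    unfolding eq c[symmetric] by (intro nn_integral_mono mult_right_mono le) auto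
qed

text \<open>By the lower bound on the Jacobian, the indicator of the null set has integral zero also
  against dr dz dtheta, and a vanishing iterated integral vanishes fibre by fibre. This turns
  statements about almost every point of \<open>\<Omega>\<close> into statements about almost every
  circle around the axis.\<close>

lemma cyl_AE:
  assumes N: "N \<in> null_sets lborel"
  shows "AE r in lborel. 0 < r \<longrightarrow> (AE z in lborel. AE \<theta> in lborel. 0 \<le> \<theta> \<and> \<theta> < 2 * pi \<longrightarrow> cyl_point r z \<theta> \<notin> N \<inter> \<Omega>)"
proof -
  note [measurable] = sets_\<Omega>(1)
  have [measurable]: "N \<in> sets borel" using N by auto
  have "ennreal r\<^sub>0 * cyl_int (\<lambda>x. ennreal (indicator (N \<inter> \<Omega>) x)) \<le> (\<integral>\<^sup>+x. ennreal (indicator (N \<inter> \<Omega>) x) \<partial>lborel)"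
  proof (rule cyl_int_bounds(2)[of _ 1])
    show "(\<lambda>x. indicat_real (N \<inter> \<Omega>) x) \<in> borel_measurable borel"
      by (rule borel_measurable_indicator) auto
  qed (auto simp: indicator_def)
  also have "\<dots> = emeasure lborel (N \<inter> \<Omega>)" by (simp add: ennreal_indicator nn_integral_indicator sets.Int)
  also have "\<dots> = 0" using N null_set_Int1[of N lborel \<Omega>] by (subst Int_commute) (auto simp: null_sets_def)
  finally have "cyl_int (\<lambda>x. ennreal (indicator (N \<inter> \<Omega>) x)) = 0" using r0_pos by simp
  then have "AE r in lborel. (\<integral>\<^sup>+z. \<integral>\<^sup>+\<theta>. ennreal (indicator (N \<inter> \<Omega>) (cyl_point r z \<theta>)) * indicator {0<..} r * indicator {0..<2*pi} \<theta> \<partial>lborel \<partial>lborel) = 0"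
    unfolding cyl_int_def by (subst (asm) nn_integral_0_iff_AE) auto
  then show ?thesis
  proof (eventually_elim, intro impI)
    fix r :: real assume r: "0 < r" and "(\<integral>\<^sup>+z. \<integral>\<^sup>+\<theta>. ennreal (indicator (N \<inter> \<Omega>) (cyl_point r z \<theta>)) * indicator {0<..} r * indicator {0..<2*pi} \<theta> \<partial>lborel \<partial>lborel) = 0"
    then have "AE z in lborel. (\<integral>\<^sup>+\<theta>. ennreal (indicator (N \<inter> \<Omega>) (cyl_point r z \<theta>)) * indicator {0<..} r * indicator {0..<2*pi} \<theta> \<partial>lborel) = 0"
      by (subst (asm) nn_integral_0_iff_AE) auto
    then show "AE z in lborel. AE \<theta> in lborel. 0 \<le> \<theta> \<and> \<theta> < 2 * pi \<longrightarrow> cyl_point r z \<theta> \<notin> N \<inter> \<Omega>"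
    proof eventually_elim
      fix z assume "(\<integral>\<^sup>+\<theta>. ennreal (indicator (N \<inter> \<Omega>) (cyl_point r z \<theta>)) * indicator {0<..} r * indicator {0..<2*pi} \<theta> \<partial>lborel) = 0"
      then have "AE \<theta> in lborel. ennreal (indicator (N \<inter> \<Omega>) (cyl_point r z \<theta>)) * indicator {0<..} r * indicator {0..<2*pi} \<theta> = 0"
        by (subst (asm) nn_integral_0_iff_AE) auto
      then show "AE \<theta> in lborel. 0 \<le> \<theta> \<and> \<theta> < 2 * pi \<longrightarrow> cyl_point r z \<theta> \<notin> N \<inter> \<Omega>"
        by eventually_elim (use r in \<open>auto simp: indicator_def split: if_splits\<close>)
    qed
  qed
qed

end

context axi
begin

text \<open>The derivative of |phi|^2 is integrated from a point where phi vanishes: radially from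
  the axis, which does not meet \<open>\<Omega>\<close>, and vertically from below the support. Both
  lines keep the angle fixed, so that it can be integrated out afterwards.\<close>

lemma test_cyl_line_bounds:
  fixes \<phi> :: "real^3 \<Rightarrow> real^3"
  assumes \<phi>: "\<phi> \<in> test_functions \<Omega>"
  defines "P \<equiv> \<lambda>x. ennreal (2 * norm (\<phi> x) * norm (jacobian \<phi> (at x)))"
  shows "0 < r \<Longrightarrow> ennreal ((norm (\<phi> (cyl_point r z \<theta>)))\<^sup>2) \<le> (\<integral>\<^sup>+s. P (cyl_point s z \<theta>) * indicator {0<..} s \<partial>lborel)"
    and "ennreal ((norm (\<phi> (cyl_point r z \<theta>)))\<^sup>2) \<le> (\<integral>\<^sup>+\<zeta>. P (cyl_point r \<zeta> \<theta>) \<partial>lborel)"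
proof -
  obtain K where K: "smooth_on UNIV \<phi>" "compact K" "K \<subseteq> \<Omega>" "\<And>x. x \<notin> K \<Longrightarrow> \<phi> x = 0"
    using test_functionsE[OF \<phi>] by blast
  have D: "ennreal (2 * norm (\<phi> x) * norm (frechet_derivative \<phi> (at x) e)) \<le> P x" if "norm e \<le> 1" for x e
    unfolding P_def by (intro ennreal_leI mult_left_mono norm_frechet_le_jacobian K(1) that) auto
  show "ennreal ((norm (\<phi> (cyl_point r z \<theta>)))\<^sup>2) \<le> (\<integral>\<^sup>+s. P (cyl_point s z \<theta>) * indicator {0<..} s \<partial>lborel)" if r: "0 < r"
  proof -
    have not: "cyl_point 0 z \<theta> \<notin> \<Omega>"
    proof
      assume "cyl_point 0 z \<theta> \<in> \<Omega>"
      then obtain r' z' \<theta>' where *: "cyl_point 0 z \<theta> = cyl_point r' z' \<theta>'" "(r', z') \<in> D"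
        unfolding \<Omega>_eq axi_domain_def by auto
      then have "r' * cos \<theta>' = 0" "r' * sin \<theta>' = 0" by (auto simp: cyl_point_def vec_eq_iff forall_3)
      moreover have "r' \<noteq> 0" using D_bounds[OF *(2)] r0_pos by simp
      ultimately show False using sin_cos_squared_add[of \<theta>'] by simp
    qed
    then have "\<phi> (z *\<^sub>R axis 3 1 + 0 *\<^sub>R e_r \<theta>) = 0"
      using test_functions_zero[OF \<phi>] by (simp add: cyl_point_eq)
    from norm_square_le_line_integral[OF K(1) less_imp_le[OF r] this]
    have "ennreal ((norm (\<phi> (cyl_point r z \<theta>)))\<^sup>2) \<le> (\<integral>\<^sup>+s. ennreal (2 * norm (\<phi> (cyl_point s z \<theta>)) * norm (frechet_derivative \<phi> (at (cyl_point s z \<theta>)) (e_r \<theta>))) * indicator {0..r} s \<partial>lborel)"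
      by (simp add: cyl_point_eq)
    also have "\<dots> \<le> (\<integral>\<^sup>+s. P (cyl_point s z \<theta>) * indicator {0<..} s \<partial>lborel)"
    proof (rule nn_integral_mono_AE)
      \<comment> \<open>The radial line starts on the axis while \<open>cyl_int\<close> is
        restricted to positive radii; the two indicators differ there at s = 0 only.\<close>
      have "AE s in lborel. s \<noteq> (0::real)" by (rule AE_lborel_singleton)
      then show "AE s in lborel. ennreal (2 * norm (\<phi> (cyl_point s z \<theta>)) * norm (frechet_derivative \<phi> (at (cyl_point s z \<theta>)) (e_r \<theta>))) * indicator {0..r} s
          \<le> P (cyl_point s z \<theta>) * indicator {0<..} s"
        by eventually_elim (auto intro!: mult_mono D simp: indicator_def)
    qed
    finally show ?thesis .
  qed
  show "ennreal ((norm (\<phi> (cyl_point r z \<theta>)))\<^sup>2) \<le> (\<integral>\<^sup>+\<zeta>. P (cyl_point r \<zeta> \<theta>) \<partial>lborel)"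
  proof -
    obtain R where R: "R > 0" "\<And>x. x \<in> K \<Longrightarrow> norm x \<le> R"
      using compact_imp_bounded[OF K(2)] by (auto simp: bounded_pos)
    define s\<^sub>0 where "s\<^sub>0 = min z (- R - 1)"
    have "\<phi> (cyl_point r 0 \<theta> + s\<^sub>0 *\<^sub>R axis 3 1) = 0"
    proof (rule K(4), rule notI)
      assume "cyl_point r 0 \<theta> + s\<^sub>0 *\<^sub>R axis 3 1 \<in> K"
      then have "norm (cyl_point r 0 \<theta> + s\<^sub>0 *\<^sub>R axis 3 1) \<le> R" by (rule R)
      moreover have "\<bar>(cyl_point r 0 \<theta> + s\<^sub>0 *\<^sub>R axis 3 1) $ 3\<bar> \<le> norm (cyl_point r 0 \<theta> + s\<^sub>0 *\<^sub>R axis 3 1)"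
        by (rule component_le_norm_cart)
      moreover have "(cyl_point r 0 \<theta> + s\<^sub>0 *\<^sub>R axis 3 1) $ 3 = s\<^sub>0" by (simp add: cyl_point_def axis_def)
      moreover have "s\<^sub>0 \<le> - R - 1" by (simp add: s\<^sub>0_def)
      ultimately show False by linarith
    qed
    from norm_square_le_line_integral[OF K(1) _ this, of z]
    have "ennreal ((norm (\<phi> (cyl_point r z \<theta>)))\<^sup>2) \<le> (\<integral>\<^sup>+s. ennreal (2 * norm (\<phi> (cyl_point r s \<theta>)) * norm (frechet_derivative \<phi> (at (cyl_point r s \<theta>)) (axis 3 1))) * indicator {s\<^sub>0..z} s \<partial>lborel)"
      unfolding cyl_point_eq'[symmetric] by (simp add: s\<^sub>0_def)
    also have "\<dots> \<le> (\<integral>\<^sup>+\<zeta>. P (cyl_point r \<zeta> \<theta>) \<partial>lborel)"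
    proof (rule nn_integral_mono)
      fix s
      have "ennreal (2 * norm (\<phi> (cyl_point r s \<theta>)) * norm (frechet_derivative \<phi> (at (cyl_point r s \<theta>)) (axis 3 1))) * indicator {s\<^sub>0..z} s
          \<le> P (cyl_point r s \<theta>) * 1"
        by (intro mult_mono D) (auto simp: indicator_def)
      then show "ennreal (2 * norm (\<phi> (cyl_point r s \<theta>)) * norm (frechet_derivative \<phi> (at (cyl_point r s \<theta>)) (axis 3 1))) * indicator {s\<^sub>0..z} s
          \<le> P (cyl_point r s \<theta>)" by simp
    qed
    finally show ?thesis .
  qed
qed

text \<open>
  With \<open>F\<close> the integral of \<open>|\<phi>|\<^sup>2\<close> over the angle, the two line bounds give \<open>F(r, z) \<le> A(z)\<close> and
  \<open>F(r, z) \<le> B(r)\<close>, so that \<open>\<integral>\<integral>F\<^sup>2 \<le> \<integral>A \<integral>B\<close>; the weight \<open>g\<close> does not depend on the angle and can be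
  taken out of the inner integral.
\<close>

lemma cyl_int_anisotropic:
  fixes \<phi> :: "real^3 \<Rightarrow> real^3" and g :: "real^3 \<Rightarrow> real"
  assumes \<phi>: "\<phi> \<in> test_functions \<Omega>" and g [measurable]: "g \<in> borel_measurable borel" and g0: "\<And>x. 0 \<le> g x"
    and ax: "AE r in lborel. 0 < r \<longrightarrow> (AE z in lborel. \<exists>c. AE \<theta> in lborel. 0 \<le> \<theta> \<and> \<theta> < 2 * pi \<longrightarrow> g (cyl_point r z \<theta>) = c)"
  shows "(cyl_int (\<lambda>x. ennreal ((norm (\<phi> x))\<^sup>2 * g x)))\<^sup>2 \<le>
    ennreal (2 * pi) * cyl_int (\<lambda>x. ennreal ((g x)\<^sup>2)) * (cyl_int (\<lambda>x. ennreal (2 * norm (\<phi> x) * norm (jacobian \<phi> (at x)))))\<^sup>2"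
proof -
  note [measurable] = test_functions_borel[OF \<phi>] test_jacobian(1)[OF \<phi>]
  define P where "P = (\<lambda>x. ennreal (2 * norm (\<phi> x) * norm (jacobian \<phi> (at x))))"
  define f where "f x = ennreal ((norm (\<phi> x))\<^sup>2)" for x
  have [measurable]: "P \<in> borel_measurable borel" "f \<in> borel_measurable borel"
    unfolding P_def f_def by measurable
  define J where "J = (indicator {0<..} :: real \<Rightarrow> ennreal)"
  define I where "I = (indicator {0..<2*pi} :: real \<Rightarrow> ennreal)"
  have [measurable]: "I \<in> borel_measurable borel" "J \<in> borel_measurable borel" unfolding I_def J_def by measurable
  define F where "F r z = (\<integral>\<^sup>+\<theta>. f (cyl_point r z \<theta>) * I \<theta> \<partial>lborel)" for r z
  define G where "G r z = (\<integral>\<^sup>+\<theta>. ennreal (g (cyl_point r z \<theta>)) * I \<theta> \<partial>lborel)" for r z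
  define A where "A z = (\<integral>\<^sup>+\<theta>. \<integral>\<^sup>+s. P (cyl_point s z \<theta>) * J s * I \<theta> \<partial>lborel \<partial>lborel)" for z
  define B where "B r = (\<integral>\<^sup>+\<theta>. \<integral>\<^sup>+\<zeta>. P (cyl_point r \<zeta> \<theta>) * I \<theta> \<partial>lborel \<partial>lborel)" for r
  have int_I: "(\<integral>\<^sup>+\<theta>. c * I \<theta> \<partial>lborel) = c * ennreal (2 * pi)" for c
    by (simp add: nn_integral_cmult I_def)
  have FA: "F r z \<le> A z" if "0 < r" for r z
    unfolding F_def A_def f_def
  proof (rule nn_integral_mono)
    fix \<theta>
    have "ennreal ((norm (\<phi> (cyl_point r z \<theta>)))\<^sup>2) * I \<theta> \<le> (\<integral>\<^sup>+s. P (cyl_point s z \<theta>) * indicator {0<..} s \<partial>lborel) * I \<theta>"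
      using test_cyl_line_bounds(1)[OF \<phi> that] by (intro mult_right_mono) (auto simp: P_def)
    also have "\<dots> = (\<integral>\<^sup>+s. P (cyl_point s z \<theta>) * J s * I \<theta> \<partial>lborel)"
      unfolding J_def by (rule nn_integral_multc[symmetric]) measurable
    finally show "ennreal ((norm (\<phi> (cyl_point r z \<theta>)))\<^sup>2) * I \<theta> \<le> (\<integral>\<^sup>+s. P (cyl_point s z \<theta>) * J s * I \<theta> \<partial>lborel)" .
  qed
  have FB: "F r z \<le> B r" for r z
    unfolding F_def B_def f_def
  proof (rule nn_integral_mono)
    fix \<theta>
    have "ennreal ((norm (\<phi> (cyl_point r z \<theta>)))\<^sup>2) * I \<theta> \<le> (\<integral>\<^sup>+\<zeta>. P (cyl_point r \<zeta> \<theta>) \<partial>lborel) * I \<theta>"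
      using test_cyl_line_bounds(2)[OF \<phi>] by (intro mult_right_mono) (auto simp: P_def)
    also have "\<dots> = (\<integral>\<^sup>+\<zeta>. P (cyl_point r \<zeta> \<theta>) * I \<theta> \<partial>lborel)"
      by (rule nn_integral_multc[symmetric]) measurable
    finally show "ennreal ((norm (\<phi> (cyl_point r z \<theta>)))\<^sup>2) * I \<theta> \<le> (\<integral>\<^sup>+\<zeta>. P (cyl_point r \<zeta> \<theta>) * I \<theta> \<partial>lborel)" .
  qed
  have [measurable]: "A \<in> borel_measurable borel" "B \<in> borel_measurable borel" unfolding A_def B_def by measurable
  have intA: "(\<integral>\<^sup>+z. A z \<partial>lborel) = cyl_int P"
  proof -
    have "(\<integral>\<^sup>+z. A z \<partial>lborel) = (\<integral>\<^sup>+z. \<integral>\<^sup>+s. \<integral>\<^sup>+\<theta>. P (cyl_point s z \<theta>) * J s * I \<theta> \<partial>lborel \<partial>lborel \<partial>lborel)"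
      unfolding A_def by (intro nn_integral_cong lborel_pair.Fubini') measurable
    also have "\<dots> = (\<integral>\<^sup>+s. \<integral>\<^sup>+z. \<integral>\<^sup>+\<theta>. P (cyl_point s z \<theta>) * J s * I \<theta> \<partial>lborel \<partial>lborel \<partial>lborel)"
      by (rule lborel_pair.Fubini') measurable
    finally show ?thesis by (simp add: cyl_int_def J_def I_def)
  qed
  have intB: "(\<integral>\<^sup>+r. J r * B r \<partial>lborel) = cyl_int P"
  proof -
    have "J r * B r = (\<integral>\<^sup>+z. \<integral>\<^sup>+\<theta>. P (cyl_point r z \<theta>) * J r * I \<theta> \<partial>lborel \<partial>lborel)" for r
    proof -
      have "B r = (\<integral>\<^sup>+z. \<integral>\<^sup>+\<theta>. P (cyl_point r z \<theta>) * I \<theta> \<partial>lborel \<partial>lborel)"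
        unfolding B_def by (rule lborel_pair.Fubini') measurable
      then have "J r * B r = (\<integral>\<^sup>+z. J r * (\<integral>\<^sup>+\<theta>. P (cyl_point r z \<theta>) * I \<theta> \<partial>lborel) \<partial>lborel)"
        by (simp add: nn_integral_cmult)
      also have "\<dots> = (\<integral>\<^sup>+z. \<integral>\<^sup>+\<theta>. J r * (P (cyl_point r z \<theta>) * I \<theta>) \<partial>lborel \<partial>lborel)"
        by (intro nn_integral_cong nn_integral_cmult[symmetric]) measurable
      finally show ?thesis by (simp add: ac_simps)
    qed
    then show ?thesis by (simp add: cyl_int_def J_def I_def)
  qed
  have F2: "(\<integral>\<^sup>+r. \<integral>\<^sup>+z. (J r * F r z)\<^sup>2 \<partial>lborel \<partial>lborel) \<le> (cyl_int P)\<^sup>2"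
  proof -
    have "(\<integral>\<^sup>+r. \<integral>\<^sup>+z. (J r * F r z)\<^sup>2 \<partial>lborel \<partial>lborel) \<le> (\<integral>\<^sup>+r. \<integral>\<^sup>+z. (J r * B r) * A z \<partial>lborel \<partial>lborel)"
    proof (intro nn_integral_mono)
      fix r z
      show "(J r * F r z)\<^sup>2 \<le> (J r * B r) * A z"
        using mult_mono[OF FB[of r z] FA[of r z]] by (cases "0 < r") (auto simp: J_def power2_eq_square)
    qed
    also have "\<dots> = (\<integral>\<^sup>+r. (J r * B r) * cyl_int P \<partial>lborel)"
      by (intro nn_integral_cong) (simp add: nn_integral_cmult intA)
    also have "\<dots> = cyl_int P * cyl_int P" by (subst nn_integral_multc) (auto simp: intB)
    finally show ?thesis by (simp add: power2_eq_square)
  qed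
  \<comment> \<open>For almost every (r, z) the weight has a constant value c on the circle, so that
    \<open>G\<close> is 2 pi c. The first estimate uses 2 pi >= 1 to replace c by \<open>G\<close>.
    In the second both sides equal (2 pi c)^2, since the integral of g^2 over the circle is 2 pi
    c^2.\<close>
  have pointwise: "AE r in lborel. AE z in lborel.
      (\<integral>\<^sup>+\<theta>. ennreal ((norm (\<phi> (cyl_point r z \<theta>)))\<^sup>2 * g (cyl_point r z \<theta>)) * J r * I \<theta> \<partial>lborel) \<le> (J r * F r z) * (J r * G r z) \<and>
      (J r * G r z)\<^sup>2 \<le> ennreal (2 * pi) * (\<integral>\<^sup>+\<theta>. ennreal ((g (cyl_point r z \<theta>))\<^sup>2) * J r * I \<theta> \<partial>lborel)"
    using ax
  proof eventually_elim
    fix r assume r: "0 < r \<longrightarrow> (AE z in lborel. \<exists>c. AE \<theta> in lborel. 0 \<le> \<theta> \<and> \<theta> < 2 * pi \<longrightarrow> g (cyl_point r z \<theta>) = c)"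
    show "AE z in lborel.
      (\<integral>\<^sup>+\<theta>. ennreal ((norm (\<phi> (cyl_point r z \<theta>)))\<^sup>2 * g (cyl_point r z \<theta>)) * J r * I \<theta> \<partial>lborel) \<le> (J r * F r z) * (J r * G r z) \<and>
      (J r * G r z)\<^sup>2 \<le> ennreal (2 * pi) * (\<integral>\<^sup>+\<theta>. ennreal ((g (cyl_point r z \<theta>))\<^sup>2) * J r * I \<theta> \<partial>lborel)"
    proof (cases "0 < r")
      case False
      then show ?thesis by (simp add: J_def)
    next
      case True
      with r have "AE z in lborel. \<exists>c. AE \<theta> in lborel. 0 \<le> \<theta> \<and> \<theta> < 2 * pi \<longrightarrow> g (cyl_point r z \<theta>) = c" by simp
      then show ?thesis
      proof eventually_elim
        fix z assume "\<exists>c. AE \<theta> in lborel. 0 \<le> \<theta> \<and> \<theta> < 2 * pi \<longrightarrow> g (cyl_point r z \<theta>) = c"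
        then obtain c where c: "AE \<theta> in lborel. 0 \<le> \<theta> \<and> \<theta> < 2 * pi \<longrightarrow> g (cyl_point r z \<theta>) = c" by blast
        have J: "J r = 1" using True by (simp add: J_def)
        have 1: "(\<integral>\<^sup>+\<theta>. ennreal ((norm (\<phi> (cyl_point r z \<theta>)))\<^sup>2 * g (cyl_point r z \<theta>)) * J r * I \<theta> \<partial>lborel) = F r z * ennreal c"
        proof -
          have "(\<integral>\<^sup>+\<theta>. ennreal ((norm (\<phi> (cyl_point r z \<theta>)))\<^sup>2 * g (cyl_point r z \<theta>)) * J r * I \<theta> \<partial>lborel)
              = (\<integral>\<^sup>+\<theta>. (f (cyl_point r z \<theta>) * I \<theta>) * ennreal c \<partial>lborel)"
            using c by (intro nn_integral_cong_AE, eventually_elim) (auto simp: J I_def f_def indicator_def ennreal_mult g0 ennreal_mult')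
          also have "\<dots> = F r z * ennreal c" unfolding F_def by (rule nn_integral_multc) measurable
          finally show ?thesis .
        qed
        have 2: "G r z = ennreal c * ennreal (2 * pi)"
        proof -
          have "G r z = (\<integral>\<^sup>+\<theta>. ennreal c * I \<theta> \<partial>lborel)"
            unfolding G_def using c by (intro nn_integral_cong_AE, eventually_elim) (auto simp: I_def indicator_def)
          then show ?thesis using int_I by simp
        qed
        have 3: "(\<integral>\<^sup>+\<theta>. ennreal ((g (cyl_point r z \<theta>))\<^sup>2) * J r * I \<theta> \<partial>lborel) = (ennreal c)\<^sup>2 * ennreal (2 * pi)"
        proof -
          have "(\<integral>\<^sup>+\<theta>. ennreal ((g (cyl_point r z \<theta>))\<^sup>2) * J r * I \<theta> \<partial>lborel) = (\<integral>\<^sup>+\<theta>. (ennreal c)\<^sup>2 * I \<theta> \<partial>lborel)"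
          proof (intro nn_integral_cong_AE)
            show "AE \<theta> in lborel. ennreal ((g (cyl_point r z \<theta>))\<^sup>2) * J r * I \<theta> = (ennreal c)\<^sup>2 * I \<theta>"
              using c
            proof eventually_elim
              fix \<theta> assume "0 \<le> \<theta> \<and> \<theta> < 2 * pi \<longrightarrow> g (cyl_point r z \<theta>) = c"
              then show "ennreal ((g (cyl_point r z \<theta>))\<^sup>2) * J r * I \<theta> = (ennreal c)\<^sup>2 * I \<theta>"
                using g0[of "cyl_point r z \<theta>"] by (auto simp: J I_def indicator_def ennreal_power)
            qed
          qed
          then show ?thesis using int_I by simp
        qed
        have "F r z * ennreal c * 1 \<le> F r z * ennreal c * ennreal (2 * pi)"
          using pi_ge_two by (intro mult_left_mono) auto
        then show "(\<integral>\<^sup>+\<theta>. ennreal ((norm (\<phi> (cyl_point r z \<theta>)))\<^sup>2 * g (cyl_point r z \<theta>)) * J r * I \<theta> \<partial>lborel) \<le> (J r * F r z) * (J r * G r z) \<and>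
          (J r * G r z)\<^sup>2 \<le> ennreal (2 * pi) * (\<integral>\<^sup>+\<theta>. ennreal ((g (cyl_point r z \<theta>))\<^sup>2) * J r * I \<theta> \<partial>lborel)"
          unfolding 1 2 3 unfolding J by (simp add: power2_eq_square ac_simps)
      qed
    qed
  qed
  have [measurable]: "(\<lambda>(r, z). F r z) \<in> borel_measurable (borel \<Otimes>\<^sub>M borel)" "(\<lambda>(r, z). G r z) \<in> borel_measurable (borel \<Otimes>\<^sub>M borel)"
    unfolding F_def G_def by measurable
  define F' G' where "F' p = J (fst p) * (case p of (r, z) \<Rightarrow> F r z)" and "G' p = J (fst p) * (case p of (r, z) \<Rightarrow> G r z)" for p
  have [measurable]: "F' \<in> borel_measurable (lborel \<Otimes>\<^sub>M lborel)" "G' \<in> borel_measurable (lborel \<Otimes>\<^sub>M lborel)"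
    unfolding F'_def G'_def by measurable
  have "cyl_int (\<lambda>x. ennreal ((norm (\<phi> x))\<^sup>2 * g x)) \<le> (\<integral>\<^sup>+r. \<integral>\<^sup>+z. (J r * F r z) * (J r * G r z) \<partial>lborel \<partial>lborel)"
    unfolding cyl_int_def J_def[symmetric] I_def[symmetric]
    using pointwise by (intro nn_integral_mono_AE, eventually_elim) (intro nn_integral_mono_AE, auto elim: eventually_mono)
  also have "\<dots> = (\<integral>\<^sup>+p. F' p * G' p \<partial>(lborel \<Otimes>\<^sub>M lborel))"
    by (subst lborel.nn_integral_fst[symmetric]) (auto simp: F'_def G'_def)
  finally have "(cyl_int (\<lambda>x. ennreal ((norm (\<phi> x))\<^sup>2 * g x)))\<^sup>2 \<le> (\<integral>\<^sup>+p. F' p * G' p \<partial>(lborel \<Otimes>\<^sub>M lborel))\<^sup>2"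
    by (rule power_mono) simp
  also have "\<dots> \<le> (\<integral>\<^sup>+p. (F' p)\<^sup>2 \<partial>(lborel \<Otimes>\<^sub>M lborel)) * (\<integral>\<^sup>+p. (G' p)\<^sup>2 \<partial>(lborel \<Otimes>\<^sub>M lborel))"
    by (rule Cauchy_Schwarz_nn_integral) measurable
  also have "(\<integral>\<^sup>+p. (F' p)\<^sup>2 \<partial>(lborel \<Otimes>\<^sub>M lborel)) = (\<integral>\<^sup>+r. \<integral>\<^sup>+z. (J r * F r z)\<^sup>2 \<partial>lborel \<partial>lborel)"
    by (subst lborel.nn_integral_fst[symmetric]) (auto simp: F'_def)
  also have "(\<integral>\<^sup>+p. (G' p)\<^sup>2 \<partial>(lborel \<Otimes>\<^sub>M lborel)) = (\<integral>\<^sup>+r. \<integral>\<^sup>+z. (J r * G r z)\<^sup>2 \<partial>lborel \<partial>lborel)"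
    by (subst lborel.nn_integral_fst[symmetric]) (auto simp: G'_def)
  also have "(\<integral>\<^sup>+r. \<integral>\<^sup>+z. (J r * G r z)\<^sup>2 \<partial>lborel \<partial>lborel) \<le>
     (\<integral>\<^sup>+r. \<integral>\<^sup>+z. ennreal (2 * pi) * (\<integral>\<^sup>+\<theta>. ennreal ((g (cyl_point r z \<theta>))\<^sup>2) * J r * I \<theta> \<partial>lborel) \<partial>lborel \<partial>lborel)"
    using pointwise by (intro nn_integral_mono_AE, eventually_elim) (intro nn_integral_mono_AE, auto elim: eventually_mono)
  also have "\<dots> = ennreal (2 * pi) * cyl_int (\<lambda>x. ennreal ((g x)\<^sup>2))"
    unfolding cyl_int_def J_def[symmetric] I_def[symmetric] by (simp add: nn_integral_cmult)
  finally have "(cyl_int (\<lambda>x. ennreal ((norm (\<phi> x))\<^sup>2 * g x)))\<^sup>2 \<le>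
     (\<integral>\<^sup>+r. \<integral>\<^sup>+z. (J r * F r z)\<^sup>2 \<partial>lborel \<partial>lborel) * (ennreal (2 * pi) * cyl_int (\<lambda>x. ennreal ((g x)\<^sup>2)))"
    by (simp add: mult_left_mono)
  also have "\<dots> \<le> (cyl_int P)\<^sup>2 * (ennreal (2 * pi) * cyl_int (\<lambda>x. ennreal ((g x)\<^sup>2)))"
    by (intro mult_right_mono F2) simp
  finally show ?thesis by (simp add: P_def ac_simps)
qed

end

section \<open>The trilinear form\<close>

text \<open>The truncation g = min(|f|^2, N) satisfies g^2 <= |f|^2 g, so the hypothesis gives
  ||g||^2 <= K ||g|| with ||g|| finite, hence ||g|| <= K; monotone convergence lets N grow. Thus an
  estimate that is linear in a bounded weight bounds |f|^2 in L2, before that norm is known to be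
  finite.\<close>

lemma L2_norm_sq_truncation:
  fixes f :: "'a::euclidean_space \<Rightarrow> 'b::euclidean_space"
  assumes f: "f \<in> L2_fields \<Omega>" and K: "0 \<le> K"
    and bd: "\<And>N. (LINT x|lebesgue_on \<Omega>. (norm (f x))\<^sup>2 * min ((norm (f x))\<^sup>2) (real N))
        \<le> K * L2_norm \<Omega> (\<lambda>x. min ((norm (f x))\<^sup>2) (real N))"
  shows "(\<lambda>x. (norm (f x))\<^sup>2) \<in> L2_fields \<Omega>" "L2_norm \<Omega> (\<lambda>x. (norm (f x))\<^sup>2) \<le> K"
proof -
  let ?M = "lebesgue_on \<Omega>"
  note [measurable] = L2_fieldsD(1)[OF f]
  define g where "g N x = min ((norm (f x))\<^sup>2) (real N)" for N x
  have g0: "0 \<le> g N x" "g N x \<le> real N" "g N x \<le> (norm (f x))\<^sup>2" for N x by (auto simp: g_def)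
  have [measurable]: "g N \<in> borel_measurable ?M" for N unfolding g_def by measurable
  have gi: "integrable ?M (\<lambda>x. (norm (f x))\<^sup>2 * g N x)" for N
  proof (rule Bochner_Integration.integrable_bound)
    show "integrable ?M (\<lambda>x. real N * (norm (f x))\<^sup>2)" using L2_fieldsD(2)[OF f] by simp
    show "AE x in ?M. norm ((norm (f x))\<^sup>2 * g N x) \<le> norm (real N * (norm (f x))\<^sup>2)"
    proof (intro AE_I2)
      fix x
      have "(norm (f x))\<^sup>2 * g N x \<le> (norm (f x))\<^sup>2 * real N" using g0 by (intro mult_left_mono) auto
      then show "norm ((norm (f x))\<^sup>2 * g N x) \<le> norm (real N * (norm (f x))\<^sup>2)"
        using g0(1)[of N x] by (simp add: abs_mult mult.commute)
    qed
  qed measurable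
  have g2le: "(g N x)\<^sup>2 \<le> (norm (f x))\<^sup>2 * g N x" for N x
    unfolding power2_eq_square[of "g N x"] using g0 by (intro mult_right_mono) auto
  have g2: "integrable ?M (\<lambda>x. (g N x)\<^sup>2)" for N
    by (rule Bochner_Integration.integrable_bound[OF gi[of N]]) (use g2le g0 in \<open>auto intro: order_trans\<close>)
  have gle: "(LINT x|?M. (g N x)\<^sup>2) \<le> K\<^sup>2" for N
  proof -
    have "(L2_norm \<Omega> (g N))\<^sup>2 \<le> K * L2_norm \<Omega> (g N)"
    proof -
      have "(L2_norm \<Omega> (g N))\<^sup>2 = (LINT x|?M. (g N x)\<^sup>2)" by (simp add: L2_norm_sq)
      also have "\<dots> \<le> (LINT x|?M. (norm (f x))\<^sup>2 * g N x)" by (intro integral_mono g2 gi g2le)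
      also have "\<dots> \<le> K * L2_norm \<Omega> (g N)" using bd[of N] by (simp add: g_def[abs_def])
      finally show ?thesis .
    qed
    then have "L2_norm \<Omega> (g N) \<le> K"
      using L2_norm_nonneg[of \<Omega> "g N"] K by (cases "L2_norm \<Omega> (g N) = 0") (auto simp: power2_eq_square)
    then have "(L2_norm \<Omega> (g N))\<^sup>2 \<le> K\<^sup>2" by (intro power_mono) auto
    then show ?thesis by (simp add: L2_norm_sq)
  qed
  have mono: "N \<le> N' \<Longrightarrow> (g N x)\<^sup>2 \<le> (g N' x)\<^sup>2" for N N' x
    using g0 by (intro power_mono) (auto simp: g_def min_def)
  have inc: "incseq (\<lambda>N. LINT x|?M. (g N x)\<^sup>2)"
    by (intro incseq_SucI integral_mono g2 mono) auto
  obtain L where L: "(\<lambda>N. LINT x|?M. (g N x)\<^sup>2) \<longlonglongrightarrow> L" "\<forall>N. (LINT x|?M. (g N x)\<^sup>2) \<le> L"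
    using incseq_convergent[OF inc] gle by blast
  have lim: "(\<lambda>N. (g N x)\<^sup>2) \<longlonglongrightarrow> (norm ((norm (f x))\<^sup>2))\<^sup>2" for x
  proof -
    obtain N0 :: nat where N0: "(norm (f x))\<^sup>2 \<le> real N0" using real_arch_simple by blast
    have "\<forall>\<^sub>F N in sequentially. (g N x)\<^sup>2 = (norm ((norm (f x))\<^sup>2))\<^sup>2"
      unfolding eventually_sequentially
    proof (intro exI[of _ N0] allI impI)
      fix N assume "N0 \<le> N"
      then have "(norm (f x))\<^sup>2 \<le> real N" using N0 by linarith
      then show "(g N x)\<^sup>2 = (norm ((norm (f x))\<^sup>2))\<^sup>2" by (simp add: g_def)
    qed
    then show ?thesis by (rule tendsto_eventually)
  qed
  have mon: "AE x in ?M. mono (\<lambda>N. (g N x)\<^sup>2)" using mono by (auto simp: mono_def)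
  have i: "integrable ?M (\<lambda>x. (norm ((norm (f x))\<^sup>2))\<^sup>2)"
    by (rule integrable_monotone_convergence[OF g2 mon _ L(1)]) (use lim in auto)
  have "(LINT x|?M. (norm ((norm (f x))\<^sup>2))\<^sup>2) = L"
    by (rule integral_monotone_convergence[OF g2 mon _ L(1)]) (use lim in auto)
  also have "L \<le> K\<^sup>2" using L(1) gle by (intro LIMSEQ_le_const2) auto
  finally have "(L2_norm \<Omega> (\<lambda>x. (norm (f x))\<^sup>2))\<^sup>2 \<le> K\<^sup>2" by (simp only: L2_norm_sq)
  then show "L2_norm \<Omega> (\<lambda>x. (norm (f x))\<^sup>2) \<le> K" using K by (rule power2_le_imp_le)
  show "(\<lambda>x. (norm (f x))\<^sup>2) \<in> L2_fields \<Omega>" using i by (auto simp: L2_fields_def)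
qed

context bounded_open
begin

text \<open>With a bounded weight the integral is the inner product of \<open>\<phi> n\<close> with
  \<open>g\<close> times \<open>\<phi> n\<close>, and both factors converge in L2. This is why
  inequalities are passed to the limit with truncated weights.\<close>

lemma weighted_square_tendsto:
  fixes g :: "real^3 \<Rightarrow> real" and f :: "real^3 \<Rightarrow> real^3"
  assumes \<phi>: "\<And>n. \<phi> n \<in> L2_fields \<Omega>" "f \<in> L2_fields \<Omega>" "(\<lambda>n. L2_norm \<Omega> (\<lambda>x. \<phi> n x - f x)) \<longlonglongrightarrow> 0"
    and g: "g \<in> borel_measurable M" "\<And>x. norm (g x) \<le> B"
  shows "(\<lambda>n. LINT x|M. (norm (\<phi> n x))\<^sup>2 * g x) \<longlonglongrightarrow> (LINT x|M. (norm (f x))\<^sup>2 * g x)"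
proof -
  have "(\<lambda>n. L2_inner \<Omega> (\<phi> n) (\<lambda>x. g x *\<^sub>R \<phi> n x)) \<longlonglongrightarrow> L2_inner \<Omega> f (\<lambda>x. g x *\<^sub>R f x)"
  proof (rule L2_inner_tendsto[OF \<phi>])
    show "(\<lambda>x. g x *\<^sub>R \<phi> n x) \<in> L2_fields \<Omega>" "(\<lambda>x. g x *\<^sub>R f x) \<in> L2_fields \<Omega>" for n
      by (intro L2_fields_mult_bounded[OF g] \<phi>)+
    have lim: "(\<lambda>n. L2_norm \<Omega> (\<lambda>x. B *\<^sub>R (\<phi> n x - f x))) \<longlonglongrightarrow> 0"
      unfolding L2_norm_scaleR using tendsto_mult_right_zero[OF \<phi>(3)] by simp
    show "(\<lambda>n. L2_norm \<Omega> (\<lambda>x. g x *\<^sub>R \<phi> n x - g x *\<^sub>R f x)) \<longlonglongrightarrow> 0"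
    proof (rule tendsto_sandwich[OF _ _ tendsto_const lim])
      have d: "(\<lambda>x. \<phi> n x - f x) \<in> L2_fields \<Omega>" for n by (intro L2_fields_diff \<phi>)
      show "\<forall>\<^sub>F n in sequentially. L2_norm \<Omega> (\<lambda>x. g x *\<^sub>R \<phi> n x - g x *\<^sub>R f x) \<le> L2_norm \<Omega> (\<lambda>x. B *\<^sub>R (\<phi> n x - f x))"
      proof (intro always_eventually allI)
        fix n
        have "L2_norm \<Omega> (\<lambda>x. g x *\<^sub>R (\<phi> n x - f x)) \<le> L2_norm \<Omega> (\<lambda>x. B *\<^sub>R (\<phi> n x - f x))"
        proof (rule L2_norm_mono)
          show "(\<lambda>x. g x *\<^sub>R (\<phi> n x - f x)) \<in> borel_measurable M"
            using L2_fieldsD(1)[OF L2_fields_mult_bounded[OF g d]] .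
          show "(\<lambda>x. B *\<^sub>R (\<phi> n x - f x)) \<in> L2_fields \<Omega>" by (rule L2_fields_scaleR[OF d])
          have "\<bar>g x\<bar> \<le> \<bar>B\<bar>" for x using g(2)[of x] by simp
          then show "AE x in M. norm (g x *\<^sub>R (\<phi> n x - f x)) \<le> norm (B *\<^sub>R (\<phi> n x - f x))"
            by (auto intro!: mult_right_mono)
        qed
        then show "L2_norm \<Omega> (\<lambda>x. g x *\<^sub>R \<phi> n x - g x *\<^sub>R f x) \<le> L2_norm \<Omega> (\<lambda>x. B *\<^sub>R (\<phi> n x - f x))"
          by (simp add: scaleR_diff_right)
      qed
    qed auto
  qed
  then show ?thesis by (simp add: L2_inner_def power2_norm_eq_inner mult.commute)
qed

lemma L2_fields_truncation:
  assumes "f \<in> borel_measurable M"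
  shows "(\<lambda>x. min ((norm (f x))\<^sup>2) (real N)) \<in> L2_fields \<Omega>"
  by (rule L2_fields_bounded[of _ "real N"]) (use assms in auto)

lemma H1_tendsto_norms:
  assumes "f \<in> V_space \<Omega>" "\<And>n. \<phi> n \<in> solenoidal_test_fields \<Omega>" "(\<lambda>n. H1_norm \<Omega> (\<lambda>x. \<phi> n x - f x)) \<longlonglongrightarrow> 0"
  shows "(\<lambda>n. L2_norm \<Omega> (\<phi> n)) \<longlonglongrightarrow> L2_norm \<Omega> f"
    "(\<lambda>n. L2_norm \<Omega> (\<lambda>x. jacobian (\<phi> n) (at x))) \<longlonglongrightarrow> L2_norm \<Omega> (weak_gradient \<Omega> f)"
proof -
  note V = solenoidal_V[OF assms(2)]
  note l = H1_norm_tendsto[OF V_H1[OF V] V_H1[OF assms(1)] assms(3)]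
  show "(\<lambda>n. L2_norm \<Omega> (\<phi> n)) \<longlonglongrightarrow> L2_norm \<Omega> f"
    by (rule L2_norm_tendsto[OF V_L2[OF V] V_L2[OF assms(1)] l(1)])
  have "L2_norm \<Omega> (weak_gradient \<Omega> (\<phi> n)) = L2_norm \<Omega> (\<lambda>x. jacobian (\<phi> n) (at x))" for n
    using test_H1(2)[OF solenoidal_test[OF assms(2)]] V_gradient_L2[OF V] test_jacobian_L2[OF solenoidal_test[OF assms(2)]]
    by (intro L2_norm_cong_AE L2_fieldsD(1))
  then show "(\<lambda>n. L2_norm \<Omega> (\<lambda>x. jacobian (\<phi> n) (at x))) \<longlonglongrightarrow> L2_norm \<Omega> (weak_gradient \<Omega> f)"
    using L2_norm_tendsto[OF V_gradient_L2[OF V] V_gradient_L2[OF assms(1)] l(2)] by simp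
qed

text \<open>For a fixed truncation of |f|^2 as weight, the inequality of \<open>test_L4\<close>
  survives the limit along test fields that converge in H1; \<open>L2_norm_sq_truncation\<close>
  then removes the truncation.\<close>

lemma V_L4:
  assumes f: "f \<in> V_space \<Omega>"
  shows "(\<lambda>x. (norm (f x))\<^sup>2) \<in> L2_fields \<Omega>" "L2_norm \<Omega> (\<lambda>x. (norm (f x))\<^sup>2) \<le> 3 * (H1_norm \<Omega> f)\<^sup>2"
proof -
  obtain \<phi> where \<phi>: "\<And>n. \<phi> n \<in> solenoidal_test_fields \<Omega>" "(\<lambda>n. H1_norm \<Omega> (\<lambda>x. \<phi> n x - f x)) \<longlonglongrightarrow> 0"
    using V_approx[OF f] by blast
  note V = solenoidal_V[OF \<phi>(1)]
  note l = H1_norm_tendsto[OF V_H1[OF V] V_H1[OF f] \<phi>(2)]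
  define K where "K = sqrt (8 * L2_norm \<Omega> f * (L2_norm \<Omega> (weak_gradient \<Omega> f))^3)"
  have K: "(\<lambda>n. sqrt (8 * L2_norm \<Omega> (\<phi> n) * (L2_norm \<Omega> (\<lambda>x. jacobian (\<phi> n) (at x)))^3)) \<longlonglongrightarrow> K"
    unfolding K_def by (intro tendsto_intros H1_tendsto_norms[OF f \<phi>])
  have bd: "(LINT x|M. (norm (f x))\<^sup>2 * min ((norm (f x))\<^sup>2) (real N))
        \<le> K * L2_norm \<Omega> (\<lambda>x. min ((norm (f x))\<^sup>2) (real N))" for N
  proof -
    define g where "g x = min ((norm (f x))\<^sup>2) (real N)" for x
    have g: "g \<in> L2_fields \<Omega>" unfolding g_def using L2_fields_truncation[OF L2_fieldsD(1)[OF V_L2[OF f]]] .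
    have "(\<lambda>n. LINT x|M. (norm (\<phi> n x))\<^sup>2 * g x) \<longlonglongrightarrow> (LINT x|M. (norm (f x))\<^sup>2 * g x)"
      by (rule weighted_square_tendsto[OF V_L2[OF V] V_L2[OF f] l(1) L2_fieldsD(1)[OF g], of "real N"]) (auto simp: g_def)
    moreover have "(LINT x|M. (norm (\<phi> n x))\<^sup>2 * g x) \<le> sqrt (8 * L2_norm \<Omega> (\<phi> n) * (L2_norm \<Omega> (\<lambda>x. jacobian (\<phi> n) (at x)))^3) * L2_norm \<Omega> g" for n
    proof -
      note T = test_L4[OF solenoidal_test[OF \<phi>(1)[of n]]]
      have "(LINT x|M. (norm (\<phi> n x))\<^sup>2 * g x) \<le> L2_norm \<Omega> (\<lambda>x. (norm (\<phi> n x))\<^sup>2) * L2_norm \<Omega> g"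
        using abs_L2_inner_le[OF T(1) g] by (simp add: L2_inner_def)
      also have "\<dots> \<le> sqrt (8 * L2_norm \<Omega> (\<phi> n) * (L2_norm \<Omega> (\<lambda>x. jacobian (\<phi> n) (at x)))^3) * L2_norm \<Omega> g"
        using T(2) by (intro mult_right_mono real_le_rsqrt) auto
      finally show ?thesis .
    qed
    ultimately have "(LINT x|M. (norm (f x))\<^sup>2 * g x) \<le> K * L2_norm \<Omega> g"
      by (intro LIMSEQ_le[OF _ tendsto_mult[OF K tendsto_const]]) auto
    then show ?thesis by (simp add: g_def[abs_def])
  qed
  have K0: "0 \<le> K" by (simp add: K_def)
  note R = L2_norm_sq_truncation[OF V_L2[OF f] K0 bd]
  show "(\<lambda>x. (norm (f x))\<^sup>2) \<in> L2_fields \<Omega>" by (rule R(1))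
  \<comment> \<open>The 3 of the statement is an upper bound for the square root of 8.\<close>
  have "8 * L2_norm \<Omega> f * (L2_norm \<Omega> (weak_gradient \<Omega> f))^3 \<le> 9 * (H1_norm \<Omega> f)\<^sup>2^2"
  proof -
    have "8 * L2_norm \<Omega> f * (L2_norm \<Omega> (weak_gradient \<Omega> f))^3 \<le> 8 * H1_norm \<Omega> f * (H1_norm \<Omega> f)^3"
      by (intro mult_mono power_mono L2_le_H1) auto
    also have "\<dots> \<le> 9 * (H1_norm \<Omega> f)\<^sup>2^2"
      by (simp add: power2_eq_square power3_eq_cube algebra_simps)
    finally show ?thesis .
  qed
  then have "K \<le> 3 * (H1_norm \<Omega> f)\<^sup>2" unfolding K_def by (intro real_le_lsqrt) (auto simp: power_mult_distrib)
  then show "L2_norm \<Omega> (\<lambda>x. (norm (f x))\<^sup>2) \<le> 3 * (H1_norm \<Omega> f)\<^sup>2" using R(2) by simp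
qed

text \<open>\<open>conv f g h\<close> is the integral of \<open>((f \<cdot> \<nabla>) g) \<cdot> h\<close>.\<close>

definition conv :: "(real^3 \<Rightarrow> real^3) \<Rightarrow> (real^3 \<Rightarrow> real^3) \<Rightarrow> (real^3 \<Rightarrow> real^3) \<Rightarrow> real" where
  "conv f g h = (LINT x|M. (weak_gradient \<Omega> g x *v f x) \<bullet> h x)"

text \<open>The product of two L4 functions lies in L2, by Cauchy-Schwarz for |f|^2 and |h|^2. The
  middle identity allows a better bound on the integral of |f|^2 |h|^2 to be inserted later.\<close>

lemma V_product:
  assumes f: "f \<in> V_space \<Omega>" and h: "h \<in> V_space \<Omega>"
  shows "(\<lambda>x. norm (f x) * norm (h x)) \<in> L2_fields \<Omega>"
    "(L2_norm \<Omega> (\<lambda>x. norm (f x) * norm (h x)))\<^sup>2 = L2_inner \<Omega> (\<lambda>x. (norm (f x))\<^sup>2) (\<lambda>x. (norm (h x))\<^sup>2)"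
    "L2_norm \<Omega> (\<lambda>x. norm (f x) * norm (h x)) \<le> 3 * H1_norm \<Omega> f * H1_norm \<Omega> h"
proof -
  note [measurable] = L2_fieldsD(1)[OF V_L2[OF f]] L2_fieldsD(1)[OF V_L2[OF h]]
  have i: "integrable M (\<lambda>x. (norm (f x))\<^sup>2 \<bullet> (norm (h x))\<^sup>2)"
    by (rule integrable_inner[OF V_L4(1)[OF f] V_L4(1)[OF h]])
  then show "(\<lambda>x. norm (f x) * norm (h x)) \<in> L2_fields \<Omega>"
    by (auto simp: L2_fields_def power_mult_distrib)
  show e: "(L2_norm \<Omega> (\<lambda>x. norm (f x) * norm (h x)))\<^sup>2 = L2_inner \<Omega> (\<lambda>x. (norm (f x))\<^sup>2) (\<lambda>x. (norm (h x))\<^sup>2)"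
    by (simp add: L2_norm_sq L2_inner_def power_mult_distrib)
  have "(L2_norm \<Omega> (\<lambda>x. norm (f x) * norm (h x)))\<^sup>2 \<le> L2_norm \<Omega> (\<lambda>x. (norm (f x))\<^sup>2) * L2_norm \<Omega> (\<lambda>x. (norm (h x))\<^sup>2)"
    unfolding e using abs_L2_inner_le[OF V_L4(1)[OF f] V_L4(1)[OF h]] by simp
  also have "\<dots> \<le> (3 * (H1_norm \<Omega> f)\<^sup>2) * (3 * (H1_norm \<Omega> h)\<^sup>2)"
    by (intro mult_mono V_L4 f h) auto
  also have "\<dots> = (3 * H1_norm \<Omega> f * H1_norm \<Omega> h)\<^sup>2" by (simp add: power_mult_distrib)
  finally show "L2_norm \<Omega> (\<lambda>x. norm (f x) * norm (h x)) \<le> 3 * H1_norm \<Omega> f * H1_norm \<Omega> h"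
    by (rule power2_le_imp_le) simp
qed

lemma borel_measurable_matrix_vector [measurable (raw)]:
  fixes A :: "'x \<Rightarrow> real^3^3" and f :: "'x \<Rightarrow> real^3"
  assumes "A \<in> borel_measurable N" "f \<in> borel_measurable N"
  shows "(\<lambda>x. A x *v f x) \<in> borel_measurable N"
  by (rule borel_measurable_continuous_Pair[OF assms])
     (auto simp: matrix_vector_mult_def intro!: continuous_intros continuous_on_vec_lambda)

lemma conv_integrable:
  assumes f: "f \<in> V_space \<Omega>" and h: "h \<in> V_space \<Omega>" and g: "G \<in> L2_fields \<Omega>"
  shows "integrable M (\<lambda>x. (G x *v f x) \<bullet> h x)"
proof (rule Bochner_Integration.integrable_bound)
  note [measurable] = L2_fieldsD(1)[OF V_L2[OF f]] L2_fieldsD(1)[OF V_L2[OF h]] L2_fieldsD(1)[OF g]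
  show "(\<lambda>x. (G x *v f x) \<bullet> h x) \<in> borel_measurable M" by measurable
  show "integrable M (\<lambda>x. norm (G x) * norm (norm (f x) * norm (h x)))"
    by (rule integrable_norm_mult[OF g V_product(1)[OF f h]])
  have "\<bar>(A *v a) \<bullet> b\<bar> \<le> norm A * (norm a * norm b)" for A :: "real^3^3" and a b :: "real^3"
  proof -
    have "\<bar>(A *v a) \<bullet> b\<bar> \<le> norm (A *v a) * norm b" by (rule Cauchy_Schwarz_ineq2)
    also have "\<dots> \<le> (norm A * norm a) * norm b" by (intro mult_right_mono norm_matrix_vector_mult_le) simp
    finally show ?thesis by simp
  qed
  then show "AE x in M. norm ((G x *v f x) \<bullet> h x) \<le> norm (norm (G x) * norm (norm (f x) * norm (h x)))"
    by (auto simp: abs_mult)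
qed

text \<open>The first form keeps the product |f| |h|, where axial symmetry will improve the
  estimate; the last one gives the continuity of \<open>conv\<close> on \<open>V\<close>.\<close>

lemma abs_conv_le:
  assumes f: "f \<in> V_space \<Omega>" and g: "g \<in> V_space \<Omega>" and h: "h \<in> V_space \<Omega>"
  shows "\<bar>conv f g h\<bar> \<le> L2_norm \<Omega> (weak_gradient \<Omega> g) * L2_norm \<Omega> (\<lambda>x. norm (f x) * norm (h x))"
    "\<bar>conv f g h\<bar> \<le> 3 * H1_norm \<Omega> f * L2_norm \<Omega> (weak_gradient \<Omega> g) * H1_norm \<Omega> h"
    "\<bar>conv f g h\<bar> \<le> 3 * H1_norm \<Omega> f * H1_norm \<Omega> g * H1_norm \<Omega> h"
proof -
  note G = V_gradient_L2[OF g]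
  have p: "\<bar>(A *v a) \<bullet> b\<bar> \<le> norm A * norm (norm a * norm b)" for A :: "real^3^3" and a b :: "real^3"
  proof -
    have "\<bar>(A *v a) \<bullet> b\<bar> \<le> norm (A *v a) * norm b" by (rule Cauchy_Schwarz_ineq2)
    also have "\<dots> \<le> (norm A * norm a) * norm b" by (intro mult_right_mono norm_matrix_vector_mult_le) simp
    finally show ?thesis by simp
  qed
  have "\<bar>conv f g h\<bar> \<le> (LINT x|M. \<bar>(weak_gradient \<Omega> g x *v f x) \<bullet> h x\<bar>)"
    unfolding conv_def using integral_norm_bound[of M "\<lambda>x. (weak_gradient \<Omega> g x *v f x) \<bullet> h x"] by simp
  also have "\<dots> \<le> (LINT x|M. norm (weak_gradient \<Omega> g x) * norm (norm (f x) * norm (h x)))"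
    by (intro integral_mono integrable_abs conv_integrable[OF f h G] integrable_norm_mult[OF G V_product(1)[OF f h]] p)
  also have "\<dots> \<le> L2_norm \<Omega> (weak_gradient \<Omega> g) * L2_norm \<Omega> (\<lambda>x. norm (f x) * norm (h x))"
    by (rule integral_norm_mult_le[OF G V_product(1)[OF f h]])
  finally show 1: "\<bar>conv f g h\<bar> \<le> L2_norm \<Omega> (weak_gradient \<Omega> g) * L2_norm \<Omega> (\<lambda>x. norm (f x) * norm (h x))" .
  also have "\<dots> \<le> L2_norm \<Omega> (weak_gradient \<Omega> g) * (3 * H1_norm \<Omega> f * H1_norm \<Omega> h)"
    by (intro mult_left_mono V_product(3) f h) auto
  finally show 2: "\<bar>conv f g h\<bar> \<le> 3 * H1_norm \<Omega> f * L2_norm \<Omega> (weak_gradient \<Omega> g) * H1_norm \<Omega> h" by (simp add: ac_simps)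
  also have "\<dots> \<le> 3 * H1_norm \<Omega> f * H1_norm \<Omega> g * H1_norm \<Omega> h"
    by (intro mult_right_mono mult_left_mono L2_le_H1) auto
  finally show "\<bar>conv f g h\<bar> \<le> 3 * H1_norm \<Omega> f * H1_norm \<Omega> g * H1_norm \<Omega> h" .
qed

lemma conv_diff:
  assumes f: "f \<in> V_space \<Omega>" "f' \<in> V_space \<Omega>" and g: "g \<in> V_space \<Omega>" "g' \<in> V_space \<Omega>" and h: "h \<in> V_space \<Omega>" "h' \<in> V_space \<Omega>"
  shows "conv (\<lambda>x. f x - f' x) g h = conv f g h - conv f' g h"
    "conv f (\<lambda>x. g x - g' x) h = conv f g h - conv f g' h"
    "conv f g (\<lambda>x. h x - h' x) = conv f g h - conv f g h'"
proof -
  note G = V_gradient_L2[OF g(1)] V_gradient_L2[OF g(2)]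
  show "conv (\<lambda>x. f x - f' x) g h = conv f g h - conv f' g h"
    unfolding conv_def using conv_integrable[OF f(1) h(1) G(1)] conv_integrable[OF f(2) h(1) G(1)]
    by (simp add: matrix_vector_mult_diff_distrib inner_diff_left)
  show "conv f g (\<lambda>x. h x - h' x) = conv f g h - conv f g h'"
    unfolding conv_def using conv_integrable[OF f(1) h(1) G(1)] conv_integrable[OF f(1) h(2) G(1)]
    by (simp add: inner_diff_right)
  have "conv f (\<lambda>x. g x - g' x) h = (LINT x|M. ((weak_gradient \<Omega> g x - weak_gradient \<Omega> g' x) *v f x) \<bullet> h x)"
    unfolding conv_def
  proof (rule integral_cong_AE)
    note [measurable] = L2_fieldsD(1)[OF V_L2[OF f(1)]] L2_fieldsD(1)[OF V_L2[OF h(1)]] G[THEN L2_fieldsD(1)]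
      L2_fieldsD(1)[OF V_gradient_L2[OF V_diff[OF g]]]
    show "(\<lambda>x. (weak_gradient \<Omega> (\<lambda>x. g x - g' x) x *v f x) \<bullet> h x) \<in> borel_measurable M"
      "(\<lambda>x. ((weak_gradient \<Omega> g x - weak_gradient \<Omega> g' x) *v f x) \<bullet> h x) \<in> borel_measurable M" by measurable
    show "AE x in M. (weak_gradient \<Omega> (\<lambda>x. g x - g' x) x *v f x) \<bullet> h x = ((weak_gradient \<Omega> g x - weak_gradient \<Omega> g' x) *v f x) \<bullet> h x"
      using H1_diff(2)[OF V_H1[OF g(1)] V_H1[OF g(2)]] by eventually_elim simp
  qed
  also have "\<dots> = conv f g h - conv f g' h"
    unfolding conv_def using conv_integrable[OF f(1) h(1) G(1)] conv_integrable[OF f(1) h(1) G(2)]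
    by (simp add: matrix_vector_mult_diff_rdistrib inner_diff_left)
  finally show "conv f (\<lambda>x. g x - g' x) h = conv f g h - conv f g' h" .
qed

lemma H1_norm_V_tendsto:
  assumes "\<And>n. f n \<in> V_space \<Omega>" "f' \<in> V_space \<Omega>" "(\<lambda>n. H1_norm \<Omega> (\<lambda>x. f n x - f' x)) \<longlonglongrightarrow> 0"
  shows "(\<lambda>n. H1_norm \<Omega> (f n)) \<longlonglongrightarrow> H1_norm \<Omega> f'"
proof -
  note l = H1_norm_tendsto[OF V_H1[OF assms(1)] V_H1[OF assms(2)] assms(3)]
  show ?thesis
    unfolding H1_norm_def
    by (intro tendsto_intros L2_norm_tendsto[OF V_L2[OF assms(1)] V_L2[OF assms(2)] l(1)]
        L2_norm_tendsto[OF V_gradient_L2[OF assms(1)] V_gradient_L2[OF assms(2)] l(2)])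
qed

lemma conv_tendsto:
  assumes f: "\<And>n. f n \<in> V_space \<Omega>" "f' \<in> V_space \<Omega>" "(\<lambda>n. H1_norm \<Omega> (\<lambda>x. f n x - f' x)) \<longlonglongrightarrow> 0"
    and g: "\<And>n. g n \<in> V_space \<Omega>" "g' \<in> V_space \<Omega>" "(\<lambda>n. H1_norm \<Omega> (\<lambda>x. g n x - g' x)) \<longlonglongrightarrow> 0"
    and h: "\<And>n. h n \<in> V_space \<Omega>" "h' \<in> V_space \<Omega>" "(\<lambda>n. H1_norm \<Omega> (\<lambda>x. h n x - h' x)) \<longlonglongrightarrow> 0"
  shows "(\<lambda>n. conv (f n) (g n) (h n)) \<longlonglongrightarrow> conv f' g' h'"
proof (rule LIM_zero_cancel, rule Lim_null_comparison[OF always_eventually], rule allI)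
  fix n
  have "conv (f n) (g n) (h n) - conv f' g' h' =
      conv (\<lambda>x. f n x - f' x) (g n) (h n) + conv f' (\<lambda>x. g n x - g' x) (h n) + conv f' g' (\<lambda>x. h n x - h' x)"
    using conv_diff(1)[OF f(1) f(2) g(1) g(2) h(1) h(2), of n n n]
      conv_diff(2)[OF f(2) f(2) g(1) g(2) h(1) h(2), of n n]
      conv_diff(3)[OF f(2) f(2) g(2) g(2) h(1) h(2), of n] by simp
  then show "norm (conv (f n) (g n) (h n) - conv f' g' h') \<le>
      3 * H1_norm \<Omega> (\<lambda>x. f n x - f' x) * H1_norm \<Omega> (g n) * H1_norm \<Omega> (h n)
      + 3 * H1_norm \<Omega> f' * H1_norm \<Omega> (\<lambda>x. g n x - g' x) * H1_norm \<Omega> (h n)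
      + 3 * H1_norm \<Omega> f' * H1_norm \<Omega> g' * H1_norm \<Omega> (\<lambda>x. h n x - h' x)"
    using abs_conv_le(3)[OF V_diff[OF f(1)[of n] f(2)] g(1)[of n] h(1)[of n]]
      abs_conv_le(3)[OF f(2) V_diff[OF g(1)[of n] g(2)] h(1)[of n]]
      abs_conv_le(3)[OF f(2) g(2) V_diff[OF h(1)[of n] h(2)]] by simp
next
  have "(\<lambda>n. 3 * H1_norm \<Omega> (\<lambda>x. f n x - f' x) * H1_norm \<Omega> (g n) * H1_norm \<Omega> (h n)
      + 3 * H1_norm \<Omega> f' * H1_norm \<Omega> (\<lambda>x. g n x - g' x) * H1_norm \<Omega> (h n)
      + 3 * H1_norm \<Omega> f' * H1_norm \<Omega> g' * H1_norm \<Omega> (\<lambda>x. h n x - h' x)) \<longlonglongrightarrow>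
     3 * 0 * H1_norm \<Omega> g' * H1_norm \<Omega> h' + 3 * H1_norm \<Omega> f' * 0 * H1_norm \<Omega> h' + 3 * H1_norm \<Omega> f' * H1_norm \<Omega> g' * 0"
    by (intro tendsto_intros f g h H1_norm_V_tendsto[OF g] H1_norm_V_tendsto[OF h])
  then show "(\<lambda>n. 3 * H1_norm \<Omega> (\<lambda>x. f n x - f' x) * H1_norm \<Omega> (g n) * H1_norm \<Omega> (h n)
      + 3 * H1_norm \<Omega> f' * H1_norm \<Omega> (\<lambda>x. g n x - g' x) * H1_norm \<Omega> (h n)
      + 3 * H1_norm \<Omega> f' * H1_norm \<Omega> g' * H1_norm \<Omega> (\<lambda>x. h n x - h' x)) \<longlonglongrightarrow> 0" by simp
qed

lemma conv_test:
  assumes f: "f \<in> V_space \<Omega>" and g: "g \<in> solenoidal_test_fields \<Omega>" and h: "h \<in> V_space \<Omega>"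
  shows "conv f g h = (LINT x|M. (jacobian g (at x) *v f x) \<bullet> h x)"
  unfolding conv_def
proof (rule integral_cong_AE)
  note [measurable] = L2_fieldsD(1)[OF V_L2[OF f]] L2_fieldsD(1)[OF V_L2[OF h]]
    L2_fieldsD(1)[OF V_gradient_L2[OF solenoidal_V[OF g]]] L2_fieldsD(1)[OF test_jacobian_L2[OF solenoidal_test[OF g]]]
  show "(\<lambda>x. (weak_gradient \<Omega> g x *v f x) \<bullet> h x) \<in> borel_measurable M"
    "(\<lambda>x. (jacobian g (at x) *v f x) \<bullet> h x) \<in> borel_measurable M" by measurable
  show "AE x in M. (weak_gradient \<Omega> g x *v f x) \<bullet> h x = (jacobian g (at x) *v f x) \<bullet> h x"
    using test_H1(2)[OF solenoidal_test[OF g]] by eventually_elim simp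
qed

text \<open>Since div f = 0, the divergence of (g . h) f is f . grad (g . h), whose two terms are
  the integrands of the two trilinear forms; it integrates to zero because its support is
  compact.\<close>

lemma conv_antisym_test:
  assumes f: "f \<in> solenoidal_test_fields \<Omega>" and g: "g \<in> solenoidal_test_fields \<Omega>" and h: "h \<in> solenoidal_test_fields \<Omega>"
  shows "conv f g h = - conv f h g"
proof -
  note T = solenoidal_test[OF f] solenoidal_test[OF g] solenoidal_test[OF h]
  have s: "smooth_on UNIV f" "smooth_on UNIV g" "smooth_on UNIV h" using T by (auto simp: test_functions_def)
  define q where "q x = g x \<bullet> h x" for x
  have q: "q \<in> test_functions \<Omega>" unfolding q_def by (rule test_functions_bilinear[OF bounded_bilinear_inner T(2,3)])
  have sq: "smooth_on UNIV q" using q by (auto simp: test_functions_def)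
  have fj: "(\<lambda>x. f x $ j) \<in> test_functions \<Omega>" for j
    by (rule test_functions_linear[OF _ T(1)]) (rule bounded_linear_vec_nth)
  have sfj: "smooth_on UNIV (\<lambda>x. f x $ j)" for j using fj by (auto simp: test_functions_def)
  have p: "(\<lambda>x. f x $ j * q x) \<in> test_functions \<Omega>" for j
    by (rule test_functions_bilinear[OF bounded_bilinear_mult fj q])
  have lin: "linear (frechet_derivative q (at x))" for x
    by (rule has_derivative_linear[OF smooth_on_has_derivative[OF sq]])
  have expand: "frechet_derivative q (at x) v = (\<Sum>j\<in>UNIV. v $ j * frechet_derivative q (at x) (axis j 1))" for x v
  proof -
    have "frechet_derivative q (at x) v = frechet_derivative q (at x) (\<Sum>j\<in>UNIV. v $ j *\<^sub>R axis j 1)"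
      using basis_expansion[of v] by (simp add: scalar_mult_eq_scaleR)
    then show ?thesis by (simp add: linear_sum[OF lin] linear_cmul[OF lin])
  qed
  have dq: "frechet_derivative q (at x) v = (jacobian g (at x) *v v) \<bullet> h x + g x \<bullet> (jacobian h (at x) *v v)" for x v
  proof -
    have "(q has_derivative (\<lambda>v. g x \<bullet> (jacobian h (at x) *v v) + (jacobian g (at x) *v v) \<bullet> h x)) (at x)"
      unfolding q_def using jacobian_works[THEN iffD1, OF differentiableI[OF smooth_on_has_derivative[OF s(2)]]]
        jacobian_works[THEN iffD1, OF differentiableI[OF smooth_on_has_derivative[OF s(3)]]]
      by (rule has_derivative_inner)
    from fun_cong[OF frechet_derivative_at[OF this], of v] show ?thesis by simp
  qed
  have pt: "(\<Sum>j\<in>UNIV. frechet_derivative (\<lambda>x. f x $ j * q x) (at x) (axis j 1)) =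
      (jacobian g (at x) *v f x) \<bullet> h x + (jacobian h (at x) *v f x) \<bullet> g x" for x
  proof -
    have "(\<Sum>j\<in>UNIV. frechet_derivative (\<lambda>x. f x $ j * q x) (at x) (axis j 1)) =
      (\<Sum>j\<in>UNIV. f x $ j * frechet_derivative q (at x) (axis j 1)) + (\<Sum>j\<in>UNIV. jacobian f (at x) $ j $ j) * q x"
      by (simp add: frechet_derivative_mult[OF sfj sq] frechet_derivative_nth[OF s(1)] jacobian_nth sum.distrib sum_distrib_right)
    also have "(\<Sum>j\<in>UNIV. jacobian f (at x) $ j $ j) = divergence f x" by (simp add: divergence_def trace_def)
    also have "divergence f x = 0" using f by (simp add: solenoidal_test_fields_def)
    finally show ?thesis unfolding expand[symmetric] unfolding dq by (simp add: inner_commute)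
  qed
  have "0 = (\<Sum>j\<in>UNIV. LINT x|M. frechet_derivative (\<lambda>x. f x $ j * q x) (at x) (axis j 1))"
  proof -
    have "(LINT x|M. frechet_derivative (\<lambda>x. f x $ j * q x) (at x) (axis j 1)) = 0" for j
      using integral_directional_derivative_zero[OF p, of j "axis j 1"]
        integral_lebesgue_on_lborel(1)[of \<Omega> "\<lambda>x. frechet_derivative (\<lambda>x. f x $ j * q x) (at x) (axis j 1)"]
        test_functions_borel[OF test_functions_frechet[OF p]] test_functions_zero[OF test_functions_frechet[OF p]] by simp
    then show ?thesis by simp
  qed
  also have "\<dots> = (LINT x|M. (\<Sum>j\<in>UNIV. frechet_derivative (\<lambda>x. f x $ j * q x) (at x) (axis j 1)))"
  proof (rule Bochner_Integration.integral_sum[symmetric])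
    fix j
    show "integrable M (\<lambda>x. frechet_derivative (\<lambda>x. f x $ j * q x) (at x) (axis j 1))"
      using integral_lebesgue_on_lborel(2)[of \<Omega> "\<lambda>x. frechet_derivative (\<lambda>x. f x $ j * q x) (at x) (axis j 1)"]
        test_functions_borel[OF test_functions_frechet[OF p]] test_functions_zero[OF test_functions_frechet[OF p]]
        test_functions_integrable[OF test_functions_frechet[OF p]] by simp
  qed
  also have "\<dots> = (LINT x|M. (jacobian g (at x) *v f x) \<bullet> h x + (jacobian h (at x) *v f x) \<bullet> g x)"
    by (simp add: pt)
  also have "\<dots> = conv f g h + conv f h g"
    unfolding conv_test[OF solenoidal_V[OF f] g solenoidal_V[OF h]] conv_test[OF solenoidal_V[OF f] h solenoidal_V[OF g]]
    by (intro Bochner_Integration.integral_add conv_integrable solenoidal_V f g h test_jacobian_L2[OF T(2)] test_jacobian_L2[OF T(3)])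
  finally show ?thesis by simp
qed

text \<open>Density of the test fields and continuity of \<open>conv\<close> in all three
  arguments.\<close>

lemma conv_antisym:
  assumes f: "f \<in> V_space \<Omega>" and g: "g \<in> V_space \<Omega>" and h: "h \<in> V_space \<Omega>"
  shows "conv f g h = - conv f h g"
proof -
  obtain \<phi> where \<phi>: "\<And>n. \<phi> n \<in> solenoidal_test_fields \<Omega>" "(\<lambda>n. H1_norm \<Omega> (\<lambda>x. \<phi> n x - f x)) \<longlonglongrightarrow> 0"
    using V_approx[OF f] by blast
  obtain \<gamma> where \<gamma>: "\<And>n. \<gamma> n \<in> solenoidal_test_fields \<Omega>" "(\<lambda>n. H1_norm \<Omega> (\<lambda>x. \<gamma> n x - g x)) \<longlonglongrightarrow> 0"
    using V_approx[OF g] by blast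
  obtain \<eta> where \<eta>: "\<And>n. \<eta> n \<in> solenoidal_test_fields \<Omega>" "(\<lambda>n. H1_norm \<Omega> (\<lambda>x. \<eta> n x - h x)) \<longlonglongrightarrow> 0"
    using V_approx[OF h] by blast
  note F = solenoidal_V[OF \<phi>(1)] f \<phi>(2) and G = solenoidal_V[OF \<gamma>(1)] g \<gamma>(2) and H = solenoidal_V[OF \<eta>(1)] h \<eta>(2)
  have "(\<lambda>n. conv (\<phi> n) (\<gamma> n) (\<eta> n)) \<longlonglongrightarrow> conv f g h" by (rule conv_tendsto[OF F G H])
  moreover have "(\<lambda>n. - conv (\<phi> n) (\<eta> n) (\<gamma> n)) \<longlonglongrightarrow> - conv f h g"
    by (intro tendsto_minus conv_tendsto[OF F H G])
  ultimately show ?thesis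
    using conv_antisym_test[OF \<phi>(1) \<gamma>(1) \<eta>(1)] LIMSEQ_unique by simp
qed

end

section \<open>Axisymmetric fields\<close>

lemma norm_sq_cylindrical_frame:
  "(norm v)\<^sup>2 = (v \<bullet> e_r \<theta>)\<^sup>2 + (v \<bullet> e_theta \<theta>)\<^sup>2 + (v \<bullet> e_z)\<^sup>2"
proof -
  define c s where "c = cos \<theta>" and "s = sin \<theta>"
  have cs: "c\<^sup>2 + s\<^sup>2 = 1" by (simp add: c_def s_def)
  have "(v \<bullet> e_r \<theta>)\<^sup>2 + (v \<bullet> e_theta \<theta>)\<^sup>2 + (v \<bullet> e_z)\<^sup>2 = ((v $ 1)\<^sup>2 + (v $ 2)\<^sup>2) * (c\<^sup>2 + s\<^sup>2) + (v $ 3)\<^sup>2"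
    by (simp add: e_r_def e_theta_def e_z_def inner_vec_def sum_3 c_def[symmetric] s_def[symmetric] power2_eq_square algebra_simps)
  also have "\<dots> = (norm v)\<^sup>2"
    unfolding cs power2_norm_eq_inner by (simp add: inner_vec_def sum_3 power2_eq_square)
  finally show ?thesis by simp
qed

lemma axisymmetric_diff:
  assumes "axisymmetric \<Omega> f" "axisymmetric \<Omega> g"
  shows "axisymmetric \<Omega> (\<lambda>x. f x - g x)"
proof -
  obtain f1 f2 f3 where f: "AE x in lebesgue_on \<Omega>. \<forall>r z \<theta>. 0 < r \<and> x = cyl_point r z \<theta> \<longrightarrow>
       f x \<bullet> e_r \<theta> = f1 r z \<and> f x \<bullet> e_theta \<theta> = f2 r z \<and> f x \<bullet> e_z = f3 r z"
    using assms(1) unfolding axisymmetric_def by blast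
  obtain g1 g2 g3 where g: "AE x in lebesgue_on \<Omega>. \<forall>r z \<theta>. 0 < r \<and> x = cyl_point r z \<theta> \<longrightarrow>
       g x \<bullet> e_r \<theta> = g1 r z \<and> g x \<bullet> e_theta \<theta> = g2 r z \<and> g x \<bullet> e_z = g3 r z"
    using assms(2) unfolding axisymmetric_def by blast
  show ?thesis
    unfolding axisymmetric_def
    apply (rule exI[of _ "\<lambda>r z. f1 r z - g1 r z"], rule exI[of _ "\<lambda>r z. f2 r z - g2 r z"], rule exI[of _ "\<lambda>r z. f3 r z - g3 r z"])
    using f g by eventually_elim (auto simp: inner_diff_left)
qed

context axi
begin

definition axisym_scalar :: "(real^3 \<Rightarrow> real) \<Rightarrow> bool" where
  "axisym_scalar g \<longleftrightarrow> (\<exists>\<gamma>. AE x in M. \<forall>r z \<theta>. 0 < r \<and> x = cyl_point r z \<theta> \<longrightarrow> g x = \<gamma> r z)"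

text \<open>The cylindrical frame is orthonormal, so the squared norm is the sum of the squares of
  three components that depend on (r, z) only.\<close>

lemma axisym_scalar_norm_sq:
  assumes "axisymmetric \<Omega> u"
  shows "axisym_scalar (\<lambda>x. min ((norm (u x))\<^sup>2) c)"
proof -
  obtain f1 f2 f3 where f: "AE x in M. \<forall>r z \<theta>. 0 < r \<and> x = cyl_point r z \<theta> \<longrightarrow>
       u x \<bullet> e_r \<theta> = f1 r z \<and> u x \<bullet> e_theta \<theta> = f2 r z \<and> u x \<bullet> e_z = f3 r z"
    using assms unfolding axisymmetric_def by blast
  show ?thesis
    unfolding axisym_scalar_def
  proof (rule exI[of _ "\<lambda>r z. min ((f1 r z)\<^sup>2 + (f2 r z)\<^sup>2 + (f3 r z)\<^sup>2) c"])
    show "AE x in M. \<forall>r z \<theta>. 0 < r \<and> x = cyl_point r z \<theta> \<longrightarrow> min ((norm (u x))\<^sup>2) c = min ((f1 r z)\<^sup>2 + (f2 r z)\<^sup>2 + (f3 r z)\<^sup>2) c"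
      using f
    proof eventually_elim
      fix x assume *: "\<forall>r z \<theta>. 0 < r \<and> x = cyl_point r z \<theta> \<longrightarrow>
       u x \<bullet> e_r \<theta> = f1 r z \<and> u x \<bullet> e_theta \<theta> = f2 r z \<and> u x \<bullet> e_z = f3 r z"
      show "\<forall>r z \<theta>. 0 < r \<and> x = cyl_point r z \<theta> \<longrightarrow> min ((norm (u x))\<^sup>2) c = min ((f1 r z)\<^sup>2 + (f2 r z)\<^sup>2 + (f3 r z)\<^sup>2) c"
      proof (intro allI impI)
        fix r z \<theta> assume "0 < r \<and> x = cyl_point r z \<theta>"
        then have "u x \<bullet> e_r \<theta> = f1 r z \<and> u x \<bullet> e_theta \<theta> = f2 r z \<and> u x \<bullet> e_z = f3 r z"
          using * by blast
        then show "min ((norm (u x))\<^sup>2) c = min ((f1 r z)\<^sup>2 + (f2 r z)\<^sup>2 + (f3 r z)\<^sup>2) c"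
          by (simp add: norm_sq_cylindrical_frame[of "u x" \<theta>])
      qed
    qed
  qed
qed

text \<open>The constant is best read off from the squared estimate:
  \<open>r\<^sub>1\<^sup>2\<close> comes from its left-hand side, one power of 1 /
  \<open>r\<^sub>0\<close> from the integral of g^2 and two from the squared integral of |phi| |grad
  phi|. The number 8 pi is 2 pi, from the constancy in the angle, times 4, from the derivative of
  |phi|^2.\<close>

definition K_aniso :: real where
  "K_aniso = sqrt (8 * pi * r\<^sub>1\<^sup>2 / r\<^sub>0 ^ 3)"

lemma K_aniso_nonneg: "0 \<le> K_aniso"
  using r0_pos by (simp add: K_aniso_def)

lemma ennreal_le_divide:
  assumes "ennreal r\<^sub>0 * X \<le> ennreal Y" "0 \<le> Y"
  shows "X \<le> ennreal (Y / r\<^sub>0)"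
proof -
  have "X = ennreal (1 / r\<^sub>0) * (ennreal r\<^sub>0 * X)"
    using r0_pos by (simp add: mult.assoc[symmetric] flip: ennreal_mult)
  also have "\<dots> \<le> ennreal (1 / r\<^sub>0) * ennreal Y" by (intro mult_left_mono assms) simp
  also have "\<dots> = ennreal (Y / r\<^sub>0)" using r0_pos assms(2) by (simp flip: ennreal_mult)
  finally show ?thesis .
qed

text \<open>The estimate for dr dz dtheta is transferred to Lebesgue measure at the cost of the
  radius bounds. Most of the work replaces \<open>g\<close> by a Borel function that is bounded
  everywhere and constant on almost every circle.\<close>

lemma test_aniso:
  fixes \<phi> :: "real^3 \<Rightarrow> real^3"
  assumes \<phi>: "\<phi> \<in> test_functions \<Omega>" and g: "g \<in> borel_measurable M" "\<And>x. 0 \<le> g x" "\<And>x. g x \<le> N" and ax: "axisym_scalar g"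
  shows "(LINT x|M. (norm (\<phi> x))\<^sup>2 * g x) \<le> K_aniso * L2_norm \<Omega> g * (L2_norm \<Omega> \<phi> * L2_norm \<Omega> (\<lambda>x. jacobian \<phi> (at x)))"
proof -
  note [measurable] = test_functions_borel[OF \<phi>] test_jacobian(1)[OF \<phi>]
  obtain g' where g': "g' \<in> borel_measurable borel" "\<And>x. x \<notin> \<Omega> \<Longrightarrow> g' x = 0"
    "AE x in lborel. x \<in> \<Omega> \<longrightarrow> g' x = g x"
    using lebesgue_on_borel_version[OF sets_\<Omega>(1) g(1)] by blast
  note [measurable] = g'(1)
  have N0: "0 \<le> N" using g(2,3) order_trans by blast
  \<comment> \<open>Clamping restores the bounds 0 and \<open>N\<close> at every point, whereas
    \<open>g'\<close> is only known to obey them almost everywhere.\<close>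
  define h where "h x = max 0 (min N (g' x))" for x
  have [measurable]: "h \<in> borel_measurable borel" unfolding h_def by measurable
  have h0: "0 \<le> h x" "h x \<le> N" for x using N0 by (auto simp: h_def)
  have hz: "h x = 0" if "x \<notin> \<Omega>" for x using g'(2)[OF that] N0 by (simp add: h_def)
  have hg: "AE x in lborel. x \<in> \<Omega> \<longrightarrow> h x = g x"
    using g'(3) by eventually_elim (use g(2,3) in \<open>auto simp: h_def\<close>)
  have hgM: "AE x in M. h x = g x"
    using hg by (simp add: AE_lebesgue_on_iff[OF sets_\<Omega>(2)] AE_completion)
  obtain \<gamma> where "AE x in M. \<forall>r z \<theta>. 0 < r \<and> x = cyl_point r z \<theta> \<longrightarrow> g x = \<gamma> r z"
    using ax by (auto simp: axisym_scalar_def)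
  with hgM have "AE x in M. \<forall>r z \<theta>. 0 < r \<and> x = cyl_point r z \<theta> \<longrightarrow> h x = \<gamma> r z"
    by eventually_elim auto
  then have "AE x in lebesgue. x \<in> \<Omega> \<longrightarrow> (\<forall>r z \<theta>. 0 < r \<and> x = cyl_point r z \<theta> \<longrightarrow> h x = \<gamma> r z)"
    by (simp only: AE_lebesgue_on_iff[OF sets_\<Omega>(2)])
  then have "AE x in lborel. x \<in> \<Omega> \<longrightarrow> (\<forall>r z \<theta>. 0 < r \<and> x = cyl_point r z \<theta> \<longrightarrow> h x = \<gamma> r z)"
    by (simp only: AE_completion_iff)
  then obtain Z where Z: "Z \<in> null_sets lborel"
    "{x \<in> space lborel. \<not> (x \<in> \<Omega> \<longrightarrow> (\<forall>r z \<theta>. 0 < r \<and> x = cyl_point r z \<theta> \<longrightarrow> h x = \<gamma> r z))} \<subseteq> Z"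
    by (auto simp only: eventually_ae_filter)
  have hax: "AE r in lborel. 0 < r \<longrightarrow> (AE z in lborel. \<exists>c. AE \<theta> in lborel. 0 \<le> \<theta> \<and> \<theta> < 2 * pi \<longrightarrow> h (cyl_point r z \<theta>) = c)"
    using cyl_AE[OF Z(1)]
  proof (eventually_elim, intro impI)
    fix r :: real assume r: "0 < r" and "0 < r \<longrightarrow> (AE z in lborel. AE \<theta> in lborel. 0 \<le> \<theta> \<and> \<theta> < 2 * pi \<longrightarrow> cyl_point r z \<theta> \<notin> Z \<inter> \<Omega>)"
    then have "AE z in lborel. AE \<theta> in lborel. 0 \<le> \<theta> \<and> \<theta> < 2 * pi \<longrightarrow> cyl_point r z \<theta> \<notin> Z \<inter> \<Omega>" by simp
    then show "AE z in lborel. \<exists>c. AE \<theta> in lborel. 0 \<le> \<theta> \<and> \<theta> < 2 * pi \<longrightarrow> h (cyl_point r z \<theta>) = c"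
    proof eventually_elim
      fix z assume *: "AE \<theta> in lborel. 0 \<le> \<theta> \<and> \<theta> < 2 * pi \<longrightarrow> cyl_point r z \<theta> \<notin> Z \<inter> \<Omega>"
      show "\<exists>c. AE \<theta> in lborel. 0 \<le> \<theta> \<and> \<theta> < 2 * pi \<longrightarrow> h (cyl_point r z \<theta>) = c"
      proof (cases "(r, z) \<in> D")
        case True
        then have in\<Omega>: "cyl_point r z \<theta> \<in> \<Omega>" for \<theta> using cyl_in_iff[OF r] by simp
        show ?thesis
        proof (rule exI[of _ "\<gamma> r z"])
          show "AE \<theta> in lborel. 0 \<le> \<theta> \<and> \<theta> < 2 * pi \<longrightarrow> h (cyl_point r z \<theta>) = \<gamma> r z"
            using *
          proof (eventually_elim, intro impI)
            fix \<theta> assume "0 \<le> \<theta> \<and> \<theta> < 2 * pi \<longrightarrow> cyl_point r z \<theta> \<notin> Z \<inter> \<Omega>" "0 \<le> \<theta> \<and> \<theta> < 2 * pi"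
            then have "cyl_point r z \<theta> \<notin> Z" using in\<Omega> by blast
            then have "cyl_point r z \<theta> \<in> \<Omega> \<longrightarrow> (\<forall>r' z' \<theta>'. 0 < r' \<and> cyl_point r z \<theta> = cyl_point r' z' \<theta>' \<longrightarrow> h (cyl_point r z \<theta>) = \<gamma> r' z')"
              using Z(2) by auto
            then show "h (cyl_point r z \<theta>) = \<gamma> r z" using in\<Omega> r by blast
          qed
        qed
      next
        case False
        then have "h (cyl_point r z \<theta>) = 0" for \<theta> using cyl_in_iff[OF r] hz by simp
        then show ?thesis by auto
      qed
    qed
  qed
  obtain B where B: "B > 0" "\<And>x. norm (\<phi> x) \<le> B" using test_functions_bounded[OF \<phi>] by blast
  obtain B' where B': "B' > 0" "\<And>x. norm (jacobian \<phi> (at x)) \<le> B'" using test_jacobian(2)[OF \<phi>] by blast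
  have z: "\<phi> x = 0" if "x \<notin> \<Omega>" for x using test_functions_zero[OF \<phi> that] .
  define X1 X2 X3 where "X1 = (LINT x|M. (norm (\<phi> x))\<^sup>2 * h x)" and "X2 = (LINT x|M. (h x)\<^sup>2)"
    and "X3 = (LINT x|M. 2 * norm (\<phi> x) * norm (jacobian \<phi> (at x)))"
  have conv: "(\<integral>\<^sup>+x. ennreal (f x) \<partial>lborel) = ennreal (LINT x|M. f x)"
    if [measurable]: "f \<in> borel_measurable borel" and f: "\<And>x. 0 \<le> f x" "\<And>x. f x \<le> c" "\<And>x. x \<notin> \<Omega> \<Longrightarrow> f x = 0" for f :: "real^3 \<Rightarrow> real" and c
  proof -
    have i: "integrable M f"
      by (rule Bochner_Integration.integrable_bound[OF integrable_const_M[of c]])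
         (use f in \<open>auto intro!: borel_M that(1) order_trans[OF _ abs_ge_self]\<close>)
    then have "integrable lborel f" using integral_lebesgue_on_lborel(2)[of \<Omega> f] f that(1) by simp
    then have "(\<integral>\<^sup>+x. ennreal (f x) \<partial>lborel) = ennreal (LINT x|lborel. f x)"
      by (rule nn_integral_eq_integral) (use f in auto)
    also have "(LINT x|lborel. f x) = (LINT x|M. f x)"
      by (rule integral_lebesgue_on_lborel(1)[symmetric]) (use f that(1) in auto)
    finally show ?thesis .
  qed
  have m: "(\<lambda>x. (norm (\<phi> x))\<^sup>2 * h x) \<in> borel_measurable borel" "(\<lambda>x. (h x)\<^sup>2) \<in> borel_measurable borel"
    "(\<lambda>x. 2 * norm (\<phi> x) * norm (jacobian \<phi> (at x))) \<in> borel_measurable borel" by measurable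
  have b1: "0 \<le> (norm (\<phi> x))\<^sup>2 * h x" "(norm (\<phi> x))\<^sup>2 * h x \<le> B\<^sup>2 * N" "x \<notin> \<Omega> \<Longrightarrow> (norm (\<phi> x))\<^sup>2 * h x = 0" for x
    using h0 B z hz by (auto intro!: mult_mono power_mono)
  have b2: "0 \<le> (h x)\<^sup>2" "(h x)\<^sup>2 \<le> N\<^sup>2" "x \<notin> \<Omega> \<Longrightarrow> (h x)\<^sup>2 = 0" for x
    using h0 hz by (auto intro!: power_mono)
  have b3: "0 \<le> 2 * norm (\<phi> x) * norm (jacobian \<phi> (at x))" "2 * norm (\<phi> x) * norm (jacobian \<phi> (at x)) \<le> 2 * B * B'"
    "x \<notin> \<Omega> \<Longrightarrow> 2 * norm (\<phi> x) * norm (jacobian \<phi> (at x)) = 0" for x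
    using B B' z by (auto intro!: mult_mono)
  have X0: "0 \<le> X1" "0 \<le> X2" "0 \<le> X3" unfolding X1_def X2_def X3_def using b1 b2 b3 by simp_all
  have I1: "ennreal X1 \<le> ennreal r\<^sub>1 * cyl_int (\<lambda>x. ennreal ((norm (\<phi> x))\<^sup>2 * h x))"
    using cyl_int_bounds(1)[OF m(1) b1] conv[OF m(1) b1] by (simp add: X1_def)
  have I2: "cyl_int (\<lambda>x. ennreal ((h x)\<^sup>2)) \<le> ennreal (X2 / r\<^sub>0)"
    using cyl_int_bounds(2)[OF m(2) b2] conv[OF m(2) b2] X0 by (intro ennreal_le_divide) (simp_all add: X2_def)
  have I3: "cyl_int (\<lambda>x. ennreal (2 * norm (\<phi> x) * norm (jacobian \<phi> (at x)))) \<le> ennreal (X3 / r\<^sub>0)"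
    using cyl_int_bounds(2)[OF m(3) b3] conv[OF m(3) b3] X0 by (intro ennreal_le_divide) (simp_all add: X3_def)
  have "ennreal (X1\<^sup>2) = (ennreal X1)\<^sup>2" using X0 by (simp add: ennreal_power)
  also have "\<dots> \<le> (ennreal r\<^sub>1 * cyl_int (\<lambda>x. ennreal ((norm (\<phi> x))\<^sup>2 * h x)))\<^sup>2" by (intro power_mono I1) simp
  also have "\<dots> = (ennreal r\<^sub>1)\<^sup>2 * (cyl_int (\<lambda>x. ennreal ((norm (\<phi> x))\<^sup>2 * h x)))\<^sup>2" by (simp add: power_mult_distrib)
  also have "\<dots> \<le> (ennreal \<bar>r\<^sub>1\<bar>)\<^sup>2 * (ennreal (2 * pi) * cyl_int (\<lambda>x. ennreal ((h x)\<^sup>2)) * (cyl_int (\<lambda>x. ennreal (2 * norm (\<phi> x) * norm (jacobian \<phi> (at x)))))\<^sup>2)"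
    by (intro mult_mono power_mono cyl_int_anisotropic \<phi> h0 hax ennreal_leI) auto
  also have "\<dots> \<le> (ennreal \<bar>r\<^sub>1\<bar>)\<^sup>2 * (ennreal (2 * pi) * ennreal (X2 / r\<^sub>0) * (ennreal (X3 / r\<^sub>0))\<^sup>2)"
    by (intro mult_left_mono mult_mono power_mono I2 I3) auto
  also have "\<dots> = ennreal (r\<^sub>1\<^sup>2 * (2 * pi * (X2 / r\<^sub>0) * (X3 / r\<^sub>0)\<^sup>2))"
  proof -
    have "(ennreal \<bar>r\<^sub>1\<bar>)\<^sup>2 * (ennreal (2 * pi) * ennreal a * (ennreal b)\<^sup>2) = ennreal (r\<^sub>1\<^sup>2 * (2 * pi * a * b\<^sup>2))"
      if "0 \<le> a" "0 \<le> b" for a b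
      using that by (simp add: ennreal_mult ennreal_power)
    then show ?thesis using X0 r0_pos by simp
  qed
  finally have "X1\<^sup>2 \<le> r\<^sub>1\<^sup>2 * (2 * pi * (X2 / r\<^sub>0) * (X3 / r\<^sub>0)\<^sup>2)"
    using X0 r0_pos by (subst (asm) ennreal_le_iff) auto
  also have "\<dots> = (2 * pi * r\<^sub>1\<^sup>2 / r\<^sub>0 ^ 3) * X2 * X3\<^sup>2"
    using r0_pos by (simp add: field_simps power2_eq_square power3_eq_cube)
  finally have X: "X1\<^sup>2 \<le> (2 * pi * r\<^sub>1\<^sup>2 / r\<^sub>0 ^ 3) * X2 * X3\<^sup>2" .
  have X2: "X2 = (L2_norm \<Omega> g)\<^sup>2"
    unfolding X2_def L2_norm_sq using hgM g(1)
    by (intro integral_cong_AE) (auto intro: borel_M elim!: eventually_mono)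
  have X3: "X3 \<le> 2 * (L2_norm \<Omega> \<phi> * L2_norm \<Omega> (\<lambda>x. jacobian \<phi> (at x)))"
    unfolding X3_def using integral_norm_mult_le[OF test_L2[OF \<phi>] test_jacobian_L2[OF \<phi>]] by (simp add: mult.assoc)
  have X1: "X1 = (LINT x|M. (norm (\<phi> x))\<^sup>2 * g x)"
    unfolding X1_def
  proof (rule integral_cong_AE)
    have "(\<lambda>x. (norm (\<phi> x))\<^sup>2) \<in> borel_measurable M" by (rule borel_M) measurable
    then show "(\<lambda>x. (norm (\<phi> x))\<^sup>2 * g x) \<in> borel_measurable M" using g(1) by measurable
    show "AE x in M. (norm (\<phi> x))\<^sup>2 * h x = (norm (\<phi> x))\<^sup>2 * g x"
      using hgM by eventually_elim simp
  qed (rule borel_M[OF m(1)])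
  have "X1\<^sup>2 \<le> (2 * pi * r\<^sub>1\<^sup>2 / r\<^sub>0 ^ 3) * (L2_norm \<Omega> g)\<^sup>2 * (2 * (L2_norm \<Omega> \<phi> * L2_norm \<Omega> (\<lambda>x. jacobian \<phi> (at x))))\<^sup>2"
    by (rule order_trans[OF X[unfolded X2]])
       (intro mult_left_mono power_mono X3 X0; simp add: r0_pos less_imp_le)
  also have "\<dots> = (K_aniso * L2_norm \<Omega> g * (L2_norm \<Omega> \<phi> * L2_norm \<Omega> (\<lambda>x. jacobian \<phi> (at x))))\<^sup>2"
    using r0_pos by (simp add: K_aniso_def power_mult_distrib field_simps)
  finally have "X1 \<le> K_aniso * L2_norm \<Omega> g * (L2_norm \<Omega> \<phi> * L2_norm \<Omega> (\<lambda>x. jacobian \<phi> (at x)))"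
    by (rule power2_le_imp_le) (simp add: K_aniso_nonneg)
  then show ?thesis by (simp add: X1)
qed

text \<open>For a bounded weight both sides converge along test fields that converge in H1.\<close>

lemma V_aniso:
  assumes f: "f \<in> V_space \<Omega>" and g: "g \<in> borel_measurable M" "\<And>x. 0 \<le> g x" "\<And>x. g x \<le> N" and ax: "axisym_scalar g"
  shows "(LINT x|M. (norm (f x))\<^sup>2 * g x) \<le> K_aniso * L2_norm \<Omega> g * (L2_norm \<Omega> f * L2_norm \<Omega> (weak_gradient \<Omega> f))"
proof -
  obtain \<phi> where \<phi>: "\<And>n. \<phi> n \<in> solenoidal_test_fields \<Omega>" "(\<lambda>n. H1_norm \<Omega> (\<lambda>x. \<phi> n x - f x)) \<longlonglongrightarrow> 0"
    using V_approx[OF f] by blast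
  note V = solenoidal_V[OF \<phi>(1)]
  note l = H1_norm_tendsto[OF V_H1[OF V] V_H1[OF f] \<phi>(2)]
  show ?thesis
  proof (rule LIMSEQ_le)
    show "(\<lambda>n. LINT x|M. (norm (\<phi> n x))\<^sup>2 * g x) \<longlonglongrightarrow> (LINT x|M. (norm (f x))\<^sup>2 * g x)"
      by (rule weighted_square_tendsto[OF V_L2[OF V] V_L2[OF f] l(1) g(1), of N]) (use g in auto)
    show "(\<lambda>n. K_aniso * L2_norm \<Omega> g * (L2_norm \<Omega> (\<phi> n) * L2_norm \<Omega> (\<lambda>x. jacobian (\<phi> n) (at x)))) \<longlonglongrightarrow>
       K_aniso * L2_norm \<Omega> g * (L2_norm \<Omega> f * L2_norm \<Omega> (weak_gradient \<Omega> f))"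
      by (intro tendsto_intros H1_tendsto_norms[OF f \<phi>])
    show "\<exists>N. \<forall>n\<ge>N. (LINT x|M. (norm (\<phi> n x))\<^sup>2 * g x) \<le> K_aniso * L2_norm \<Omega> g * (L2_norm \<Omega> (\<phi> n) * L2_norm \<Omega> (\<lambda>x. jacobian (\<phi> n) (at x)))"
      using test_aniso[OF solenoidal_test[OF \<phi>(1)] g ax] by auto
  qed
qed

text \<open>\<open>V_aniso\<close> is used with the truncation of |u|^2 itself as weight, which is
  axisymmetric, and \<open>L2_norm_sq_truncation\<close> closes the estimate. The exponents are
  those of Ladyzhenskaya's inequality in the plane.\<close>

lemma V_axisymmetric_L4:
  assumes u: "u \<in> V_space \<Omega>" and ax: "axisymmetric \<Omega> u"
  shows "L2_norm \<Omega> (\<lambda>x. (norm (u x))\<^sup>2) \<le> K_aniso * (L2_norm \<Omega> u * L2_norm \<Omega> (weak_gradient \<Omega> u))"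
proof (rule L2_norm_sq_truncation(2)[OF V_L2[OF u]])
  note [measurable] = L2_fieldsD(1)[OF V_L2[OF u]]
  show "0 \<le> K_aniso * (L2_norm \<Omega> u * L2_norm \<Omega> (weak_gradient \<Omega> u))" by (simp add: K_aniso_nonneg)
  fix N
  show "(LINT x|M. (norm (u x))\<^sup>2 * min ((norm (u x))\<^sup>2) (real N)) \<le>
     K_aniso * (L2_norm \<Omega> u * L2_norm \<Omega> (weak_gradient \<Omega> u)) * L2_norm \<Omega> (\<lambda>x. min ((norm (u x))\<^sup>2) (real N))"
    using V_aniso[OF u _ _ _ axisym_scalar_norm_sq[OF ax, of "real N"], of "real N"] by (simp add: ac_simps)
qed

text \<open>The truncated weight |u|^2 has L2 norm at most \<open>K_aniso\<close> ||u|| ||grad u||,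
  which explains the square of the constant. The truncation is removed by dominated convergence,
  with majorant |w|^2 |u|^2; this is integrable by the three-dimensional L4 bound.\<close>

lemma V_aniso_product:
  assumes w: "w \<in> V_space \<Omega>" and u: "u \<in> V_space \<Omega>" and ax: "axisymmetric \<Omega> u"
  shows "(L2_norm \<Omega> (\<lambda>x. norm (w x) * norm (u x)))\<^sup>2 \<le>
    K_aniso\<^sup>2 * (L2_norm \<Omega> u * L2_norm \<Omega> (weak_gradient \<Omega> u)) * (L2_norm \<Omega> w * L2_norm \<Omega> (weak_gradient \<Omega> w))"
proof -
  note [measurable] = L2_fieldsD(1)[OF V_L2[OF u]] L2_fieldsD(1)[OF V_L2[OF w]]
  define g where "g N x = min ((norm (u x))\<^sup>2) (real N)" for N x
  have le: "(LINT x|M. (norm (w x))\<^sup>2 * g N x) \<le> K_aniso\<^sup>2 * (L2_norm \<Omega> u * L2_norm \<Omega> (weak_gradient \<Omega> u)) * (L2_norm \<Omega> w * L2_norm \<Omega> (weak_gradient \<Omega> w))" for N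
  proof -
    have "(LINT x|M. (norm (w x))\<^sup>2 * g N x) \<le> K_aniso * L2_norm \<Omega> (g N) * (L2_norm \<Omega> w * L2_norm \<Omega> (weak_gradient \<Omega> w))"
      using V_aniso[OF w _ _ _ axisym_scalar_norm_sq[OF ax, of "real N"], of "real N"] by (simp add: g_def[abs_def])
    also have "\<dots> \<le> K_aniso * (K_aniso * (L2_norm \<Omega> u * L2_norm \<Omega> (weak_gradient \<Omega> u))) * (L2_norm \<Omega> w * L2_norm \<Omega> (weak_gradient \<Omega> w))"
    proof (intro mult_right_mono mult_left_mono K_aniso_nonneg)
      have "L2_norm \<Omega> (g N) \<le> L2_norm \<Omega> (\<lambda>x. (norm (u x))\<^sup>2)"
        by (rule L2_norm_mono[OF _ V_L4(1)[OF u]]) (auto simp: g_def[abs_def])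
      then show "L2_norm \<Omega> (g N) \<le> K_aniso * (L2_norm \<Omega> u * L2_norm \<Omega> (weak_gradient \<Omega> u))"
        using V_axisymmetric_L4[OF u ax] by simp
    qed auto
    finally show ?thesis by (simp add: power2_eq_square ac_simps)
  qed
  have i: "integrable M (\<lambda>x. (norm (w x))\<^sup>2 * (norm (u x))\<^sup>2)"
    using integrable_inner[OF V_L4(1)[OF w] V_L4(1)[OF u]] by simp
  have "(\<lambda>N. LINT x|M. (norm (w x))\<^sup>2 * g N x) \<longlonglongrightarrow> (LINT x|M. (norm (w x))\<^sup>2 * (norm (u x))\<^sup>2)"
  proof (rule integral_dominated_convergence[OF _ _ i])
    show "AE x in M. (\<lambda>N. (norm (w x))\<^sup>2 * g N x) \<longlonglongrightarrow> (norm (w x))\<^sup>2 * (norm (u x))\<^sup>2"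
    proof (intro AE_I2 tendsto_intros)
      fix x
      obtain N0 :: nat where N0: "(norm (u x))\<^sup>2 \<le> real N0" using real_arch_simple by blast
      have "\<forall>\<^sub>F N in sequentially. g N x = (norm (u x))\<^sup>2"
        unfolding eventually_sequentially
      proof (intro exI[of _ N0] allI impI)
        fix N assume "N0 \<le> N"
        then have "(norm (u x))\<^sup>2 \<le> real N" using N0 by linarith
        then show "g N x = (norm (u x))\<^sup>2" by (simp add: g_def)
      qed
      then show "(\<lambda>N. g N x) \<longlonglongrightarrow> (norm (u x))\<^sup>2" by (rule tendsto_eventually)
    qed
    show "AE x in M. norm ((norm (w x))\<^sup>2 * g N x) \<le> (norm (w x))\<^sup>2 * (norm (u x))\<^sup>2" for N
      by (auto simp: g_def abs_mult intro!: mult_left_mono)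
  qed (auto simp: g_def)
  then have "(LINT x|M. (norm (w x))\<^sup>2 * (norm (u x))\<^sup>2) \<le> K_aniso\<^sup>2 * (L2_norm \<Omega> u * L2_norm \<Omega> (weak_gradient \<Omega> u)) * (L2_norm \<Omega> w * L2_norm \<Omega> (weak_gradient \<Omega> w))"
    using le by (intro LIMSEQ_le_const2) auto
  then show ?thesis unfolding V_product(2)[OF w u] by (simp add: L2_inner_def)
qed

text \<open>Symmetry is asked of \<open>u\<close> alone while \<open>w\<close> and \<open>f\<close>
  are arbitrary, as the difference of an axisymmetric and a general solution requires.\<close>

lemma abs_conv_axisymmetric_le:
  assumes w: "w \<in> V_space \<Omega>" and f: "f \<in> V_space \<Omega>" and u: "u \<in> V_space \<Omega>" and ax: "axisymmetric \<Omega> u"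
  shows "\<bar>conv w f u\<bar> \<le> K_aniso * L2_norm \<Omega> (weak_gradient \<Omega> f) *
    sqrt ((L2_norm \<Omega> u * L2_norm \<Omega> (weak_gradient \<Omega> u)) * (L2_norm \<Omega> w * L2_norm \<Omega> (weak_gradient \<Omega> w)))"
proof -
  have "L2_norm \<Omega> (\<lambda>x. norm (w x) * norm (u x)) \<le> sqrt (K_aniso\<^sup>2 * (L2_norm \<Omega> u * L2_norm \<Omega> (weak_gradient \<Omega> u)) * (L2_norm \<Omega> w * L2_norm \<Omega> (weak_gradient \<Omega> w)))"
    by (rule real_le_rsqrt[OF V_aniso_product[OF w u ax]])
  also have "\<dots> = K_aniso * sqrt ((L2_norm \<Omega> u * L2_norm \<Omega> (weak_gradient \<Omega> u)) * (L2_norm \<Omega> w * L2_norm \<Omega> (weak_gradient \<Omega> w)))"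
    using K_aniso_nonneg by (simp add: real_sqrt_mult)
  finally have "L2_norm \<Omega> (weak_gradient \<Omega> f) * L2_norm \<Omega> (\<lambda>x. norm (w x) * norm (u x)) \<le>
      L2_norm \<Omega> (weak_gradient \<Omega> f) * (K_aniso * sqrt ((L2_norm \<Omega> u * L2_norm \<Omega> (weak_gradient \<Omega> u)) * (L2_norm \<Omega> w * L2_norm \<Omega> (weak_gradient \<Omega> w))))"
    by (intro mult_left_mono) auto
  with abs_conv_le(1)[OF w f u] show ?thesis by (simp add: ac_simps)
qed

end

section \<open>Functions of time with values in a pseudometric space\<close>

lemma nn_integral_shift:
  fixes f :: "real \<Rightarrow> ennreal"
  assumes "f \<in> borel_measurable borel"
  shows "(\<integral>\<^sup>+x. f (x + c) \<partial>lborel) = (\<integral>\<^sup>+x. f x \<partial>lborel)"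
  using nn_integral_real_affine[OF assms, of 1 c] by (simp add: add.commute)

text \<open>Measurable functions are almost everywhere limits of continuous ones. Clamped to
  [-B, B], these converge in L1 on bounded intervals, and for a continuous function the claim is
  uniform continuity.\<close>

lemma bounded_translation_continuous:
  fixes q :: "real \<Rightarrow> real"
  assumes q [measurable]: "q \<in> borel_measurable borel" and qB: "\<And>t. \<bar>q t\<bar> \<le> B" and S: "0 \<le> S" and \<epsilon>: "0 < \<epsilon>"
  obtains \<delta> where "0 < \<delta>" "\<And>h. 0 \<le> h \<Longrightarrow> h \<le> \<delta> \<Longrightarrow> (\<integral>\<^sup>+t. ennreal \<bar>q (t + h) - q t\<bar> * indicator {0..S} t \<partial>lborel) \<le> ennreal \<epsilon>"
proof -
  have "q \<in> borel_measurable lebesgue" by (rule measurable_completion) simp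
  then have "q measurable_on UNIV" by (rule lebesgue_measurable_imp_measurable_on) simp
  then obtain N g where N: "negligible N" "\<And>n. continuous_on UNIV (g n)" "\<And>x. x \<notin> N \<Longrightarrow> (\<lambda>n. g n x) \<longlonglongrightarrow> q x"
    unfolding measurable_on_def by auto
  define c where "c n t = max (- B) (min B (g n t))" for n t
  have cc: "continuous_on A (c n)" for n A
    unfolding c_def by (intro continuous_intros continuous_on_subset[OF N(2)]) auto
  have [measurable]: "c n \<in> borel_measurable borel" for n by (rule borel_measurable_continuous_onI[OF cc])
  have cB: "\<bar>c n t\<bar> \<le> B" for n t using qB[of t] by (auto simp: c_def abs_le_iff min_def max_def)
  have clim: "(\<lambda>n. c n t) \<longlonglongrightarrow> q t" if "t \<notin> N" for t
  proof -
    have "(\<lambda>n. c n t) \<longlonglongrightarrow> max (- B) (min B (q t))"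
      unfolding c_def by (intro tendsto_max tendsto_min tendsto_const N(3) that)
    moreover have "max (- B) (min B (q t)) = q t" using qB[of t] by (auto simp: abs_le_iff)
    ultimately show ?thesis by simp
  qed
  \<comment> \<open>The interval is longer by 1 because t + h has to stay in it for t <= S and h <=
    1.\<close>
  have ind: "integrable lborel (indicat_real {0..S + 1})" by (rule integrable_real_indicator) (use S in auto)
  define I where "I n = (LINT t|lborel. \<bar>c n t - q t\<bar> * indicator {0..S + 1} t)" for n
  have i: "integrable lborel (\<lambda>t. \<bar>c n t - q t\<bar> * indicator {0..S + 1} t)" for n
  proof (rule Bochner_Integration.integrable_bound)
    show "integrable lborel (\<lambda>t. 2 * B * indicator {0..S + 1} t)" using ind by simp
    have "\<bar>c n t - q t\<bar> \<le> \<bar>2 * B\<bar>" for t using cB[of n t] qB[of t] by linarith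
    then show "AE t in lborel. norm (\<bar>c n t - q t\<bar> * indicator {0..S + 1} t) \<le> norm (2 * B * indicator {0..S + 1} t)"
      by (auto simp: indicator_def)
  qed measurable
  have "I \<longlonglongrightarrow> (LINT t|(lborel :: real measure). 0)"
    unfolding I_def
  proof (rule integral_dominated_convergence)
    show "integrable lborel (\<lambda>t. 2 * B * indicator {0..S + 1} t)" using ind by simp
    have "\<bar>c n t - q t\<bar> \<le> 2 * B" for n t using cB[of n t] qB[of t] by linarith
    then show "AE t in lborel. norm (\<bar>c n t - q t\<bar> * indicator {0..S + 1} t) \<le> 2 * B * indicator {0..S + 1} t" for n
      by (auto simp: indicator_def)
    have "AE t in lebesgue. t \<notin> N" using N(1) by (simp add: AE_not_in negligible_iff_null_sets)
    then have "AE t in lborel. t \<notin> N" by (simp only: AE_completion_iff)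
    then show "AE t in lborel. (\<lambda>n. \<bar>c n t - q t\<bar> * indicator {0..S + 1} t) \<longlonglongrightarrow> 0"
    proof eventually_elim
      fix t assume "t \<notin> N"
      from clim[OF this] have "(\<lambda>n. \<bar>c n t - q t\<bar>) \<longlonglongrightarrow> 0" by (intro tendsto_rabs_zero LIM_zero)
      from tendsto_mult_left_zero[OF this] show "(\<lambda>n. \<bar>c n t - q t\<bar> * indicator {0..S + 1} t) \<longlonglongrightarrow> 0" .
    qed
  qed auto
  then have "\<forall>\<^sub>F n in sequentially. I n < \<epsilon> / 3" using \<epsilon> by (intro order_tendstoD(2)[of I 0]) auto
  then obtain n where n: "I n < \<epsilon> / 3" by (meson eventually_sequentially order_refl)
  have "uniformly_continuous_on {0..S + 1} (c n)" by (intro compact_uniformly_continuous cc) auto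
  then obtain d where d: "d > 0" "\<And>x y. x \<in> {0..S+1} \<Longrightarrow> y \<in> {0..S+1} \<Longrightarrow> dist y x < d \<Longrightarrow> dist (c n y) (c n x) < \<epsilon> / (3 * (S + 1))"
    unfolding uniformly_continuous_on_def using \<epsilon> S by (metis divide_pos_pos mult_pos_pos add_nonneg_pos zero_less_numeral zero_less_one)
  define F where "F t = ennreal (\<bar>c n t - q t\<bar> * indicator {0..S + 1} t)" for t
  have [measurable]: "F \<in> borel_measurable borel" unfolding F_def by measurable
  have F: "(\<integral>\<^sup>+t. F t \<partial>lborel) \<le> ennreal (\<epsilon> / 3)"
  proof -
    have "(\<integral>\<^sup>+t. F t \<partial>lborel) = ennreal (I n)"
      unfolding F_def I_def by (rule nn_integral_eq_integral[OF i]) auto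
    then show ?thesis using n by (simp add: ennreal_leI)
  qed
  show ?thesis
  proof (rule that[of "min (d / 2) 1"])
    show "0 < min (d / 2) 1" using d(1) by simp
    fix h :: real assume h: "0 \<le> h" "h \<le> min (d / 2) 1"
    have "(\<integral>\<^sup>+t. ennreal \<bar>q (t + h) - q t\<bar> * indicator {0..S} t \<partial>lborel) \<le>
        (\<integral>\<^sup>+t. F (t + h) + ennreal (\<epsilon> / (3 * (S + 1))) * indicator {0..S} t + F t \<partial>lborel)"
    proof (rule nn_integral_mono)
      fix t
      show "ennreal \<bar>q (t + h) - q t\<bar> * indicator {0..S} t \<le> F (t + h) + ennreal (\<epsilon> / (3 * (S + 1))) * indicator {0..S} t + F t"
      proof (cases "t \<in> {0..S}")
        case True
        then have "dist (c n (t + h)) (c n t) < \<epsilon> / (3 * (S + 1))"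
          using h d(1) by (intro d(2)) (auto simp: dist_real_def)
        then have "\<bar>q (t + h) - q t\<bar> \<le> \<bar>c n (t + h) - q (t + h)\<bar> + \<epsilon> / (3 * (S + 1)) + \<bar>c n t - q t\<bar>"
          unfolding dist_real_def by linarith
        then have "ennreal \<bar>q (t + h) - q t\<bar> \<le> ennreal (\<bar>c n (t + h) - q (t + h)\<bar> + \<epsilon> / (3 * (S + 1)) + \<bar>c n t - q t\<bar>)"
          by (rule ennreal_leI)
        then show ?thesis using True h \<epsilon> S by (simp add: F_def)
      qed simp
    qed
    also have "\<dots> = (\<integral>\<^sup>+t. F (t + h) \<partial>lborel) + (\<integral>\<^sup>+t. ennreal (\<epsilon> / (3 * (S + 1))) * indicator {0..S} t \<partial>lborel) + (\<integral>\<^sup>+t. F t \<partial>lborel)"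
      by (simp add: nn_integral_add)
    also have "\<dots> \<le> ennreal (\<epsilon> / 3) + ennreal (\<epsilon> / 3) + ennreal (\<epsilon> / 3)"
    proof (intro add_mono)
      show "(\<integral>\<^sup>+t. F (t + h) \<partial>lborel) \<le> ennreal (\<epsilon> / 3)" using F by (simp add: nn_integral_shift)
      have "(\<integral>\<^sup>+t. ennreal (\<epsilon> / (3 * (S + 1))) * indicator {0..S} t \<partial>lborel) = ennreal (\<epsilon> / (3 * (S + 1)) * S)"
        using S \<epsilon> ennreal_mult[of "\<epsilon> / (3 * (S + 1))" S] by (simp add: nn_integral_cmult)
      also have "\<epsilon> / (3 * (S + 1)) * S \<le> \<epsilon> / 3" using S \<epsilon> by (simp add: field_simps)
      finally show "(\<integral>\<^sup>+t. ennreal (\<epsilon> / (3 * (S + 1))) * indicator {0..S} t \<partial>lborel) \<le> ennreal (\<epsilon> / 3)"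
        by (simp add: ennreal_leI)
      show "(\<integral>\<^sup>+t. F t \<partial>lborel) \<le> ennreal (\<epsilon> / 3)" by (rule F)
    qed
    also have "\<dots> = ennreal \<epsilon>" using \<epsilon> by (simp flip: ennreal_plus)
    finally show "(\<integral>\<^sup>+t. ennreal \<bar>q (t + h) - q t\<bar> * indicator {0..S} t \<partial>lborel) \<le> ennreal \<epsilon>" .
  qed
qed

section \<open>Measurability and translations for functions with values in a pseudometric
  space\<close>

text \<open>The H1 norm does not separate fields that agree almost everywhere, and \<open>V\<close>
  is a set of functions rather than a type. A pseudometric on a set is all that the arguments in
  time require.\<close>

locale pseudometric =
  fixes X :: "'e set" and d :: "'e \<Rightarrow> 'e \<Rightarrow> real"
  assumes d_nonneg: "x \<in> X \<Longrightarrow> y \<in> X \<Longrightarrow> 0 \<le> d x y"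
    and d_refl: "x \<in> X \<Longrightarrow> d x x = 0"
    and d_sym: "x \<in> X \<Longrightarrow> y \<in> X \<Longrightarrow> d x y = d y x"
    and d_tri: "x \<in> X \<Longrightarrow> y \<in> X \<Longrightarrow> z \<in> X \<Longrightarrow> d x z \<le> d x y + d y z"
begin

text \<open>In contrast to strong measurability, membership and convergence are required at every
  point, so that composition with any measurable map, such as a shift or a projection of pairs of
  times, keeps the property.\<close>

definition approx :: "'x measure \<Rightarrow> ('x \<Rightarrow> 'e) \<Rightarrow> (nat \<Rightarrow> 'x \<Rightarrow> 'e) \<Rightarrow> bool" where
  "approx N f s \<longleftrightarrow> (\<forall>n. simple_function N (s n)) \<and> (\<forall>n x. s n x \<in> X) \<and> (\<forall>x. f x \<in> X) \<and>
     (\<forall>x. (\<lambda>n. d (s n x) (f x)) \<longlonglongrightarrow> 0)"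

lemma approx_compose:
  "approx N f s \<Longrightarrow> T \<in> measurable N' N \<Longrightarrow> approx N' (\<lambda>x. f (T x)) (\<lambda>n x. s n (T x))"
  by (auto simp: approx_def intro: simple_function_comp)

lemma approx_const: "x \<in> X \<Longrightarrow> approx N (\<lambda>_. x) (\<lambda>_ _. x)"
  by (simp add: approx_def d_refl)

text \<open>Simple functions take finitely many values, so \<open>\<Psi>\<close> of a pair of them
  is measurable without any sigma-algebra on \<open>X\<close>; the sequential continuity of
  \<open>\<Psi>\<close> carries this to the limit. Norms, inner products and the trilinear form
  become measurable in time in this way.\<close>

lemma approx_measurable:
  fixes \<Psi> :: "'e \<Rightarrow> 'e \<Rightarrow> real"
  assumes f: "approx N f s" and g: "approx N g r"
    and \<Psi>: "\<And>a a' b b'. (\<And>n::nat. a n \<in> X) \<Longrightarrow> a' \<in> X \<Longrightarrow> (\<lambda>n. d (a n) a') \<longlonglongrightarrow> 0 \<Longrightarrow>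
      (\<And>n. b n \<in> X) \<Longrightarrow> b' \<in> X \<Longrightarrow> (\<lambda>n. d (b n) b') \<longlonglongrightarrow> 0 \<Longrightarrow> (\<lambda>n. \<Psi> (a n) (b n)) \<longlonglongrightarrow> \<Psi> a' b'"
  shows "(\<lambda>x. \<Psi> (f x) (g x)) \<in> borel_measurable N"
proof (rule borel_measurable_LIMSEQ_real)
  show "(\<lambda>n. \<Psi> (s n x) (r n x)) \<longlonglongrightarrow> \<Psi> (f x) (g x)" for x
    by (rule \<Psi>) (use f g in \<open>auto simp: approx_def\<close>)
  have "simple_function N (\<lambda>x. (\<lambda>p. \<Psi> (fst p) (snd p)) (s n x, r n x))" for n
    by (rule simple_function_compose1, rule simple_function_Pair) (use f g in \<open>auto simp: approx_def\<close>)
  then show "(\<lambda>x. \<Psi> (s n x) (r n x)) \<in> borel_measurable N" for n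
    using borel_measurable_simple_function by auto
qed

lemma d_abs_diff: "x \<in> X \<Longrightarrow> y \<in> X \<Longrightarrow> z \<in> X \<Longrightarrow> \<bar>d x z - d y z\<bar> \<le> d x y"
  using d_tri[of x y z] d_tri[of y x z] d_sym[of x y] by auto

lemma d_continuous:
  assumes "\<And>n::nat. a n \<in> X" "a' \<in> X" "(\<lambda>n. d (a n) a') \<longlonglongrightarrow> 0" "\<And>n. b n \<in> X" "b' \<in> X" "(\<lambda>n. d (b n) b') \<longlonglongrightarrow> 0"
  shows "(\<lambda>n. d (a n) (b n)) \<longlonglongrightarrow> d a' b'"
proof (rule LIM_zero_cancel, rule Lim_null_comparison[OF always_eventually], rule allI)
  fix n
  have "\<bar>d (a n) (b n) - d a' (b n)\<bar> \<le> d (a n) a'" using assms by (intro d_abs_diff) auto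
  moreover have "\<bar>d a' (b n) - d a' b'\<bar> \<le> d (b n) b'"
    using d_abs_diff[of "b n" b' a'] d_sym[of a'] assms by auto
  ultimately show "norm (d (a n) (b n) - d a' b') \<le> d (a n) a' + d (b n) b'" by simp
next
  show "(\<lambda>n. d (a n) a' + d (b n) b') \<longlonglongrightarrow> 0" using tendsto_add[OF assms(3,6)] by simp
qed

lemma approx_d_measurable:
  assumes "approx N f s" "approx N g r"
  shows "(\<lambda>x. d (f x) (g x)) \<in> borel_measurable N"
  by (rule approx_measurable[OF assms d_continuous])

lemma approx_simple_L2:
  fixes f :: "real \<Rightarrow> 'e"
  assumes f: "approx lborel f s" and z: "z \<in> X" and i: "integrable lborel (\<lambda>t. (d (f t) z)\<^sup>2)" and \<epsilon>: "0 < \<epsilon>"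
  obtains \<sigma> where "simple_function lborel \<sigma>" "\<And>t. \<sigma> t \<in> X" "(\<integral>\<^sup>+t. ennreal ((d (f t) (\<sigma> t))\<^sup>2) \<partial>lborel) \<le> ennreal \<epsilon>"
proof -
  have s: "simple_function lborel (s n)" "s n t \<in> X" "f t \<in> X" "(\<lambda>n. d (s n t) (f t)) \<longlonglongrightarrow> 0" for n t
    using f by (auto simp: approx_def)
  \<comment> \<open>Values too far from \<open>z\<close> are replaced by \<open>z\<close>. Then d(f,
    sigma) <= 3 d(f, z), which gives a majorant, and where d(f, z) > 0 nothing is replaced for large
    n.\<close>
  define \<sigma> where "\<sigma> n t = (if d (s n t) z \<le> 2 * d (f t) z then s n t else z)" for n t
  have \<sigma>X: "\<sigma> n t \<in> X" for n t using s z by (simp add: \<sigma>_def)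
  have sa: "approx lborel (s n) (\<lambda>_. s n)" for n using s by (simp add: approx_def d_refl)
  have mf [measurable]: "(\<lambda>t. d (f t) z) \<in> borel_measurable lborel"
    by (rule approx_d_measurable[OF f approx_const[OF z]])
  have ms [measurable]: "(\<lambda>t. d (s n t) z) \<in> borel_measurable lborel" for n
    by (rule approx_d_measurable[OF sa approx_const[OF z]])
  have \<sigma>s: "simple_function lborel (\<sigma> n)" for n
    unfolding \<sigma>_def by (intro simple_function_If s simple_function_const) measurable
  have \<sigma>a: "approx lborel (\<sigma> n) (\<lambda>_. \<sigma> n)" for n using \<sigma>s \<sigma>X by (simp add: approx_def d_refl)
  have md [measurable]: "(\<lambda>t. d (f t) (\<sigma> n t)) \<in> borel_measurable lborel" for n
    by (rule approx_d_measurable[OF f \<sigma>a])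
  have bound: "d (f t) (\<sigma> n t) \<le> 3 * d (f t) z" for n t
  proof -
    have "d (f t) (\<sigma> n t) \<le> d (f t) z + d z (\<sigma> n t)" by (intro d_tri s z \<sigma>X)
    also have "d z (\<sigma> n t) = d (\<sigma> n t) z" by (intro d_sym z \<sigma>X)
    also have "d (\<sigma> n t) z \<le> 2 * d (f t) z" using d_nonneg[OF s(3)[of t] z] d_refl[OF z] by (auto simp: \<sigma>_def)
    finally show ?thesis by simp
  qed
  have lim: "(\<lambda>n. (d (f t) (\<sigma> n t))\<^sup>2) \<longlonglongrightarrow> 0" for t
  proof (cases "d (f t) z = 0")
    case True
    then have "d (f t) (\<sigma> n t) = 0" for n using bound[of t n] d_nonneg[OF s(3)[of t] \<sigma>X[of n t]] by simp
    then show ?thesis by simp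
  next
    case False
    then have p: "d (f t) z > 0" using d_nonneg[OF s(3)[of t] z] by simp
    have "(\<lambda>n. d (s n t) z) \<longlonglongrightarrow> d (f t) z"
      by (rule d_continuous) (use s z in \<open>auto simp: d_refl\<close>)
    then have "\<forall>\<^sub>F n in sequentially. d (s n t) z < 2 * d (f t) z" using p by (intro order_tendstoD(2)) auto
    then have "\<forall>\<^sub>F n in sequentially. (d (s n t) (f t))\<^sup>2 = (d (f t) (\<sigma> n t))\<^sup>2"
    proof eventually_elim
      fix n assume "d (s n t) z < 2 * d (f t) z"
      then have "\<sigma> n t = s n t" by (simp add: \<sigma>_def)
      then show "(d (s n t) (f t))\<^sup>2 = (d (f t) (\<sigma> n t))\<^sup>2" using d_sym[OF s(2)[of n t] s(3)[of t]] by simp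
    qed
    moreover have "(\<lambda>n. (d (s n t) (f t))\<^sup>2) \<longlonglongrightarrow> 0" using tendsto_power[OF s(4)[of t], of 2] by simp
    ultimately show ?thesis by (rule Lim_transform_eventually[rotated])
  qed
  have dom: "norm ((d (f t) (\<sigma> n t))\<^sup>2) \<le> 9 * (d (f t) z)\<^sup>2" for n t
  proof -
    have "(d (f t) (\<sigma> n t))\<^sup>2 \<le> (3 * d (f t) z)\<^sup>2" by (intro power_mono bound d_nonneg s \<sigma>X)
    then show ?thesis by (simp add: power_mult_distrib)
  qed
  have i9: "integrable lborel (\<lambda>t. 9 * (d (f t) z)\<^sup>2)" using i by simp
  have "(\<lambda>n. LINT t|lborel. (d (f t) (\<sigma> n t))\<^sup>2) \<longlonglongrightarrow> (LINT t|(lborel::real measure). 0)"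
    by (rule integral_dominated_convergence[OF _ _ i9]) (use lim dom in auto)
  then have "\<forall>\<^sub>F n in sequentially. (LINT t|lborel. (d (f t) (\<sigma> n t))\<^sup>2) < \<epsilon>"
    using \<epsilon> by (intro order_tendstoD(2)) auto
  then obtain n where n: "(LINT t|lborel. (d (f t) (\<sigma> n t))\<^sup>2) < \<epsilon>" by (meson eventually_sequentially order_refl)
  have "integrable lborel (\<lambda>t. (d (f t) (\<sigma> n t))\<^sup>2)"
    by (rule Bochner_Integration.integrable_bound[OF i9]) (use dom[of _ n] in auto)
  then have "(\<integral>\<^sup>+t. ennreal ((d (f t) (\<sigma> n t))\<^sup>2) \<partial>lborel) = ennreal (LINT t|lborel. (d (f t) (\<sigma> n t))\<^sup>2)"
    by (intro nn_integral_eq_integral) auto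
  then have "(\<integral>\<^sup>+t. ennreal ((d (f t) (\<sigma> n t))\<^sup>2) \<partial>lborel) \<le> ennreal \<epsilon>" using n by (simp add: ennreal_leI)
  then show ?thesis using that[OF \<sigma>s \<sigma>X] by blast
qed

text \<open>After approximation by a simple function sigma, its finitely many values are numbered.
  The resulting real function \<open>q\<close> is covered by
  \<open>bounded_translation_continuous\<close>, and d(sigma x, sigma y)^2 <= C |q x - q y| because
  distinct numbers differ by at least 1.\<close>

lemma translation_continuous:
  fixes f :: "real \<Rightarrow> 'e"
  assumes f: "approx lborel f s" and z: "z \<in> X" and i: "integrable lborel (\<lambda>t. (d (f t) z)\<^sup>2)" and S: "0 \<le> S" and \<epsilon>: "0 < \<epsilon>"
  obtains \<delta> where "0 < \<delta>" "\<And>h. 0 \<le> h \<Longrightarrow> h \<le> \<delta> \<Longrightarrow> (\<integral>\<^sup>+t. ennreal ((d (f (t + h)) (f t))\<^sup>2) * indicator {0..S} t \<partial>lborel) \<le> ennreal \<epsilon>"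
proof -
  obtain \<sigma> where \<sigma>: "simple_function lborel \<sigma>" "\<And>t. \<sigma> t \<in> X" "(\<integral>\<^sup>+t. ennreal ((d (f t) (\<sigma> t))\<^sup>2) \<partial>lborel) \<le> ennreal (\<epsilon> / 9)"
    using approx_simple_L2[OF f z i, of "\<epsilon> / 9"] \<epsilon> by auto
  have fX: "f t \<in> X" for t using f by (simp add: approx_def)
  have \<sigma>a: "approx lborel \<sigma> (\<lambda>_. \<sigma>)" using \<sigma> by (simp add: approx_def d_refl)
  have m [measurable]: "(\<lambda>t. d (f t) (\<sigma> t)) \<in> borel_measurable borel"
    using approx_d_measurable[OF f \<sigma>a] by simp
  have fin: "finite (range \<sigma>)" using simple_functionD(1)[OF \<sigma>(1)] by simp
  obtain \<iota> :: "'e \<Rightarrow> nat" where \<iota>: "inj_on \<iota> (range \<sigma>)" using finite_imp_inj_to_nat_seg[OF fin] by blast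
  define q where "q t = real (\<iota> (\<sigma> t))" for t
  have "simple_function lborel q" unfolding q_def by (rule simple_function_compose1[OF \<sigma>(1)])
  then have qm: "q \<in> borel_measurable borel" using borel_measurable_simple_function by force
  have "finite (range q)" unfolding q_def using fin by (metis finite_imageI image_image)
  then have "bounded (range q)" by (rule finite_imp_bounded)
  then obtain B where B: "\<And>t. \<bar>q t\<bar> \<le> B" by (auto simp: bounded_iff)
  have qd: "1 \<le> \<bar>q x - q y\<bar>" if "\<sigma> x \<noteq> \<sigma> y" for x y
  proof -
    have "\<iota> (\<sigma> x) \<noteq> \<iota> (\<sigma> y)" using \<iota> that by (auto dest: inj_onD)
    then show ?thesis unfolding q_def by linarith
  qed
  have "finite ((\<lambda>(x, y). (d x y)\<^sup>2) ` (range \<sigma> \<times> range \<sigma>))" using fin by auto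
  then have "bounded ((\<lambda>(x, y). (d x y)\<^sup>2) ` (range \<sigma> \<times> range \<sigma>))" by (rule finite_imp_bounded)
  then obtain C' where C': "\<And>x y. (d (\<sigma> x) (\<sigma> y))\<^sup>2 \<le> C'" by (force simp: bounded_iff)
  define C where "C = max C' 1"
  have C: "C > 0" "(d (\<sigma> x) (\<sigma> y))\<^sup>2 \<le> C" for x y using C'[of x y] by (auto simp: C_def)
  have dC: "(d (\<sigma> x) (\<sigma> y))\<^sup>2 \<le> C * \<bar>q x - q y\<bar>" for x y
  proof (cases "\<sigma> x = \<sigma> y")
    case True
    then show ?thesis using C(1) d_refl[OF \<sigma>(2)] by simp
  next
    case False
    have "C * 1 \<le> C * \<bar>q x - q y\<bar>" using qd[OF False] C(1) by (intro mult_left_mono) auto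
    with C(2)[of x y] show ?thesis by simp
  qed
  have \<epsilon>9: "0 < \<epsilon> / (9 * C)" using \<epsilon> C(1) by simp
  obtain \<delta> where \<delta>: "0 < \<delta>" "\<And>h. 0 \<le> h \<Longrightarrow> h \<le> \<delta> \<Longrightarrow> (\<integral>\<^sup>+t. ennreal \<bar>q (t + h) - q t\<bar> * indicator {0..S} t \<partial>lborel) \<le> ennreal (\<epsilon> / (9 * C))"
    using bounded_translation_continuous[OF qm B S \<epsilon>9] by blast
  define F where "F t = ennreal ((d (f t) (\<sigma> t))\<^sup>2)" for t
  have [measurable]: "F \<in> borel_measurable borel" unfolding F_def by measurable
  note [measurable] = qm
  show ?thesis
  proof (rule that[OF \<delta>(1)])
    fix h :: real assume h: "0 \<le> h" "h \<le> \<delta>"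
    have "(\<integral>\<^sup>+t. ennreal ((d (f (t + h)) (f t))\<^sup>2) * indicator {0..S} t \<partial>lborel) \<le>
      (\<integral>\<^sup>+t. 3 * F (t + h) + ennreal (3 * C) * (ennreal \<bar>q (t + h) - q t\<bar> * indicator {0..S} t) + 3 * F t \<partial>lborel)"
    proof (rule nn_integral_mono)
      fix t
      have "d (f (t + h)) (f t) \<le> d (f (t + h)) (\<sigma> (t + h)) + d (\<sigma> (t + h)) (\<sigma> t) + d (\<sigma> t) (f t)"
        using d_tri[OF fX \<sigma>(2) fX, of "t + h" t "t + h"] d_tri[OF \<sigma>(2) \<sigma>(2) fX, of "t + h" t t] by simp
      then have "(d (f (t + h)) (f t))\<^sup>2 \<le> (d (f (t + h)) (\<sigma> (t + h)) + d (\<sigma> (t + h)) (\<sigma> t) + d (\<sigma> t) (f t))\<^sup>2"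
        by (intro power_mono d_nonneg fX) auto
      also have "\<dots> \<le> 3 * (d (f (t + h)) (\<sigma> (t + h)))\<^sup>2 + 3 * (d (\<sigma> (t + h)) (\<sigma> t))\<^sup>2 + 3 * (d (\<sigma> t) (f t))\<^sup>2"
      proof -
        have "(a + b + c)\<^sup>2 \<le> 3 * a\<^sup>2 + 3 * b\<^sup>2 + 3 * c\<^sup>2" for a b c :: real
        proof -
          have "0 \<le> (a - b)\<^sup>2 + (b - c)\<^sup>2 + (a - c)\<^sup>2" by simp
          then show ?thesis by (simp add: power2_eq_square algebra_simps)
        qed
        then show ?thesis .
      qed
      also have "\<dots> \<le> 3 * (d (f (t + h)) (\<sigma> (t + h)))\<^sup>2 + 3 * (C * \<bar>q (t + h) - q t\<bar>) + 3 * (d (f t) (\<sigma> t))\<^sup>2"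
        using dC[of "t + h" t] d_sym[OF \<sigma>(2) fX, of t t] by simp
      finally have "ennreal ((d (f (t + h)) (f t))\<^sup>2) \<le> ennreal (3 * (d (f (t + h)) (\<sigma> (t + h)))\<^sup>2 + 3 * C * \<bar>q (t + h) - q t\<bar> + 3 * (d (f t) (\<sigma> t))\<^sup>2)"
        by (intro ennreal_leI) simp
      also have "\<dots> = 3 * F (t + h) + ennreal (3 * C) * ennreal \<bar>q (t + h) - q t\<bar> + 3 * F t"
        using C(1) by (simp add: F_def ennreal_mult mult.assoc)
      finally show "ennreal ((d (f (t + h)) (f t))\<^sup>2) * indicator {0..S} t \<le>
          3 * F (t + h) + ennreal (3 * C) * (ennreal \<bar>q (t + h) - q t\<bar> * indicator {0..S} t) + 3 * F t"
        by (auto simp: indicator_def)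
    qed
    also have "\<dots> = 3 * (\<integral>\<^sup>+t. F (t + h) \<partial>lborel) + ennreal (3 * C) * (\<integral>\<^sup>+t. ennreal \<bar>q (t + h) - q t\<bar> * indicator {0..S} t \<partial>lborel) + 3 * (\<integral>\<^sup>+t. F t \<partial>lborel)"
      by (simp add: nn_integral_add nn_integral_cmult)
    also have "\<dots> \<le> 3 * ennreal (\<epsilon> / 9) + ennreal (3 * C) * ennreal (\<epsilon> / (9 * C)) + 3 * ennreal (\<epsilon> / 9)"
      using \<sigma>(3) \<delta>(2)[OF h] by (intro add_mono mult_left_mono) (auto simp: nn_integral_shift F_def[symmetric])
    also have "3 * ennreal (\<epsilon> / 9) = ennreal (\<epsilon> / 3)"
      using ennreal_mult[of 3 "\<epsilon> / 9"] \<epsilon> by simp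
    also have "ennreal (3 * C) * ennreal (\<epsilon> / (9 * C)) = ennreal (\<epsilon> / 3)"
      using ennreal_mult[of "3 * C" "\<epsilon> / (9 * C)"] \<epsilon> C(1) by simp
    also have "ennreal (\<epsilon> / 3) + ennreal (\<epsilon> / 3) + ennreal (\<epsilon> / 3) = ennreal \<epsilon>"
      using \<epsilon> by (simp flip: ennreal_plus)
    finally show "(\<integral>\<^sup>+t. ennreal ((d (f (t + h)) (f t))\<^sup>2) * indicator {0..S} t \<partial>lborel) \<le> ennreal \<epsilon>" .
  qed
qed

end

section \<open>Scalar integral equations\<close>

lemma integrable_restrict_Icc:
  fixes f :: "real \<Rightarrow> real"
  assumes "integrable lborel f"
  shows "integrable lborel (\<lambda>s. indicator {a..b} s * f s)"
  using integrable_mult_indicator[of "{a..b}" lborel f] assms by simp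

lemma integral_indicator_trivial_Icc:
  fixes f :: "real \<Rightarrow> real"
  shows "(LINT s|lborel. indicator {a..a} s * f s) = 0"
proof (rule integral_eq_zero_AE)
  have "AE s in lborel. s \<noteq> a" by (rule AE_lborel_singleton)
  then show "AE s in lborel. indicator {a..a} s * f s = 0" by eventually_elim (auto simp: indicator_def)
qed

lemma indefinite_integral_diff:
  fixes f :: "real \<Rightarrow> real"
  assumes f: "\<And>T. integrable lborel (\<lambda>s. indicator {0..T} s * f s)" and st: "0 \<le> s" "s \<le> t"
  shows "(LINT r|lborel. indicator {0..t} r * f r) - (LINT r|lborel. indicator {0..s} r * f r)
    = (LINT r|lborel. indicator {s..t} r * f r)" "integrable lborel (\<lambda>r. indicator {s..t} r * f r)"
proof -
  have e: "indicator {s..t} r * f r = indicator {s..t} r * (indicator {0..t} r * f r)" for r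
    using st by (auto simp: indicator_def)
  show i: "integrable lborel (\<lambda>r. indicator {s..t} r * f r)"
    by (subst e) (rule integrable_restrict_Icc[OF f])
  have "(LINT r|lborel. indicator {0..t} r * f r) - (LINT r|lborel. indicator {0..s} r * f r) =
     (LINT r|lborel. indicator {0..t} r * f r - indicator {0..s} r * f r)"
    using f by simp
  also have "\<dots> = (LINT r|lborel. indicator {s..t} r * f r)"
  proof (rule integral_cong_AE)
    have "AE r in lborel. r \<noteq> s" by (rule AE_lborel_singleton)
    then show "AE r in lborel. indicator {0..t} r * f r - indicator {0..s} r * f r = indicator {s..t} r * f r"
      by eventually_elim (use st in \<open>auto simp: indicator_def\<close>)
  qed (use borel_measurable_integrable[OF f] borel_measurable_integrable[OF i] in auto)
  finally show "(LINT r|lborel. indicator {0..t} r * f r) - (LINT r|lborel. indicator {0..s} r * f r)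
    = (LINT r|lborel. indicator {s..t} r * f r)" .
qed

lemma indefinite_integral_continuous_lborel:
  fixes f :: "real \<Rightarrow> real"
  assumes f: "\<And>T. integrable lborel (\<lambda>s. indicator {0..T} s * f s)"
  shows "continuous_on {0..} (\<lambda>t. LINT s|lborel. indicator {0..t} s * f s)"
proof -
  have *: "continuous_on {0..<T} (\<lambda>t. LINT s|lborel. indicator {0..t} s * f s)" for T
  proof -
    have e: "(\<lambda>s. indicator {0..T} s * f s) = (\<lambda>s. if s \<in> {0..T} then f s else 0)" by (auto simp: indicator_def)
    have hi: "f integrable_on {0..T}"
      using has_integral_integral_lborel[OF f[of T]] unfolding e has_integral_restrict_UNIV by blast
    have "(LINT s|lborel. indicator {0..t} s * f s) = integral {0..t} f" for t
    proof -
      have "(\<lambda>s. indicator {0..t} s * f s) = (\<lambda>s. if s \<in> {0..t} then f s else 0)" by (auto simp: indicator_def)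
      then show ?thesis using has_integral_integral_lborel[OF f[of t]] by (metis has_integral_restrict_UNIV integral_unique)
    qed
    then show ?thesis
      using continuous_on_subset[OF indefinite_integral_continuous_1[OF hi], of "{0..<T}"] by (simp add: subset_iff)
  qed
  show ?thesis
  proof (rule continuous_on_eq_continuous_within[THEN iffD2], rule ballI)
    fix t :: real assume t: "t \<in> {0..}"
    then have "continuous (at t within {0..<t+1}) (\<lambda>t. LINT s|lborel. indicator {0..t} s * f s)"
      using *[of "t + 1"] by (auto simp: continuous_on_eq_continuous_within)
    moreover have "at t within {0..<t+1} = at t within {0..}"
      by (rule at_within_nhd[of _ "{..<t+1}"]) auto
    ultimately show "continuous (at t within {0..}) (\<lambda>t. LINT s|lborel. indicator {0..t} s * f s)" by simp
  qed
qed

text \<open>The coefficient \<open>a\<close> is merely integrable, so the argument is discrete. Over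
  a step on which the primitive alpha grows by Delta, monotonicity of the right-hand side
  \<open>R\<close> gives R(t) (1 - Delta) <= R(s). A partition with every Delta < epsilon and the
  estimate 1 / (1 - Delta) <= exp(Delta / (1 - epsilon)) yield the claim with a factor 1 / (1 -
  epsilon) in the exponent, which disappears as epsilon tends to 0.\<close>

lemma Gronwall_lborel:
  fixes a y :: "real \<Rightarrow> real"
  assumes a: "\<And>T. integrable lborel (\<lambda>s. indicator {0..T} s * a s)" "\<And>s. 0 \<le> a s"
    and ay: "\<And>T. integrable lborel (\<lambda>s. indicator {0..T} s * (a s * y s))"
    and y: "\<And>t. 0 \<le> t \<Longrightarrow> y t \<le> A + (LINT s|lborel. indicator {0..t} s * (a s * y s))" "\<And>t. 0 \<le> t \<Longrightarrow> 0 \<le> y t"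
    and A: "0 \<le> A" and T: "0 \<le> T"
  shows "y T \<le> A * exp (LINT s|lborel. indicator {0..T} s * a s)"
proof -
  define \<alpha> where "\<alpha> t = (LINT s|lborel. indicator {0..t} s * a s)" for t
  define R where "R t = A + (LINT s|lborel. indicator {0..t} s * (a s * y s))" for t
  have R_mono: "R s \<le> R t" if "0 \<le> s" "s \<le> t" for s t
  proof -
    have "R t - R s = (LINT r|lborel. indicator {s..t} r * (a r * y r))"
      unfolding R_def using indefinite_integral_diff(1)[OF ay that] by simp
    also have "\<dots> \<ge> 0" using that a(2) y(2) by (intro integral_nonneg_AE AE_I2) (auto simp: indicator_def)
    finally show ?thesis by simp
  qed
  have \<alpha>_mono: "\<alpha> s \<le> \<alpha> t" if "0 \<le> s" "s \<le> t" for s t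
  proof -
    have "\<alpha> t - \<alpha> s = (LINT r|lborel. indicator {s..t} r * a r)"
      unfolding \<alpha>_def using indefinite_integral_diff(1)[OF a(1) that] by simp
    also have "\<dots> \<ge> 0" using a(2) by (intro integral_nonneg_AE AE_I2) auto
    finally show ?thesis by simp
  qed
  have R0: "0 \<le> R t" if "0 \<le> t" for t using y[OF that] by (simp add: R_def)
  have step: "R t * (1 - (\<alpha> t - \<alpha> s)) \<le> R s" if st: "0 \<le> s" "s \<le> t" for s t
  proof -
    have "R t - R s = (LINT r|lborel. indicator {s..t} r * (a r * y r))"
      unfolding R_def using indefinite_integral_diff(1)[OF ay st] by simp
    also have "\<dots> \<le> (LINT r|lborel. R t * (indicator {s..t} r * a r))"
    proof (rule integral_mono)
      show "integrable lborel (\<lambda>r. R t * (indicator {s..t} r * a r))"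
        using indefinite_integral_diff(2)[OF a(1) st] by simp
      fix r
      show "indicator {s..t} r * (a r * y r) \<le> R t * (indicator {s..t} r * a r)"
      proof (cases "r \<in> {s..t}")
        case True
        then have "y r \<le> R r" using y(1)[of r] st by (simp add: R_def)
        also have "R r \<le> R t" using True st by (intro R_mono) auto
        finally have "a r * y r \<le> a r * R t" by (intro mult_left_mono a)
        then show ?thesis using True by (simp add: mult.commute)
      qed simp
    qed (rule indefinite_integral_diff(2)[OF ay st])
    also have "\<dots> = R t * (\<alpha> t - \<alpha> s)"
      unfolding \<alpha>_def using indefinite_integral_diff(1)[OF a(1) st] by simp
    finally show ?thesis by (simp add: algebra_simps)
  qed
  have main: "R T \<le> A * exp (\<alpha> T / (1 - \<epsilon>))" if \<epsilon>: "0 < \<epsilon>" "\<epsilon> < 1" for \<epsilon>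
  proof -
    have "continuous_on {0..T} \<alpha>"
      unfolding \<alpha>_def using continuous_on_subset[OF indefinite_integral_continuous_lborel[OF a(1)]] by auto
    then have "uniformly_continuous_on {0..T} \<alpha>" by (intro compact_uniformly_continuous) auto
    then obtain \<delta> where \<delta>: "\<delta> > 0" "\<And>x x'. x \<in> {0..T} \<Longrightarrow> x' \<in> {0..T} \<Longrightarrow> dist x' x < \<delta> \<Longrightarrow> dist (\<alpha> x') (\<alpha> x) < \<epsilon>"
      using \<epsilon>(1) unfolding uniformly_continuous_on_def by metis
    obtain N :: nat where N: "T / \<delta> < real N" using reals_Archimedean2 by blast
    have "0 \<le> T / \<delta>" using T \<delta>(1) by simp
    then have "0 < real N" using N by linarith
    then have N0: "N > 0" by simp
    define t where "t k = real k * T / real N" for k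
    have t0: "0 \<le> t k" for k using T by (simp add: t_def)
    have tT: "t k \<le> T" if "k \<le> N" for k
    proof -
      have "real k * T \<le> real N * T" using that T by (intro mult_right_mono) auto
      then show ?thesis using N0 by (simp add: t_def divide_le_eq mult.commute)
    qed
    have ts: "t (Suc k) = t k + T / real N" for k by (simp add: t_def add_divide_distrib algebra_simps)
    have small: "T / real N < \<delta>" using N N0 \<delta>(1) by (simp add: field_simps)
    have \<alpha>0: "\<alpha> 0 = 0" unfolding \<alpha>_def by (rule integral_indicator_trivial_Icc)
    have Rz: "R 0 = A" unfolding R_def integral_indicator_trivial_Icc by simp
    have "R (t k) \<le> A * exp (\<alpha> (t k) / (1 - \<epsilon>))" if "k \<le> N" for k
      using that
    proof (induction k)
      case 0
      then show ?case by (simp add: t_def Rz \<alpha>0)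
    next
      case (Suc k)
      define \<Delta> where "\<Delta> = \<alpha> (t (Suc k)) - \<alpha> (t k)"
      have le: "t k \<le> t (Suc k)" using ts T by simp
      have \<Delta>0: "0 \<le> \<Delta>" unfolding \<Delta>_def using \<alpha>_mono[OF t0 le] by simp
      have "dist (t (Suc k)) (t k) < \<delta>" using ts[of k] small T by (simp add: dist_real_def)
      then have "dist (\<alpha> (t (Suc k))) (\<alpha> (t k)) < \<epsilon>" using Suc.prems t0 tT by (intro \<delta>(2)) auto
      then have \<Delta>\<epsilon>: "\<Delta> < \<epsilon>" by (simp add: \<Delta>_def dist_real_def)
      have "R (t (Suc k)) * (1 - \<Delta>) \<le> R (t k)" unfolding \<Delta>_def by (rule step[OF t0 le])
      then have "R (t (Suc k)) \<le> R (t k) * (1 / (1 - \<Delta>))" using \<Delta>\<epsilon> \<epsilon> by (simp add: field_simps)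
      also have "\<dots> \<le> R (t k) * exp (\<Delta> / (1 - \<epsilon>))"
      proof (rule mult_left_mono[OF _ R0[OF t0]])
        have "1 / (1 - \<Delta>) = 1 + \<Delta> / (1 - \<Delta>)" using \<Delta>\<epsilon> \<epsilon> by (simp add: field_simps)
        also have "\<dots> \<le> exp (\<Delta> / (1 - \<Delta>))" by (rule exp_ge_add_one_self)
        also have "\<dots> \<le> exp (\<Delta> / (1 - \<epsilon>))" using \<Delta>\<epsilon> \<Delta>0 \<epsilon> by (simp add: frac_le)
        finally show "1 / (1 - \<Delta>) \<le> exp (\<Delta> / (1 - \<epsilon>))" .
      qed
      also have "\<dots> \<le> A * exp (\<alpha> (t k) / (1 - \<epsilon>)) * exp (\<Delta> / (1 - \<epsilon>))"
        using Suc by (intro mult_right_mono) auto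
      also have "\<dots> = A * exp (\<alpha> (t (Suc k)) / (1 - \<epsilon>))"
        by (simp add: mult.assoc exp_add[symmetric] add_divide_distrib[symmetric] \<Delta>_def)
      finally show ?case .
    qed
    from this[of N] show ?thesis using N0 by (simp add: t_def)
  qed
  have lim: "((\<lambda>\<epsilon>. A * exp (\<alpha> T / (1 - \<epsilon>))) \<longlongrightarrow> A * exp (\<alpha> T / (1 - 0))) (at_right 0)"
    by (intro tendsto_intros) auto
  have "R T \<le> A * exp (\<alpha> T / (1 - 0))"
  proof (rule tendsto_lowerbound[OF lim])
    show "\<forall>\<^sub>F \<epsilon> in at_right 0. R T \<le> A * exp (\<alpha> T / (1 - \<epsilon>))"
      using eventually_at_right_real[of 0 1] by (auto elim!: eventually_mono intro: main)
  qed simp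
  then show ?thesis using y(1)[OF T] by (simp add: R_def \<alpha>_def)
qed

text \<open>The integral of G(t + h) - G(t) over [0, T] equals the integral of G over [T, T + h]
  minus that over [0, h]. Divided by h it tends to G(T) - G(0) by continuity, while the hypothesis
  keeps it below every epsilon.\<close>

lemma increments_vanish:
  fixes G :: "real \<Rightarrow> real"
  assumes G: "continuous_on {0..} G" and T: "0 \<le> T"
    and small: "\<And>\<epsilon>. 0 < \<epsilon> \<Longrightarrow> \<exists>\<delta>>0. \<forall>h. 0 < h \<and> h \<le> \<delta> \<longrightarrow> (\<integral>\<^sup>+\<tau>. ennreal \<bar>G (\<tau> + h) - G \<tau>\<bar> * indicator {0..T} \<tau> \<partial>lborel) \<le> ennreal (\<epsilon> * h)"
  shows "G T = G 0"
proof -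
  \<comment> \<open>Constant extension to negative times makes the function continuous on the whole
    line.\<close>
  define g where "g t = G (max 0 t)" for t
  have gc: "continuous_on A g" for A
    unfolding g_def by (rule continuous_on_compose2[OF G]) (auto intro!: continuous_intros)
  have gi: "g integrable_on {a..b}" for a b by (rule integrable_continuous_interval[OF gc])
  define P where "P x = integral {0..x} g" for x
  have P: "(P has_vector_derivative g x) (at x within {0..T + 1})" if "x \<in> {0..T + 1}" for x
    unfolding P_def by (rule integral_has_vector_derivative[OF gc that])
  have right: "((\<lambda>h. (P (x + h) - P x) / h) \<longlongrightarrow> g x) (at_right 0)" if "0 \<le> x" "x \<le> T" for x
  proof -
    have "(P has_real_derivative g x) (at x within {0..T + 1})"
      using P[of x] that by (simp add: has_real_derivative_iff_has_vector_derivative)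
    then have "(P has_real_derivative g x) (at x within {x..T + 1})"
      by (rule DERIV_subset) (use that in auto)
    moreover have "at x within {x..T+1} = at_right x"
      using that by (intro at_within_Icc_at_right) auto
    ultimately have "((\<lambda>y. (P y - P x) / (y - x)) \<longlongrightarrow> g x) (at_right x)"
      by (simp add: has_field_derivative_iff)
    then show ?thesis
      by (subst (asm) at_right_to_0) (simp add: filterlim_filtermap add.commute)
  qed
  have incr: "integral {0..T} (\<lambda>\<tau>. g (\<tau> + h) - g \<tau>) = (P (T + h) - P T) - P h" if h: "0 \<le> h" for h
  proof -
    have i1: "((\<lambda>\<tau>. g (\<tau> + h)) has_integral integral {h..T + h} g) {0..T}"
      using has_integral_shift_Icc_real[of g h "integral {h..T + h} g" 0 T] gi[of h "T + h"]
      by (simp add: o_def add.commute integrable_integral)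
    have "integral {0..T} (\<lambda>\<tau>. g (\<tau> + h) - g \<tau>) = integral {h..T + h} g - P T"
      unfolding P_def using i1 gi by (intro integral_unique has_integral_diff) auto
    also have "integral {h..T + h} g = P (T + h) - P h"
      unfolding P_def using Henstock_Kurzweil_Integration.integral_combine[of 0 h "T + h" g] h T gi by simp
    finally show ?thesis by simp
  qed
  have bound: "\<exists>\<delta>>0. \<forall>h. 0 < h \<and> h \<le> \<delta> \<longrightarrow> \<bar>(P (T + h) - P T) / h - (P (0 + h) - P 0) / h\<bar> \<le> \<epsilon>" if \<epsilon>: "0 < \<epsilon>" for \<epsilon>
  proof -
    obtain \<delta> where \<delta>: "\<delta> > 0" "\<And>h. 0 < h \<Longrightarrow> h \<le> \<delta> \<Longrightarrow> (\<integral>\<^sup>+\<tau>. ennreal \<bar>G (\<tau> + h) - G \<tau>\<bar> * indicator {0..T} \<tau> \<partial>lborel) \<le> ennreal (\<epsilon> * h)"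
      using small[OF \<epsilon>] by blast
    show ?thesis
    proof (intro exI[of _ \<delta>] conjI allI impI \<delta>(1))
      fix h assume h: "0 < h \<and> h \<le> \<delta>"
      define f where "f \<tau> = g (\<tau> + h) - g \<tau>" for \<tau>
      have fc: "continuous_on A f" for A unfolding f_def
        by (intro continuous_on_diff gc continuous_on_compose2[OF gc[of UNIV], of A "\<lambda>x. x + h"] continuous_intros) auto
      have fi: "f integrable_on {0..T}" "(\<lambda>\<tau>. norm (f \<tau>)) integrable_on {0..T}"
        by (intro integrable_continuous_interval fc continuous_on_norm)+
      have "\<bar>integral {0..T} f\<bar> \<le> integral {0..T} (\<lambda>\<tau>. norm (f \<tau>))"
        using integral_norm_bound_integral[OF fi] by simp
      moreover have "ennreal (integral {0..T} (\<lambda>\<tau>. norm (f \<tau>))) \<le> ennreal (\<epsilon> * h)"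
      proof -
        have "ennreal (integral {0..T} (\<lambda>\<tau>. norm (f \<tau>))) = (\<integral>\<^sup>+\<tau>. ennreal (norm (f \<tau>)) * indicator {0..T} \<tau> \<partial>lborel)"
          by (rule nn_integral_has_integral_lebesgue'[symmetric]) (use fi(2) in auto)
        also have "\<dots> = (\<integral>\<^sup>+\<tau>. ennreal \<bar>G (\<tau> + h) - G \<tau>\<bar> * indicator {0..T} \<tau> \<partial>lborel)"
          by (intro nn_integral_cong) (use h in \<open>auto simp: f_def g_def indicator_def max_def\<close>)
        also have "\<dots> \<le> ennreal (\<epsilon> * h)" using \<delta>(2) h by blast
        finally show ?thesis .
      qed
      ultimately have "\<bar>integral {0..T} f\<bar> \<le> \<epsilon> * h"
        using h \<epsilon> by (simp add: ennreal_le_iff)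
      then have "\<bar>(P (T + h) - P T) - P h\<bar> \<le> \<epsilon> * h" using incr[of h] h by (simp add: f_def[abs_def])
      moreover have "P 0 = 0" by (simp add: P_def)
      ultimately have "\<bar>((P (T + h) - P T) - (P (0 + h) - P 0)) / h\<bar> \<le> \<epsilon>"
        using h by (simp add: abs_divide pos_divide_le_eq)
      then show "\<bar>(P (T + h) - P T) / h - (P (0 + h) - P 0) / h\<bar> \<le> \<epsilon>"
        by (simp add: diff_divide_distrib)
    qed
  qed
  have "\<bar>g T - g 0\<bar> \<le> \<epsilon>" if \<epsilon>: "0 < \<epsilon>" for \<epsilon>
  proof (rule tendsto_upperbound)
    show "((\<lambda>h. \<bar>(P (T + h) - P T) / h - (P (0 + h) - P 0) / h\<bar>) \<longlongrightarrow> \<bar>g T - g 0\<bar>) (at_right 0)"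
      by (intro tendsto_intros right) (use T in auto)
    obtain \<delta> where \<delta>: "\<delta> > 0" "\<And>h. 0 < h \<Longrightarrow> h \<le> \<delta> \<Longrightarrow> \<bar>(P (T + h) - P T) / h - (P (0 + h) - P 0) / h\<bar> \<le> \<epsilon>"
      using bound[OF \<epsilon>] by blast
    show "\<forall>\<^sub>F h in at_right 0. \<bar>(P (T + h) - P T) / h - (P (0 + h) - P 0) / h\<bar> \<le> \<epsilon>"
      using eventually_at_right_real[OF \<delta>(1)] by eventually_elim (use \<delta>(2) in auto)
  qed simp
  then have "g T = g 0" by (metis abs_le_zero_iff dense_ge eq_iff_diff_eq_0)
  then show ?thesis using T by (simp add: g_def)
qed

text \<open>Expressions in a solution agree with Borel expressions in its representative only almost
  everywhere, so the measurability of \<open>f\<close> has to be deduced from the completeness of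
  Lebesgue measure.\<close>

lemma integral_lebesgue_on_AE:
  fixes f g :: "'a::euclidean_space \<Rightarrow> real"
  assumes S [measurable]: "S \<in> sets borel" and g [measurable]: "g \<in> borel_measurable borel"
    and ae: "AE x in lborel. x \<in> S \<longrightarrow> f x = g x"
  shows "(LINT x|lebesgue_on S. f x) = (LINT x|lborel. indicator S x * g x)"
proof -
  have ae': "AE x in lebesgue. indicator S x *\<^sub>R g x = indicator S x *\<^sub>R f x"
  proof -
    have "AE x in lebesgue. x \<in> S \<longrightarrow> f x = g x" by (rule AE_completion[OF ae])
    then show ?thesis by eventually_elim (auto simp: indicator_def)
  qed
  have gm: "(\<lambda>x. indicator S x *\<^sub>R g x) \<in> borel_measurable lebesgue"
    by (rule measurable_completion) simp
  have fm: "(\<lambda>x. indicator S x *\<^sub>R f x) \<in> borel_measurable lebesgue"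
    by (rule borel_measurable_AE[OF gm ae'])
  have "(LINT x|lebesgue_on S. f x) = (LINT x|lebesgue. indicator S x *\<^sub>R f x)"
    by (rule integral_restrict_space) (use S in auto)
  also have "\<dots> = (LINT x|lebesgue. indicator S x *\<^sub>R g x)"
    by (rule integral_cong_AE[OF fm gm]) (use ae' in \<open>auto elim: eventually_mono\<close>)
  also have "\<dots> = (LINT x|lborel. indicator S x * g x)"
    by (subst integral_completion) auto
  finally show ?thesis .
qed

text \<open>The test functions \<open>\<eta> n\<close> are 1 on [0, t] and fall to 0 on
  [t, t + e n]. Minus their derivative approximates the Dirac mass at t, so the first term tends to
  a(t), while \<open>\<eta> n 0 = 1\<close> produces the constant c.\<close>

lemma distributional_ODE:
  fixes a b :: "real \<Rightarrow> real"
  assumes a: "continuous_on UNIV a" and b: "\<And>T. integrable lborel (\<lambda>s. indicator {0..T} s * b s)"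
    and [measurable]: "b \<in> borel_measurable borel"
    and weak: "\<And>\<eta> \<eta>'. \<eta> \<in> test_functions UNIV \<Longrightarrow> (\<And>t. (\<eta> has_real_derivative \<eta>' t) (at t)) \<Longrightarrow>
      (LINT s|lborel. indicator {0..} s * (- \<eta>' s * a s - \<eta> s * b s)) = \<eta> 0 * c"
    and t: "0 \<le> t"
  shows "a t = c + (LINT s|lborel. indicator {0..t} s * b s)"
proof -
  obtain S :: "real \<Rightarrow> real" where S: "smooth_on UNIV S" "\<And>x. x \<le> 0 \<Longrightarrow> S x = 0" "\<And>x. x \<ge> 1 \<Longrightarrow> S x = 1" "mono S"
    using ex_smooth_step by blast
  have S0: "0 \<le> S x" for x using monoD[OF S(4), of "min x 0" x] S(2)[of "min x 0"] by simp
  have S1: "S x \<le> 1" for x using monoD[OF S(4), of x "max x 1"] S(3)[of "max x 1"] by simp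
  define S' where "S' x = frechet_derivative S (at x) 1" for x
  have dS: "(S has_real_derivative S' x) (at x)" for x
  proof -
    have "frechet_derivative S (at x) h = S' x * h" for h
      using linear_cmul[OF has_derivative_linear[OF smooth_on_has_derivative[OF S(1)]], of x h 1] by (simp add: S'_def)
    then have "frechet_derivative S (at x) = (*) (S' x)" by (rule ext)
    then show ?thesis using smooth_on_has_derivative[OF S(1), of x] by (simp add: has_field_derivative_def)
  qed
  have S'c: "continuous_on A S'" for A
    unfolding S'_def by (rule smooth_on_continuous[OF smooth_on_frechet[OF S(1)]])
  have S'z: "S' x = 0" if "x < 0 \<or> 1 < x" for x
  proof -
    have "(S has_real_derivative 0) (at x)"
    proof (cases "x < 0")
      case True
      show ?thesis
        by (rule has_field_derivative_transform_within_open[OF DERIV_const[of 0], of "{..<0}"]) (use True S in auto)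
    next
      case False
      with that have x1: "1 < x" by simp
      show ?thesis
        by (rule has_field_derivative_transform_within_open[OF DERIV_const[of 1], of "{1<..}"]) (use x1 S in auto)
    qed
    then show ?thesis using dS DERIV_unique by blast
  qed
  obtain B where B: "B > 0" "\<And>x. \<bar>S' x\<bar> \<le> B"
  proof -
    have "bounded (S' ` {0..1})" by (intro compact_imp_bounded compact_continuous_image S'c) auto
    then obtain B where B: "\<forall>x\<in>{0..1}. \<bar>S' x\<bar> \<le> B" by (auto simp: bounded_iff)
    have "\<bar>S' x\<bar> \<le> max B 1" for x
      using B S'z[of x] by (cases "x \<in> {0..1}") (auto simp: le_max_iff_disj)
    then show ?thesis using that[of "max B 1"] by auto
  qed
  have am [measurable]: "a \<in> borel_measurable borel" by (rule borel_measurable_continuous_onI[OF a])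
  define e where "e n = 1 / real (Suc n)" for n
  have e: "e n > 0" "e n \<le> 1" for n by (auto simp: e_def)
  have elim: "e \<longlonglongrightarrow> 0" unfolding e_def using LIMSEQ_inverse_real_of_nat by (simp add: inverse_eq_divide)
  \<comment> \<open>The factor S(s + 2) is 1 for s >= -1; it only provides compact support on the
    left.\<close>
  define \<eta> where "\<eta> n s = S (s + 2) * S ((t + e n - s) / e n)" for n s
  define \<eta>' where "\<eta>' n s = S' (s + 2) * S ((t + e n - s) / e n) + S' ((t + e n - s) / e n) * (- 1 / e n) * S (s + 2)" for n s
  have d\<eta>: "(\<eta> n has_real_derivative \<eta>' n s) (at s)" for n s
  proof -
    have "((\<lambda>s. (t + e n - s) / e n) has_real_derivative (- 1 / e n)) (at s)"
      using e(1)[of n] by (auto intro!: derivative_eq_intros)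
    from DERIV_chain2[OF dS this] have 1: "((\<lambda>s. S ((t + e n - s) / e n)) has_real_derivative S' ((t + e n - s) / e n) * (- 1 / e n)) (at s)" .
    have "((\<lambda>s. s + 2) has_real_derivative 1) (at s)" by (auto intro!: derivative_eq_intros)
    from DERIV_chain2[OF dS this] have 2: "((\<lambda>s. S (s + 2)) has_real_derivative S' (s + 2)) (at s)" by simp
    show ?thesis unfolding \<eta>_def[abs_def] \<eta>'_def by (rule DERIV_mult[OF 2 1])
  qed
  have \<eta>test: "\<eta> n \<in> test_functions UNIV" for n
  proof (rule test_functionsI[of _ "{-2..t + 1}"])
    have 1: "smooth_on UNIV (\<lambda>s. S (s + 2))"
      by (rule smooth_on_compose_affine[OF bounded_linear_ident S(1)])
    have "smooth_on UNIV (\<lambda>s. S ((- 1 / e n) * s + (t + e n) / e n))"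
      by (rule smooth_on_compose_affine[OF bounded_linear_mult_right S(1)])
    moreover have "(\<lambda>s. S ((- 1 / e n) * s + (t + e n) / e n)) = (\<lambda>s. S ((t + e n - s) / e n))"
      by (simp add: diff_divide_distrib add_divide_distrib)
    ultimately have 2: "smooth_on UNIV (\<lambda>s. S ((t + e n - s) / e n))" by simp
    show "smooth_on UNIV (\<eta> n)" unfolding \<eta>_def[abs_def] by (rule smooth_on_bilinear[OF bounded_bilinear_mult 1 2])
    fix s assume "s \<notin> {-2..t + 1}"
    then consider "s < -2" | "t + 1 < s" by fastforce
    then show "\<eta> n s = 0"
    proof cases
      case 1
      then show ?thesis by (simp add: \<eta>_def S(2))
    next
      case 2
      then have "(t + e n - s) / e n \<le> 0" using e[of n] by (simp add: divide_le_0_iff)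
      then show ?thesis by (simp add: \<eta>_def S(2))
    qed
  qed auto
  have \<eta>0: "\<eta> n 0 = 1" for n
    using t e(1)[of n] by (simp add: \<eta>_def S(3))
  have \<eta>pos: "\<eta> n s = S ((t + e n - s) / e n)" "\<eta>' n s = - S' ((t + e n - s) / e n) / e n" if "0 \<le> s" for n s
    using that by (auto simp: \<eta>_def \<eta>'_def S(3) S'z)
  have \<eta>'c: "continuous_on A (\<eta>' n)" for A n
    unfolding \<eta>'_def using e(1)[of n]
    by (intro continuous_intros continuous_on_compose2[OF S'c[of UNIV]] continuous_on_compose2[OF smooth_on_continuous[OF S(1), of UNIV]]) auto
  have [measurable]: "\<eta> n \<in> borel_measurable borel" "\<eta>' n \<in> borel_measurable borel" for n
    using test_functions_borel[OF \<eta>test] borel_measurable_continuous_onI[OF \<eta>'c] by auto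
  have supp: "indicator {0..} s * (- \<eta>' n s) = indicator {t..t + e n} s * (- \<eta>' n s)" for n s
  proof -
    consider "s < 0" | "0 \<le> s" "s < t" | "s \<in> {t..t + e n}" | "t + e n < s" by fastforce
    then show ?thesis
    proof cases
      case 2
      then have "(t + e n - s) / e n > 1" using e(1)[of n] by (simp add: field_simps)
      then show ?thesis using 2 by (simp add: \<eta>pos S'z)
    next
      case 4
      then have "(t + e n - s) / e n < 0" using e(1)[of n] by (simp add: field_simps)
      moreover have "0 \<le> s" using 4 t e(1)[of n] by linarith
      ultimately show ?thesis using 4 by (simp add: \<eta>pos S'z)
    qed (use t in auto)
  qed
  have Icont: "integrable lborel (\<lambda>s. indicator {t..t + e n} s * f s)" if "continuous_on UNIV f" for f :: "real \<Rightarrow> real" and n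
    using borel_integrable_compact[of "{t..t + e n}" f] continuous_on_subset[OF that] by simp
  define X where "X n = (LINT s|lborel. indicator {t..t + e n} s * (- \<eta>' n s * a s))" for n
  define Y where "Y n = (LINT s|lborel. indicator {0..} s * (\<eta> n s * b s))" for n
  have iX: "integrable lborel (\<lambda>s. indicator {t..t + e n} s * (- \<eta>' n s * a s))" for n
    by (intro Icont continuous_intros \<eta>'c a)
  have \<eta>e: "indicator {0..} s * (\<eta> n s * b s) = \<eta> n s * (indicator {0..t + 1} s * b s)" for n s
  proof -
    have "\<eta> n s = 0" if "t + 1 < s"
    proof -
      have "(t + e n - s) / e n \<le> 0" using that e[of n] by (simp add: divide_le_0_iff)
      then show ?thesis by (simp add: \<eta>_def S(2))
    qed
    then show ?thesis by (auto simp: indicator_def)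
  qed
  have \<eta>b: "\<bar>\<eta> n s\<bar> \<le> 1" for n s using S0 S1 by (simp add: \<eta>_def abs_mult mult_le_one)
  have dom: "norm (\<eta> n s * (indicator {0..t + 1} s * b s)) \<le> norm (indicator {0..t + 1} s * b s)" for n s
    using mult_right_mono[OF \<eta>b[of n s], of "\<bar>indicator {0..t + 1} s * b s\<bar>"] by (simp add: abs_mult)
  have iY: "integrable lborel (\<lambda>s. indicator {0..} s * (\<eta> n s * b s))" for n
    unfolding \<eta>e by (rule Bochner_Integration.integrable_bound[OF b[of "t + 1"]]) (use dom in auto)
  have XY: "X n - Y n = c" for n
  proof -
    have "(LINT s|lborel. indicator {0..} s * (- \<eta>' n s * a s - \<eta> n s * b s)) = c"
      using weak[OF \<eta>test[of n] d\<eta>[of n]] \<eta>0[of n] by simp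
    moreover have "indicator {0..} s * (- \<eta>' n s * a s - \<eta> n s * b s) =
       indicator {t..t + e n} s * (- \<eta>' n s * a s) - indicator {0..} s * (\<eta> n s * b s)" for s
      using supp[of s n] by (simp add: right_diff_distrib mult.assoc[symmetric])
    ultimately show ?thesis unfolding X_def Y_def using iX[of n] iY[of n] by simp
  qed
  have "Y \<longlonglongrightarrow> (LINT s|lborel. indicator {0..t} s * b s)"
    unfolding Y_def \<eta>e
  proof (rule integral_dominated_convergence[where w="\<lambda>s. norm (indicator {0..t + 1} s * b s)"])
    show "integrable lborel (\<lambda>s. norm (indicator {0..t + 1} s * b s))" by (intro integrable_norm b)
    show "AE s in lborel. (\<lambda>n. \<eta> n s * (indicator {0..t + 1} s * b s)) \<longlonglongrightarrow> indicator {0..t} s * b s"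
    proof (intro AE_I2)
      fix s
      show "(\<lambda>n. \<eta> n s * (indicator {0..t + 1} s * b s)) \<longlonglongrightarrow> indicator {0..t} s * b s"
      proof (cases "s \<le> t")
        case True
        have e1: "\<eta> n s * (indicator {0..t + 1} s * b s) = indicator {0..t} s * b s" for n
        proof (cases "0 \<le> s")
          case s: True
          have "(t + e n - s) / e n \<ge> 1" using True e(1)[of n] by (simp add: field_simps)
          then show ?thesis using s True by (simp add: \<eta>pos S(3))
        qed simp
        show ?thesis unfolding e1 by (rule tendsto_const)
      next
        case False
        have "\<forall>\<^sub>F n in sequentially. e n < s - t" using False by (intro order_tendstoD(2)[OF elim]) auto
        then have "\<forall>\<^sub>F n in sequentially. \<eta> n s * (indicator {0..t + 1} s * b s) = 0"
        proof eventually_elim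
          fix n assume "e n < s - t"
          then have "(t + e n - s) / e n \<le> 0" using e(1)[of n] by (simp add: divide_le_0_iff)
          then show "\<eta> n s * (indicator {0..t + 1} s * b s) = 0" by (simp add: \<eta>_def S(2))
        qed
        then show ?thesis using False by (simp add: tendsto_eventually)
      qed
    qed
    show "AE s in lborel. norm (\<eta> n s * (indicator {0..t + 1} s * b s)) \<le> norm (indicator {0..t + 1} s * b s)" for n
      using dom by auto
  qed auto
  moreover have "X \<longlonglongrightarrow> a t"
  proof (rule LIMSEQ_I)
    fix r :: real assume r: "0 < r"
    have "isCont a t" using a by (simp add: continuous_on_eq_continuous_at)
    then obtain \<delta> where \<delta>: "\<delta> > 0" "\<And>s. \<bar>s - t\<bar> < \<delta> \<Longrightarrow> \<bar>a s - a t\<bar> < r / (2 * B)"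
      using r B(1) unfolding continuous_at_eps_delta dist_real_def by (metis divide_pos_pos mult_pos_pos zero_less_numeral)
    have "\<forall>\<^sub>F n in sequentially. e n < \<delta>" using \<delta>(1) by (intro order_tendstoD(2)[OF elim])
    then obtain n0 where n0: "\<And>n. n \<ge> n0 \<Longrightarrow> e n < \<delta>" by (auto simp: eventually_sequentially)
    show "\<exists>no. \<forall>n\<ge>no. norm (X n - a t) < r"
    proof (intro exI allI impI)
      fix n assume n: "n0 \<le> n"
      \<comment> \<open>Since the weights integrate to 1, X n - a t is the weighted integral of a(s)
        - a(t). The weights are at most B / e n on an interval of length e n, and delta was chosen
        so that this leaves at most r / 2.\<close>
      have FTC: "(LINT s|lborel. indicator {t..t + e n} s * (- \<eta>' n s)) = 1"
      proof -
        have "(LINT s|lborel. (- \<eta>' n s) * indicator {t..t + e n} s) = - \<eta> n (t + e n) - (- \<eta> n t)"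
          by (rule integral_FTC_Icc_real[of t "t + e n" "\<lambda>s. - \<eta> n s"])
             (use e(1)[of n] \<eta>'c[of UNIV n] in \<open>auto intro!: DERIV_minus d\<eta> continuous_minus simp: less_imp_le continuous_on_eq_continuous_at\<close>)
        then show ?thesis using t e(1)[of n] by (simp add: \<eta>pos S mult.commute)
      qed
      have "X n - a t = X n - (LINT s|lborel. indicator {t..t + e n} s * (- \<eta>' n s)) * a t" using FTC by simp
      also have "\<dots> = (LINT s|lborel. indicator {t..t + e n} s * (- \<eta>' n s * a s) - indicator {t..t + e n} s * (- \<eta>' n s) * a t)"
        unfolding X_def using iX[of n] Icont[OF continuous_on_minus[OF \<eta>'c], of n n] by simp
      finally have eq: "X n - a t = (LINT s|lborel. indicator {t..t + e n} s * (- \<eta>' n s * a s) - indicator {t..t + e n} s * (- \<eta>' n s) * a t)" .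
      have "norm (X n - a t) \<le> (LINT s|lborel. indicator {t..t + e n} s * (B / e n * (r / (2 * B))))"
        unfolding eq
      proof (rule Bochner_Integration.integral_norm_bound_integral)
        show "integrable lborel (\<lambda>s. indicator {t..t + e n} s * (- \<eta>' n s * a s) - indicator {t..t + e n} s * (- \<eta>' n s) * a t)"
          using iX[of n] Icont[OF continuous_on_minus[OF \<eta>'c], of n n] by simp
        show "integrable lborel (\<lambda>s. indicator {t..t + e n} s * (B / e n * (r / (2 * B))))"
          by (rule Icont) simp
        fix s
        show "norm (indicator {t..t + e n} s * (- \<eta>' n s * a s) - indicator {t..t + e n} s * (- \<eta>' n s) * a t) \<le> indicator {t..t + e n} s * (B / e n * (r / (2 * B)))"
        proof (cases "s \<in> {t..t + e n}")
          case True
          then have "\<bar>a s - a t\<bar> \<le> r / (2 * B)" using n0[OF n] by (intro less_imp_le \<delta>(2)) auto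
          moreover have "\<bar>\<eta>' n s\<bar> \<le> B / e n"
            using True t B(2) e(1)[of n] by (simp add: \<eta>pos divide_right_mono)
          ultimately have "\<bar>\<eta>' n s\<bar> * \<bar>a s - a t\<bar> \<le> B / e n * (r / (2 * B))"
            using B(1) e(1)[of n] by (intro mult_mono) auto
          moreover have "norm (- \<eta>' n s * a s - (- \<eta>' n s) * a t) = \<bar>\<eta>' n s\<bar> * \<bar>a s - a t\<bar>"
            by (simp add: abs_mult[symmetric] right_diff_distrib abs_minus_commute)
          ultimately show ?thesis using True by simp
        qed simp
      qed
      also have "\<dots> = r / 2" using e(1)[of n] B(1) by simp
      also have "\<dots> < r" using r by simp
      finally show "norm (X n - a t) < r" .
    qed
  qed
  ultimately have "(\<lambda>n. X n - Y n) \<longlonglongrightarrow> a t - (LINT s|lborel. indicator {0..t} s * b s)"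
    by (intro tendsto_diff)
  then have "a t - (LINT s|lborel. indicator {0..t} s * b s) = c"
    unfolding XY by (simp add: LIMSEQ_const_iff)
  then show ?thesis by simp
qed

lemma zero_solenoidal: "(\<lambda>_. 0) \<in> solenoidal_test_fields \<Omega>"
proof -
  have "(\<lambda>_. 0) \<in> test_functions \<Omega>" by (rule test_functionsI[of _ "{}"]) (auto intro: smooth_on_const)
  then show ?thesis by (simp add: solenoidal_test_fields_def divergence_def trace_def jacobian_def matrix_def)
qed

section \<open>Borel representatives in time with values in V\<close>

context bounded_open
begin

abbreviation "dV f g \<equiv> H1_norm \<Omega> (\<lambda>x. f x - g x)"

sublocale Vm: pseudometric "V_space \<Omega>" dV
proof
  fix x y z assume "x \<in> V_space \<Omega>" "y \<in> V_space \<Omega>" "z \<in> V_space \<Omega>"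
  then show "dV x z \<le> dV x y + dV y z" by (intro H1_norm_triangle V_H1)
next
  fix x y assume "x \<in> V_space \<Omega>" "y \<in> V_space \<Omega>"
  then show "dV x y = dV y x" by (intro H1_norm_commute V_H1)
next
  fix x assume "x \<in> V_space \<Omega>"
  then show "dV x x = 0"
    unfolding H1_norm_def using H1_diff_norm[of x x] by (simp add: V_H1 L2_norm_def)
qed simp

lemma zero_V: "(\<lambda>_. 0) \<in> V_space \<Omega>"
  by (rule solenoidal_V[OF zero_solenoidal])

text \<open>The simple functions are replaced by Borel ones, and everything is set to the zero field
  for t <= 0 and on a Borel null set that contains all exceptional times. The alternative in the
  third conclusion lets bounds and symmetries of \<open>v\<close> hold for \<open>vh\<close> at
  every time.\<close>

lemma Bochner_representative:
  assumes v: "v \<in> Bochner_L2 (V_space \<Omega>) (H1_norm \<Omega>) {0<..}"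
  obtains vh s where "Vm.approx lborel vh s" "AE t in lborel. 0 < t \<longrightarrow> vh t = v t"
    "\<And>t. (0 < t \<and> vh t = v t) \<or> vh t = (\<lambda>_. 0)" "integrable lborel (\<lambda>t. (H1_norm \<Omega> (vh t))\<^sup>2)"
proof -
  let ?I = "{0<..} :: real set"
  have Is: "?I \<in> sets lebesgue" by simp
  obtain s where s: "\<And>n. simple_function (lebesgue_on ?I) (s n)" "\<And>n. s n ` ?I \<subseteq> V_space \<Omega>"
    "AE t in lebesgue_on ?I. (\<lambda>n. dV (s n t) (v t)) \<longlonglongrightarrow> 0"
    and vX: "AE t in lebesgue_on ?I. v t \<in> V_space \<Omega>"
    and vi: "integrable (lebesgue_on ?I) (\<lambda>t. (H1_norm \<Omega> (v t))\<^sup>2)"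
    using v unfolding Bochner_L2_def strongly_measurable_def by blast
  define s1 where "s1 n t = (if 0 < t then s n t else (\<lambda>_. 0))" for n t
  have s1: "simple_function lebesgue (s1 n)" for n
    unfolding simple_function_def
  proof (intro conjI ballI)
    have "s1 n ` space lebesgue \<subseteq> insert (\<lambda>_. 0) (s n ` ?I)" by (auto simp: s1_def)
    moreover have "finite (s n ` ?I)" using simple_functionD(1)[OF s(1)[of n]] by simp
    ultimately show "finite (s1 n ` space lebesgue)" by (meson finite_insert finite_subset)
    fix x
    have "s n -` {x} \<inter> ?I \<in> sets (lebesgue_on ?I)" using simple_functionD(2)[OF s(1)[of n], of "{x}"] by simp
    then have 1: "s n -` {x} \<inter> ?I \<in> sets lebesgue" by (simp add: sets_restrict_space_iff)
    have "s1 n -` {x} \<inter> space lebesgue = (s n -` {x} \<inter> ?I) \<union> (if x = (\<lambda>_. 0) then {..0} else {})"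
      by (auto simp: s1_def split: if_splits)
    also have "\<dots> \<in> sets lebesgue" using 1 by auto
    finally show "s1 n -` {x} \<inter> space lebesgue \<in> sets lebesgue" .
  qed
  have "\<forall>n. \<exists>s2. simple_function lborel s2 \<and> (AE t in lborel. s1 n t = s2 t)"
    using completion_ex_simple_function[OF s1] by blast
  then obtain s2 where s2: "\<And>n. simple_function lborel (s2 n)" "\<And>n. AE t in lborel. s1 n t = s2 n t" by metis
  have "AE t in lborel. \<forall>n. s1 n t = s2 n t" using s2(2) by (simp add: AE_all_countable)
  moreover have "AE t in lborel. t \<in> ?I \<longrightarrow> (\<lambda>n. dV (s n t) (v t)) \<longlonglongrightarrow> 0" "AE t in lborel. t \<in> ?I \<longrightarrow> v t \<in> V_space \<Omega>"
    using s(3) vX by (simp_all only: AE_lebesgue_on_iff[OF Is] AE_completion_iff)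
  ultimately have "AE t in lborel. (\<forall>n. s1 n t = s2 n t) \<and> (0 < t \<longrightarrow> (\<lambda>n. dV (s n t) (v t)) \<longlonglongrightarrow> 0 \<and> v t \<in> V_space \<Omega>)"
    by eventually_elim auto
  then obtain Z where Z: "Z \<in> null_sets lborel"
    "{t \<in> space lborel. \<not> ((\<forall>n. s1 n t = s2 n t) \<and> (0 < t \<longrightarrow> (\<lambda>n. dV (s n t) (v t)) \<longlonglongrightarrow> 0 \<and> v t \<in> V_space \<Omega>))} \<subseteq> Z"
    by (auto simp only: eventually_ae_filter)
  have good: "s1 n t = s2 n t" "0 < t \<Longrightarrow> (\<lambda>n. dV (s n t) (v t)) \<longlonglongrightarrow> 0" "0 < t \<Longrightarrow> v t \<in> V_space \<Omega>" if "t \<notin> Z" for t n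
    using Z(2) that by auto
  define A where "A = Z \<union> {..0}"
  have A: "A \<in> sets borel" using Z(1) by (auto simp: A_def)
  define vh where "vh t = (if t \<in> A then (\<lambda>_. 0) else v t)" for t
  define s3 where "s3 n t = (if t \<in> A then (\<lambda>_. 0) else s2 n t)" for n t
  have out: "t \<notin> Z" "0 < t" if "t \<notin> A" for t using that by (auto simp: A_def)
  have s3X: "s3 n t \<in> V_space \<Omega>" for n t
  proof (cases "t \<in> A")
    case False
    then have "s3 n t = s n t" using good(1)[of t n] out[OF False] by (simp add: s3_def s1_def)
    then show ?thesis using s(2)[of n] out(2)[OF False] by auto
  qed (simp add: s3_def zero_V)
  have vhX: "vh t \<in> V_space \<Omega>" for t using good(3)[of t] out[of t] zero_V by (auto simp: vh_def)
  have lim: "(\<lambda>n. dV (s3 n t) (vh t)) \<longlonglongrightarrow> 0" for t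
  proof (cases "t \<in> A")
    case True
    then show ?thesis using Vm.d_refl[OF zero_V] by (simp add: s3_def vh_def)
  next
    case False
    then have "s3 n t = s n t" for n using good(1)[of t n] out[OF False] by (simp add: s3_def s1_def)
    then show ?thesis using good(2)[OF out[OF False]] False by (simp add: vh_def)
  qed
  have s3s: "simple_function lborel (s3 n)" for n
    unfolding s3_def by (intro simple_function_If_set s2 simple_function_const) (use A in auto)
  have ap: "Vm.approx lborel vh s3" unfolding Vm.approx_def using s3s s3X vhX lim by blast
  have ae: "AE t in lborel. 0 < t \<longrightarrow> vh t = v t"
    using AE_not_in[OF Z(1)] by eventually_elim (auto simp: vh_def A_def)
  have m: "(\<lambda>t. (H1_norm \<Omega> (vh t))\<^sup>2) \<in> borel_measurable borel"
    using Vm.approx_d_measurable[OF ap Vm.approx_const[OF zero_V]] by simp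
  have z: "H1_norm \<Omega> (\<lambda>_. 0) = 0" using Vm.d_refl[OF zero_V] by simp
  have "integrable lborel (\<lambda>t. (H1_norm \<Omega> (vh t))\<^sup>2)"
  proof -
    have "integrable lebesgue (\<lambda>t. indicator ?I t *\<^sub>R (H1_norm \<Omega> (v t))\<^sup>2)"
      using vi by (subst (asm) integrable_restrict_space) auto
    moreover have "AE t in lebesgue. indicator ?I t *\<^sub>R (H1_norm \<Omega> (v t))\<^sup>2 = (H1_norm \<Omega> (vh t))\<^sup>2"
      using AE_completion[OF ae]
    proof eventually_elim
      fix t assume "0 < t \<longrightarrow> vh t = v t"
      moreover have "vh t = (\<lambda>_. 0)" if "\<not> 0 < t" using that by (simp add: vh_def A_def)
      ultimately show "indicator ?I t *\<^sub>R (H1_norm \<Omega> (v t))\<^sup>2 = (H1_norm \<Omega> (vh t))\<^sup>2"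
        using z by (cases "0 < t") simp_all
    qed
    ultimately have "integrable lebesgue (\<lambda>t. (H1_norm \<Omega> (vh t))\<^sup>2)"
      using m by (intro integrable_cong_AE_imp[of lebesgue _ "\<lambda>t. (H1_norm \<Omega> (vh t))\<^sup>2"])
        (auto intro: measurable_completion elim: eventually_mono)
    then show ?thesis using m by (simp add: integrable_completion)
  qed
  moreover have "(0 < t \<and> vh t = v t) \<or> vh t = (\<lambda>_. 0)" for t by (auto simp: vh_def A_def)
  ultimately show ?thesis using that[OF ap ae] by blast
qed

end

section \<open>Leray-Hopf solutions\<close>

context pseudometric
begin

text \<open>With sigma = tau + xi, respectively sigma = tau + h - xi, exchanging the integrals
  leaves for each shift xi in [0, h] a translation integral of size at most epsilon; the integration
  over xi gives the factor h.\<close>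

lemma averaged_translation:
  fixes f :: "real \<Rightarrow> 'e"
  assumes f: "approx lborel f s" and z: "z \<in> X" and i: "integrable lborel (\<lambda>t. (d (f t) z)\<^sup>2)" and T: "0 \<le> T" and \<epsilon>: "0 < \<epsilon>"
  obtains \<delta> where "0 < \<delta>"
    "\<And>h. 0 < h \<Longrightarrow> h \<le> \<delta> \<Longrightarrow> (\<integral>\<^sup>+\<tau>. (\<integral>\<^sup>+\<sigma>. ennreal ((d (f \<sigma>) (f \<tau>))\<^sup>2) * indicator {\<tau>..\<tau> + h} \<sigma> \<partial>lborel) * indicator {0..T} \<tau> \<partial>lborel) \<le> ennreal (\<epsilon> * h)"
    "\<And>h. 0 < h \<Longrightarrow> h \<le> \<delta> \<Longrightarrow> (\<integral>\<^sup>+\<tau>. (\<integral>\<^sup>+\<sigma>. ennreal ((d (f (\<tau> + h)) (f \<sigma>))\<^sup>2) * indicator {\<tau>..\<tau> + h} \<sigma> \<partial>lborel) * indicator {0..T} \<tau> \<partial>lborel) \<le> ennreal (\<epsilon> * h)"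
proof -
  \<comment> \<open>In the second estimate the base point tau + h - xi may exceed T by as much as h,
    so translations are controlled on [0, T + 1] and h is kept below 1.\<close>
  have T1: "0 \<le> T + 1" using T by simp
  obtain \<delta> where \<delta>: "0 < \<delta>" "\<And>h. 0 \<le> h \<Longrightarrow> h \<le> \<delta> \<Longrightarrow> (\<integral>\<^sup>+t. ennreal ((d (f (t + h)) (f t))\<^sup>2) * indicator {0..T + 1} t \<partial>lborel) \<le> ennreal \<epsilon>"
    using translation_continuous[OF f z i T1 \<epsilon>] by blast
  define D where "D p = ennreal ((d (f (fst p)) (f (snd p)))\<^sup>2)" for p
  have "(\<lambda>p. d (f (fst p)) (f (snd p))) \<in> borel_measurable (borel \<Otimes>\<^sub>M borel)"
  proof (rule approx_d_measurable)
    show "approx (borel \<Otimes>\<^sub>M borel) (\<lambda>p. f (fst p)) (\<lambda>n p. s n (fst p))"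
      "approx (borel \<Otimes>\<^sub>M borel) (\<lambda>p. f (snd p)) (\<lambda>n p. s n (snd p))"
      by (rule approx_compose[OF f], simp)+
  qed
  then have [measurable]: "D \<in> borel_measurable (borel \<Otimes>\<^sub>M borel)" unfolding D_def by measurable
  have \<omega>: "(\<integral>\<^sup>+t. D (t + \<xi>, t) * indicator {0..T + 1} t \<partial>lborel) \<le> ennreal \<epsilon>" if "0 \<le> \<xi>" "\<xi> \<le> \<delta>" for \<xi>
    using \<delta>(2)[OF that] by (simp add: D_def)
  have const: "(\<integral>\<^sup>+\<xi>. ennreal \<epsilon> * indicator {0..h} \<xi> \<partial>lborel) = ennreal (\<epsilon> * h)" if "0 < h" for h
    using that \<epsilon> by (simp add: nn_integral_cmult ennreal_mult)
  have 1: "(\<integral>\<^sup>+\<tau>. (\<integral>\<^sup>+\<sigma>. D (\<sigma>, \<tau>) * indicator {\<tau>..\<tau> + h} \<sigma> \<partial>lborel) * indicator {0..T} \<tau> \<partial>lborel) \<le> ennreal (\<epsilon> * h)"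
    if h: "0 < h" "h \<le> min \<delta> 1" for h
  proof -
    have "(\<integral>\<^sup>+\<tau>. (\<integral>\<^sup>+\<sigma>. D (\<sigma>, \<tau>) * indicator {\<tau>..\<tau> + h} \<sigma> \<partial>lborel) * indicator {0..T} \<tau> \<partial>lborel)
        = (\<integral>\<^sup>+\<tau>. (\<integral>\<^sup>+\<xi>. D (\<tau> + \<xi>, \<tau>) * indicator {0..h} \<xi> \<partial>lborel) * indicator {0..T} \<tau> \<partial>lborel)"
    proof -
      have e: "(\<integral>\<^sup>+\<sigma>. D (\<sigma>, \<tau>) * indicator {\<tau>..\<tau> + h} \<sigma> \<partial>lborel) = (\<integral>\<^sup>+\<xi>. D (\<tau> + \<xi>, \<tau>) * indicator {0..h} \<xi> \<partial>lborel)" for \<tau>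
      proof -
        have "(\<integral>\<^sup>+\<sigma>. D (\<sigma>, \<tau>) * indicator {\<tau>..\<tau> + h} \<sigma> \<partial>lborel) = (\<integral>\<^sup>+\<xi>. D (\<xi> + \<tau>, \<tau>) * indicator {\<tau>..\<tau> + h} (\<xi> + \<tau>) \<partial>lborel)"
          by (rule nn_integral_shift[symmetric]) measurable
        also have "\<dots> = (\<integral>\<^sup>+\<xi>. D (\<tau> + \<xi>, \<tau>) * indicator {0..h} \<xi> \<partial>lborel)"
          by (intro nn_integral_cong) (auto simp: indicator_def add.commute)
        finally show ?thesis .
      qed
      show ?thesis unfolding e ..
    qed
    also have "\<dots> = (\<integral>\<^sup>+\<tau>. \<integral>\<^sup>+\<xi>. D (\<tau> + \<xi>, \<tau>) * indicator {0..h} \<xi> * indicator {0..T} \<tau> \<partial>lborel \<partial>lborel)"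
      by (intro nn_integral_cong nn_integral_multc[symmetric]) measurable
    also have "\<dots> = (\<integral>\<^sup>+\<xi>. \<integral>\<^sup>+\<tau>. D (\<tau> + \<xi>, \<tau>) * indicator {0..h} \<xi> * indicator {0..T} \<tau> \<partial>lborel \<partial>lborel)"
      by (rule lborel_pair.Fubini') measurable
    also have "\<dots> \<le> (\<integral>\<^sup>+\<xi>. ennreal \<epsilon> * indicator {0..h} \<xi> \<partial>lborel)"
    proof (rule nn_integral_mono)
      fix \<xi>
      show "(\<integral>\<^sup>+\<tau>. D (\<tau> + \<xi>, \<tau>) * indicator {0..h} \<xi> * indicator {0..T} \<tau> \<partial>lborel) \<le> ennreal \<epsilon> * indicator {0..h} \<xi>"
      proof (cases "\<xi> \<in> {0..h}")
        case True
        have "(\<integral>\<^sup>+\<tau>. D (\<tau> + \<xi>, \<tau>) * indicator {0..h} \<xi> * indicator {0..T} \<tau> \<partial>lborel) \<le> (\<integral>\<^sup>+t. D (t + \<xi>, t) * indicator {0..T + 1} t \<partial>lborel)"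
          by (intro nn_integral_mono) (auto simp: indicator_def)
        also have "\<dots> \<le> ennreal \<epsilon>" using True h by (intro \<omega>) auto
        finally show ?thesis using True by simp
      qed simp
    qed
    finally show ?thesis using const[OF h(1)] by simp
  qed
  have 2: "(\<integral>\<^sup>+\<tau>. (\<integral>\<^sup>+\<sigma>. D (\<tau> + h, \<sigma>) * indicator {\<tau>..\<tau> + h} \<sigma> \<partial>lborel) * indicator {0..T} \<tau> \<partial>lborel) \<le> ennreal (\<epsilon> * h)"
    if h: "0 < h" "h \<le> min \<delta> 1" for h
  proof -
    have "(\<integral>\<^sup>+\<tau>. (\<integral>\<^sup>+\<sigma>. D (\<tau> + h, \<sigma>) * indicator {\<tau>..\<tau> + h} \<sigma> \<partial>lborel) * indicator {0..T} \<tau> \<partial>lborel)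
        = (\<integral>\<^sup>+\<tau>. (\<integral>\<^sup>+\<xi>. D (\<tau> + h, \<tau> + h - \<xi>) * indicator {0..h} \<xi> \<partial>lborel) * indicator {0..T} \<tau> \<partial>lborel)"
    proof -
      have e: "(\<integral>\<^sup>+\<sigma>. D (\<tau> + h, \<sigma>) * indicator {\<tau>..\<tau> + h} \<sigma> \<partial>lborel) = (\<integral>\<^sup>+\<xi>. D (\<tau> + h, \<tau> + h - \<xi>) * indicator {0..h} \<xi> \<partial>lborel)" for \<tau>
      proof -
        have m: "(\<lambda>\<sigma>. D (\<tau> + h, \<sigma>) * indicator {\<tau>..\<tau> + h} \<sigma>) \<in> borel_measurable borel" by measurable
        have "(\<integral>\<^sup>+\<sigma>. D (\<tau> + h, \<sigma>) * indicator {\<tau>..\<tau> + h} \<sigma> \<partial>lborel) = (\<integral>\<^sup>+\<xi>. D (\<tau> + h, \<tau> + h - \<xi>) * indicator {\<tau>..\<tau> + h} (\<tau> + h - \<xi>) \<partial>lborel)"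
          using nn_integral_real_affine[OF m, of "-1" "\<tau> + h"] by simp
        also have "\<dots> = (\<integral>\<^sup>+\<xi>. D (\<tau> + h, \<tau> + h - \<xi>) * indicator {0..h} \<xi> \<partial>lborel)"
          by (intro nn_integral_cong) (auto simp: indicator_def)
        finally show ?thesis .
      qed
      show ?thesis unfolding e ..
    qed
    also have "\<dots> = (\<integral>\<^sup>+\<tau>. \<integral>\<^sup>+\<xi>. D (\<tau> + h, \<tau> + h - \<xi>) * indicator {0..h} \<xi> * indicator {0..T} \<tau> \<partial>lborel \<partial>lborel)"
      by (intro nn_integral_cong nn_integral_multc[symmetric]) measurable
    also have "\<dots> = (\<integral>\<^sup>+\<xi>. \<integral>\<^sup>+\<tau>. D (\<tau> + h, \<tau> + h - \<xi>) * indicator {0..h} \<xi> * indicator {0..T} \<tau> \<partial>lborel \<partial>lborel)"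
      by (rule lborel_pair.Fubini') measurable
    also have "\<dots> \<le> (\<integral>\<^sup>+\<xi>. ennreal \<epsilon> * indicator {0..h} \<xi> \<partial>lborel)"
    proof (rule nn_integral_mono)
      fix \<xi>
      show "(\<integral>\<^sup>+\<tau>. D (\<tau> + h, \<tau> + h - \<xi>) * indicator {0..h} \<xi> * indicator {0..T} \<tau> \<partial>lborel) \<le> ennreal \<epsilon> * indicator {0..h} \<xi>"
      proof (cases "\<xi> \<in> {0..h}")
        case True
        have "(\<integral>\<^sup>+\<tau>. D (\<tau> + h, \<tau> + h - \<xi>) * indicator {0..h} \<xi> * indicator {0..T} \<tau> \<partial>lborel) \<le>
            (\<integral>\<^sup>+\<tau>. (\<lambda>t. D (t + \<xi>, t) * indicator {0..T + 1} t) (\<tau> + (h - \<xi>)) \<partial>lborel)"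
          by (intro nn_integral_mono) (use True h in \<open>auto simp: indicator_def add_diff_eq\<close>)
        also have "\<dots> = (\<integral>\<^sup>+t. D (t + \<xi>, t) * indicator {0..T + 1} t \<partial>lborel)"
          by (rule nn_integral_shift) measurable
        also have "\<dots> \<le> ennreal \<epsilon>" using True h by (intro \<omega>) auto
        finally show ?thesis using True by simp
      qed simp
    qed
    finally show ?thesis using const[OF h(1)] by simp
  qed
  show ?thesis
    by (rule that[of "min \<delta> 1"]) (use \<delta>(1) 1 2 in \<open>auto simp: D_def\<close>)
qed

end

context bounded_open
begin

text \<open>The right-hand side of the weak equation \<open>d/dt (v, \<phi>) = nse \<nu> v \<phi>\<close> for divergence-free \<open>\<phi>\<close>.\<close>

definition nse :: "real \<Rightarrow> (real^3 \<Rightarrow> real^3) \<Rightarrow> (real^3 \<Rightarrow> real^3) \<Rightarrow> real" where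
  "nse \<nu> v \<phi> = conv v \<phi> v - \<nu> * L2_inner \<Omega> (weak_gradient \<Omega> v) (weak_gradient \<Omega> \<phi>)"

lemma gradient_inner_bound:
  assumes "f \<in> V_space \<Omega>" "g \<in> V_space \<Omega>"
  shows "\<bar>L2_inner \<Omega> (weak_gradient \<Omega> f) (weak_gradient \<Omega> g)\<bar> \<le> H1_norm \<Omega> f * H1_norm \<Omega> g"
  by (rule order_trans[OF abs_L2_inner_le[OF V_gradient_L2 V_gradient_L2, OF assms]])
     (intro mult_mono L2_le_H1; simp)

lemma gradient_inner_diff:
  assumes "f \<in> V_space \<Omega>" "g \<in> V_space \<Omega>" "h \<in> V_space \<Omega>"
  shows "L2_inner \<Omega> (weak_gradient \<Omega> f) (weak_gradient \<Omega> (\<lambda>x. g x - h x)) =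
    L2_inner \<Omega> (weak_gradient \<Omega> f) (weak_gradient \<Omega> g) - L2_inner \<Omega> (weak_gradient \<Omega> f) (weak_gradient \<Omega> h)"
proof -
  note G = V_gradient_L2[OF assms(1)] V_gradient_L2[OF assms(2)] V_gradient_L2[OF assms(3)] V_gradient_L2[OF V_diff[OF assms(2,3)]]
  have "L2_inner \<Omega> (weak_gradient \<Omega> f) (weak_gradient \<Omega> (\<lambda>x. g x - h x)) =
     L2_inner \<Omega> (weak_gradient \<Omega> f) (\<lambda>x. weak_gradient \<Omega> g x - weak_gradient \<Omega> h x)"
    unfolding L2_inner_def
  proof (rule integral_cong_AE)
    note [measurable] = G[THEN L2_fieldsD(1)]
    show "(\<lambda>x. weak_gradient \<Omega> f x \<bullet> weak_gradient \<Omega> (\<lambda>x. g x - h x) x) \<in> borel_measurable M"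
      "(\<lambda>x. weak_gradient \<Omega> f x \<bullet> (weak_gradient \<Omega> g x - weak_gradient \<Omega> h x)) \<in> borel_measurable M" by measurable
    show "AE x in M. weak_gradient \<Omega> f x \<bullet> weak_gradient \<Omega> (\<lambda>x. g x - h x) x = weak_gradient \<Omega> f x \<bullet> (weak_gradient \<Omega> g x - weak_gradient \<Omega> h x)"
      using H1_diff(2)[OF V_H1[OF assms(2)] V_H1[OF assms(3)]] by eventually_elim simp
  qed
  then show ?thesis using L2_inner_diff_right[OF G(2,3,1)] by simp
qed

lemma gradient_inner_tendsto:
  assumes f: "\<And>n. f n \<in> V_space \<Omega>" "f' \<in> V_space \<Omega>" "(\<lambda>n. dV (f n) f') \<longlonglongrightarrow> 0"
    and g: "\<And>n. g n \<in> V_space \<Omega>" "g' \<in> V_space \<Omega>" "(\<lambda>n. dV (g n) g') \<longlonglongrightarrow> 0"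
  shows "(\<lambda>n. L2_inner \<Omega> (weak_gradient \<Omega> (f n)) (weak_gradient \<Omega> (g n))) \<longlonglongrightarrow> L2_inner \<Omega> (weak_gradient \<Omega> f') (weak_gradient \<Omega> g')"
  using H1_norm_tendsto(2)[OF V_H1[OF f(1)] V_H1[OF f(2)] f(3)] H1_norm_tendsto(2)[OF V_H1[OF g(1)] V_H1[OF g(2)] g(3)]
  by (intro L2_inner_tendsto V_gradient_L2 f g)

lemma nse_tendsto:
  assumes f: "\<And>n. f n \<in> V_space \<Omega>" "f' \<in> V_space \<Omega>" "(\<lambda>n. dV (f n) f') \<longlonglongrightarrow> 0"
    and g: "\<And>n. g n \<in> V_space \<Omega>" "g' \<in> V_space \<Omega>" "(\<lambda>n. dV (g n) g') \<longlonglongrightarrow> 0"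
  shows "(\<lambda>n. nse \<nu> (f n) (g n)) \<longlonglongrightarrow> nse \<nu> f' g'"
  unfolding nse_def by (intro tendsto_intros conv_tendsto gradient_inner_tendsto f g)

lemma nse_diff:
  assumes "f \<in> V_space \<Omega>" "g \<in> V_space \<Omega>" "h \<in> V_space \<Omega>"
  shows "nse \<nu> f (\<lambda>x. g x - h x) = nse \<nu> f g - nse \<nu> f h"
  unfolding nse_def gradient_inner_diff[OF assms] conv_diff(2)[OF assms(1,1,2,3,1,1)] by (simp add: algebra_simps)

text \<open>Quadratic in \<open>f\<close> and linear in \<open>g\<close>: integrable in time for
  \<open>f\<close> in L2(V) and fixed \<open>g\<close>, which is what the integrated weak equation
  asks for. When \<open>g\<close> varies in L2(V) as well, axial symmetry has to come in.\<close>

lemma nse_bound: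
  assumes "f \<in> V_space \<Omega>" "g \<in> V_space \<Omega>" "0 \<le> \<nu>"
  shows "\<bar>nse \<nu> f g\<bar> \<le> (3 + \<nu>) * (1 + (H1_norm \<Omega> f)\<^sup>2) * H1_norm \<Omega> g"
proof -
  have 1: "\<bar>conv f g f\<bar> \<le> 3 * (1 + (H1_norm \<Omega> f)\<^sup>2) * H1_norm \<Omega> g"
  proof -
    have "\<bar>conv f g f\<bar> \<le> 3 * (H1_norm \<Omega> f)\<^sup>2 * H1_norm \<Omega> g"
      using abs_conv_le(3)[OF assms(1,2,1)] by (simp add: power2_eq_square ac_simps)
    also have "\<dots> \<le> 3 * (1 + (H1_norm \<Omega> f)\<^sup>2) * H1_norm \<Omega> g" by (intro mult_right_mono) auto
    finally show ?thesis .
  qed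
  have "H1_norm \<Omega> f \<le> 1 + (H1_norm \<Omega> f)\<^sup>2"
  proof -
    have "2 * H1_norm \<Omega> f \<le> 1 + (H1_norm \<Omega> f)\<^sup>2" using sum_squares_bound[of 1 "H1_norm \<Omega> f"] by simp
    then show ?thesis using H1_norm_nonneg[of f] by linarith
  qed
  then have "\<bar>L2_inner \<Omega> (weak_gradient \<Omega> f) (weak_gradient \<Omega> g)\<bar> \<le> (1 + (H1_norm \<Omega> f)\<^sup>2) * H1_norm \<Omega> g"
    by (intro order_trans[OF gradient_inner_bound[OF assms(1,2)]] mult_right_mono) auto
  then have 2: "\<bar>\<nu> * L2_inner \<Omega> (weak_gradient \<Omega> f) (weak_gradient \<Omega> g)\<bar> \<le> \<nu> * ((1 + (H1_norm \<Omega> f)\<^sup>2) * H1_norm \<Omega> g)"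
    using assms(3) by (simp add: abs_mult mult_left_mono)
  show ?thesis using 1 2 unfolding nse_def by (simp add: algebra_simps)
qed

lemma gradient_inner_test:
  assumes f: "f \<in> V_space \<Omega>" and g: "g \<in> solenoidal_test_fields \<Omega>"
  shows "L2_inner \<Omega> (weak_gradient \<Omega> f) (weak_gradient \<Omega> g) = (LINT x|M. weak_gradient \<Omega> f x \<bullet> jacobian g (at x))"
  unfolding L2_inner_def
proof (rule integral_cong_AE)
  note [measurable] = L2_fieldsD(1)[OF V_gradient_L2[OF f]] L2_fieldsD(1)[OF V_gradient_L2[OF solenoidal_V[OF g]]]
    L2_fieldsD(1)[OF test_jacobian_L2[OF solenoidal_test[OF g]]]
  show "(\<lambda>x. weak_gradient \<Omega> f x \<bullet> weak_gradient \<Omega> g x) \<in> borel_measurable M"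
    "(\<lambda>x. weak_gradient \<Omega> f x \<bullet> jacobian g (at x)) \<in> borel_measurable M" by measurable
  show "AE x in M. weak_gradient \<Omega> f x \<bullet> weak_gradient \<Omega> g x = weak_gradient \<Omega> f x \<bullet> jacobian g (at x)"
    using test_H1(2)[OF solenoidal_test[OF g]] by eventually_elim simp
qed

lemma H_L2: "f \<in> H_space \<Omega> \<Longrightarrow> f \<in> L2_fields \<Omega>"
  by (simp add: H_space_def)

lemma H_approx:
  assumes "f \<in> H_space \<Omega>"
  obtains \<phi> where "\<And>n. \<phi> n \<in> solenoidal_test_fields \<Omega>" "(\<lambda>n. L2_norm \<Omega> (\<lambda>x. \<phi> n x - f x)) \<longlonglongrightarrow> 0"
proof -
  have "\<forall>n. \<exists>\<phi>\<in>solenoidal_test_fields \<Omega>. L2_norm \<Omega> (\<lambda>x. f x - \<phi> x) < inverse (real (Suc n))"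
    using assms by (auto simp: H_space_def)
  then obtain \<phi> where \<phi>: "\<And>n. \<phi> n \<in> solenoidal_test_fields \<Omega>"
    "\<And>n. L2_norm \<Omega> (\<lambda>x. f x - \<phi> n x) < inverse (real (Suc n))" by metis
  have "(\<lambda>n. L2_norm \<Omega> (\<lambda>x. \<phi> n x - f x)) \<longlonglongrightarrow> 0"
    by (rule tendsto_sandwich[OF _ _ tendsto_const LIMSEQ_inverse_real_of_nat])
       (use \<phi>(2) in \<open>auto simp: L2_norm_commute[of \<Omega> _ f] intro!: always_eventually less_imp_le\<close>)
  with \<phi>(1) show ?thesis using that by blast
qed

end

section \<open>One Leray-Hopf solution: the integrated equation, initial data and energy\<close>

lemma jacobian_scaleR:
  fixes \<phi> :: "real^3 \<Rightarrow> real^3"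
  assumes "smooth_on UNIV \<phi>"
  shows "jacobian (\<lambda>y. c *\<^sub>R \<phi> y) (at x) = c *\<^sub>R jacobian \<phi> (at x)"
proof -
  have "frechet_derivative (\<lambda>y. c *\<^sub>R \<phi> y) (at x) = (\<lambda>h. c *\<^sub>R frechet_derivative \<phi> (at x) h)"
    by (rule frechet_derivative_at[symmetric]) (intro has_derivative_scaleR_right smooth_on_has_derivative assms)
  then show ?thesis by (simp add: jacobian_def matrix_def vec_eq_iff)
qed

text \<open>
  Here \<open>vh\<close> is a Borel representative of \<open>v\<close> with values in \<open>V\<close> at every time (zero on an
  exceptional null set and for \<open>t \<le> 0\<close>), and \<open>s n\<close> are simple functions converging to it.
\<close>

locale leray_hopf = bounded_open +
  fixes \<nu> :: real and v\<^sub>0 :: "real^3 \<Rightarrow> real^3" and v vh :: "real \<Rightarrow> real^3 \<Rightarrow> real^3" and s :: "nat \<Rightarrow> real \<Rightarrow> real^3 \<Rightarrow> real^3"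
  assumes \<nu>: "0 < \<nu>" and LH: "Leray_Hopf_solution \<nu> \<Omega> v\<^sub>0 v" and v0: "v\<^sub>0 \<in> H_space \<Omega>"
    and approx: "Vm.approx lborel vh s" and vh_AE: "AE t in lborel. 0 < t \<longrightarrow> vh t = v t"
    and vh_cases: "\<And>t. (0 < t \<and> vh t = v t) \<or> vh t = (\<lambda>_. 0)"
    and vh_int: "integrable lborel (\<lambda>t. (H1_norm \<Omega> (vh t))\<^sup>2)"
begin

lemma vh_V: "vh t \<in> V_space \<Omega>"
  using approx by (simp add: Vm.approx_def)

lemma v_H: "0 \<le> t \<Longrightarrow> v t \<in> H_space \<Omega>"
  using LH by (simp add: Leray_Hopf_solution_def C0_weak_def)

lemma v_L2: "0 \<le> t \<Longrightarrow> v t \<in> L2_fields \<Omega>"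
  using v_H H_L2 by blast

lemma v_weakly_continuous:
  "\<psi> \<in> L2_fields \<Omega> \<Longrightarrow> continuous_on {0..} (\<lambda>t. L2_inner \<Omega> (v t) \<psi>)"
  using LH by (simp add: Leray_Hopf_solution_def C0_weak_def L2_inner_def)

lemma nse_measurable:
  assumes "\<phi> \<in> V_space \<Omega>"
  shows "(\<lambda>t. nse \<nu> (vh t) \<phi>) \<in> borel_measurable borel"
  using Vm.approx_measurable[OF approx Vm.approx_const[OF assms], of "nse \<nu>"] nse_tendsto by simp

lemma H1_majorant:
  "integrable lborel (\<lambda>t. indicator {0..T} t * (c * (1 + (H1_norm \<Omega> (vh t))\<^sup>2) * e))"
proof -
  have "integrable lborel (\<lambda>t. c * e * indicat_real {0..T} t + c * e * (indicator {0..T} t * (H1_norm \<Omega> (vh t))\<^sup>2))"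
    using integrable_restrict_Icc[OF vh_int, of 0 T]
    by (intro Bochner_Integration.integrable_add Bochner_Integration.integrable_mult_right integrable_real_indicator)
       (auto simp: emeasure_lborel_Icc_eq)
  then show ?thesis by (simp add: algebra_simps)
qed

lemma nse_integrable:
  assumes \<phi>: "\<phi> \<in> V_space \<Omega>"
  shows "integrable lborel (\<lambda>t. indicator {0..T} t * nse \<nu> (vh t) \<phi>)"
proof (rule Bochner_Integration.integrable_bound[OF H1_majorant[of T "3 + \<nu>" "H1_norm \<Omega> \<phi>"]])
  show "(\<lambda>t. indicator {0..T} t * nse \<nu> (vh t) \<phi>) \<in> borel_measurable lborel"
    using nse_measurable[OF \<phi>] by measurable
  show "AE t in lborel. norm (indicator {0..T} t * nse \<nu> (vh t) \<phi>) \<le> norm (indicator {0..T} t * ((3 + \<nu>) * (1 + (H1_norm \<Omega> (vh t))\<^sup>2) * H1_norm \<Omega> \<phi>))"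
    using nse_bound[OF vh_V \<phi>, of \<nu>] \<nu> by (auto simp: abs_mult indicator_def)
qed

text \<open>Tested with products eta(t) phi(x), the weak formulation becomes a scalar equation in
  the sense of distributions for (v(t), phi), which \<open>distributional_ODE\<close> integrates up
  to every time.\<close>

lemma weak_evolution_test:
  assumes \<phi>: "\<phi> \<in> solenoidal_test_fields \<Omega>" and t: "0 \<le> t"
  shows "L2_inner \<Omega> (v t) \<phi> = L2_inner \<Omega> v\<^sub>0 \<phi> + (LINT r|lborel. indicator {0..t} r * nse \<nu> (vh r) \<phi>)"
proof -
  note \<phi>t = solenoidal_test[OF \<phi>] and \<phi>V = solenoidal_V[OF \<phi>]
  have \<phi>s: "smooth_on UNIV \<phi>" using \<phi>t by (simp add: test_functions_def)
  \<comment> \<open>The pairing is continued to negative times by its value at 0 in order to have a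
    continuous function on the line.\<close>
  define a where "a t = L2_inner \<Omega> (v (max 0 t)) \<phi>" for t
  have a: "continuous_on UNIV a"
    unfolding a_def
    by (rule continuous_on_compose2[OF v_weakly_continuous[OF test_L2[OF \<phi>t]]]) (auto intro!: continuous_intros)
  have am [measurable]: "a \<in> borel_measurable borel" by (rule borel_measurable_continuous_onI[OF a])
  note [measurable] = nse_measurable[OF \<phi>V]
  have "a t = L2_inner \<Omega> v\<^sub>0 \<phi> + (LINT r|lborel. indicator {0..t} r * nse \<nu> (vh r) \<phi>)"
  proof (rule distributional_ODE[OF a nse_integrable[OF \<phi>V] _ _ t])
    fix \<eta> \<eta>' :: "real \<Rightarrow> real"
    assume \<eta>: "\<eta> \<in> test_functions UNIV" and d\<eta>: "\<And>t. (\<eta> has_real_derivative \<eta>' t) (at t)"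
    have \<eta>s: "smooth_on UNIV \<eta>" using \<eta> by (simp add: test_functions_def)
    have "\<eta>' t = frechet_derivative \<eta> (at t) 1" for t
      using frechet_derivative_at[OF d\<eta>[of t, unfolded has_field_derivative_def]] by (metis mult.right_neutral)
    then have "\<eta>' = (\<lambda>t. frechet_derivative \<eta> (at t) 1)" by (rule ext)
    then have [measurable]: "\<eta>' \<in> borel_measurable borel" using test_functions_borel[OF test_functions_frechet[OF \<eta>]] by simp
    have [measurable]: "\<eta> \<in> borel_measurable borel" by (rule test_functions_borel[OF \<eta>])
    define \<psi> where "\<psi> p = \<eta> (fst p) *\<^sub>R \<phi> (snd p)" for p :: "real \<times> (real^3)"
    have \<psi>: "\<psi> \<in> test_functions (UNIV \<times> \<Omega>)"
    proof -
      obtain K\<eta> where K\<eta>: "compact K\<eta>" "\<And>x. x \<notin> K\<eta> \<Longrightarrow> \<eta> x = 0" using test_functionsE[OF \<eta>] by metis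
      obtain K\<phi> where K\<phi>: "compact K\<phi>" "K\<phi> \<subseteq> \<Omega>" "\<And>x. x \<notin> K\<phi> \<Longrightarrow> \<phi> x = 0" using test_functionsE[OF \<phi>t] by metis
      show ?thesis
      proof (rule test_functionsI[of _ "K\<eta> \<times> K\<phi>"])
        have 1: "smooth_on UNIV (\<lambda>p::real \<times> (real^3). \<eta> (fst p))"
          using smooth_on_compose_affine[OF bounded_linear_fst \<eta>s, of 0] by simp
        have 2: "smooth_on UNIV (\<lambda>p::real \<times> (real^3). \<phi> (snd p))"
          using smooth_on_compose_affine[OF bounded_linear_snd \<phi>s, of 0] by simp
        show "smooth_on UNIV \<psi>" unfolding \<psi>_def[abs_def] by (rule smooth_on_bilinear[OF bounded_bilinear_scaleR 1 2])
        fix p assume "p \<notin> K\<eta> \<times> K\<phi>"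
        then show "\<psi> p = 0"
          using K\<eta>(2) K\<phi>(3) by (cases "fst p \<in> K\<eta>") (auto simp: \<psi>_def mem_Times_iff)
      qed (use K\<eta>(1) K\<phi>(1,2) in \<open>auto simp: compact_Times\<close>)
    qed
    have jac: "jacobian (\<lambda>y. \<psi> (t, y)) (at x) = \<eta> t *\<^sub>R jacobian \<phi> (at x)" for t x
      by (simp add: \<psi>_def jacobian_scaleR[OF \<phi>s])
    have "divergence (\<lambda>y. \<psi> (t, y)) x = 0" for t x
    proof -
      have "divergence \<phi> x = 0" using \<phi> by (simp add: solenoidal_test_fields_def)
      then show ?thesis unfolding divergence_def jac by (simp add: trace_def sum_distrib_left[symmetric])
    qed
    moreover have "weak_formulation \<nu> \<Omega> v\<^sub>0 v" using LH by (simp add: Leray_Hopf_solution_def)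
    ultimately have W: "(LINT t|lebesgue_on {0..}. LINT x|M.
           - (vector_derivative (\<lambda>s. \<psi> (s, x)) (at t) \<bullet> v t x)
           - (jacobian (\<lambda>y. \<psi> (t, y)) (at x) *v v t x) \<bullet> v t x
           + \<nu> * (weak_gradient \<Omega> (v t) x \<bullet> jacobian (\<lambda>y. \<psi> (t, y)) (at x)))
        - (LINT x|M. v\<^sub>0 x \<bullet> \<psi> (0, x)) = 0"
      using \<psi> unfolding weak_formulation_def by blast
    have vd: "vector_derivative (\<lambda>s. \<psi> (s, x)) (at t) = \<eta>' t *\<^sub>R \<phi> x" for t x
    proof (rule vector_derivative_at)
      show "((\<lambda>s. \<psi> (s, x)) has_vector_derivative \<eta>' t *\<^sub>R \<phi> x) (at t)"
        using has_vector_derivative_scaleR[OF d\<eta>[of t] has_vector_derivative_const[of "\<phi> x"]] by (simp add: \<psi>_def)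
    qed
    \<comment> \<open>The weak gradient of \<open>v t\<close> is meaningful only when
      \<open>v t\<close> lies in \<open>V\<close>, which is known where the representative agrees
      with it; the remaining positive times form a null set.\<close>
    have inner: "(LINT x|M. - (vector_derivative (\<lambda>s. \<psi> (s, x)) (at t) \<bullet> v t x)
           - (jacobian (\<lambda>y. \<psi> (t, y)) (at x) *v v t x) \<bullet> v t x
           + \<nu> * (weak_gradient \<Omega> (v t) x \<bullet> jacobian (\<lambda>y. \<psi> (t, y)) (at x)))
        = - \<eta>' t * a t - \<eta> t * nse \<nu> (vh t) \<phi>" if t: "0 < t" "vh t = v t" for t
    proof -
      have vV: "v t \<in> V_space \<Omega>" using vh_V[of t] t by simp
      have i1: "integrable M (\<lambda>x. v t x \<bullet> \<phi> x)" by (rule integrable_inner[OF V_L2[OF vV] test_L2[OF \<phi>t]])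
      have i2: "integrable M (\<lambda>x. (jacobian \<phi> (at x) *v v t x) \<bullet> v t x)"
        by (rule conv_integrable[OF vV vV test_jacobian_L2[OF \<phi>t]])
      have i3: "integrable M (\<lambda>x. weak_gradient \<Omega> (v t) x \<bullet> jacobian \<phi> (at x))"
        by (rule integrable_inner[OF V_gradient_L2[OF vV] test_jacobian_L2[OF \<phi>t]])
      have "(LINT x|M. - (vector_derivative (\<lambda>s. \<psi> (s, x)) (at t) \<bullet> v t x)
           - (jacobian (\<lambda>y. \<psi> (t, y)) (at x) *v v t x) \<bullet> v t x
           + \<nu> * (weak_gradient \<Omega> (v t) x \<bullet> jacobian (\<lambda>y. \<psi> (t, y)) (at x)))
        = (LINT x|M. (- \<eta>' t) * (v t x \<bullet> \<phi> x) - \<eta> t * ((jacobian \<phi> (at x) *v v t x) \<bullet> v t x)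
            + (\<nu> * \<eta> t) * (weak_gradient \<Omega> (v t) x \<bullet> jacobian \<phi> (at x)))"
        unfolding vd jac by (intro Bochner_Integration.integral_cong refl)
          (simp add: inner_commute scaleR_matrix_vector_assoc[symmetric])
      also have "\<dots> = (- \<eta>' t) * L2_inner \<Omega> (v t) \<phi> - \<eta> t * conv (v t) \<phi> (v t)
            + (\<nu> * \<eta> t) * L2_inner \<Omega> (weak_gradient \<Omega> (v t)) (weak_gradient \<Omega> \<phi>)"
        unfolding conv_test[OF vV \<phi> vV] gradient_inner_test[OF vV \<phi>] L2_inner_def[of \<Omega> "v t"]
        using i1 i2 i3 by simp
      also have "\<dots> = - \<eta>' t * a t - \<eta> t * nse \<nu> (vh t) \<phi>"
        using t by (simp add: a_def nse_def algebra_simps)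
      finally show ?thesis .
    qed
    have "(LINT t|lebesgue_on {0..}. LINT x|M.
           - (vector_derivative (\<lambda>s. \<psi> (s, x)) (at t) \<bullet> v t x)
           - (jacobian (\<lambda>y. \<psi> (t, y)) (at x) *v v t x) \<bullet> v t x
           + \<nu> * (weak_gradient \<Omega> (v t) x \<bullet> jacobian (\<lambda>y. \<psi> (t, y)) (at x))) =
       (LINT t|lborel. indicator {0..} t * (- \<eta>' t * a t - \<eta> t * nse \<nu> (vh t) \<phi>))"
    proof (rule integral_lebesgue_on_AE)
      have "AE t in lborel. t \<noteq> (0::real)" by (rule AE_lborel_singleton)
      then show "AE t in lborel. t \<in> {0..} \<longrightarrow> (LINT x|M.
           - (vector_derivative (\<lambda>s. \<psi> (s, x)) (at t) \<bullet> v t x)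
           - (jacobian (\<lambda>y. \<psi> (t, y)) (at x) *v v t x) \<bullet> v t x
           + \<nu> * (weak_gradient \<Omega> (v t) x \<bullet> jacobian (\<lambda>y. \<psi> (t, y)) (at x))) = - \<eta>' t * a t - \<eta> t * nse \<nu> (vh t) \<phi>"
        using vh_AE by eventually_elim (use inner in auto)
    qed auto
    moreover have "(LINT x|M. v\<^sub>0 x \<bullet> \<psi> (0, x)) = \<eta> 0 * L2_inner \<Omega> v\<^sub>0 \<phi>"
      by (simp add: \<psi>_def L2_inner_def)
    ultimately show "(LINT s|lborel. indicator {0..} s * (- \<eta>' s * a s - \<eta> s * nse \<nu> (vh s) \<phi>)) = \<eta> 0 * L2_inner \<Omega> v\<^sub>0 \<phi>"
      using W by simp
  qed (rule nse_measurable[OF \<phi>V])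
  then show ?thesis using t by (simp add: a_def)
qed

text \<open>The integrated equation at t = 0 shows that the difference is orthogonal to all
  solenoidal test fields. Both \<open>v 0\<close> and \<open>v\<^sub>0\<close> are L2 limits of such
  fields, so the difference is orthogonal to itself.\<close>

lemma initial_L2: "L2_norm \<Omega> (\<lambda>x. v 0 x - v\<^sub>0 x) = 0"
proof -
  note L = v_L2[of 0] H_L2[OF v0]
  have z: "L2_inner \<Omega> (\<lambda>x. v 0 x - v\<^sub>0 x) \<phi> = 0" if \<phi>: "\<phi> \<in> solenoidal_test_fields \<Omega>" for \<phi>
  proof -
    have "L2_inner \<Omega> (v 0) \<phi> = L2_inner \<Omega> v\<^sub>0 \<phi>"
      using weak_evolution_test[OF \<phi>, of 0] unfolding integral_indicator_trivial_Icc by simp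
    then show ?thesis
      using L2_inner_diff_left[OF L(1) L(2) test_L2[OF solenoidal_test[OF \<phi>]]] by simp
  qed
  obtain \<phi> where \<phi>: "\<And>n. \<phi> n \<in> solenoidal_test_fields \<Omega>" "(\<lambda>n. L2_norm \<Omega> (\<lambda>x. \<phi> n x - v 0 x)) \<longlonglongrightarrow> 0"
    using H_approx[OF v_H[of 0]] by auto
  obtain \<gamma> where \<gamma>: "\<And>n. \<gamma> n \<in> solenoidal_test_fields \<Omega>" "(\<lambda>n. L2_norm \<Omega> (\<lambda>x. \<gamma> n x - v\<^sub>0 x)) \<longlonglongrightarrow> 0"
    using H_approx[OF v0] by auto
  have d: "(\<lambda>x. v 0 x - v\<^sub>0 x) \<in> L2_fields \<Omega>" using L by (intro L2_fields_diff) auto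
  have "(\<lambda>n. L2_inner \<Omega> (\<lambda>x. v 0 x - v\<^sub>0 x) (\<phi> n)) \<longlonglongrightarrow> L2_inner \<Omega> (\<lambda>x. v 0 x - v\<^sub>0 x) (v 0)"
    by (rule L2_inner_tendsto[OF d d _ test_L2[OF solenoidal_test[OF \<phi>(1)]] _ \<phi>(2)]) (use L in \<open>auto simp: L2_norm_def\<close>)
  then have 1: "L2_inner \<Omega> (\<lambda>x. v 0 x - v\<^sub>0 x) (v 0) = 0" using z[OF \<phi>(1)] by (simp add: LIMSEQ_const_iff)
  have "(\<lambda>n. L2_inner \<Omega> (\<lambda>x. v 0 x - v\<^sub>0 x) (\<gamma> n)) \<longlonglongrightarrow> L2_inner \<Omega> (\<lambda>x. v 0 x - v\<^sub>0 x) v\<^sub>0"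
    by (rule L2_inner_tendsto[OF d d _ test_L2[OF solenoidal_test[OF \<gamma>(1)]] _ \<gamma>(2)]) (use L in \<open>auto simp: L2_norm_def\<close>)
  then have 2: "L2_inner \<Omega> (\<lambda>x. v 0 x - v\<^sub>0 x) v\<^sub>0 = 0" using z[OF \<gamma>(1)] by (simp add: LIMSEQ_const_iff)
  have "L2_inner \<Omega> (\<lambda>x. v 0 x - v\<^sub>0 x) (\<lambda>x. v 0 x - v\<^sub>0 x) = 0"
    using L2_inner_diff_right[OF L(1) L(2) d] 1 2 by simp
  then show ?thesis by (simp add: L2_inner_self)
qed

lemma initial_inner:
  assumes "f \<in> L2_fields \<Omega>"
  shows "L2_inner \<Omega> (v 0) f = L2_inner \<Omega> v\<^sub>0 f"
proof -
  note L = v_L2[of 0] H_L2[OF v0]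
  have "\<bar>L2_inner \<Omega> (\<lambda>x. v 0 x - v\<^sub>0 x) f\<bar> \<le> 0"
    using abs_L2_inner_le[OF L2_fields_diff[OF L(1) L(2)] assms] initial_L2 by simp
  then show ?thesis using L2_inner_diff_left[OF L(1) L(2) assms] by simp
qed

text \<open>Density of solenoidal test fields in \<open>V\<close>. The time integral converges
  because \<open>nse_bound\<close> is uniform along a bounded sequence.\<close>

lemma weak_evolution:
  assumes \<phi>: "\<phi> \<in> V_space \<Omega>" and t: "0 \<le> t"
  shows "L2_inner \<Omega> (v t) \<phi> = L2_inner \<Omega> v\<^sub>0 \<phi> + (LINT r|lborel. indicator {0..t} r * nse \<nu> (vh r) \<phi>)"
proof -
  obtain \<gamma> where \<gamma>: "\<And>n. \<gamma> n \<in> solenoidal_test_fields \<Omega>" "(\<lambda>n. dV (\<gamma> n) \<phi>) \<longlonglongrightarrow> 0"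
    using V_approx[OF \<phi>] by blast
  note \<gamma>V = solenoidal_V[OF \<gamma>(1)]
  note l = H1_norm_tendsto(1)[OF V_H1[OF \<gamma>V] V_H1[OF \<phi>] \<gamma>(2)]
  have 1: "(\<lambda>n. L2_inner \<Omega> f (\<gamma> n)) \<longlonglongrightarrow> L2_inner \<Omega> f \<phi>" if "f \<in> L2_fields \<Omega>" for f
    by (rule L2_inner_tendsto[OF that that _ V_L2[OF \<gamma>V] V_L2[OF \<phi>] l]) (simp add: L2_norm_def)
  have 2: "(\<lambda>n. LINT r|lborel. indicator {0..t} r * nse \<nu> (vh r) (\<gamma> n)) \<longlonglongrightarrow> (LINT r|lborel. indicator {0..t} r * nse \<nu> (vh r) \<phi>)"
  proof -
    \<comment> \<open>From this index on, the H1 norms of \<open>\<gamma> n\<close> are at most 1 +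
      |phi|_V, which supplies a single integrable majorant.\<close>
    have "\<forall>\<^sub>F n in sequentially. dV (\<gamma> n) \<phi> < 1" using \<gamma>(2) by (intro order_tendstoD(2)) auto
    then obtain n0 where n0: "\<And>n. n \<ge> n0 \<Longrightarrow> dV (\<gamma> n) \<phi> < 1" by (auto simp: eventually_sequentially)
    have b: "H1_norm \<Omega> (\<gamma> (n + n0)) \<le> 1 + H1_norm \<Omega> \<phi>" for n
    proof -
      have "H1_norm \<Omega> (\<lambda>x. \<gamma> (n + n0) x - 0) \<le> dV (\<gamma> (n + n0)) \<phi> + H1_norm \<Omega> (\<lambda>x. \<phi> x - 0)"
        by (rule Vm.d_tri[OF \<gamma>V \<phi> zero_V])
      then show ?thesis using n0[of "n + n0"] by simp
    qed
    have "(\<lambda>n. LINT r|lborel. indicator {0..t} r * nse \<nu> (vh r) (\<gamma> (n + n0))) \<longlonglongrightarrow> (LINT r|lborel. indicator {0..t} r * nse \<nu> (vh r) \<phi>)"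
    proof (rule integral_dominated_convergence[OF _ _ H1_majorant[of t "3 + \<nu>" "1 + H1_norm \<Omega> \<phi>"]])
      show "(\<lambda>r. indicator {0..t} r * nse \<nu> (vh r) \<phi>) \<in> borel_measurable lborel"
        using borel_measurable_integrable[OF nse_integrable[OF \<phi>]] .
      show "(\<lambda>r. indicator {0..t} r * nse \<nu> (vh r) (\<gamma> (n + n0))) \<in> borel_measurable lborel" for n
        using borel_measurable_integrable[OF nse_integrable[OF \<gamma>V]] .
      show "AE r in lborel. (\<lambda>n. indicator {0..t} r * nse \<nu> (vh r) (\<gamma> (n + n0))) \<longlonglongrightarrow> indicator {0..t} r * nse \<nu> (vh r) \<phi>"
      proof (intro AE_I2 tendsto_mult tendsto_const)
        fix r
        have "(\<lambda>n. nse \<nu> (vh r) (\<gamma> n)) \<longlonglongrightarrow> nse \<nu> (vh r) \<phi>"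
          by (rule nse_tendsto[OF vh_V vh_V _ \<gamma>V \<phi> \<gamma>(2)]) (use Vm.d_refl[OF vh_V[of r]] in simp)
        then show "(\<lambda>n. nse \<nu> (vh r) (\<gamma> (n + n0))) \<longlonglongrightarrow> nse \<nu> (vh r) \<phi>" by (rule LIMSEQ_ignore_initial_segment)
      qed
      show "AE r in lborel. norm (indicator {0..t} r * nse \<nu> (vh r) (\<gamma> (n + n0))) \<le> indicator {0..t} r * ((3 + \<nu>) * (1 + (H1_norm \<Omega> (vh r))\<^sup>2) * (1 + H1_norm \<Omega> \<phi>))" for n
      proof (intro AE_I2)
        fix r
        have "\<bar>nse \<nu> (vh r) (\<gamma> (n + n0))\<bar> \<le> (3 + \<nu>) * (1 + (H1_norm \<Omega> (vh r))\<^sup>2) * H1_norm \<Omega> (\<gamma> (n + n0))"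
          using \<nu> by (intro nse_bound vh_V \<gamma>V) simp
        also have "\<dots> \<le> (3 + \<nu>) * (1 + (H1_norm \<Omega> (vh r))\<^sup>2) * (1 + H1_norm \<Omega> \<phi>)"
          using \<nu> by (intro mult_left_mono b) auto
        finally show "norm (indicator {0..t} r * nse \<nu> (vh r) (\<gamma> (n + n0))) \<le> indicator {0..t} r * ((3 + \<nu>) * (1 + (H1_norm \<Omega> (vh r))\<^sup>2) * (1 + H1_norm \<Omega> \<phi>))"
          by (auto simp: indicator_def)
      qed
    qed
    then show ?thesis by (rule LIMSEQ_offset)
  qed
  have "(\<lambda>n. L2_inner \<Omega> (v t) (\<gamma> n)) \<longlonglongrightarrow> L2_inner \<Omega> v\<^sub>0 \<phi> + (LINT r|lborel. indicator {0..t} r * nse \<nu> (vh r) \<phi>)"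
    unfolding weak_evolution_test[OF \<gamma>(1) t] by (intro tendsto_add 1 2 H_L2[OF v0])
  with 1[OF v_L2[OF t]] show ?thesis using LIMSEQ_unique by blast
qed

lemma weak_increment:
  assumes \<phi>: "\<phi> \<in> V_space \<Omega>" and st: "0 \<le> a" "a \<le> b"
  shows "L2_inner \<Omega> (v b) \<phi> - L2_inner \<Omega> (v a) \<phi> = (LINT r|lborel. indicator {a..b} r * nse \<nu> (vh r) \<phi>)"
    "integrable lborel (\<lambda>r. indicator {a..b} r * nse \<nu> (vh r) \<phi>)"
  using weak_evolution[OF \<phi>, of a] weak_evolution[OF \<phi>, of b] st
    indefinite_integral_diff[OF nse_integrable[OF \<phi>] st] by auto

lemma gradient_sq_integrable:
  "integrable lborel (\<lambda>t. (L2_norm \<Omega> (weak_gradient \<Omega> (vh t)))\<^sup>2)"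
proof (rule Bochner_Integration.integrable_bound[OF vh_int])
  have "(\<lambda>t. L2_inner \<Omega> (weak_gradient \<Omega> (vh t)) (weak_gradient \<Omega> (vh t))) \<in> borel_measurable lborel"
    by (rule Vm.approx_measurable[OF approx approx]) (rule gradient_inner_tendsto)
  then show "(\<lambda>t. (L2_norm \<Omega> (weak_gradient \<Omega> (vh t)))\<^sup>2) \<in> borel_measurable lborel" by (simp add: L2_inner_self)
  show "AE t in lborel. norm ((L2_norm \<Omega> (weak_gradient \<Omega> (vh t)))\<^sup>2) \<le> norm ((H1_norm \<Omega> (vh t))\<^sup>2)"
    by (auto intro!: power_mono L2_le_H1)
qed

lemma energy:
  assumes t: "0 < t"
  shows "(L2_norm \<Omega> (v t))\<^sup>2 + 2 * \<nu> * (LINT r|lborel. indicator {0..t} r * (L2_norm \<Omega> (weak_gradient \<Omega> (vh r)))\<^sup>2) \<le> (L2_norm \<Omega> v\<^sub>0)\<^sup>2"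
proof -
  have "(LINT r|lebesgue_on {0..t}. (L2_norm \<Omega> (weak_gradient \<Omega> (v r)))\<^sup>2) = (LINT r|lborel. indicator {0..t} r * (L2_norm \<Omega> (weak_gradient \<Omega> (vh r)))\<^sup>2)"
  proof (rule integral_lebesgue_on_AE)
    show "(\<lambda>r. (L2_norm \<Omega> (weak_gradient \<Omega> (vh r)))\<^sup>2) \<in> borel_measurable borel"
      using borel_measurable_integrable[OF gradient_sq_integrable] by simp
    have "AE r in lborel. r \<noteq> (0::real)" by (rule AE_lborel_singleton)
    then show "AE r in lborel. r \<in> {0..t} \<longrightarrow> (L2_norm \<Omega> (weak_gradient \<Omega> (v r)))\<^sup>2 = (L2_norm \<Omega> (weak_gradient \<Omega> (vh r)))\<^sup>2"
      using vh_AE by eventually_elim auto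
  qed simp
  note eq = this
  have "energy_inequality \<nu> \<Omega> v\<^sub>0 v" using LH by (simp add: Leray_Hopf_solution_def)
  from this[unfolded energy_inequality_def, rule_format, OF t] show ?thesis unfolding eq .
qed

lemma v_bound:
  assumes "0 \<le> t"
  shows "L2_norm \<Omega> (v t) \<le> L2_norm \<Omega> v\<^sub>0"
\<comment> \<open>The energy inequality speaks of t > 0; at t = 0 the initial value is attained in
  L2.\<close>
proof (cases "t = 0")
  case True
  then show ?thesis
    using L2_norm_abs_diff_le[OF v_L2[of 0] H_L2[OF v0]] initial_L2 by simp
next
  case False
  then have t: "0 < t" using assms by simp
  have "0 \<le> (LINT r|lborel. indicator {0..t} r * (L2_norm \<Omega> (weak_gradient \<Omega> (vh r)))\<^sup>2)"
    by (intro integral_nonneg_AE AE_I2) auto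
  then have "0 \<le> 2 * \<nu> * (LINT r|lborel. indicator {0..t} r * (L2_norm \<Omega> (weak_gradient \<Omega> (vh r)))\<^sup>2)"
    using \<nu> by simp
  then have "(L2_norm \<Omega> (v t))\<^sup>2 \<le> (L2_norm \<Omega> v\<^sub>0)\<^sup>2" using energy[OF t] by linarith
  then show ?thesis by (rule power2_le_imp_le) simp
qed

lemma vh_bound: "L2_norm \<Omega> (vh t) \<le> L2_norm \<Omega> v\<^sub>0"
proof -
  have "L2_norm \<Omega> (\<lambda>_. 0 :: real^3) = 0" by (simp add: L2_norm_def)
  then show ?thesis using vh_cases[of t] v_bound[of t] L2_norm_nonneg[of \<Omega> v\<^sub>0] by (metis less_imp_le)
qed

end

section \<open>The cross identity\<close>

text \<open>Young's inequality with exponents 4/3 and 4 for a^(3/2) e^(1/2), up to constants. It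
  suffices to see which term dominates: the first one for e <= delta^2 a, the second one
  otherwise.\<close>

lemma Young_3_2:
  fixes a e \<delta> :: real
  assumes "0 \<le> a" "0 \<le> e" "0 < \<delta>"
  shows "sqrt (a ^ 3 * e) \<le> \<delta> * a\<^sup>2 + e\<^sup>2 / \<delta> ^ 3"
proof (cases "e \<le> \<delta>\<^sup>2 * a")
  case True
  have "sqrt (a ^ 3 * e) \<le> \<delta> * a\<^sup>2"
  proof (rule real_le_lsqrt)
    have "a ^ 3 * e \<le> a ^ 3 * (\<delta>\<^sup>2 * a)" using True assms by (intro mult_left_mono) auto
    then show "a ^ 3 * e \<le> (\<delta> * a\<^sup>2)\<^sup>2" by (simp add: power2_eq_square power3_eq_cube algebra_simps)
  qed (use assms in auto)
  then show ?thesis using assms by (simp add: add_increasing2)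
next
  case False
  then have a: "a \<le> e / \<delta>\<^sup>2" using assms by (simp add: field_simps)
  have "sqrt (a ^ 3 * e) \<le> e\<^sup>2 / \<delta> ^ 3"
  proof (rule real_le_lsqrt)
    have "a ^ 3 * e \<le> (e / \<delta>\<^sup>2) ^ 3 * e" using a assms by (intro mult_right_mono power_mono) auto
    also have "\<dots> = (e\<^sup>2 / \<delta> ^ 3)\<^sup>2" by (simp add: power_divide flip: power_mult) (simp add: power2_eq_square power3_eq_cube eval_nat_numeral)
    finally show "a ^ 3 * e \<le> (e\<^sup>2 / \<delta> ^ 3)\<^sup>2" .
  qed (use assms in auto)
  then show ?thesis using assms by (simp add: add_increasing)
qed

lemma Young_1_1:
  fixes a e \<delta> :: real
  assumes "0 < \<delta>"
  shows "a * e \<le> \<delta> * a\<^sup>2 + e\<^sup>2 / \<delta>"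
proof -
  have "0 \<le> (\<delta> * a - e)\<^sup>2 + (\<delta> * a)\<^sup>2 + e\<^sup>2" by simp
  then have "2 * (\<delta> * a * e) \<le> 2 * (\<delta>\<^sup>2 * a\<^sup>2 + e\<^sup>2)" by (simp add: power2_eq_square algebra_simps)
  then have "\<delta> * (a * e) \<le> \<delta> * (\<delta> * a\<^sup>2 + e\<^sup>2 / \<delta>)" using assms by (simp add: power2_eq_square algebra_simps)
  then show ?thesis using assms by (simp only: mult_le_cancel_left_pos)
qed

context axi
begin

text \<open>Antisymmetry moves the derivative off \<open>\<phi>\<close>, which then stands where its
  symmetry helps. What remains is of order |v|_V^(3/2) |phi|_V^(1/2), and Young's inequality leaves
  squares only. The parameter puts a small factor on \<open>v\<close> and a large one on
  \<open>\<phi>\<close>, which will be a time difference that is small in L2(V).\<close>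

lemma nse_axisymmetric_target:
  assumes v: "v \<in> V_space \<Omega>" and \<phi>: "\<phi> \<in> V_space \<Omega>" and ax: "axisymmetric \<Omega> \<phi>"
    and P: "L2_norm \<Omega> \<phi> \<le> P" and Q: "L2_norm \<Omega> v \<le> Q" and \<delta>: "0 < \<delta>" and \<nu>: "0 \<le> \<nu>"
  shows "\<bar>nse \<nu> v \<phi>\<bar> \<le> (K_aniso * sqrt (P * Q) + \<nu>) * (\<delta> * (H1_norm \<Omega> v)\<^sup>2 + (1 / \<delta> ^ 3 + 1 / \<delta>) * (H1_norm \<Omega> \<phi>)\<^sup>2)"
proof -
  define a e where "a = H1_norm \<Omega> v" and "e = H1_norm \<Omega> \<phi>"
  have ae: "0 \<le> a" "0 \<le> e" by (simp_all add: a_def e_def)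
  have PQ: "0 \<le> P" "0 \<le> Q" using P Q L2_norm_nonneg order_trans by blast+
  define R where "R = \<delta> * a\<^sup>2 + (1 / \<delta> ^ 3 + 1 / \<delta>) * e\<^sup>2"
  have R1: "sqrt (a ^ 3 * e) \<le> R"
  proof -
    have "sqrt (a ^ 3 * e) \<le> \<delta> * a\<^sup>2 + e\<^sup>2 / \<delta> ^ 3" by (rule Young_3_2[OF ae \<delta>])
    also have "\<dots> \<le> R" using \<delta> by (simp add: R_def algebra_simps)
    finally show ?thesis .
  qed
  have R2: "a * e \<le> R"
  proof -
    have "a * e \<le> \<delta> * a\<^sup>2 + e\<^sup>2 / \<delta>" by (rule Young_1_1[OF \<delta>])
    also have "\<dots> \<le> R" using \<delta> by (simp add: R_def algebra_simps)
    finally show ?thesis .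
  qed
  define x y where "x = L2_norm \<Omega> (weak_gradient \<Omega> v)" and "y = L2_norm \<Omega> (weak_gradient \<Omega> \<phi>)"
  have xy: "0 \<le> x" "x \<le> a" "0 \<le> y" "y \<le> e" by (auto simp: x_def y_def a_def e_def L2_le_H1)
  have "\<bar>conv v \<phi> v\<bar> = \<bar>conv v v \<phi>\<bar>" using conv_antisym[OF v \<phi> v] by simp
  also have "\<dots> \<le> K_aniso * x * sqrt ((L2_norm \<Omega> \<phi> * y) * (L2_norm \<Omega> v * x))"
    unfolding x_def y_def by (rule abs_conv_axisymmetric_le[OF v v \<phi> ax])
  also have "\<dots> \<le> K_aniso * a * sqrt ((P * e) * (Q * a))"
    using xy PQ P Q ae K_aniso_nonneg by (intro mult_mono real_sqrt_le_mono) auto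
  also have "\<dots> = K_aniso * sqrt (P * Q) * sqrt (a ^ 3 * e)"
  proof -
    have "sqrt (a ^ 3 * e) = a * sqrt (a * e)"
      using ae by (simp add: power3_eq_cube real_sqrt_mult)
    moreover have "sqrt ((P * e) * (Q * a)) = sqrt (P * Q) * sqrt (a * e)"
      by (simp add: real_sqrt_mult)
    ultimately show ?thesis by simp
  qed
  also have "\<dots> \<le> K_aniso * sqrt (P * Q) * R"
    using PQ K_aniso_nonneg by (intro mult_left_mono R1) auto
  finally have 1: "\<bar>conv v \<phi> v\<bar> \<le> K_aniso * sqrt (P * Q) * R" .
  have "\<bar>\<nu> * L2_inner \<Omega> (weak_gradient \<Omega> v) (weak_gradient \<Omega> \<phi>)\<bar> \<le> \<nu> * (a * e)"
    using gradient_inner_bound[OF v \<phi>] \<nu> unfolding a_def e_def by (simp add: abs_mult mult_left_mono)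
  also have "\<dots> \<le> \<nu> * R" by (intro mult_left_mono R2 \<nu>)
  finally have "\<bar>nse \<nu> v \<phi>\<bar> \<le> (K_aniso * sqrt (P * Q) + \<nu>) * R"
    using 1 unfolding nse_def distrib_right by linarith
  then show ?thesis by (simp add: R_def a_def e_def)
qed

text \<open>Now the symmetric field is the convecting one: its squared L4 norm is at most
  \<open>K_aniso\<close> P |u|_V, so the convective term is bounded by a plain product |u|_V
  |phi|_V. The result is brought into the same form as in \<open>nse_axisymmetric_target\<close>, so
  that the two contributions can be added.\<close>

lemma nse_axisymmetric_source:
  assumes u: "u \<in> V_space \<Omega>" and \<phi>: "\<phi> \<in> V_space \<Omega>" and ax: "axisymmetric \<Omega> u"
    and P: "L2_norm \<Omega> u \<le> P" and \<delta>: "0 < \<delta>" and \<nu>: "0 \<le> \<nu>"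
  shows "\<bar>nse \<nu> u \<phi>\<bar> \<le> (K_aniso * P + \<nu>) * (\<delta> * (H1_norm \<Omega> u)\<^sup>2 + (1 / \<delta> ^ 3 + 1 / \<delta>) * (H1_norm \<Omega> \<phi>)\<^sup>2)"
proof -
  define a e where "a = H1_norm \<Omega> u" and "e = H1_norm \<Omega> \<phi>"
  have ae: "0 \<le> a" "0 \<le> e" by (simp_all add: a_def e_def)
  have P0: "0 \<le> P" using P L2_norm_nonneg order_trans by blast
  have R2: "a * e \<le> \<delta> * a\<^sup>2 + (1 / \<delta> ^ 3 + 1 / \<delta>) * e\<^sup>2"
  proof -
    have "a * e \<le> \<delta> * a\<^sup>2 + e\<^sup>2 / \<delta>" by (rule Young_1_1[OF \<delta>])
    also have "\<dots> \<le> \<delta> * a\<^sup>2 + (1 / \<delta> ^ 3 + 1 / \<delta>) * e\<^sup>2" using \<delta> by (simp add: algebra_simps)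
    finally show ?thesis .
  qed
  have "L2_norm \<Omega> (\<lambda>x. norm (u x) * norm (u x)) = L2_norm \<Omega> (\<lambda>x. (norm (u x))\<^sup>2)" by (simp add: power2_eq_square)
  also have "\<dots> \<le> K_aniso * (L2_norm \<Omega> u * L2_norm \<Omega> (weak_gradient \<Omega> u))" by (rule V_axisymmetric_L4[OF u ax])
  also have "\<dots> \<le> K_aniso * (P * a)"
    using P P0 K_aniso_nonneg by (intro mult_left_mono mult_mono) (auto simp: a_def L2_le_H1)
  finally have n: "L2_norm \<Omega> (\<lambda>x. norm (u x) * norm (u x)) \<le> K_aniso * (P * a)" .
  have "\<bar>conv u \<phi> u\<bar> \<le> L2_norm \<Omega> (weak_gradient \<Omega> \<phi>) * L2_norm \<Omega> (\<lambda>x. norm (u x) * norm (u x))"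
    by (rule abs_conv_le(1)[OF u \<phi> u])
  also have "\<dots> \<le> e * (K_aniso * (P * a))"
    by (intro mult_mono n) (use ae in \<open>auto simp: e_def L2_le_H1\<close>)
  finally have 1: "\<bar>conv u \<phi> u\<bar> \<le> K_aniso * P * (a * e)" by (simp add: ac_simps)
  have 2: "\<bar>\<nu> * L2_inner \<Omega> (weak_gradient \<Omega> u) (weak_gradient \<Omega> \<phi>)\<bar> \<le> \<nu> * (a * e)"
    using gradient_inner_bound[OF u \<phi>] \<nu> unfolding a_def e_def by (simp add: abs_mult mult_left_mono)
  have "\<bar>nse \<nu> u \<phi>\<bar> \<le> (K_aniso * P + \<nu>) * (a * e)"
    using 1 2 unfolding nse_def distrib_right by linarith
  also have "\<dots> \<le> (K_aniso * P + \<nu>) * (\<delta> * a\<^sup>2 + (1 / \<delta> ^ 3 + 1 / \<delta>) * e\<^sup>2)"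
    using P0 K_aniso_nonneg \<nu> by (intro mult_left_mono R2) auto
  finally show ?thesis by (simp add: a_def e_def)
qed

end

section \<open>The pairing of two solutions and its increments in time\<close>

locale weak_strong = axi \<Omega> D r\<^sub>0 r\<^sub>1 + U: leray_hopf \<Omega> \<nu> u\<^sub>0 u uh su + W: leray_hopf \<Omega> \<nu> v\<^sub>0 v vh sv
  for \<Omega> D r\<^sub>0 r\<^sub>1 \<nu> u\<^sub>0 u uh su v\<^sub>0 v vh sv +
  assumes uh_axi: "\<And>t. axisymmetric \<Omega> (uh t)" and v_strong: "v \<in> C0_strong \<Omega>"
begin

text \<open>Large enough for the bounds in both roles. The factor 2 under the root is there because
  the test field in the equation of \<open>v\<close> will be a difference of two values of
  \<open>uh\<close>.\<close>

definition K\<^sub>1 :: real where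
  "K\<^sub>1 = K_aniso * sqrt (2 * L2_norm \<Omega> u\<^sub>0 * L2_norm \<Omega> v\<^sub>0) + K_aniso * L2_norm \<Omega> u\<^sub>0 + \<nu>"

lemma K1_pos: "0 < K\<^sub>1"
  using U.\<nu> K_aniso_nonneg by (simp add: K\<^sub>1_def add_nonneg_pos)

lemma nse_vh_bound:
  assumes \<phi>: "\<phi> \<in> V_space \<Omega>" "axisymmetric \<Omega> \<phi>" "L2_norm \<Omega> \<phi> \<le> 2 * L2_norm \<Omega> u\<^sub>0" and \<delta>: "0 < \<delta>"
  shows "\<bar>nse \<nu> (vh \<sigma>) \<phi>\<bar> \<le> K\<^sub>1 * (\<delta> * (H1_norm \<Omega> (vh \<sigma>))\<^sup>2 + (1 / \<delta> ^ 3 + 1 / \<delta>) * (H1_norm \<Omega> \<phi>)\<^sup>2)"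
proof -
  have "\<bar>nse \<nu> (vh \<sigma>) \<phi>\<bar> \<le> (K_aniso * sqrt (2 * L2_norm \<Omega> u\<^sub>0 * L2_norm \<Omega> v\<^sub>0) + \<nu>) * (\<delta> * (H1_norm \<Omega> (vh \<sigma>))\<^sup>2 + (1 / \<delta> ^ 3 + 1 / \<delta>) * (H1_norm \<Omega> \<phi>)\<^sup>2)"
    using nse_axisymmetric_target[OF W.vh_V \<phi> W.vh_bound \<delta>] U.\<nu> by (simp add: less_imp_le)
  also have "\<dots> \<le> K\<^sub>1 * (\<delta> * (H1_norm \<Omega> (vh \<sigma>))\<^sup>2 + (1 / \<delta> ^ 3 + 1 / \<delta>) * (H1_norm \<Omega> \<phi>)\<^sup>2)"
    using \<delta> K_aniso_nonneg by (intro mult_right_mono) (auto simp: K\<^sub>1_def)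
  finally show ?thesis .
qed

lemma nse_uh_bound:
  assumes \<phi>: "\<phi> \<in> V_space \<Omega>" and \<delta>: "0 < \<delta>"
  shows "\<bar>nse \<nu> (uh \<sigma>) \<phi>\<bar> \<le> K\<^sub>1 * (\<delta> * (H1_norm \<Omega> (uh \<sigma>))\<^sup>2 + (1 / \<delta> ^ 3 + 1 / \<delta>) * (H1_norm \<Omega> \<phi>)\<^sup>2)"
proof -
  have "\<bar>nse \<nu> (uh \<sigma>) \<phi>\<bar> \<le> (K_aniso * L2_norm \<Omega> u\<^sub>0 + \<nu>) * (\<delta> * (H1_norm \<Omega> (uh \<sigma>))\<^sup>2 + (1 / \<delta> ^ 3 + 1 / \<delta>) * (H1_norm \<Omega> \<phi>)\<^sup>2)"
    using nse_axisymmetric_source[OF U.vh_V \<phi> uh_axi U.vh_bound \<delta>] U.\<nu> by (simp add: less_imp_le)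
  also have "\<dots> \<le> K\<^sub>1 * (\<delta> * (H1_norm \<Omega> (uh \<sigma>))\<^sup>2 + (1 / \<delta> ^ 3 + 1 / \<delta>) * (H1_norm \<Omega> \<phi>)\<^sup>2)"
    using \<delta> K_aniso_nonneg by (intro mult_right_mono) (auto simp: K\<^sub>1_def)
  finally show ?thesis .
qed

text \<open>Formally the time derivative of (v, u).\<close>

definition J :: "real \<Rightarrow> real" where
  "J r = nse \<nu> (vh r) (uh r) + nse \<nu> (uh r) (vh r)"

definition A :: "real \<Rightarrow> real" where
  "A r = (H1_norm \<Omega> (vh r))\<^sup>2 + (H1_norm \<Omega> (uh r))\<^sup>2"

lemma A_nonneg: "0 \<le> A r" by (simp add: A_def)

lemma A_integrable: "integrable lborel A"
  unfolding A_def[abs_def] using U.vh_int W.vh_int by simp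

text \<open>Both bounds are taken with delta = 1, where 1 / delta^3 + 1 / delta = 2, so that they
  add up to 3 \<open>A\<close>. The symmetry of \<open>uh\<close> is essential here, since the
  general bound is cubic in the H1 norms.\<close>

lemma J_integrable: "integrable lborel J"
proof (rule Bochner_Integration.integrable_bound)
  show "integrable lborel (\<lambda>r. K\<^sub>1 * (3 * A r))" using A_integrable by simp
  show "J \<in> borel_measurable lborel"
    unfolding J_def[abs_def]
    by (rule Vm.approx_measurable[OF W.approx U.approx, of "\<lambda>a b. nse \<nu> a b + nse \<nu> b a"])
       (intro tendsto_add nse_tendsto)
  have "\<bar>J r\<bar> \<le> K\<^sub>1 * (3 * A r)" for r
  proof -
    have "L2_norm \<Omega> (uh r) \<le> 2 * L2_norm \<Omega> u\<^sub>0" using U.vh_bound[of r] L2_norm_nonneg[of \<Omega> u\<^sub>0] by linarith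
    then have "\<bar>nse \<nu> (vh r) (uh r)\<bar> \<le> K\<^sub>1 * ((H1_norm \<Omega> (vh r))\<^sup>2 + 2 * (H1_norm \<Omega> (uh r))\<^sup>2)"
      using nse_vh_bound[OF U.vh_V uh_axi, of r 1 r] by simp
    moreover have "\<bar>nse \<nu> (uh r) (vh r)\<bar> \<le> K\<^sub>1 * ((H1_norm \<Omega> (uh r))\<^sup>2 + 2 * (H1_norm \<Omega> (vh r))\<^sup>2)"
      using nse_uh_bound[OF W.vh_V, of 1 r r] by simp
    ultimately show ?thesis unfolding J_def A_def by (simp add: algebra_simps)
  qed
  then show "AE r in lborel. norm (J r) \<le> norm (K\<^sub>1 * (3 * A r))"
    using K1_pos A_nonneg by (auto simp: abs_mult)
qed

text \<open>An inner product is continuous along one strongly and one weakly convergent factor if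
  the weak one stays bounded. The strong factor is \<open>v\<close>; the bound on \<open>u\<close>
  comes from its energy inequality.\<close>

lemma inner_continuous: "continuous_on {0..} (\<lambda>t. L2_inner \<Omega> (v t) (u t))"
proof (rule continuous_on_eq_continuous_within[THEN iffD2], rule ballI)
  fix t :: real assume "t \<in> {0..}"
  then have t: "0 \<le> t" by simp
  have "((\<lambda>s. L2_inner \<Omega> (v s) (u s)) \<longlongrightarrow> L2_inner \<Omega> (v t) (u t)) (at t within {0..})"
  proof (rule LIM_zero_cancel, rule Lim_null_comparison)
    show "\<forall>\<^sub>F s in at t within {0..}. norm (L2_inner \<Omega> (v s) (u s) - L2_inner \<Omega> (v t) (u t)) \<le>
        L2_norm \<Omega> (\<lambda>x. v s x - v t x) * L2_norm \<Omega> u\<^sub>0 + \<bar>L2_inner \<Omega> (u s) (v t) - L2_inner \<Omega> (u t) (v t)\<bar>"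
      unfolding eventually_at_filter
    proof (intro always_eventually allI impI)
      fix s :: real assume "s \<noteq> t" "s \<in> {0..}"
      then have s: "0 \<le> s" by simp
      note L = W.v_L2[OF s] W.v_L2[OF t] U.v_L2[OF s]
      have "L2_inner \<Omega> (v s) (u s) - L2_inner \<Omega> (v t) (u t) =
          L2_inner \<Omega> (\<lambda>x. v s x - v t x) (u s) + (L2_inner \<Omega> (u s) (v t) - L2_inner \<Omega> (u t) (v t))"
        using L2_inner_diff_left[OF L(1,2,3)] by (simp add: L2_inner_commute[of \<Omega> _ "v t"])
      moreover have "\<bar>L2_inner \<Omega> (\<lambda>x. v s x - v t x) (u s)\<bar> \<le> L2_norm \<Omega> (\<lambda>x. v s x - v t x) * L2_norm \<Omega> u\<^sub>0"
        by (rule order_trans[OF abs_L2_inner_le[OF L2_fields_diff[OF L(1,2)] L(3)]])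
           (intro mult_left_mono U.v_bound s; simp)
      ultimately show "norm (L2_inner \<Omega> (v s) (u s) - L2_inner \<Omega> (v t) (u t)) \<le>
        L2_norm \<Omega> (\<lambda>x. v s x - v t x) * L2_norm \<Omega> u\<^sub>0 + \<bar>L2_inner \<Omega> (u s) (v t) - L2_inner \<Omega> (u t) (v t)\<bar>" by simp
    qed
    have 1: "((\<lambda>s. L2_norm \<Omega> (\<lambda>x. v s x - v t x)) \<longlongrightarrow> 0) (at t within {0..})"
      using v_strong t by (simp add: C0_strong_def)
    have 2: "((\<lambda>s. L2_inner \<Omega> (u s) (v t)) \<longlongrightarrow> L2_inner \<Omega> (u t) (v t)) (at t within {0..})"
      using U.v_weakly_continuous[OF W.v_L2[OF t]] t by (simp add: continuous_on_def)
    have "((\<lambda>s. L2_norm \<Omega> (\<lambda>x. v s x - v t x) * L2_norm \<Omega> u\<^sub>0 + \<bar>L2_inner \<Omega> (u s) (v t) - L2_inner \<Omega> (u t) (v t)\<bar>) \<longlongrightarrow> 0 * L2_norm \<Omega> u\<^sub>0 + \<bar>0\<bar>) (at t within {0..})"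
      by (intro tendsto_intros 1 LIM_zero[OF 2])
    then show "((\<lambda>s. L2_norm \<Omega> (\<lambda>x. v s x - v t x) * L2_norm \<Omega> u\<^sub>0 + \<bar>L2_inner \<Omega> (u s) (v t) - L2_inner \<Omega> (u t) (v t)\<bar>) \<longlongrightarrow> 0) (at t within {0..})" by simp
  qed
  then show "continuous (at t within {0..}) (\<lambda>t. L2_inner \<Omega> (v t) (u t))" by (simp add: continuous_within)
qed

definition G :: "real \<Rightarrow> real" where
  "G t = L2_inner \<Omega> (v t) (u t) - (LINT r|lborel. indicator {0..t} r * J r)"

lemma G_continuous: "continuous_on {0..} G"
  unfolding G_def[abs_def]
  by (intro continuous_on_diff inner_continuous indefinite_integral_continuous_lborel integrable_restrict_Icc J_integrable)

text \<open>
  Testing the equation of \<open>v\<close> with \<open>u (\<tau> + h)\<close> and that of \<open>u\<close> with \<open>v \<tau>\<close> makes the increment exact;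
  after subtracting \<open>J\<close> only differences of the fields at nearby times are left.
\<close>

lemma G_increment:
  assumes \<tau>: "0 \<le> \<tau>" and h: "0 \<le> h" and v\<tau>: "vh \<tau> = v \<tau>" and u\<tau>: "uh (\<tau> + h) = u (\<tau> + h)" and \<delta>: "0 < \<delta>"
  shows "ennreal \<bar>G (\<tau> + h) - G \<tau>\<bar> \<le>
     ennreal (K\<^sub>1 * \<delta>) * (\<integral>\<^sup>+\<sigma>. ennreal (A \<sigma>) * indicator {\<tau>..\<tau> + h} \<sigma> \<partial>lborel) +
     ennreal (K\<^sub>1 * (1 / \<delta> ^ 3 + 1 / \<delta>)) * (\<integral>\<^sup>+\<sigma>. ennreal ((dV (uh (\<tau> + h)) (uh \<sigma>))\<^sup>2) * indicator {\<tau>..\<tau> + h} \<sigma> \<partial>lborel) +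
     ennreal (K\<^sub>1 * (1 / \<delta> ^ 3 + 1 / \<delta>)) * (\<integral>\<^sup>+\<sigma>. ennreal ((dV (vh \<sigma>) (vh \<tau>))\<^sup>2) * indicator {\<tau>..\<tau> + h} \<sigma> \<partial>lborel)"
proof -
  have h': "\<tau> \<le> \<tau> + h" using h by simp
  have \<tau>h: "0 \<le> \<tau> + h" using \<tau> h by simp
  note ui = U.weak_increment[OF W.vh_V[of \<tau>] \<tau> h'] and vi = W.weak_increment[OF U.vh_V[of "\<tau> + h"] \<tau> h']
  note Ji = indefinite_integral_diff[OF integrable_restrict_Icc[OF J_integrable] \<tau> h']
  define c where "c = 1 / \<delta> ^ 3 + 1 / \<delta>"
  have c0: "0 \<le> c" using \<delta> by (simp add: c_def)
  define f where "f \<sigma> = nse \<nu> (vh \<sigma>) (uh (\<tau> + h)) + nse \<nu> (uh \<sigma>) (vh \<tau>) - J \<sigma>" for \<sigma>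
  have fi: "integrable lborel (\<lambda>\<sigma>. indicator {\<tau>..\<tau> + h} \<sigma> * f \<sigma>)"
    using ui(2) vi(2) Ji(2) by (simp add: f_def distrib_left right_diff_distrib)
  have "L2_inner \<Omega> (v (\<tau> + h)) (u (\<tau> + h)) - L2_inner \<Omega> (v \<tau>) (u \<tau>) =
      (L2_inner \<Omega> (v (\<tau> + h)) (uh (\<tau> + h)) - L2_inner \<Omega> (v \<tau>) (uh (\<tau> + h))) +
      (L2_inner \<Omega> (u (\<tau> + h)) (vh \<tau>) - L2_inner \<Omega> (u \<tau>) (vh \<tau>))"
    by (simp add: v\<tau> u\<tau> L2_inner_commute[of \<Omega> "v \<tau>"])
  then have "G (\<tau> + h) - G \<tau> = (LINT \<sigma>|lborel. indicator {\<tau>..\<tau> + h} \<sigma> * f \<sigma>)"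
    unfolding G_def using ui vi Ji by (simp add: f_def distrib_left right_diff_distrib)
  then have "ennreal \<bar>G (\<tau> + h) - G \<tau>\<bar> \<le> (\<integral>\<^sup>+\<sigma>. ennreal (norm (indicator {\<tau>..\<tau> + h} \<sigma> * f \<sigma>)) \<partial>lborel)"
    using integral_norm_bound_ennreal[OF fi] by simp
  also have "\<dots> \<le> (\<integral>\<^sup>+\<sigma>. ennreal (K\<^sub>1 * \<delta>) * (ennreal (A \<sigma>) * indicator {\<tau>..\<tau> + h} \<sigma>) +
     ennreal (K\<^sub>1 * c) * (ennreal ((dV (uh (\<tau> + h)) (uh \<sigma>))\<^sup>2) * indicator {\<tau>..\<tau> + h} \<sigma>) +
     ennreal (K\<^sub>1 * c) * (ennreal ((dV (vh \<sigma>) (vh \<tau>))\<^sup>2) * indicator {\<tau>..\<tau> + h} \<sigma>) \<partial>lborel)"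
  proof (rule nn_integral_mono)
    fix \<sigma>
    have f: "f \<sigma> = nse \<nu> (vh \<sigma>) (\<lambda>x. uh (\<tau> + h) x - uh \<sigma> x) + nse \<nu> (uh \<sigma>) (\<lambda>x. vh \<tau> x - vh \<sigma> x)"
      using nse_diff[OF W.vh_V[of \<sigma>] U.vh_V[of "\<tau> + h"] U.vh_V[of \<sigma>]] nse_diff[OF U.vh_V[of \<sigma>] W.vh_V[of \<tau>] W.vh_V[of \<sigma>]]
      by (simp add: f_def J_def)
    have n: "L2_norm \<Omega> (\<lambda>x. uh (\<tau> + h) x - uh \<sigma> x) \<le> 2 * L2_norm \<Omega> u\<^sub>0"
    proof -
      have "(\<lambda>_. 0 :: real^3) \<in> L2_fields \<Omega>" using V_L2[OF zero_V] .
      from L2_norm_triangle_diff[OF V_L2[OF U.vh_V[of "\<tau> + h"]] this V_L2[OF U.vh_V[of \<sigma>]]]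
      have "L2_norm \<Omega> (\<lambda>x. uh (\<tau> + h) x - uh \<sigma> x) \<le> L2_norm \<Omega> (uh (\<tau> + h)) + L2_norm \<Omega> (uh \<sigma>)"
        using L2_norm_commute[of \<Omega> "\<lambda>_. 0" "uh \<sigma>"] by simp
      then show ?thesis using U.vh_bound[of "\<tau> + h"] U.vh_bound[of \<sigma>] by linarith
    qed
    have 1: "\<bar>nse \<nu> (vh \<sigma>) (\<lambda>x. uh (\<tau> + h) x - uh \<sigma> x)\<bar> \<le> K\<^sub>1 * (\<delta> * (H1_norm \<Omega> (vh \<sigma>))\<^sup>2 + c * (dV (uh (\<tau> + h)) (uh \<sigma>))\<^sup>2)"
      unfolding c_def by (rule nse_vh_bound[OF V_diff[OF U.vh_V U.vh_V] axisymmetric_diff[OF uh_axi uh_axi] n \<delta>])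
    have 2: "\<bar>nse \<nu> (uh \<sigma>) (\<lambda>x. vh \<tau> x - vh \<sigma> x)\<bar> \<le> K\<^sub>1 * (\<delta> * (H1_norm \<Omega> (uh \<sigma>))\<^sup>2 + c * (dV (vh \<sigma>) (vh \<tau>))\<^sup>2)"
      using nse_uh_bound[OF V_diff[OF W.vh_V[of \<tau>] W.vh_V[of \<sigma>]] \<delta>, of \<sigma>] Vm.d_sym[OF W.vh_V[of \<sigma>] W.vh_V[of \<tau>]] unfolding c_def by simp
    have "\<bar>f \<sigma>\<bar> \<le> K\<^sub>1 * \<delta> * A \<sigma> + K\<^sub>1 * c * (dV (uh (\<tau> + h)) (uh \<sigma>))\<^sup>2 + K\<^sub>1 * c * (dV (vh \<sigma>) (vh \<tau>))\<^sup>2"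
      using 1 2 unfolding f A_def by (simp add: algebra_simps)
    then have "ennreal \<bar>f \<sigma>\<bar> \<le> ennreal (K\<^sub>1 * \<delta> * A \<sigma> + K\<^sub>1 * c * (dV (uh (\<tau> + h)) (uh \<sigma>))\<^sup>2 + K\<^sub>1 * c * (dV (vh \<sigma>) (vh \<tau>))\<^sup>2)"
      by (rule ennreal_leI)
    also have "\<dots> = ennreal (K\<^sub>1 * \<delta>) * ennreal (A \<sigma>) + ennreal (K\<^sub>1 * c) * ennreal ((dV (uh (\<tau> + h)) (uh \<sigma>))\<^sup>2) + ennreal (K\<^sub>1 * c) * ennreal ((dV (vh \<sigma>) (vh \<tau>))\<^sup>2)"
    proof -
      have p: "0 \<le> K\<^sub>1 * \<delta>" "0 \<le> K\<^sub>1 * c" using K1_pos \<delta> c0 by auto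
      have "ennreal (x * a + y * b + y * e) = ennreal x * ennreal a + ennreal y * ennreal b + ennreal y * ennreal e"
        if "0 \<le> x" "0 \<le> y" "0 \<le> a" "0 \<le> b" "0 \<le> e" for x y a b e
        using that by (simp add: ennreal_mult)
      from this[OF p A_nonneg] show ?thesis by simp
    qed
    finally show "ennreal (norm (indicator {\<tau>..\<tau> + h} \<sigma> * f \<sigma>)) \<le> ennreal (K\<^sub>1 * \<delta>) * (ennreal (A \<sigma>) * indicator {\<tau>..\<tau> + h} \<sigma>) +
     ennreal (K\<^sub>1 * c) * (ennreal ((dV (uh (\<tau> + h)) (uh \<sigma>))\<^sup>2) * indicator {\<tau>..\<tau> + h} \<sigma>) +
     ennreal (K\<^sub>1 * c) * (ennreal ((dV (vh \<sigma>) (vh \<tau>))\<^sup>2) * indicator {\<tau>..\<tau> + h} \<sigma>)"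
      by (cases "\<sigma> \<in> {\<tau>..\<tau> + h}") auto
  qed
  also have "\<dots> = ennreal (K\<^sub>1 * \<delta>) * (\<integral>\<^sup>+\<sigma>. ennreal (A \<sigma>) * indicator {\<tau>..\<tau> + h} \<sigma> \<partial>lborel) +
     ennreal (K\<^sub>1 * c) * (\<integral>\<^sup>+\<sigma>. ennreal ((dV (uh (\<tau> + h)) (uh \<sigma>))\<^sup>2) * indicator {\<tau>..\<tau> + h} \<sigma> \<partial>lborel) +
     ennreal (K\<^sub>1 * c) * (\<integral>\<^sup>+\<sigma>. ennreal ((dV (vh \<sigma>) (vh \<tau>))\<^sup>2) * indicator {\<tau>..\<tau> + h} \<sigma> \<partial>lborel)"
  proof -
    have [measurable]: "A \<in> borel_measurable borel" using borel_measurable_integrable[OF A_integrable] by simp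
    have [measurable]: "(\<lambda>\<sigma>. dV (uh (\<tau> + h)) (uh \<sigma>)) \<in> borel_measurable borel"
      using Vm.approx_d_measurable[OF Vm.approx_const[OF U.vh_V[of "\<tau> + h"]] U.approx] by simp
    have [measurable]: "(\<lambda>\<sigma>. dV (vh \<sigma>) (vh \<tau>)) \<in> borel_measurable borel"
      using Vm.approx_d_measurable[OF W.approx Vm.approx_const[OF W.vh_V[of \<tau>]]] by simp
    show ?thesis by (simp add: nn_integral_add nn_integral_cmult)
  qed
  finally show ?thesis by (simp add: c_def)
qed

text \<open>After exchanging the integrals, each sigma is counted for the times tau in an interval
  of length h.\<close>

lemma A_window:
  assumes h: "0 \<le> h"
  shows "(\<integral>\<^sup>+\<tau>. (\<integral>\<^sup>+\<sigma>. ennreal (A \<sigma>) * indicator {\<tau>..\<tau> + h} \<sigma> \<partial>lborel) * indicator {0..T} \<tau> \<partial>lborel) \<le> ennreal (h * (LINT r|lborel. A r))"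
proof -
  have [measurable]: "A \<in> borel_measurable borel" using borel_measurable_integrable[OF A_integrable] by simp
  have "(\<integral>\<^sup>+\<tau>. (\<integral>\<^sup>+\<sigma>. ennreal (A \<sigma>) * indicator {\<tau>..\<tau> + h} \<sigma> \<partial>lborel) * indicator {0..T} \<tau> \<partial>lborel) \<le>
      (\<integral>\<^sup>+\<tau>. \<integral>\<^sup>+\<sigma>. ennreal (A \<sigma>) * indicator {0..h} (\<sigma> - \<tau>) \<partial>lborel \<partial>lborel)"
  proof (rule nn_integral_mono)
    fix \<tau>
    have "(\<integral>\<^sup>+\<sigma>. ennreal (A \<sigma>) * indicator {\<tau>..\<tau> + h} \<sigma> \<partial>lborel) * indicator {0..T} \<tau> \<le> (\<integral>\<^sup>+\<sigma>. ennreal (A \<sigma>) * indicator {\<tau>..\<tau> + h} \<sigma> \<partial>lborel)"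
      by (auto simp: indicator_def)
    also have "\<dots> = (\<integral>\<^sup>+\<sigma>. ennreal (A \<sigma>) * indicator {0..h} (\<sigma> - \<tau>) \<partial>lborel)"
      by (intro nn_integral_cong) (auto simp: indicator_def)
    finally show "(\<integral>\<^sup>+\<sigma>. ennreal (A \<sigma>) * indicator {\<tau>..\<tau> + h} \<sigma> \<partial>lborel) * indicator {0..T} \<tau> \<le> (\<integral>\<^sup>+\<sigma>. ennreal (A \<sigma>) * indicator {0..h} (\<sigma> - \<tau>) \<partial>lborel)" .
  qed
  also have "\<dots> = (\<integral>\<^sup>+\<sigma>. \<integral>\<^sup>+\<tau>. ennreal (A \<sigma>) * indicator {0..h} (\<sigma> - \<tau>) \<partial>lborel \<partial>lborel)"
    by (rule lborel_pair.Fubini') measurable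
  also have "\<dots> = (\<integral>\<^sup>+\<sigma>. ennreal (A \<sigma>) * ennreal h \<partial>lborel)"
  proof (rule nn_integral_cong)
    fix \<sigma>
    have "(\<integral>\<^sup>+\<tau>. ennreal (A \<sigma>) * indicator {0..h} (\<sigma> - \<tau>) \<partial>lborel) = (\<integral>\<^sup>+\<tau>. ennreal (A \<sigma>) * indicator {\<sigma> - h..\<sigma>} \<tau> \<partial>lborel)"
      by (intro nn_integral_cong) (auto simp: indicator_def)
    also have "\<dots> = ennreal (A \<sigma>) * ennreal h" using h by (simp add: nn_integral_cmult)
    finally show "(\<integral>\<^sup>+\<tau>. ennreal (A \<sigma>) * indicator {0..h} (\<sigma> - \<tau>) \<partial>lborel) = ennreal (A \<sigma>) * ennreal h" .
  qed
  also have "\<dots> = (\<integral>\<^sup>+\<sigma>. ennreal (A \<sigma>) \<partial>lborel) * ennreal h" by (rule nn_integral_multc) simp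
  also have "(\<integral>\<^sup>+\<sigma>. ennreal (A \<sigma>) \<partial>lborel) = ennreal (LINT r|lborel. A r)"
    by (rule nn_integral_eq_integral[OF A_integrable]) (simp add: A_nonneg)
  finally show ?thesis using h A_nonneg by (simp add: ennreal_mult mult.commute)
qed

text \<open>By \<open>increments_vanish\<close> it is enough that the increments of \<open>G\<close>
  are small compared with h in the mean. The order of the choices matters: delta is fixed first and
  makes the term with \<open>A\<close> at most a third of epsilon h. The other two terms carry a
  factor that grows as delta shrinks; they are made small afterwards, by taking h small, through the
  continuity of translations in L2(V).\<close>

lemma cross_identity:
  assumes T: "0 \<le> T"
  shows "L2_inner \<Omega> (v T) (u T) = L2_inner \<Omega> v\<^sub>0 u\<^sub>0 + (LINT r|lborel. indicator {0..T} r * J r)"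
proof -
  have "G T = G 0"
  proof (rule increments_vanish[OF G_continuous T])
    fix \<epsilon> :: real assume \<epsilon>: "0 < \<epsilon>"
    define IA where "IA = (LINT r|lborel. A r)"
    have IA: "0 \<le> IA" unfolding IA_def using A_nonneg by simp
    define \<delta> where "\<delta> = \<epsilon> / (3 * (K\<^sub>1 * (IA + 1)))"
    have \<delta>: "0 < \<delta>" using \<epsilon> K1_pos IA by (simp add: \<delta>_def)
    define c where "c = K\<^sub>1 * (1 / \<delta> ^ 3 + 1 / \<delta>)"
    have c: "0 < c" using \<delta> K1_pos by (simp add: c_def add_pos_pos)
    define \<epsilon>' where "\<epsilon>' = \<epsilon> / (3 * c)"
    have \<epsilon>': "0 < \<epsilon>'" using \<epsilon> c by (simp add: \<epsilon>'_def)
    have ui: "integrable lborel (\<lambda>t. (dV (uh t) (\<lambda>_. 0))\<^sup>2)" and vi: "integrable lborel (\<lambda>t. (dV (vh t) (\<lambda>_. 0))\<^sup>2)"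
      using U.vh_int W.vh_int by simp_all
    obtain d1 where d1: "0 < d1"
      "\<And>h. 0 < h \<Longrightarrow> h \<le> d1 \<Longrightarrow> (\<integral>\<^sup>+\<tau>. (\<integral>\<^sup>+\<sigma>. ennreal ((dV (uh \<sigma>) (uh \<tau>))\<^sup>2) * indicator {\<tau>..\<tau> + h} \<sigma> \<partial>lborel) * indicator {0..T} \<tau> \<partial>lborel) \<le> ennreal (\<epsilon>' * h)"
      "\<And>h. 0 < h \<Longrightarrow> h \<le> d1 \<Longrightarrow> (\<integral>\<^sup>+\<tau>. (\<integral>\<^sup>+\<sigma>. ennreal ((dV (uh (\<tau> + h)) (uh \<sigma>))\<^sup>2) * indicator {\<tau>..\<tau> + h} \<sigma> \<partial>lborel) * indicator {0..T} \<tau> \<partial>lborel) \<le> ennreal (\<epsilon>' * h)"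
      using Vm.averaged_translation[OF U.approx zero_V ui T \<epsilon>'] by blast
    obtain d2 where d2: "0 < d2"
      "\<And>h. 0 < h \<Longrightarrow> h \<le> d2 \<Longrightarrow> (\<integral>\<^sup>+\<tau>. (\<integral>\<^sup>+\<sigma>. ennreal ((dV (vh \<sigma>) (vh \<tau>))\<^sup>2) * indicator {\<tau>..\<tau> + h} \<sigma> \<partial>lborel) * indicator {0..T} \<tau> \<partial>lborel) \<le> ennreal (\<epsilon>' * h)"
      "\<And>h. 0 < h \<Longrightarrow> h \<le> d2 \<Longrightarrow> (\<integral>\<^sup>+\<tau>. (\<integral>\<^sup>+\<sigma>. ennreal ((dV (vh (\<tau> + h)) (vh \<sigma>))\<^sup>2) * indicator {\<tau>..\<tau> + h} \<sigma> \<partial>lborel) * indicator {0..T} \<tau> \<partial>lborel) \<le> ennreal (\<epsilon>' * h)"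
      using Vm.averaged_translation[OF W.approx zero_V vi T \<epsilon>'] by blast
    show "\<exists>\<delta>>0. \<forall>h. 0 < h \<and> h \<le> \<delta> \<longrightarrow> (\<integral>\<^sup>+\<tau>. ennreal \<bar>G (\<tau> + h) - G \<tau>\<bar> * indicator {0..T} \<tau> \<partial>lborel) \<le> ennreal (\<epsilon> * h)"
    proof (intro exI[of _ "min d1 d2"] conjI allI impI)
      show "0 < min d1 d2" using d1(1) d2(1) by simp
      fix h assume "0 < h \<and> h \<le> min d1 d2"
      then have h: "0 < h" "h \<le> d1" "h \<le> d2" by auto
      define X1 X2 X3 where "X1 \<tau> = (\<integral>\<^sup>+\<sigma>. ennreal (A \<sigma>) * indicator {\<tau>..\<tau> + h} \<sigma> \<partial>lborel)"
        and "X2 \<tau> = (\<integral>\<^sup>+\<sigma>. ennreal ((dV (uh (\<tau> + h)) (uh \<sigma>))\<^sup>2) * indicator {\<tau>..\<tau> + h} \<sigma> \<partial>lborel)"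
        and "X3 \<tau> = (\<integral>\<^sup>+\<sigma>. ennreal ((dV (vh \<sigma>) (vh \<tau>))\<^sup>2) * indicator {\<tau>..\<tau> + h} \<sigma> \<partial>lborel)" for \<tau>
      have [measurable]: "A \<in> borel_measurable borel" using borel_measurable_integrable[OF A_integrable] by simp
      have Du: "(\<lambda>p. dV (uh (fst p + h)) (uh (snd p))) \<in> borel_measurable (borel \<Otimes>\<^sub>M borel)"
      proof (rule Vm.approx_d_measurable)
        show "Vm.approx (borel \<Otimes>\<^sub>M borel) (\<lambda>p. uh (fst p + h)) (\<lambda>n p. su n (fst p + h))"
          by (rule Vm.approx_compose[OF U.approx]) simp
        show "Vm.approx (borel \<Otimes>\<^sub>M borel) (\<lambda>p. uh (snd p)) (\<lambda>n p. su n (snd p))"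
          by (rule Vm.approx_compose[OF U.approx]) simp
      qed
      have Dv: "(\<lambda>p. dV (vh (snd p)) (vh (fst p))) \<in> borel_measurable (borel \<Otimes>\<^sub>M borel)"
      proof (rule Vm.approx_d_measurable)
        show "Vm.approx (borel \<Otimes>\<^sub>M borel) (\<lambda>p. vh (snd p)) (\<lambda>n p. sv n (snd p))"
          by (rule Vm.approx_compose[OF W.approx]) simp
        show "Vm.approx (borel \<Otimes>\<^sub>M borel) (\<lambda>p. vh (fst p)) (\<lambda>n p. sv n (fst p))"
          by (rule Vm.approx_compose[OF W.approx]) simp
      qed
      define Eu where "Eu p = ennreal ((dV (uh (fst p + h)) (uh (snd p)))\<^sup>2)" for p
      define Ev where "Ev p = ennreal ((dV (vh (snd p)) (vh (fst p)))\<^sup>2)" for p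
      have [measurable]: "Eu \<in> borel_measurable (borel \<Otimes>\<^sub>M borel)" unfolding Eu_def using Du by measurable
      have [measurable]: "Ev \<in> borel_measurable (borel \<Otimes>\<^sub>M borel)" unfolding Ev_def using Dv by measurable
      have X2e: "X2 = (\<lambda>\<tau>. \<integral>\<^sup>+\<sigma>. Eu (\<tau>, \<sigma>) * indicator {\<tau>..\<tau> + h} \<sigma> \<partial>lborel)" by (simp add: X2_def[abs_def] Eu_def)
      have X3e: "X3 = (\<lambda>\<tau>. \<integral>\<^sup>+\<sigma>. Ev (\<tau>, \<sigma>) * indicator {\<tau>..\<tau> + h} \<sigma> \<partial>lborel)" by (simp add: X3_def[abs_def] Ev_def)
      have ind: "indicator {\<tau>..\<tau> + h} \<sigma> = (indicator {0..h} (\<sigma> - \<tau>) :: ennreal)" for \<tau> \<sigma>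
        by (auto simp: indicator_def)
      have [measurable]: "X1 \<in> borel_measurable borel" unfolding X1_def[abs_def] ind by measurable
      have [measurable]: "X2 \<in> borel_measurable borel" unfolding X2e ind by measurable
      have [measurable]: "X3 \<in> borel_measurable borel" unfolding X3e ind by measurable
      \<comment> \<open>The increment is tested with \<open>uh\<close> at the shifted time, so the
        exceptional set is translated by h; it remains a null set.\<close>
      have aeu: "AE \<tau> in lborel. 0 < \<tau> + h \<longrightarrow> uh (\<tau> + h) = u (\<tau> + h)"
      proof -
        obtain Z where Z: "Z \<in> null_sets lborel" "{t \<in> space lborel. \<not> (0 < t \<longrightarrow> uh t = u t)} \<subseteq> Z"
          using U.vh_AE by (auto simp only: eventually_ae_filter)
        have "AE \<tau> in lborel. \<tau> + h \<notin> Z"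
        proof -
          have "emeasure lborel ((\<lambda>\<tau>. \<tau> + h) -` Z) = emeasure (distr lborel borel ((+) h)) Z"
            using Z(1) by (subst emeasure_distr) (auto simp: vimage_def add.commute)
          also have "\<dots> = 0" using null_setsD1[OF Z(1)] by (simp add: lborel_distr_plus)
          finally have "emeasure lborel ((\<lambda>\<tau>. \<tau> + h) -` Z) = 0" .
          moreover have "(\<lambda>\<tau>. \<tau> + h) -` Z \<in> sets lborel"
          proof -
            have "(\<lambda>\<tau>. \<tau> + h) -` Z \<inter> space lborel \<in> sets lborel"
              by (rule measurable_sets[of _ _ borel]) (use Z(1) in auto)
            then show ?thesis by simp
          qed
          ultimately have "(\<lambda>\<tau>. \<tau> + h) -` Z \<in> null_sets lborel" by (simp add: null_sets_def)
          from AE_not_in[OF this] show ?thesis by simp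
        qed
        then show ?thesis by eventually_elim (use Z(2) in auto)
      qed
      have "(\<integral>\<^sup>+\<tau>. ennreal \<bar>G (\<tau> + h) - G \<tau>\<bar> * indicator {0..T} \<tau> \<partial>lborel) \<le>
         (\<integral>\<^sup>+\<tau>. ennreal (K\<^sub>1 * \<delta>) * (X1 \<tau> * indicator {0..T} \<tau>) + ennreal c * (X2 \<tau> * indicator {0..T} \<tau>) + ennreal c * (X3 \<tau> * indicator {0..T} \<tau>) \<partial>lborel)"
      proof (rule nn_integral_mono_AE)
        have "AE \<tau> in lborel. \<tau> \<noteq> (0::real)" by (rule AE_lborel_singleton)
        then show "AE \<tau> in lborel. ennreal \<bar>G (\<tau> + h) - G \<tau>\<bar> * indicator {0..T} \<tau> \<le>
          ennreal (K\<^sub>1 * \<delta>) * (X1 \<tau> * indicator {0..T} \<tau>) + ennreal c * (X2 \<tau> * indicator {0..T} \<tau>) + ennreal c * (X3 \<tau> * indicator {0..T} \<tau>)"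
          using aeu W.vh_AE
        proof eventually_elim
          fix \<tau> :: real
          assume \<tau>: "\<tau> \<noteq> 0" "0 < \<tau> + h \<longrightarrow> uh (\<tau> + h) = u (\<tau> + h)" "0 < \<tau> \<longrightarrow> vh \<tau> = v \<tau>"
          show "ennreal \<bar>G (\<tau> + h) - G \<tau>\<bar> * indicator {0..T} \<tau> \<le>
            ennreal (K\<^sub>1 * \<delta>) * (X1 \<tau> * indicator {0..T} \<tau>) + ennreal c * (X2 \<tau> * indicator {0..T} \<tau>) + ennreal c * (X3 \<tau> * indicator {0..T} \<tau>)"
          proof (cases "\<tau> \<in> {0..T}")
            case True
            then have "0 < \<tau>" using \<tau>(1) by simp
            then show ?thesis
              using G_increment[of \<tau> h \<delta>] \<tau> h \<delta> True unfolding X1_def X2_def X3_def c_def by simp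
          qed simp
        qed
      qed
      also have "\<dots> = ennreal (K\<^sub>1 * \<delta>) * (\<integral>\<^sup>+\<tau>. X1 \<tau> * indicator {0..T} \<tau> \<partial>lborel) + ennreal c * (\<integral>\<^sup>+\<tau>. X2 \<tau> * indicator {0..T} \<tau> \<partial>lborel) + ennreal c * (\<integral>\<^sup>+\<tau>. X3 \<tau> * indicator {0..T} \<tau> \<partial>lborel)"
        by (simp add: nn_integral_add nn_integral_cmult)
      also have "\<dots> \<le> ennreal (K\<^sub>1 * \<delta>) * ennreal (h * IA) + ennreal c * ennreal (\<epsilon>' * h) + ennreal c * ennreal (\<epsilon>' * h)"
      proof (intro add_mono mult_left_mono)
        show "(\<integral>\<^sup>+\<tau>. X1 \<tau> * indicator {0..T} \<tau> \<partial>lborel) \<le> ennreal (h * IA)"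
          unfolding X1_def IA_def using A_window[of h T] h by simp
        show "(\<integral>\<^sup>+\<tau>. X2 \<tau> * indicator {0..T} \<tau> \<partial>lborel) \<le> ennreal (\<epsilon>' * h)" unfolding X2_def by (rule d1(3)[OF h(1,2)])
        show "(\<integral>\<^sup>+\<tau>. X3 \<tau> * indicator {0..T} \<tau> \<partial>lborel) \<le> ennreal (\<epsilon>' * h)" unfolding X3_def by (rule d2(2)[OF h(1,3)])
      qed auto
      also have "\<dots> = ennreal (K\<^sub>1 * \<delta> * (h * IA) + c * (\<epsilon>' * h) + c * (\<epsilon>' * h))"
      proof -
        have p: "0 \<le> K\<^sub>1 * \<delta>" "0 \<le> c" "0 \<le> h * IA" "0 \<le> \<epsilon>' * h" using K1_pos \<delta> c h IA \<epsilon>' by auto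
        then show ?thesis by (simp add: ennreal_mult[symmetric] flip: ennreal_plus)
      qed
      also have "\<dots> \<le> ennreal (\<epsilon> * h)"
      proof (rule ennreal_leI)
        have "K\<^sub>1 * \<delta> * IA \<le> \<epsilon> / 3"
        proof -
          have "K\<^sub>1 * \<delta> = \<epsilon> / (3 * (IA + 1))" using K1_pos by (simp add: \<delta>_def)
          then have "K\<^sub>1 * \<delta> * IA = \<epsilon> / 3 * (IA / (IA + 1))" by simp
          also have "\<dots> \<le> \<epsilon> / 3 * 1" using IA \<epsilon> by (intro mult_left_mono) auto
          finally show ?thesis by simp
        qed
        then have "K\<^sub>1 * \<delta> * (h * IA) \<le> \<epsilon> / 3 * h" using mult_right_mono[of "K\<^sub>1 * \<delta> * IA" "\<epsilon> / 3" h] h by (simp add: ac_simps)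
        moreover have "c * (\<epsilon>' * h) = \<epsilon> / 3 * h" using c by (simp add: \<epsilon>'_def)
        ultimately show "K\<^sub>1 * \<delta> * (h * IA) + c * (\<epsilon>' * h) + c * (\<epsilon>' * h) \<le> \<epsilon> * h" by linarith
      qed
      finally show "(\<integral>\<^sup>+\<tau>. ennreal \<bar>G (\<tau> + h) - G \<tau>\<bar> * indicator {0..T} \<tau> \<partial>lborel) \<le> ennreal (\<epsilon> * h)" .
    qed
  qed
  moreover have "G 0 = L2_inner \<Omega> v\<^sub>0 u\<^sub>0"
  proof -
    have "L2_inner \<Omega> (v 0) (u 0) = L2_inner \<Omega> v\<^sub>0 u\<^sub>0"
      using W.initial_inner[OF U.v_L2[of 0]] U.initial_inner[OF H_L2[OF W.v0]] by (simp add: L2_inner_commute)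
    then show ?thesis unfolding G_def integral_indicator_trivial_Icc by simp
  qed
  ultimately show ?thesis by (simp add: G_def)
qed

end

section \<open>Stability\<close>

context weak_strong
begin

text \<open>Twice the constant that Young's inequality produces for delta = nu / (K_aniso + 1); the
  added 1 keeps the divisor positive.\<close>

definition \<kappa> :: real where
  "\<kappa> = 2 * (K_aniso + 1) ^ 4 / \<nu> ^ 3"

lemma \<kappa>_nonneg: "0 \<le> \<kappa>"
  using U.\<nu> K_aniso_nonneg by (simp add: \<kappa>_def)

definition w :: "real \<Rightarrow> real^3 \<Rightarrow> real^3" where
  "w r = (\<lambda>x. vh r x - uh r x)"

text \<open>Antisymmetry reduces the convective part of \<open>J\<close> to
  \<open>conv w w u\<close>, and the viscous terms combine to -2 nu ||grad w||^2. Young's inequality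
  spends this dissipation completely and leaves a multiple of ||w||^2 whose coefficient is
  integrable in time.\<close>

lemma dissipation_bound:
  "- 2 * J r - 2 * \<nu> * (L2_norm \<Omega> (weak_gradient \<Omega> (vh r)))\<^sup>2 - 2 * \<nu> * (L2_norm \<Omega> (weak_gradient \<Omega> (uh r)))\<^sup>2
    \<le> \<kappa> * (L2_norm \<Omega> u\<^sub>0)\<^sup>2 * (L2_norm \<Omega> (weak_gradient \<Omega> (uh r)))\<^sup>2 * (L2_norm \<Omega> (w r))\<^sup>2"
proof -
  note V = W.vh_V[of r] and Uh = U.vh_V[of r]
  have wV: "w r \<in> V_space \<Omega>" unfolding w_def by (rule V_diff[OF V Uh])
  define x y where "x = L2_norm \<Omega> (weak_gradient \<Omega> (w r))" and "y = L2_norm \<Omega> (weak_gradient \<Omega> (uh r))"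
  define m where "m = L2_norm \<Omega> (uh r) * y * L2_norm \<Omega> (w r)"
  have nn: "0 \<le> x" "0 \<le> y" "0 \<le> m" by (simp_all add: x_def y_def m_def)
  \<comment> \<open>Here conv u v u = - conv u u v, so the sum is conv w u v. Writing v = w + u adds
    conv w u u, which is zero by antisymmetry, and one more exchange gives the form in w.\<close>
  have c: "conv (vh r) (uh r) (vh r) + conv (uh r) (vh r) (uh r) = - conv (w r) (w r) (uh r)"
  proof -
    have "conv (vh r) (uh r) (vh r) + conv (uh r) (vh r) (uh r) = conv (vh r) (uh r) (vh r) - conv (uh r) (uh r) (vh r)"
      using conv_antisym[OF Uh V Uh] by simp
    also have "\<dots> = conv (w r) (uh r) (vh r)" unfolding w_def using conv_diff(1)[OF V Uh Uh Uh V V] by simp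
    also have "\<dots> = conv (w r) (uh r) (w r) + conv (w r) (uh r) (uh r)"
      using conv_diff(3)[OF wV wV Uh Uh V Uh] by (simp add: w_def)
    also have "conv (w r) (uh r) (uh r) = 0" using conv_antisym[OF wV Uh Uh] by simp
    finally show ?thesis using conv_antisym[OF wV Uh wV] by simp
  qed
  have x2: "x\<^sup>2 = (L2_norm \<Omega> (weak_gradient \<Omega> (vh r)))\<^sup>2 + (L2_norm \<Omega> (weak_gradient \<Omega> (uh r)))\<^sup>2 - 2 * L2_inner \<Omega> (weak_gradient \<Omega> (vh r)) (weak_gradient \<Omega> (uh r))"
    unfolding x_def w_def H1_diff_norm[OF V_H1[OF V] V_H1[OF Uh]]
    by (rule L2_norm_diff_sq[OF V_gradient_L2[OF V] V_gradient_L2[OF Uh]])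
  have J: "J r = - conv (w r) (w r) (uh r) - 2 * \<nu> * L2_inner \<Omega> (weak_gradient \<Omega> (vh r)) (weak_gradient \<Omega> (uh r))"
    unfolding J_def nse_def using c by (simp add: L2_inner_commute[of \<Omega> "weak_gradient \<Omega> (uh r)"])
  define K' where "K' = K_aniso + 1"
  have K': "0 < K'" "K_aniso \<le> K'" using K_aniso_nonneg by (auto simp: K'_def)
  have "\<bar>conv (w r) (w r) (uh r)\<bar> \<le> K_aniso * x * sqrt ((L2_norm \<Omega> (uh r) * y) * (L2_norm \<Omega> (w r) * x))"
    unfolding x_def y_def by (rule abs_conv_axisymmetric_le[OF wV wV Uh uh_axi])
  also have "\<dots> = K_aniso * sqrt (x ^ 3 * m)"
  proof -
    have "sqrt (x ^ 3 * m) = sqrt (x\<^sup>2 * (m * x))" by (simp add: power2_eq_square power3_eq_cube ac_simps)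
    also have "\<dots> = x * sqrt (m * x)" using nn by (simp add: real_sqrt_mult)
    finally show ?thesis by (simp add: m_def ac_simps)
  qed
  \<comment> \<open>Young's inequality with delta = nu / K', so that the coefficient of x^2 becomes
    exactly nu.\<close>
  also have "\<dots> \<le> K' * (\<nu> / K' * x\<^sup>2 + m\<^sup>2 / (\<nu> / K') ^ 3)"
    using K' nn U.\<nu> K_aniso_nonneg by (intro mult_mono Young_3_2) auto
  also have "\<dots> = \<nu> * x\<^sup>2 + K' ^ 4 / \<nu> ^ 3 * m\<^sup>2"
    using K' U.\<nu> by (simp add: field_simps eval_nat_numeral)
  finally have "2 * conv (w r) (w r) (uh r) \<le> 2 * \<nu> * x\<^sup>2 + \<kappa> * m\<^sup>2"
    by (simp add: \<kappa>_def K'_def[symmetric])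
  then have 1: "- 2 * J r - 2 * \<nu> * (L2_norm \<Omega> (weak_gradient \<Omega> (vh r)))\<^sup>2 - 2 * \<nu> * (L2_norm \<Omega> (weak_gradient \<Omega> (uh r)))\<^sup>2 \<le> \<kappa> * m\<^sup>2"
    unfolding J x2 by (simp add: algebra_simps)
  have "m\<^sup>2 \<le> (L2_norm \<Omega> u\<^sub>0 * y * L2_norm \<Omega> (w r))\<^sup>2"
    unfolding m_def using nn by (intro power_mono mult_right_mono U.vh_bound) auto
  then have "\<kappa> * m\<^sup>2 \<le> \<kappa> * (L2_norm \<Omega> u\<^sub>0 * y * L2_norm \<Omega> (w r))\<^sup>2" using \<kappa>_nonneg by (intro mult_left_mono)
  with 1 show ?thesis by (simp add: y_def power_mult_distrib mult.assoc)
qed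

text \<open>The squared norm of the difference is expanded, so that it becomes a sequentially
  continuous expression in the pair of representatives.\<close>

lemma w_measurable: "(\<lambda>r. (L2_norm \<Omega> (w r))\<^sup>2) \<in> borel_measurable borel"
proof -
  have "(\<lambda>r. (L2_norm \<Omega> (vh r))\<^sup>2 + (L2_norm \<Omega> (uh r))\<^sup>2 - 2 * L2_inner \<Omega> (vh r) (uh r)) \<in> borel_measurable lborel"
  proof (rule Vm.approx_measurable[OF W.approx U.approx, of "\<lambda>a b. (L2_norm \<Omega> a)\<^sup>2 + (L2_norm \<Omega> b)\<^sup>2 - 2 * L2_inner \<Omega> a b"])
    fix a b :: "nat \<Rightarrow> real^3 \<Rightarrow> real^3" and a' b'
    assume a: "\<And>n. a n \<in> V_space \<Omega>" "a' \<in> V_space \<Omega>" "(\<lambda>n. dV (a n) a') \<longlonglongrightarrow> 0"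
      and b: "\<And>n. b n \<in> V_space \<Omega>" "b' \<in> V_space \<Omega>" "(\<lambda>n. dV (b n) b') \<longlonglongrightarrow> 0"
    note la = H1_norm_tendsto(1)[OF V_H1[OF a(1)] V_H1[OF a(2)] a(3)]
    note lb = H1_norm_tendsto(1)[OF V_H1[OF b(1)] V_H1[OF b(2)] b(3)]
    show "(\<lambda>n. (L2_norm \<Omega> (a n))\<^sup>2 + (L2_norm \<Omega> (b n))\<^sup>2 - 2 * L2_inner \<Omega> (a n) (b n)) \<longlonglongrightarrow>
       (L2_norm \<Omega> a')\<^sup>2 + (L2_norm \<Omega> b')\<^sup>2 - 2 * L2_inner \<Omega> a' b'"
      by (intro tendsto_intros L2_norm_tendsto[OF V_L2[OF a(1)] V_L2[OF a(2)] la]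
          L2_norm_tendsto[OF V_L2[OF b(1)] V_L2[OF b(2)] lb]
          L2_inner_tendsto[OF V_L2[OF a(1)] V_L2[OF a(2)] la V_L2[OF b(1)] V_L2[OF b(2)] lb])
  qed
  then show ?thesis unfolding w_def using L2_norm_diff_sq[OF V_L2[OF W.vh_V] V_L2[OF U.vh_V]] by simp
qed

lemma w_bound: "(L2_norm \<Omega> (w r))\<^sup>2 \<le> (L2_norm \<Omega> v\<^sub>0 + L2_norm \<Omega> u\<^sub>0)\<^sup>2"
proof -
  have z: "(\<lambda>_. 0 :: real^3) \<in> L2_fields \<Omega>" using V_L2[OF zero_V] .
  have "L2_norm \<Omega> (w r) \<le> L2_norm \<Omega> (vh r) + L2_norm \<Omega> (uh r)"
    using L2_norm_triangle_diff[OF V_L2[OF W.vh_V[of r]] z V_L2[OF U.vh_V[of r]]]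
      L2_norm_commute[of \<Omega> "\<lambda>_. 0" "uh r"] by (simp add: w_def)
  then show ?thesis using U.vh_bound[of r] W.vh_bound[of r] by (intro power_mono) auto
qed

definition \<alpha> :: "real \<Rightarrow> real" where
  "\<alpha> r = \<kappa> * (L2_norm \<Omega> u\<^sub>0)\<^sup>2 * (L2_norm \<Omega> (weak_gradient \<Omega> (uh r)))\<^sup>2"

lemma \<alpha>_nonneg: "0 \<le> \<alpha> r"
  using \<kappa>_nonneg by (simp add: \<alpha>_def)

lemma \<alpha>_integrable: "integrable lborel \<alpha>"
  unfolding \<alpha>_def[abs_def] using U.gradient_sq_integrable by simp

lemma \<alpha>w_integrable: "integrable lborel (\<lambda>r. \<alpha> r * (L2_norm \<Omega> (w r))\<^sup>2)"
proof (rule Bochner_Integration.integrable_bound)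
  show "integrable lborel (\<lambda>r. (L2_norm \<Omega> v\<^sub>0 + L2_norm \<Omega> u\<^sub>0)\<^sup>2 * \<alpha> r)" using \<alpha>_integrable by simp
  show "(\<lambda>r. \<alpha> r * (L2_norm \<Omega> (w r))\<^sup>2) \<in> borel_measurable lborel"
    using borel_measurable_integrable[OF \<alpha>_integrable] w_measurable by simp
  show "AE r in lborel. norm (\<alpha> r * (L2_norm \<Omega> (w r))\<^sup>2) \<le> norm ((L2_norm \<Omega> v\<^sub>0 + L2_norm \<Omega> u\<^sub>0)\<^sup>2 * \<alpha> r)"
  proof (intro AE_I2)
    fix r
    have "\<alpha> r * (L2_norm \<Omega> (w r))\<^sup>2 \<le> \<alpha> r * (L2_norm \<Omega> v\<^sub>0 + L2_norm \<Omega> u\<^sub>0)\<^sup>2"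
      by (intro mult_left_mono w_bound \<alpha>_nonneg)
    then show "norm (\<alpha> r * (L2_norm \<Omega> (w r))\<^sup>2) \<le> norm ((L2_norm \<Omega> v\<^sub>0 + L2_norm \<Omega> u\<^sub>0)\<^sup>2 * \<alpha> r)"
      using \<alpha>_nonneg[of r] by (simp add: abs_mult mult.commute)
  qed
qed

text \<open>The right-hand side of the integral inequality serves as the unknown in Gronwall's
  inequality: it is continuous, and it dominates the squared norm of \<open>w\<close> at almost
  every positive time, which is enough under the integral.\<close>

definition R :: "real \<Rightarrow> real" where
  "R t = (L2_norm \<Omega> (\<lambda>x. v\<^sub>0 x - u\<^sub>0 x))\<^sup>2 + (LINT r|lborel. indicator {0..t} r * (\<alpha> r * (L2_norm \<Omega> (w r))\<^sup>2))"

lemma difference_le_R: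
  assumes t: "0 < t"
  shows "(L2_norm \<Omega> (\<lambda>x. v t x - u t x))\<^sup>2 \<le> R t"
proof -
  have t0: "0 \<le> t" using t by simp
  define gv gu where "gv r = (L2_norm \<Omega> (weak_gradient \<Omega> (vh r)))\<^sup>2" and "gu r = (L2_norm \<Omega> (weak_gradient \<Omega> (uh r)))\<^sup>2" for r
  have gi: "integrable lborel (\<lambda>r. indicator {0..t} r * gv r)" "integrable lborel (\<lambda>r. indicator {0..t} r * gu r)"
    unfolding gv_def gu_def by (intro integrable_restrict_Icc U.gradient_sq_integrable W.gradient_sq_integrable)+
  have Ji: "integrable lborel (\<lambda>r. indicator {0..t} r * J r)" by (rule integrable_restrict_Icc[OF J_integrable])
  have "(L2_norm \<Omega> (\<lambda>x. v t x - u t x))\<^sup>2 = (L2_norm \<Omega> (v t))\<^sup>2 + (L2_norm \<Omega> (u t))\<^sup>2 - 2 * L2_inner \<Omega> (v t) (u t)"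
    by (rule L2_norm_diff_sq[OF W.v_L2[OF t0] U.v_L2[OF t0]])
  also have "\<dots> \<le> (L2_norm \<Omega> v\<^sub>0)\<^sup>2 + (L2_norm \<Omega> u\<^sub>0)\<^sup>2 - 2 * L2_inner \<Omega> v\<^sub>0 u\<^sub>0
     + (- 2 * (LINT r|lborel. indicator {0..t} r * J r) - 2 * \<nu> * (LINT r|lborel. indicator {0..t} r * gv r) - 2 * \<nu> * (LINT r|lborel. indicator {0..t} r * gu r))"
    using W.energy[OF t] U.energy[OF t] cross_identity[OF t0] unfolding gv_def gu_def by simp
  also have "(L2_norm \<Omega> v\<^sub>0)\<^sup>2 + (L2_norm \<Omega> u\<^sub>0)\<^sup>2 - 2 * L2_inner \<Omega> v\<^sub>0 u\<^sub>0 = (L2_norm \<Omega> (\<lambda>x. v\<^sub>0 x - u\<^sub>0 x))\<^sup>2"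
    by (rule L2_norm_diff_sq[OF H_L2[OF W.v0] H_L2[OF U.v0], symmetric])
  also have "- 2 * (LINT r|lborel. indicator {0..t} r * J r) - 2 * \<nu> * (LINT r|lborel. indicator {0..t} r * gv r) - 2 * \<nu> * (LINT r|lborel. indicator {0..t} r * gu r)
     = (LINT r|lborel. (- 2) * (indicator {0..t} r * J r) - (2 * \<nu>) * (indicator {0..t} r * gv r) - (2 * \<nu>) * (indicator {0..t} r * gu r))"
    using Ji gi by simp
  also have "\<dots> \<le> (LINT r|lborel. indicator {0..t} r * (\<alpha> r * (L2_norm \<Omega> (w r))\<^sup>2))"
  proof (rule integral_mono)
    show "integrable lborel (\<lambda>r. (- 2) * (indicator {0..t} r * J r) - (2 * \<nu>) * (indicator {0..t} r * gv r) - (2 * \<nu>) * (indicator {0..t} r * gu r))"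
      using Ji gi by simp
    show "integrable lborel (\<lambda>r. indicator {0..t} r * (\<alpha> r * (L2_norm \<Omega> (w r))\<^sup>2))"
      by (rule integrable_restrict_Icc[OF \<alpha>w_integrable])
    fix r
    show "(- 2) * (indicator {0..t} r * J r) - (2 * \<nu>) * (indicator {0..t} r * gv r) - (2 * \<nu>) * (indicator {0..t} r * gu r)
        \<le> indicator {0..t} r * (\<alpha> r * (L2_norm \<Omega> (w r))\<^sup>2)"
      using dissipation_bound[of r] by (auto simp: indicator_def gv_def gu_def \<alpha>_def)
  qed
  finally show ?thesis by (simp add: R_def)
qed

lemma R_continuous: "continuous_on {0..} R"
  unfolding R_def[abs_def]
  by (intro continuous_intros indefinite_integral_continuous_lborel integrable_restrict_Icc \<alpha>w_integrable)

lemma R_nonneg: "0 \<le> R t"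
  unfolding R_def using \<alpha>_nonneg by (intro add_nonneg_nonneg integral_nonneg_AE AE_I2) auto

lemma w_le_R: "AE r in lborel. 0 < r \<longrightarrow> (L2_norm \<Omega> (w r))\<^sup>2 \<le> R r"
  using U.vh_AE W.vh_AE by eventually_elim (use difference_le_R in \<open>auto simp: w_def\<close>)

lemma R_le:
  assumes t: "0 \<le> t"
  shows "R t \<le> (L2_norm \<Omega> (\<lambda>x. v\<^sub>0 x - u\<^sub>0 x))\<^sup>2 * exp (LINT r|lborel. indicator {0..t} r * \<alpha> r)"
proof -
  have Rmax: "R r \<le> R' " if "R' = (L2_norm \<Omega> (\<lambda>x. v\<^sub>0 x - u\<^sub>0 x))\<^sup>2 + (LINT r|lborel. \<alpha> r * (L2_norm \<Omega> (w r))\<^sup>2)" for r R'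
    unfolding R_def that using \<alpha>_nonneg
    by (intro add_left_mono integral_mono integrable_restrict_Icc \<alpha>w_integrable) (auto simp: indicator_def)
  have Rm: "(\<lambda>r. indicator {0..} r *\<^sub>R R r) \<in> borel_measurable borel"
    using borel_measurable_continuous_on_indicator[OF _ R_continuous] by simp
  have ai: "integrable lborel (\<lambda>r. indicator {0..T} r * (\<alpha> r * R r))" for T
  proof (rule Bochner_Integration.integrable_bound)
    define R' where "R' = (L2_norm \<Omega> (\<lambda>x. v\<^sub>0 x - u\<^sub>0 x))\<^sup>2 + (LINT r|lborel. \<alpha> r * (L2_norm \<Omega> (w r))\<^sup>2)"
    show "integrable lborel (\<lambda>r. R' * \<alpha> r)" using \<alpha>_integrable by simp
    have e: "(\<lambda>r. indicator {0..T} r * (\<alpha> r * R r)) = (\<lambda>r. indicator {0..T} r * (\<alpha> r * (indicator {0..} r *\<^sub>R R r)))"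
      by (auto simp: indicator_def)
    show "(\<lambda>r. indicator {0..T} r * (\<alpha> r * R r)) \<in> borel_measurable lborel"
      unfolding e using borel_measurable_integrable[OF \<alpha>_integrable] Rm by simp
    show "AE r in lborel. norm (indicator {0..T} r * (\<alpha> r * R r)) \<le> norm (R' * \<alpha> r)"
    proof (intro AE_I2)
      fix r
      have "\<alpha> r * R r \<le> \<alpha> r * R'" by (intro mult_left_mono Rmax[OF R'_def] \<alpha>_nonneg)
      moreover have "0 \<le> \<alpha> r * R r" by (intro mult_nonneg_nonneg \<alpha>_nonneg R_nonneg)
      ultimately show "norm (indicator {0..T} r * (\<alpha> r * R r)) \<le> norm (R' * \<alpha> r)"
        by (auto simp: indicator_def mult.commute)
    qed
  qed
  show ?thesis
  proof (rule Gronwall_lborel[OF integrable_restrict_Icc[OF \<alpha>_integrable] \<alpha>_nonneg ai _ _ _ t])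
    fix s :: real assume "0 \<le> s"
    show "R s \<le> (L2_norm \<Omega> (\<lambda>x. v\<^sub>0 x - u\<^sub>0 x))\<^sup>2 + (LINT r|lborel. indicator {0..s} r * (\<alpha> r * R r))"
      unfolding R_def[of s]
    proof (intro add_left_mono integral_mono_AE integrable_restrict_Icc[OF \<alpha>w_integrable] ai)
      have "AE r in lborel. r \<noteq> (0::real)" by (rule AE_lborel_singleton)
      then show "AE r in lborel. indicator {0..s} r * (\<alpha> r * (L2_norm \<Omega> (w r))\<^sup>2) \<le> indicator {0..s} r * (\<alpha> r * R r)"
        using w_le_R by eventually_elim (auto simp: indicator_def intro!: mult_left_mono \<alpha>_nonneg)
    qed
  qed (auto simp: R_nonneg)
qed

lemma stability:
  assumes t: "0 \<le> t"
  shows "(L2_norm \<Omega> (\<lambda>x. v t x - u t x))\<^sup>2 \<le>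
    (L2_norm \<Omega> (\<lambda>x. v\<^sub>0 x - u\<^sub>0 x))\<^sup>2 * exp ((K_aniso + 1) ^ 4 / \<nu> ^ 4 * (L2_norm \<Omega> u\<^sub>0) ^ 4)"
\<comment> \<open>The energy inequalities concern positive times. At t = 0 both solutions agree with
  their data in L2, and the exponential is at least 1.\<close>
proof (cases "t = 0")
  case True
  note L = W.v_L2[of 0] H_L2[OF W.v0] H_L2[OF U.v0] U.v_L2[of 0]
  have "L2_norm \<Omega> (\<lambda>x. v 0 x - u 0 x) \<le> L2_norm \<Omega> (\<lambda>x. v 0 x - v\<^sub>0 x) + (L2_norm \<Omega> (\<lambda>x. v\<^sub>0 x - u\<^sub>0 x) + L2_norm \<Omega> (\<lambda>x. u\<^sub>0 x - u 0 x))"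
    using L2_norm_triangle_diff[OF L(1) L(2) L(4)] L2_norm_triangle_diff[OF L(2) L(3) L(4)] by simp
  also have "\<dots> = L2_norm \<Omega> (\<lambda>x. v\<^sub>0 x - u\<^sub>0 x)"
    using W.initial_L2 U.initial_L2 L2_norm_commute[of \<Omega> u\<^sub>0 "u 0"] by simp
  finally have "(L2_norm \<Omega> (\<lambda>x. v 0 x - u 0 x))\<^sup>2 \<le> (L2_norm \<Omega> (\<lambda>x. v\<^sub>0 x - u\<^sub>0 x))\<^sup>2 * 1"
    by (simp add: power_mono)
  also have "\<dots> \<le> (L2_norm \<Omega> (\<lambda>x. v\<^sub>0 x - u\<^sub>0 x))\<^sup>2 * exp ((K_aniso + 1) ^ 4 / \<nu> ^ 4 * (L2_norm \<Omega> u\<^sub>0) ^ 4)"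
    using U.\<nu> K_aniso_nonneg by (intro mult_left_mono) auto
  finally show ?thesis using True by simp
next
  case False
  then have t': "0 < t" using t by simp
  \<comment> \<open>The origin of the fourth power: one factor ||u0||^2 is contained in alpha, the
    other is the bound ||u0||^2 / (2 nu) on the time integral of ||grad u||^2. The latter also turns
    nu^3 into nu^4 and cancels the 2 in \<open>\<kappa>\<close>.\<close>
  have I: "(LINT r|lborel. indicator {0..t} r * \<alpha> r) \<le> (K_aniso + 1) ^ 4 / \<nu> ^ 4 * (L2_norm \<Omega> u\<^sub>0) ^ 4"
  proof -
    define g where "g = (LINT r|lborel. indicator {0..t} r * (L2_norm \<Omega> (weak_gradient \<Omega> (uh r)))\<^sup>2)"
    have "(LINT r|lborel. indicator {0..t} r * \<alpha> r) = (LINT r|lborel. (\<kappa> * (L2_norm \<Omega> u\<^sub>0)\<^sup>2) * (indicator {0..t} r * (L2_norm \<Omega> (weak_gradient \<Omega> (uh r)))\<^sup>2))"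
      by (simp add: \<alpha>_def ac_simps)
    also have "\<dots> = \<kappa> * (L2_norm \<Omega> u\<^sub>0)\<^sup>2 * g" unfolding g_def by (rule integral_mult_right_zero)
    also have "\<dots> \<le> \<kappa> * (L2_norm \<Omega> u\<^sub>0)\<^sup>2 * ((L2_norm \<Omega> u\<^sub>0)\<^sup>2 / (2 * \<nu>))"
    proof (rule mult_left_mono)
      have "2 * \<nu> * g \<le> (L2_norm \<Omega> u\<^sub>0)\<^sup>2"
        using U.energy[OF t'] zero_le_power2[of "L2_norm \<Omega> (u t)"] unfolding g_def by linarith
      then show "g \<le> (L2_norm \<Omega> u\<^sub>0)\<^sup>2 / (2 * \<nu>)" using U.\<nu> by (simp add: field_simps)
    qed (use \<kappa>_nonneg in simp)
    also have "\<dots> = (K_aniso + 1) ^ 4 / \<nu> ^ 4 * (L2_norm \<Omega> u\<^sub>0) ^ 4"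
      using U.\<nu> by (simp add: \<kappa>_def field_simps eval_nat_numeral)
    finally show ?thesis .
  qed
  have "(L2_norm \<Omega> (\<lambda>x. v t x - u t x))\<^sup>2 \<le> R t" by (rule difference_le_R[OF t'])
  also have "\<dots> \<le> (L2_norm \<Omega> (\<lambda>x. v\<^sub>0 x - u\<^sub>0 x))\<^sup>2 * exp (LINT r|lborel. indicator {0..t} r * \<alpha> r)" by (rule R_le[OF t])
  also have "\<dots> \<le> (L2_norm \<Omega> (\<lambda>x. v\<^sub>0 x - u\<^sub>0 x))\<^sup>2 * exp ((K_aniso + 1) ^ 4 / \<nu> ^ 4 * (L2_norm \<Omega> u\<^sub>0) ^ 4)"
    using I by (intro mult_left_mono) auto
  finally show ?thesis .
qed

end

section \<open>Geometry of the rotated domain and conclusion\<close>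

text \<open>This form exhibits the rotated domain as the preimage of \<open>D\<close> under a
  continuous map, from which openness follows. The angle is recovered from the normalised horizontal
  components.\<close>

lemma axi_domain_eq:
  assumes "D \<subseteq> {p. 0 < fst p}"
  shows "axi_domain D = {x. (sqrt ((x $ 1)\<^sup>2 + (x $ 2)\<^sup>2), x $ 3) \<in> D}"
proof (intro equalityI subsetI)
  fix x assume "x \<in> axi_domain D"
  then obtain r z \<theta> where x: "x = cyl_point r z \<theta>" "(r, z) \<in> D" by (auto simp: axi_domain_def)
  have "(r * cos \<theta>)\<^sup>2 + (r * sin \<theta>)\<^sup>2 = r\<^sup>2" by (simp add: power_mult_distrib flip: distrib_left)
  moreover have "0 < r" using x(2) assms by auto
  ultimately show "x \<in> {x. (sqrt ((x $ 1)\<^sup>2 + (x $ 2)\<^sup>2), x $ 3) \<in> D}"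
    using x by (simp add: cyl_point_def)
next
  fix x :: "real^3" assume "x \<in> {x. (sqrt ((x $ 1)\<^sup>2 + (x $ 2)\<^sup>2), x $ 3) \<in> D}"
  then have D: "(sqrt ((x $ 1)\<^sup>2 + (x $ 2)\<^sup>2), x $ 3) \<in> D" by simp
  define r where "r = sqrt ((x $ 1)\<^sup>2 + (x $ 2)\<^sup>2)"
  have r: "0 < r" using D assms by (auto simp: r_def)
  have r2: "r\<^sup>2 = (x $ 1)\<^sup>2 + (x $ 2)\<^sup>2" by (simp add: r_def)
  have "(x $ 1 / r)\<^sup>2 + (x $ 2 / r)\<^sup>2 = r\<^sup>2 / r\<^sup>2"
    unfolding power_divide r2 by (rule add_divide_distrib[symmetric])
  then have "(x $ 1 / r)\<^sup>2 + (x $ 2 / r)\<^sup>2 = 1" using r by simp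
  then obtain \<theta> where \<theta>: "0 \<le> \<theta>" "\<theta> < 2 * pi" "x $ 1 / r = cos \<theta>" "x $ 2 / r = sin \<theta>"
    using sincos_total_2pi by metis
  then have "x = cyl_point r (x $ 3) \<theta>"
    using r by (simp add: cyl_point_def vec_eq_iff forall_3 field_simps)
  then show "x \<in> axi_domain D" using D \<theta> by (force simp: axi_domain_def r_def)
qed

lemma open_axi_domain:
  assumes "open D" "D \<subseteq> {p. 0 < fst p}"
  shows "open (axi_domain D)"
proof -
  have "continuous_on UNIV (\<lambda>x::real^3. (sqrt ((x $ 1)\<^sup>2 + (x $ 2)\<^sup>2), x $ 3))"
    by (intro continuous_intros)
  from open_vimage[OF assms(1) this] show ?thesis
    unfolding axi_domain_eq[OF assms(2)] by (simp add: vimage_def)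
qed

lemma bounded_axi_domain:
  assumes "bounded D"
  shows "bounded (axi_domain D)"
proof -
  obtain B where B: "\<And>p. p \<in> D \<Longrightarrow> norm p \<le> B" using assms by (auto simp: bounded_iff)
  have "norm x \<le> B" if x_in: "x \<in> axi_domain D" for x
  proof -
    obtain r z \<theta> where x: "x = cyl_point r z \<theta>" "(r, z) \<in> D" using x_in unfolding axi_domain_def by blast
    have "(norm x)\<^sup>2 = (r * cos \<theta>)\<^sup>2 + (r * sin \<theta>)\<^sup>2 + z\<^sup>2"
      unfolding power2_norm_eq_inner x(1) by (simp add: cyl_point_def inner_vec_def sum_3 power2_eq_square)
    also have "(r * cos \<theta>)\<^sup>2 + (r * sin \<theta>)\<^sup>2 = r\<^sup>2" by (simp add: power_mult_distrib flip: distrib_left)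
    finally have "norm x = norm (r, z)" by (simp add: norm_Pair real_sqrt_unique[symmetric])
    then show ?thesis using B[OF x(2)] by simp
  qed
  then show ?thesis by (auto simp: bounded_iff)
qed

theorem theorem3p3:
  fixes \<nu> :: real and D :: "(real \<times> real) set" and C :: "(real^3) set"
  assumes "\<nu> > 0"
    and "bounded D" and "smooth_domain D" and "closure D \<subseteq> {p. 0 < fst p}"
    and C_def: "C = axi_domain D"
  shows "\<exists>M>0. \<forall>u\<^sub>0 u v\<^sub>0 v.
      u\<^sub>0 \<in> H_space C \<and> axisymmetric C u\<^sub>0 \<and>
      u \<in> C0_weak C \<and> u \<in> Bochner_L2 (V_space C) (H1_norm C) {0<..} \<and>
      axisymmetric_weak_solution \<nu> C u\<^sub>0 u \<and>
      v\<^sub>0 \<in> H_space C \<and>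
      v \<in> C0_strong C \<and> v \<in> Bochner_L2 (V_space C) (H1_norm C) {0<..} \<and>
      Leray_Hopf_solution \<nu> C v\<^sub>0 v
      \<longrightarrow> (\<forall>t\<ge>0. (L2_norm C (\<lambda>x. v t x - u t x))\<^sup>2
              \<le> (L2_norm C (\<lambda>x. v\<^sub>0 x - u\<^sub>0 x))\<^sup>2 * exp (M * (L2_norm C u\<^sub>0) ^ 4))"
proof -
  have D: "open D" "D \<noteq> {}" using assms(3) by (auto simp: smooth_domain_def)
  have Dpos: "D \<subseteq> {p. 0 < fst p}" using assms(4) closure_subset by blast
  have cD: "compact (closure D)" "closure D \<noteq> {}" using assms(2) D(2) by (auto simp: compact_closure)
  \<comment> \<open>The smallest radius on the compact closure of \<open>D\<close> is attained, and
    it is positive because the closure avoids the axis; it serves as \<open>r\<^sub>0\<close>, and a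
    bound for the norm on \<open>D\<close> serves as \<open>r\<^sub>1\<close>.\<close>
  obtain p where p: "p \<in> closure D" "\<And>q. q \<in> closure D \<Longrightarrow> fst p \<le> fst q"
    using continuous_attains_inf[OF cD, of fst] continuous_on_fst[OF continuous_on_id] by (metis id_apply)
  obtain B where B: "\<And>p. p \<in> D \<Longrightarrow> norm p \<le> B" using assms(2) by (auto simp: bounded_iff)
  interpret axi C D "fst p" B
  proof
    show "open C" "bounded C" unfolding C_def by (rule open_axi_domain[OF D(1) Dpos] bounded_axi_domain[OF assms(2)])+
    show "C = axi_domain D" by (rule C_def)
    show "0 < fst p" using p(1) assms(4) by auto
    fix r z assume rz: "(r, z) \<in> D"
    then have "fst p \<le> r" using p(2)[of "(r, z)"] closure_subset by auto
    moreover have "r \<le> B" using B[OF rz] norm_fst_le[of r z] by simp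
    ultimately show "fst p \<le> r \<and> r \<le> B" by simp
  qed
  show ?thesis
  \<comment> \<open>Apart from \<open>\<nu>\<close> this depends on the two radius bounds inside
    \<open>K_aniso\<close> only, and it is fixed before the data and the solutions.\<close>
  proof (rule exI[of _ "(K_aniso + 1) ^ 4 / \<nu> ^ 4"], intro conjI allI impI)
    show "0 < (K_aniso + 1) ^ 4 / \<nu> ^ 4" using assms(1) K_aniso_nonneg by (simp add: add_nonneg_pos)
    fix u\<^sub>0 u v\<^sub>0 v and t :: real
    assume H: "u\<^sub>0 \<in> H_space C \<and> axisymmetric C u\<^sub>0 \<and>
      u \<in> C0_weak C \<and> u \<in> Bochner_L2 (V_space C) (H1_norm C) {0<..} \<and>
      axisymmetric_weak_solution \<nu> C u\<^sub>0 u \<and>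
      v\<^sub>0 \<in> H_space C \<and>
      v \<in> C0_strong C \<and> v \<in> Bochner_L2 (V_space C) (H1_norm C) {0<..} \<and>
      Leray_Hopf_solution \<nu> C v\<^sub>0 v" and t: "0 \<le> t"
    obtain uh su where uh: "Vm.approx lborel uh su" "AE t in lborel. 0 < t \<longrightarrow> uh t = u t"
      "\<And>t. (0 < t \<and> uh t = u t) \<or> uh t = (\<lambda>_. 0)" "integrable lborel (\<lambda>t. (H1_norm C (uh t))\<^sup>2)"
      using Bochner_representative[of u] H by blast
    obtain vh sv where vh: "Vm.approx lborel vh sv" "AE t in lborel. 0 < t \<longrightarrow> vh t = v t"
      "\<And>t. (0 < t \<and> vh t = v t) \<or> vh t = (\<lambda>_. 0)" "integrable lborel (\<lambda>t. (H1_norm C (vh t))\<^sup>2)"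
      using Bochner_representative[of v] H by blast
    interpret weak_strong C D "fst p" B \<nu> u\<^sub>0 u uh su v\<^sub>0 v vh sv
    proof
      show "Leray_Hopf_solution \<nu> C u\<^sub>0 u" "Leray_Hopf_solution \<nu> C v\<^sub>0 v" "u\<^sub>0 \<in> H_space C" "v\<^sub>0 \<in> H_space C" "v \<in> C0_strong C"
        using H by (auto simp: axisymmetric_weak_solution_def)
      \<comment> \<open>At exceptional times \<open>uh\<close> is the zero field, which therefore
        has to be axisymmetric as well.\<close>
      have "axisymmetric C (\<lambda>_. 0)" unfolding axisymmetric_def by (rule exI[of _ "\<lambda>_ _. 0"])+ simp
      then show "axisymmetric C (uh t)" for t
        using uh(3)[of t] H by (auto simp: axisymmetric_weak_solution_def less_imp_le)
    qed (use assms(1) uh vh in auto)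
    show "(L2_norm C (\<lambda>x. v t x - u t x))\<^sup>2 \<le> (L2_norm C (\<lambda>x. v\<^sub>0 x - u\<^sub>0 x))\<^sup>2 * exp ((K_aniso + 1) ^ 4 / \<nu> ^ 4 * (L2_norm C u\<^sub>0) ^ 4)"
      by (rule stability[OF t])
  qed
qed

end
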